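(* Let $n\ge2$, $\rho=\frac n2$, $\rho_H=\frac{n-1}2$, and let $(\zeta,\mathbb S)$ be an irreducible representation of $\mathrm{Cl}(n;\mathbb C)$. The renormalized $\mathrm{End}_{\mathbb C}(\mathbb S)$-valued distribution $$\widetilde{\mathsf K}{}^{\mathbb A,+}_{\lambda,\nu}(x)=\frac{\mathsf K^{\mathbb A,+}_{\lambda,\nu}(x)}{\Gamma(\frac12(\lambda+\nu+\frac32))\Gamma(\frac12(\lambda-\nu+\frac12))}$$ on $\mathbb R^n$ depends holomorphically on $(\lambda,\nu)\in\mathbb C^2$ and vanishes only for $(\lambda,\nu)\in\mathsf L_{\mathrm{even}}$. More precisely: 1. For $(\lambda,\nu)\in\mathbb C^2\setminus(X^+\cup Y^+)$ we have $\mathrm{supp}\,\widetilde{\mathsf K}{}^{\mathbb A,+}_{\lambda,\nu}=\mathbb R^n$. 2. For $(\lambda,\nu)\in X^+\setminus Y^+$ with $\lambda+\nu=-\frac32-2k$, $k\in\mathbb N$, $$\widetilde{\mathsf K}{}^{\mathbb A,+}_{\lambda,\nu}=\frac{(-1)^{k+1}k!}{(2k+1)!}\widetilde{\mathsf K}{}^{\mathbb B,+}_{\lambda,\nu};$$ in particular $\mathrm{supp}\,\widetilde{\mathsf K}{}^{\mathbb A,+}_{\lambda,\nu}=\mathbb R^{n-1}$. 3. For $(\lambda,\nu)\in Y^+\setminus\mathsf L_{\mathrm{even}}$ with $\lambda-\nu=-\frac12-2\ell$, $\ell\in\mathbb N$, $$\widetilde{\mathsf K}{}^{\mathbb A,+}_{\lambda,\nu}=\frac{(-1)^\ell\ell!\,\pi^{\frac{n-1}2}}{2^{2\ell}\Gamma(\nu+\frac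 n2)}\widetilde{\mathsf K}{}^{\mathbb C,+}_{\lambda,\nu};$$ in particular $\mathrm{supp}\,\widetilde{\mathsf K}{}^{\mathbb A,+}_{\lambda,\nu}=\{0\}$. 4. For $(-\rho-\frac12-i,-\rho_H-\frac12-j)\in\mathsf L_{\mathrm{even}}$, $2\ell=i-j$, restricting $(\lambda,\nu)\mapsto\widetilde{\mathsf K}{}^{\mathbb A,+}_{\lambda,\nu}$ to two different complex hyperplanes in $\mathbb C^2$ through this point and renormalizing gives two holomorphic families of distributions: $$\widetilde{\mathsf K}{}^{\mathbb C,+}_{\lambda,\nu}=\frac{(-1)^\ell2^{2\ell}}{\ell!\,\pi^{\frac{n-1}2}}\Gamma(\nu+\rho_H+\tfrac12)\widetilde{\mathsf K}{}^{\mathbb A,+}_{\lambda,\nu}\quad(\lambda-\nu=-\tfrac12-(i-j)),$$ $$\widetilde{\widetilde{\mathsf K}}{}^{\mathbb A,+}_{\lambda,\nu}=\Gamma(\tfrac12(\lambda-\nu+\tfrac12))\widetilde{\mathsf K}{}^{\mathbb A,+}_{\lambda,\nu}\quad(\nu=-\rho_H-\tfrac12-j).$$ Their special values at $(\lambda,\nu)=(-\rho-\frac12-i,-\rho_H-\frac12-j)$ satisfy $\mathrm{supp}\,\widetilde{\mathsf K}{}^{\mathbb C,+}_{\lambda,\nu}=\{0\}$ and $\mathrm{supp}\,\widetilde{\widetilde{\mathsf K}}{}^{\mathbb A,+}_{\lambda,\nu}=\mathbb R^n$ for $n$ even, $=\mathbb R^{n-1}$ for $n$ odd; more precisely, for $n$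 odd and $2k=n+i+j-1$, $$\widetilde{\widetilde{\mathsf K}}{}^{\mathbb A,+}_{-\rho-\frac12-i,-\rho_H-\frac12-j}=\frac{(-1)^{k+1}k!}{(2k+1)!}(|x'|^2+x_n^2)^j\big(\zeta(x')\delta^{(2k+1)}(x_n)-(2k+1)\,\underline{e_n}\,\delta^{(2k)}(x_n)\big).$$
   Context: $\mathbb N=\{0,1,2,\dots\}$; $(a)_m=a(a+1)\cdots(a+m-1)$; $x=(x',x_n)\in\mathbb R^{n-1}\times\mathbb R$; $\mathbb R^{n-1}=\{x_n=0\}$. $\mathrm{Cl}(n;\mathbb C)$ is the complex Clifford algebra generated by $e_1,\dots,e_n$ with $e_i^2=-1$, $e_ie_j=-e_je_i$ ($i\ne j$); $\zeta(x)=\sum_{i=1}^nx_i\underline{e_i}$ with $\underline{e_i}=\zeta(e_i)\in\mathrm{End}_{\mathbb C}(\mathbb S)$, and $\zeta(x')=\sum_{i=1}^{n-1}x_i\underline{e_i}$; $\mathsf D_{\mathbb R^{n-1}}=\sum_{i=1}^{n-1}\underline{e_i}\,\partial_i$. $$\mathsf K^{\mathbb A,+}_{\lambda,\nu}(x)=\zeta(x)\cdot K^{\mathbb A,-}_{\lambda-\frac12,\nu+\frac12}(x),\qquad K^{\mathbb A,-}_{\lambda,\nu}(x)=\mathrm{sgn}(x_n)|x_n|^{\lambda+\nu-\frac12}(|x'|^2+x_n^2)^{-\nu-\frac{n-1}2},$$ extended meromorphically in $(\lambda,\nu)\in\mathbb C^2$. $$X^+=\{\lambda+\nu=-\tfrac32-2k,\,k\in\mathbb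 N\},\quad Y^+=\{\lambda-\nu=-\tfrac12-2\ell,\,\ell\in\mathbb N\},$$ $$\mathsf L_{\mathrm{even}}=\{(-\rho-\tfrac12-i,-\rho_H-\tfrac12-j):i,j\in\mathbb N,\ i-j\in2\mathbb N\}\subseteq Y^+.$$ For $\lambda+\nu=-\frac32-2k$ (by analytic continuation in $\nu$), $$\widetilde{\mathsf K}{}^{\mathbb B,+}_{\lambda,\nu}(x)=\frac{1}{\Gamma(\frac12(\lambda-\nu+\frac12))}\Big(\zeta(x')(|x'|^2+x_n^2)^{-\nu-\frac n2}\delta^{(2k+1)}(x_n)-(2k+1)(|x'|^2+x_n^2)^{-\nu-\frac n2}\,\underline{e_n}\,\delta^{(2k)}(x_n)\Big).$$ For $\lambda-\nu=-\frac12-2\ell$, $$\widetilde{\mathsf K}{}^{\mathbb C,+}_{\lambda,\nu}=\sum_{j=0}^{\ell-1}\frac{2^{2\ell-2j-1}(\nu+\frac12-\ell)_{\ell-j-1}}{j!(2\ell-2j-1)!}\Delta^j_{\mathbb R^{n-1}}\partial_n^{2\ell-2j-1}\mathsf D_{\mathbb R^{n-1}}\delta+\sum_{j=0}^\ell\frac{2^{2\ell-2j}(\nu+\frac12-\ell)_{\ell-j}}{j!(2\ell-2j)!}\,\underline{e_n}\,\Delta^j_{\mathbb R^{n-1}}\partial_n^{2\ell-2j}\delta.$$ *)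

theory Defs
  imports "HOL-Complex_Analysis.Complex_Analysis"
begin

section \<open>Test functions and distributions\<close>

definition pderiv_dir ::
  "'a::euclidean_space \<Rightarrow> ('a \<Rightarrow> complex) \<Rightarrow> 'a \<Rightarrow> complex" where
  "pderiv_dir v f = (\<lambda>x. frechet_derivative f (at x) v)"

definition pderivs ::
  "'a::euclidean_space list \<Rightarrow> ('a \<Rightarrow> complex) \<Rightarrow> 'a \<Rightarrow> complex" where
  "pderivs vs f = foldr pderiv_dir vs f"

definition smooth :: "('a::euclidean_space \<Rightarrow> complex) \<Rightarrow> bool" where
  "smooth f \<longleftrightarrow> (\<forall>vs. set vs \<subseteq> Basis \<longrightarrow> (\<forall>x. pderivs vs f differentiable (at x)))"

definition fsupp :: "('a::euclidean_space \<Rightarrow> complex) \<Rightarrow> 'a set" where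
  "fsupp f = closure {x. f x \<noteq> 0}"

definition test_functions :: "('a::euclidean_space \<Rightarrow> complex) set" where
  "test_functions = {f. smooth f \<and> compact (fsupp f)}"

definition csmult :: "complex \<Rightarrow> complex^'s::finite^'s \<Rightarrow> complex^'s::finite^'s" where
  "csmult c A = (\<chi> a b. c * A $ a $ b)"

text \<open>With \<open>S = complex^'s\<close>, an \<open>End(S)\<close>-valued distribution is a functional whose values are
  complex matrices.  Functionals are total functions; only their values on
  \<^const>\<open>test_functions\<close> carry meaning, so distributions are compared with \<open>dist_eq\<close>.\<close>

type_synonym ('a, 's) mdist = "('a \<Rightarrow> complex) \<Rightarrow> complex^'s^'s"

definition distribution :: "('a::euclidean_space, 's::finite) mdist \<Rightarrow> bool" where
  "distribution T \<longleftrightarrow>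
     (\<forall>\<phi>\<in>test_functions. \<forall>\<psi>\<in>test_functions. T (\<lambda>x. \<phi> x + \<psi> x) = T \<phi> + T \<psi>) \<and>
     (\<forall>c. \<forall>\<phi>\<in>test_functions. T (\<lambda>x. c * \<phi> x) = csmult c (T \<phi>)) \<and>
     (\<forall>K. compact K \<longrightarrow> (\<exists>C N. \<forall>\<phi>\<in>test_functions. fsupp \<phi> \<subseteq> K \<longrightarrow>
        norm (T \<phi>) \<le> C * (\<Sum>vs | set vs \<subseteq> Basis \<and> length vs \<le> N.
                               SUP x. cmod (pderivs vs \<phi> x))))"

definition dist_eq ::
  "('a::euclidean_space, 's::finite) mdist \<Rightarrow> ('a, 's) mdist \<Rightarrow> bool" where
  "dist_eq T S \<longleftrightarrow> (\<forall>\<phi>\<in>test_functions. T \<phi> = S \<phi>)"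

definition dist_supp :: "('a::euclidean_space, 's::finite) mdist \<Rightarrow> 'a set" where
  "dist_supp T = - \<Union>{U. open U \<and> (\<forall>\<phi>\<in>test_functions. fsupp \<phi> \<subseteq> U \<longrightarrow> T \<phi> = 0)}"

definition dist_scale :: "complex \<Rightarrow> ('a, 's::finite) mdist \<Rightarrow> ('a, 's) mdist" where
  "dist_scale c T = (\<lambda>\<phi>. csmult c (T \<phi>))"

definition dist_deriv :: "'a \<Rightarrow> ('a::euclidean_space, 's::finite) mdist \<Rightarrow> ('a, 's) mdist" where
  "dist_deriv v T = (\<lambda>\<phi>. - T (pderiv_dir v \<phi>))"

text \<open>The product \<open>A \<cdot> T\<close> of a matrix-valued function with a scalar functional.  For \<open>T\<close> of finite
  order, \<open>A\<close> only has to be sufficiently often differentiable.\<close>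

definition mat_times_dist ::
  "('a \<Rightarrow> complex^'s::finite^'s) \<Rightarrow> (('a \<Rightarrow> complex) \<Rightarrow> complex) \<Rightarrow> ('a, 's) mdist" where
  "mat_times_dist A T = (\<lambda>\<phi>. \<chi> a b. T (\<lambda>x. A x $ a $ b * \<phi> x))"


section \<open>Holomorphic families and analytic continuation\<close>

definition entire2 :: "(complex \<times> complex \<Rightarrow> complex) \<Rightarrow> bool" where
  "entire2 f \<longleftrightarrow> (\<forall>p. \<exists>a b. (f has_derivative (\<lambda>h. a * fst h + b * snd h)) (at p))"

definition holomorphic_family1 ::
  "(complex \<Rightarrow> ('a::euclidean_space, 's::finite) mdist) \<Rightarrow> bool" where
  "holomorphic_family1 F \<longleftrightarrow> (\<forall>z. distribution (F z)) \<and>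
     (\<forall>\<phi>\<in>test_functions. \<forall>a b. (\<lambda>z. F z \<phi> $ a $ b) holomorphic_on UNIV)"

definition holomorphic_family2 ::
  "(complex \<times> complex \<Rightarrow> ('a::euclidean_space, 's::finite) mdist) \<Rightarrow> bool" where
  "holomorphic_family2 F \<longleftrightarrow> (\<forall>p. distribution (F p)) \<and>
     (\<forall>\<phi>\<in>test_functions. \<forall>a b. entire2 (\<lambda>p. F p \<phi> $ a $ b))"

text \<open>The value at \<open>p\<close> of the meromorphic continuation to \<open>\<complex>\<^sup>2\<close> of a function \<open>f\<close> given on a nonempty
  open set \<open>\<Omega>\<close>.  Meromorphic functions on \<open>\<complex>\<^sup>2\<close> are the quotients \<open>g/h\<close> of entire functions with
  \<open>h \<noteq> 0\<close>, and for \<open>g/h\<close> in lowest terms \<open>h p \<noteq> 0\<close> exactly at the regular points \<open>p\<close>.  By the identity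
  theorem the value at a regular point is unique; at a singular point it is unspecified.\<close>

definition mero_cont2 ::
  "(complex \<times> complex) set \<Rightarrow> (complex \<times> complex \<Rightarrow> complex) \<Rightarrow> complex \<times> complex \<Rightarrow> complex" where
  "mero_cont2 \<Omega> f p = (THE v. \<exists>g h. entire2 g \<and> entire2 h \<and> h p \<noteq> 0 \<and>
      (\<forall>q\<in>\<Omega>. g q = h q * f q) \<and> v = g p / h p)"

text \<open>The same in one variable, for continuations that are entire.\<close>

definition holo_cont1 :: "complex set \<Rightarrow> (complex \<Rightarrow> complex) \<Rightarrow> complex \<Rightarrow> complex" where
  "holo_cont1 \<Omega> f z =
     (THE v. \<exists>g. g holomorphic_on UNIV \<and> (\<forall>w\<in>\<Omega>. g w = f w) \<and> v = g z)"


section \<open>Representations of the Clifford algebra\<close>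

text \<open>Points are \<open>x = (x', x\<^sub>n)\<close> in \<open>real^'m \<times> real\<close>, so \<open>n = CARD('m) + 1\<close>.  The generators
  \<open>e\<^sub>1, \<dots>, e\<^sub>n\<^sub>-\<^sub>1\<close> are indexed by \<open>Some i\<close> and \<open>e\<^sub>n\<close> by \<open>None\<close>.  As \<open>Cl(n;\<complex>)\<close> is the algebra on
  these generators with the Clifford relations, a representation on \<open>complex^'s\<close> is a choice of
  images \<open>e i\<close> of the generators satisfying the relations, and a subspace is invariant under the
  algebra iff it is invariant under all \<open>e i\<close>.\<close>

definition clifford_rep :: "('m::finite option \<Rightarrow> complex^'s::finite^'s) \<Rightarrow> bool" where
  "clifford_rep e \<longleftrightarrow> (\<forall>i. e i ** e i = - mat 1) \<and>
     (\<forall>i j. i \<noteq> j \<longrightarrow> e i ** e j = - (e j ** e i))"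

definition irreducible_clifford_rep ::
  "('m::finite option \<Rightarrow> complex^'s::finite^'s) \<Rightarrow> bool" where
  "irreducible_clifford_rep e \<longleftrightarrow> clifford_rep e \<and>
     (\<forall>W. vec.subspace W \<and> (\<forall>i. \<forall>w\<in>W. e i *v w \<in> W) \<longrightarrow> W = {0} \<or> W = UNIV)"

type_synonym 'm pt = "(real^'m) \<times> real"

definition zeta' ::
  "('m::finite option \<Rightarrow> complex^'s::finite^'s) \<Rightarrow> 'm pt \<Rightarrow> complex^'s::finite^'s" where
  "zeta' e x = (\<Sum>i\<in>UNIV. (fst x $ i) *\<^sub>R e (Some i))"

definition zeta ::
  "('m::finite option \<Rightarrow> complex^'s::finite^'s) \<Rightarrow> 'm pt \<Rightarrow> complex^'s::finite^'s" where
  "zeta e x = zeta' e x + snd x *\<^sub>R e None"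

definition rsq :: "'m::finite pt \<Rightarrow> real" where
  "rsq x = (norm (fst x))\<^sup>2 + (snd x)\<^sup>2"

definition hyperplane :: "'m::finite pt set" where
  "hyperplane = {x. snd x = 0}"


section \<open>Parameter sets\<close>

definition rho :: "nat \<Rightarrow> complex" where "rho n = of_nat n / 2"

definition rhoH :: "nat \<Rightarrow> complex" where "rhoH n = (of_nat n - 1) / 2"

definition Xplus :: "(complex \<times> complex) set" where
  "Xplus = {(lam, nu). \<exists>k::nat. lam + nu = - 3/2 - 2 * of_nat k}"

definition Yplus :: "(complex \<times> complex) set" where
  "Yplus = {(lam, nu). \<exists>l::nat. lam - nu = - 1/2 - 2 * of_nat l}"

definition Leven :: "nat \<Rightarrow> (complex \<times> complex) set" where
  "Leven n = {(- rho n - 1/2 - of_nat i, - rhoH n - 1/2 - of_nat j) | i j.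
                \<exists>l. int i - int j = 2 * int l}"


section \<open>The family A\<close>

definition KA_minus :: "complex \<Rightarrow> complex \<Rightarrow> 'm::finite pt \<Rightarrow> complex" where
  "KA_minus lam nu x =
     of_real (sgn (snd x)) * of_real \<bar>snd x\<bar> powr (lam + nu - 1/2)
       * of_real (rsq x) powr (- nu - (of_nat (CARD('m) + 1) - 1) / 2)"

definition KA_plus_fun ::
  "('m::finite option \<Rightarrow> complex^'s::finite^'s) \<Rightarrow> complex \<Rightarrow> complex \<Rightarrow> 'm pt \<Rightarrow> complex^'s::finite^'s" where
  "KA_plus_fun e lam nu x = csmult (KA_minus (lam - 1/2) (nu + 1/2) x) (zeta e x)"

text \<open>The domain on which \<^const>\<open>KA_plus_fun\<close> is locally integrable: the exponent of
  \<open>\<bar>x\<^sub>n\<bar>\<close> exceeds \<open>-1\<close> and the homogeneity degree \<open>\<lambda> - \<nu> + 1/2 - n\<close> exceeds \<open>-n\<close>.\<close>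

definition KA_domain :: "(complex \<times> complex) set" where
  "KA_domain = {(lam, nu). Re (lam + nu) > - 1/2 \<and> Re (lam - nu) > - 1/2}"

definition KA_int ::
  "('m::finite option \<Rightarrow> complex^'s::finite^'s) \<Rightarrow> complex \<times> complex \<Rightarrow> ('m pt, 's) mdist" where
  "KA_int e = (\<lambda>(lam, nu). mat_times_dist (KA_plus_fun e lam nu) (\<lambda>f. LINT x|lborel. f x))"

definition KA_plus ::
  "('m::finite option \<Rightarrow> complex^'s::finite^'s) \<Rightarrow> complex \<times> complex \<Rightarrow> ('m pt, 's) mdist" where
  "KA_plus e p = (\<lambda>\<phi>. \<chi> a b. mero_cont2 KA_domain (\<lambda>q. KA_int e q \<phi> $ a $ b) p)"

definition gamma_factor :: "complex \<times> complex \<Rightarrow> complex" where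
  "gamma_factor = (\<lambda>(lam, nu). rGamma ((lam + nu + 3/2) / 2) * rGamma ((lam - nu + 1/2) / 2))"

text \<open>The quotient \<open>K / (\<Gamma> \<Gamma>)\<close> of meromorphic families, continued across removable singularities.
  It is formed off \<open>X\<^sup>+ \<union> Y\<^sup>+\<close>, which is where both Gamma factors are finite.\<close>

definition KAt ::
  "('m::finite option \<Rightarrow> complex^'s::finite^'s) \<Rightarrow> complex \<times> complex \<Rightarrow> ('m pt, 's) mdist" where
  "KAt e p = (\<lambda>\<phi>. \<chi> a b.
     mero_cont2 (- (Xplus \<union> Yplus)) (\<lambda>q. gamma_factor q * KA_plus e q \<phi> $ a $ b) p)"

text \<open>For fixed \<open>\<nu> = - \<rho>\<^sub>H - 1/2 - j\<close>, the entire continuation in \<open>\<lambda>\<close> of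
  \<open>\<Gamma>((\<lambda> - \<nu> + 1/2)/2)\<close> times \<^const>\<open>KAt\<close> from the complement of the Gamma poles.\<close>

definition KAtt ::
  "('m::finite option \<Rightarrow> complex^'s::finite^'s) \<Rightarrow> nat \<Rightarrow> complex \<Rightarrow> ('m pt, 's) mdist" where
  "KAtt e j lam = (let nu = - rhoH (CARD('m) + 1) - 1/2 - of_nat j in
     (\<lambda>\<phi>. \<chi> a b. holo_cont1 {l. (l - nu + 1/2) / 2 \<notin> \<int>\<^sub>\<le>\<^sub>0}
        (\<lambda>l. Gamma ((l - nu + 1/2) / 2) * KAt e (l, nu) \<phi> $ a $ b) lam))"


section \<open>The family B\<close>

text \<open>The distribution \<open>\<delta>\<^sup>(\<^sup>m\<^sup>)(x\<^sub>n)\<close> on \<open>\<real>\<^sup>n\<close>.\<close>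

definition delta_n :: "nat \<Rightarrow> ('m::finite pt \<Rightarrow> complex) \<Rightarrow> complex" where
  "delta_n m f = (-1) ^ m * (LINT x'|lborel. pderivs (replicate m (0, 1)) f (x', 0))"

text \<open>The combination \<open>w \<zeta>(x') \<delta>\<^sup>(\<^sup>2\<^sup>k\<^sup>+\<^sup>1\<^sup>)(x\<^sub>n) - (2k+1) w e\<^sub>n \<delta>\<^sup>(\<^sup>2\<^sup>k\<^sup>)(x\<^sub>n)\<close> for a scalar function \<open>w\<close>.\<close>

definition delta_comb ::
  "('m::finite option \<Rightarrow> complex^'s::finite^'s) \<Rightarrow> nat \<Rightarrow> ('m pt \<Rightarrow> complex) \<Rightarrow> ('m pt, 's) mdist" where
  "delta_comb e k w = (\<lambda>\<phi>.
     mat_times_dist (\<lambda>x. csmult (w x) (zeta' e x)) (delta_n (2*k+1)) \<phi>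
     - csmult (of_nat (2*k+1)) (mat_times_dist (\<lambda>x. csmult (w x) (e None)) (delta_n (2*k)) \<phi>))"

text \<open>Here \<open>\<lambda> = - 3/2 - 2 k - \<nu>\<close>.  The continuation in \<open>\<nu>\<close> starts from the half plane where
  \<open>\<bar>x\<bar>\<^sup>-\<^sup>2\<^sup>\<nu>\<^sup>-\<^sup>n\<close> is \<open>2k+1\<close> times continuously differentiable on \<open>\<real>\<^sup>n\<close>, so that its product with
  \<open>\<delta>\<^sup>(\<^sup>2\<^sup>k\<^sup>+\<^sup>1\<^sup>)(x\<^sub>n)\<close> is defined.\<close>

definition KBt ::
  "('m::finite option \<Rightarrow> complex^'s::finite^'s) \<Rightarrow> nat \<Rightarrow> complex \<Rightarrow> ('m pt, 's) mdist" where
  "KBt e k nu = (\<lambda>\<phi>. \<chi> a b.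
     holo_cont1 {v. Re (- 2 * v - of_nat (CARD('m) + 1)) > real (2*k+1)}
       (\<lambda>v. let lam = - 3/2 - 2 * of_nat k - v in
          rGamma ((lam - v + 1/2) / 2) *
          delta_comb e k (\<lambda>x. of_real (rsq x) powr (- v - of_nat (CARD('m) + 1) / 2)) \<phi> $ a $ b)
       nu)"


section \<open>The family C\<close>

definition delta0 :: "('m::finite pt, 's::finite) mdist" where
  "delta0 = (\<lambda>\<phi>. mat (\<phi> 0))"

definition d_n :: "('m::finite pt, 's::finite) mdist \<Rightarrow> ('m pt, 's) mdist" where
  "d_n = dist_deriv (0, 1)"

definition d_i :: "'m \<Rightarrow> ('m::finite pt, 's::finite) mdist \<Rightarrow> ('m pt, 's) mdist" where
  "d_i i = dist_deriv (axis i 1, 0)"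

definition laplace' :: "('m::finite pt, 's::finite) mdist \<Rightarrow> ('m pt, 's) mdist" where
  "laplace' T = (\<lambda>\<phi>. \<Sum>i\<in>UNIV. d_i i (d_i i T) \<phi>)"

definition dirac' ::
  "('m::finite option \<Rightarrow> complex^'s::finite^'s) \<Rightarrow> ('m pt, 's) mdist \<Rightarrow> ('m pt, 's) mdist" where
  "dirac' e T = (\<lambda>\<phi>. \<Sum>i\<in>UNIV. e (Some i) ** d_i i T \<phi>)"

text \<open>Here \<open>\<lambda> = \<nu> - 1/2 - 2 l\<close>.\<close>

definition KCt ::
  "('m::finite option \<Rightarrow> complex^'s::finite^'s) \<Rightarrow> nat \<Rightarrow> complex \<Rightarrow> ('m pt, 's) mdist" where
  "KCt e l nu = (\<lambda>\<phi>.
     (\<Sum>j<l. csmult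
        (2 ^ (2*l - 2*j - 1) * pochhammer (nu + 1/2 - of_nat l) (l - j - 1)
           / (fact j * fact (2*l - 2*j - 1)))
        ((laplace' ^^ j) ((d_n ^^ (2*l - 2*j - 1)) (dirac' e delta0)) \<phi>))
   + (\<Sum>j\<le>l. csmult
        (2 ^ (2*l - 2*j) * pochhammer (nu + 1/2 - of_nat l) (l - j)
           / (fact j * fact (2*l - 2*j)))
        (e None ** (laplace' ^^ j) ((d_n ^^ (2*l - 2*j)) delta0) \<phi>)))"

end

theory Submission
  imports Defs
begin

text \<open>Put \<open>a = \<lambda> + \<nu> + 1/2\<close> and \<open>z = \<lambda> - \<nu> + 1/2\<close>.  Dividing odd parts by \<open>x\<^sub>n\<close> reduces the
  spinor-valued kernel to the scalar kernel \<open>\<bar>x\<^sub>n\<bar>\<^sup>a \<bar>x\<bar>\<^sup>(\<^sup>z\<^sup>-\<^sup>a\<^sup>-\<^sup>n\<^sup>)\<close>.  Divided by \<open>\<Gamma>((a+1)/2) \<Gamma>(z/2)\<close>, it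
  extends to an entire family \<open>G a z\<close>: the Laplacian and \<open>x\<^sub>n\<^sup>-\<^sup>1\<partial>\<^sub>n\<close> map the kernel at \<open>(a+2, z+2)\<close> to
  multiples of kernels at lower parameters, so integration by parts moves the parameters.  The same
  recursions evaluate \<open>G\<close> at \<open>z = -2l\<close>, starting from a point mass at \<open>z = 0\<close>, and at
  \<open>a = -1-2k\<close>, starting from an integral over the hyperplane at \<open>a = -1\<close>.  Away from the
  hyperplane \<open>G\<close> is still the Gamma factors times the kernel, and \<open>\<zeta>(x)\<close> is invertible for
  \<open>x \<noteq> 0\<close>; testing against bump functions, multiplied by powers of \<open>x\<^sub>n\<close> on the hyperplane
  and of a tangential coordinate at the origin, determines the supports.\<close>

section \<open>Smooth functions\<close>

text \<open>The continuation is carried out on the test functions: \<open>lap\<close> and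
  \<open>Pop\<close> preserve smoothness and the ball of support, so \<open>G\<close> is evaluated
  by convergent integrals at raised parameters. The differential identities are checked only where
  the kernel is smooth enough to integrate by parts; both sides are holomorphic in (a, z), and an
  identity theorem along complex lines carries them everywhere. Two identities are needed. One
  raises a and z together and reaches every point. The other expresses the value at a through a + 2
  and matches the Leibniz rule for normal derivatives on the hyperplane. The constant pi^((n-1)/2) /
  Gamma is the residue at z = 0, that is, the integral of |x_n|^a over the unit ball, found by
  comparing a Gaussian integral with a product of one-dimensional ones. In the last item nu = -rhoH
  - 1/2 - j means z = a + n + 2j, so that the power of |x| is the polynomial |x|^(2j), which the
  test function absorbs. What remains is |x_n|^a, on the line z = a + n. There the second identity
  loses its first term, so that Gamma(z/2) can be multiplied in without creating poles.\<close>

definition smooth_on :: "'a::euclidean_space set \<Rightarrow> ('a \<Rightarrow> complex) \<Rightarrow> bool" where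
  "smooth_on U f \<longleftrightarrow> (\<forall>vs. set vs \<subseteq> Basis \<longrightarrow> (\<forall>x\<in>U. pderivs vs f differentiable (at x)))"

lemma smooth_iff: "smooth f \<longleftrightarrow> smooth_on UNIV f"
  by (simp add: smooth_def smooth_on_def)

lemma pderivs_Nil [simp]: "pderivs [] f = f"
  and pderivs_Cons [simp]: "pderivs (v # vs) f = pderiv_dir v (pderivs vs f)"
  by (simp_all add: pderivs_def)

lemma pderivs_append: "pderivs (vs @ ws) f = pderivs vs (pderivs ws f)"
  by (simp add: pderivs_def)

lemma pderiv_dir_eq:
  assumes "(f has_derivative f') (at x)"
  shows "pderiv_dir v f x = f' v"
  using frechet_derivative_at[OF assms] by (simp add: pderiv_dir_def)

lemma pderiv_dir_cong:
  assumes "open U" "\<And>x. x \<in> U \<Longrightarrow> f x = g x" "x \<in> U"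
  shows "pderiv_dir v f x = pderiv_dir v g x"
proof -
  have "(f has_derivative D) (at x) \<longleftrightarrow> (g has_derivative D) (at x)" for D
    using has_derivative_transform_within_open[OF _ assms(1,3), of f D UNIV g]
      has_derivative_transform_within_open[OF _ assms(1,3), of g D UNIV f] assms(2) by metis
  then show ?thesis
    unfolding pderiv_dir_def frechet_derivative_def by simp
qed

lemma pderivs_cong:
  assumes "open U" "\<And>x. x \<in> U \<Longrightarrow> f x = g x" "x \<in> U"
  shows "pderivs vs f x = pderivs vs g x"
  using assms(3)
proof (induction vs arbitrary: x)
  case Nil
  then show ?case using assms(2) by simp
next
  case (Cons v vs)
  then show ?case using pderiv_dir_cong[OF assms(1), of "pderivs vs f" "pderivs vs g"] by simp
qed

lemma differentiable_cong_open:
  assumes "open U" "\<And>x. x \<in> U \<Longrightarrow> f x = g x" "x \<in> U" "f differentiable (at x)"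
  shows "g differentiable (at x)"
  using assms has_derivative_transform_within_open unfolding differentiable_def by blast

text \<open>By induction on the list, every iterated partial of \<open>f\<close> agrees on
  \<open>U\<close> with a member of \<open>C\<close>. Equality is asked only on the open set, so
  that formulas valid off a singularity can serve, such as those for powers of |x| off the
  origin.\<close>

lemma smooth_on_coinduct:
  assumes "open U" and f: "f \<in> C"
    and d: "\<And>g x. g \<in> C \<Longrightarrow> x \<in> U \<Longrightarrow> g differentiable (at x)"
    and s: "\<And>g v. g \<in> C \<Longrightarrow> v \<in> Basis \<Longrightarrow> \<exists>h\<in>C. \<forall>x\<in>U. pderiv_dir v g x = h x"
  shows "smooth_on U f"
proof -
  have *: "set vs \<subseteq> Basis \<Longrightarrow> \<exists>h\<in>C. \<forall>x\<in>U. pderivs vs f x = h x" for vs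
  proof (induction vs)
    case Nil
    then show ?case using f by auto
  next
    case (Cons v vs)
    then obtain h where h: "h \<in> C" "\<forall>x\<in>U. pderivs vs f x = h x" by auto
    obtain h' where h': "h' \<in> C" "\<forall>x\<in>U. pderiv_dir v h x = h' x"
      using s[OF h(1), of v] Cons.prems by (meson list.set_intros(1) subsetD)
    show ?case
      using pderiv_dir_cong[OF assms(1), of "pderivs vs f" h] h h' by auto
  qed
  show ?thesis
    unfolding smooth_on_def
  proof (intro allI impI ballI)
    fix vs x assume "set vs \<subseteq> (Basis :: 'a set)" "x \<in> U"
    then obtain h where h: "h \<in> C" "\<forall>x\<in>U. pderivs vs f x = h x" using * by blast
    then show "pderivs vs f differentiable at x"
      using differentiable_cong_open[OF assms(1), of h "pderivs vs f" x] d \<open>x \<in> U\<close> by auto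
  qed
qed

lemma smooth_on_differentiable: "smooth_on U f \<Longrightarrow> x \<in> U \<Longrightarrow> f differentiable (at x)"
  unfolding smooth_on_def by (metis empty_subsetI list.set(1) pderivs_Nil)

lemma smooth_on_pderivs: "smooth_on U f \<Longrightarrow> set vs \<subseteq> Basis \<Longrightarrow> smooth_on U (pderivs vs f)"
  unfolding smooth_on_def by (metis Un_subset_iff pderivs_append set_append)

lemma smooth_on_pderiv_dir: "smooth_on U f \<Longrightarrow> v \<in> Basis \<Longrightarrow> smooth_on U (pderiv_dir v f)"
  using smooth_on_pderivs[of U f "[v]"] by simp

lemma smooth_on_subset: "smooth_on U f \<Longrightarrow> V \<subseteq> U \<Longrightarrow> smooth_on V f"
  unfolding smooth_on_def by blast

text \<open>By the Leibniz rule this generated algebra is closed under partial derivatives as soon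
  as the derivatives of the generators lie in it, which makes it a carrier for
  \<open>smooth_on_coinduct\<close>.\<close>

inductive_set alg :: "('a \<Rightarrow> complex) set \<Rightarrow> ('a \<Rightarrow> complex) set" for B where
  base: "f \<in> B \<Longrightarrow> f \<in> alg B"
| const: "(\<lambda>x. c) \<in> alg B"
| add: "f \<in> alg B \<Longrightarrow> g \<in> alg B \<Longrightarrow> (\<lambda>x. f x + g x) \<in> alg B"
| mult: "f \<in> alg B \<Longrightarrow> g \<in> alg B \<Longrightarrow> (\<lambda>x. f x * g x) \<in> alg B"

lemma has_derivative_pderiv_dir:
  "f differentiable (at x) \<Longrightarrow> (f has_derivative (\<lambda>v. pderiv_dir v f x)) (at x)"
  unfolding pderiv_dir_def using frechet_derivative_works by blast

lemma pderiv_dir_const [simp]: "pderiv_dir v (\<lambda>x. c) = (\<lambda>x. 0)"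
  by (rule ext, rule pderiv_dir_eq) simp

lemma pderiv_dir_add:
  assumes "f differentiable (at x)" "g differentiable (at x)"
  shows "pderiv_dir v (\<lambda>x. f x + g x) x = pderiv_dir v f x + pderiv_dir v g x"
  by (rule pderiv_dir_eq[OF has_derivative_add[OF has_derivative_pderiv_dir[OF assms(1)]
      has_derivative_pderiv_dir[OF assms(2)]]])

lemma pderiv_dir_mult:
  assumes "f differentiable (at x)" "g differentiable (at x)"
  shows "pderiv_dir v (\<lambda>x. f x * g x) x = f x * pderiv_dir v g x + pderiv_dir v f x * g x"
  by (rule pderiv_dir_eq[OF has_derivative_mult[OF has_derivative_pderiv_dir[OF assms(1)]
      has_derivative_pderiv_dir[OF assms(2)]]])

lemma smooth_on_alg:
  assumes U: "open U" and f: "f \<in> alg B"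
    and d: "\<And>g x. g \<in> B \<Longrightarrow> x \<in> U \<Longrightarrow> g differentiable (at x)"
    and s: "\<And>g v. g \<in> B \<Longrightarrow> v \<in> Basis \<Longrightarrow> \<exists>h\<in>alg B. \<forall>x\<in>U. pderiv_dir v g x = h x"
  shows "smooth_on U f"
proof -
  have d': "g differentiable (at x)" if "g \<in> alg B" "x \<in> U" for g x
    using that by (induction) (auto intro!: d differentiable_add differentiable_mult)
  have s': "\<exists>h\<in>alg B. \<forall>x\<in>U. pderiv_dir v g x = h x" if "g \<in> alg B" "v \<in> Basis" for g v
    using that
  proof induction
    case (base f)
    then show ?case using s by blast
  next
    case (const c)
    then show ?case using alg.const by force
  next
    case (add f g)
    then obtain f' g' where "f' \<in> alg B" "\<forall>x\<in>U. pderiv_dir v f x = f' x"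
      "g' \<in> alg B" "\<forall>x\<in>U. pderiv_dir v g x = g' x" by blast
    then show ?case
      by (intro bexI[of _ "\<lambda>x. f' x + g' x"] alg.add)
        (simp_all add: pderiv_dir_add d' add.hyps)
  next
    case (mult f g)
    then obtain f' g' where "f' \<in> alg B" "\<forall>x\<in>U. pderiv_dir v f x = f' x"
      "g' \<in> alg B" "\<forall>x\<in>U. pderiv_dir v g x = g' x" by blast
    then show ?case
      by (intro bexI[of _ "\<lambda>x. f x * g' x + f' x * g x"] alg.add alg.mult)
        (simp_all add: pderiv_dir_mult d' mult.hyps)
  qed
  show ?thesis
    using smooth_on_coinduct[OF U f d' s'] by blast
qed

lemma smooth_on_alg_smooth:
  assumes "open U" "f \<in> alg {g. smooth_on U g}"
  shows "smooth_on U f"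
  using assms
  by (rule smooth_on_alg) (auto intro: smooth_on_differentiable alg.base smooth_on_pderiv_dir)

lemma smooth_on_const [simp]: "open U \<Longrightarrow> smooth_on U (\<lambda>x. c)"
  by (rule smooth_on_alg_smooth) (auto intro: alg.intros)

lemma smooth_on_add:
  "open U \<Longrightarrow> smooth_on U f \<Longrightarrow> smooth_on U g \<Longrightarrow> smooth_on U (\<lambda>x. f x + g x)"
  by (rule smooth_on_alg_smooth) (auto intro: alg.intros)

lemma smooth_on_mult:
  "open U \<Longrightarrow> smooth_on U f \<Longrightarrow> smooth_on U g \<Longrightarrow> smooth_on U (\<lambda>x. f x * g x)"
  by (rule smooth_on_alg_smooth) (auto intro: alg.intros)

lemma smooth_on_sum:
  "finite I \<Longrightarrow> open U \<Longrightarrow> (\<And>i. i \<in> I \<Longrightarrow> smooth_on U (f i)) \<Longrightarrow> smooth_on U (\<lambda>x. \<Sum>i\<in>I. f i x)"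
proof (induction I rule: finite_induct)
  case (insert i I)
  then show ?case by (simp add: smooth_on_add)
qed simp

lemma smooth_on_power: "open U \<Longrightarrow> smooth_on U f \<Longrightarrow> smooth_on U (\<lambda>x. f x ^ k)"
  by (induction k) (auto intro: smooth_on_mult)

lemma has_derivative_inner_complex:
  "((\<lambda>x. complex_of_real (x \<bullet> b)) has_derivative (\<lambda>v. complex_of_real (v \<bullet> b))) (at x)"
  by (auto intro!: derivative_eq_intros)

lemma pderiv_dir_inner: "pderiv_dir v (\<lambda>x. complex_of_real (x \<bullet> b)) x = of_real (v \<bullet> b)"
  by (rule pderiv_dir_eq[OF has_derivative_inner_complex])

lemma smooth_on_inner [simp]: "open U \<Longrightarrow> smooth_on U (\<lambda>x. complex_of_real (x \<bullet> b))"
proof (rule smooth_on_alg[of U _ "{\<lambda>x. complex_of_real (x \<bullet> b)}"])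
  fix g v assume "g \<in> {\<lambda>x. complex_of_real (x \<bullet> b)}"
  then show "\<exists>h\<in>alg {\<lambda>x. complex_of_real (x \<bullet> b)}. \<forall>x\<in>U. pderiv_dir v g x = h x"
    by (intro bexI[OF _ alg.const[of "of_real (v \<bullet> b)"]]) (simp add: pderiv_dir_inner)
qed (auto intro: alg.base differentiableI[OF has_derivative_inner_complex])

lemma smooth_on_norm_sq: "open U \<Longrightarrow> smooth_on U (\<lambda>x. complex_of_real ((norm x)\<^sup>2))"
proof -
  assume U: "open U"
  have eq: "(\<lambda>x. complex_of_real ((norm x)\<^sup>2)) = (\<lambda>x::'a. \<Sum>b\<in>Basis. complex_of_real (x \<bullet> b) * complex_of_real (x \<bullet> b))"
  proof
    fix x :: 'a
    show "complex_of_real ((norm x)\<^sup>2) = (\<Sum>b\<in>Basis. complex_of_real (x \<bullet> b) * complex_of_real (x \<bullet> b))"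
      unfolding power2_norm_eq_inner by (subst euclidean_inner) simp
  qed
  show ?thesis
    unfolding eq by (intro smooth_on_sum smooth_on_mult smooth_on_inner U) auto
qed

lemma pderivs_add:
  assumes U: "open U" "smooth_on U f" "smooth_on U g" "set vs \<subseteq> Basis" "x \<in> U"
  shows "pderivs vs (\<lambda>x. f x + g x) x = pderivs vs f x + pderivs vs g x"
  using assms(4,5)
proof (induction vs arbitrary: x)
  case (Cons v vs)
  have "pderiv_dir v (pderivs vs (\<lambda>x. f x + g x)) x = pderiv_dir v (\<lambda>x. pderivs vs f x + pderivs vs g x) x"
    by (rule pderiv_dir_cong[OF U(1)]) (use Cons in auto)
  also have "\<dots> = pderiv_dir v (pderivs vs f) x + pderiv_dir v (pderivs vs g) x"
    by (intro pderiv_dir_add smooth_on_differentiable[OF smooth_on_pderivs[OF assms(2)]]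
        smooth_on_differentiable[OF smooth_on_pderivs[OF assms(3)]]) (use Cons in auto)
  finally show ?case by simp
qed simp

lemma pderivs_cmult:
  assumes U: "open U" "smooth_on U f" "set vs \<subseteq> Basis" "x \<in> U"
  shows "pderivs vs (\<lambda>x. c * f x) x = c * pderivs vs f x"
  using assms(3,4)
proof (induction vs arbitrary: x)
  case (Cons v vs)
  have "pderiv_dir v (pderivs vs (\<lambda>x. c * f x)) x = pderiv_dir v (\<lambda>x. c * pderivs vs f x) x"
    by (rule pderiv_dir_cong[OF U(1)]) (use Cons in auto)
  also have "\<dots> = c * pderiv_dir v (pderivs vs f) x"
    using smooth_on_differentiable[OF smooth_on_pderivs[OF assms(2)], of vs x] Cons.prems
    by (subst pderiv_dir_mult) auto
  finally show ?case by simp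
qed simp

lemma pderivs_const: "pderivs vs (\<lambda>x. 0) = (\<lambda>x. 0)"
  by (induction vs) auto

lemma pderivs_sum:
  assumes U: "open U" "finite I" "\<And>i. i \<in> I \<Longrightarrow> smooth_on U (f i)" "set vs \<subseteq> Basis" "x \<in> U"
  shows "pderivs vs (\<lambda>x. \<Sum>i\<in>I. f i x) x = (\<Sum>i\<in>I. pderivs vs (f i) x)"
  using assms(2,3)
proof (induction I rule: finite_induct)
  case empty
  then show ?case by (simp add: pderivs_const)
next
  case (insert i I)
  then show ?case using assms
    by (simp add: pderivs_add[OF U(1) _ smooth_on_sum])
qed

lemma smooth_on_continuous: "smooth_on U f \<Longrightarrow> continuous_on U f"
  by (intro continuous_at_imp_continuous_on ballI differentiable_imp_continuous_within
      smooth_on_differentiable)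

lemma smooth_has_derivative:
  assumes "smooth_on U f" "x \<in> U"
  shows "(f has_derivative (\<lambda>v. \<Sum>b\<in>Basis. (v \<bullet> b) *\<^sub>R pderiv_dir b f x)) (at x)"
proof -
  have d: "(f has_derivative (\<lambda>v. pderiv_dir v f x)) (at x)"
    using has_derivative_pderiv_dir smooth_on_differentiable assms by blast
  have l: "linear (\<lambda>v. pderiv_dir v f x)"
    using d has_derivative_linear by blast
  have "pderiv_dir v f x = (\<Sum>b\<in>Basis. (v \<bullet> b) *\<^sub>R pderiv_dir b f x)" for v
    using linear_sum[OF l, of "\<lambda>b. (v \<bullet> b) *\<^sub>R b" Basis] linear_scale[OF l]
    by (simp add: euclidean_representation)
  then have "(\<lambda>v. pderiv_dir v f x) = (\<lambda>v. \<Sum>b\<in>Basis. (v \<bullet> b) *\<^sub>R pderiv_dir b f x)" ..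
  then show ?thesis using d by metis
qed

lemma smooth_line_derivative:
  assumes "smooth_on U f" "x + t *\<^sub>R v \<in> U" "v \<in> Basis"
  shows "((\<lambda>s. f (x + s *\<^sub>R v)) has_vector_derivative pderiv_dir v f (x + t *\<^sub>R v)) (at t within S)"
proof -
  have d: "(f has_derivative (\<lambda>v'. pderiv_dir v' f (x + t *\<^sub>R v))) (at (x + t *\<^sub>R v))"
    using has_derivative_pderiv_dir smooth_on_differentiable assms by blast
  have l: "linear (\<lambda>v'. pderiv_dir v' f (x + t *\<^sub>R v))"
    using d has_derivative_linear by blast
  have g: "((\<lambda>s. x + s *\<^sub>R v) has_derivative (\<lambda>s. s *\<^sub>R v)) (at t within S)"
    by (auto intro!: derivative_eq_intros)
  show ?thesis
    unfolding has_vector_derivative_def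
    using has_derivative_compose[OF g d] linear_scale[OF l] by simp
qed

text \<open>Symmetry of second derivatives from continuity of one mixed derivative: by
  differentiation under the integral, the integral along \<open>v\<close> of the derivative in
  \<open>v\<close> and then \<open>w\<close> is the increment of the \<open>w\<close>-derivative;
  differentiating in the upper end point identifies the two mixed derivatives.\<close>

lemma pderiv_dir_commute:
  assumes f: "smooth f" and v: "v \<in> Basis" and w: "w \<in> Basis"
  shows "pderiv_dir v (pderiv_dir w f) = pderiv_dir w (pderiv_dir v f)"
proof (rule ext)
  fix x
  have f: "smooth_on UNIV f" using f by (simp add: smooth_iff)
  note fv = smooth_on_pderiv_dir[OF f v] and fw = smooth_on_pderiv_dir[OF f w]
  note fwv = smooth_on_pderiv_dir[OF fv w] 
  have cv: "continuous_on S (\<lambda>\<sigma>. pderiv_dir v f (y + \<sigma> *\<^sub>R v))" for S y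
    by (rule continuous_on_compose2[OF smooth_on_continuous[OF fv]]) (auto intro!: continuous_intros)
  have cwv: "continuous_on S (\<lambda>(t,\<sigma>). pderiv_dir w (pderiv_dir v f) ((x + \<sigma> *\<^sub>R v) + t *\<^sub>R w))" for S
    unfolding split_beta
    by (rule continuous_on_compose2[OF smooth_on_continuous[OF fwv]]) (auto intro!: continuous_intros)
  have 1: "integral {0..s} (\<lambda>\<sigma>. pderiv_dir v f ((x + t *\<^sub>R w) + \<sigma> *\<^sub>R v)) = f ((x + t *\<^sub>R w) + s *\<^sub>R v) - f (x + t *\<^sub>R w)"
    if "0 \<le> s" for s t
    using fundamental_theorem_of_calculus[of 0 s "\<lambda>s. f ((x + t *\<^sub>R w) + s *\<^sub>R v)"] that
      smooth_line_derivative[OF f _ v] by (simp add: integral_unique)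
  \<comment> \<open>Differentiate \<open>1\<close> in \<open>t\<close> at 0: the left side under the
    integral, the right side directly, and compare by uniqueness of the derivative.\<close>
  have 2: "integral {0..s} (\<lambda>\<sigma>. pderiv_dir w (pderiv_dir v f) (x + \<sigma> *\<^sub>R v)) = pderiv_dir w f (x + s *\<^sub>R v) - pderiv_dir w f x"
    if s: "0 \<le> s" for s
  proof -
    have "((\<lambda>t. integral (cbox 0 s) (\<lambda>\<sigma>. pderiv_dir v f ((x + \<sigma> *\<^sub>R v) + t *\<^sub>R w))) has_vector_derivative
       integral (cbox 0 s) (\<lambda>\<sigma>. pderiv_dir w (pderiv_dir v f) ((x + \<sigma> *\<^sub>R v) + 0 *\<^sub>R w))) (at 0 within {-1..1})"
    proof (rule leibniz_rule_vector_derivative)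
      show "(\<lambda>\<sigma>. pderiv_dir v f ((x + \<sigma> *\<^sub>R v) + t *\<^sub>R w)) integrable_on cbox 0 s" for t
        using cv[of _ "x + t *\<^sub>R w"] by (intro integrable_continuous) (simp add: algebra_simps)
      show "continuous_on ({-1..1} \<times> cbox 0 s) (\<lambda>(t,\<sigma>). pderiv_dir w (pderiv_dir v f) (x + \<sigma> *\<^sub>R v + t *\<^sub>R w))"
        by (rule cwv)
    qed (use smooth_line_derivative[OF fv _ w] in auto)
    moreover have "integral (cbox 0 s) (\<lambda>\<sigma>. pderiv_dir v f ((x + \<sigma> *\<^sub>R v) + t *\<^sub>R w)) = f ((x + s *\<^sub>R v) + t *\<^sub>R w) - f (x + t *\<^sub>R w)" for t
      using 1[OF s, of t] by (simp add: algebra_simps)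
    moreover have "((\<lambda>t. f ((x + s *\<^sub>R v) + t *\<^sub>R w) - f (x + t *\<^sub>R w)) has_vector_derivative
        pderiv_dir w f ((x + s *\<^sub>R v) + 0 *\<^sub>R w) - pderiv_dir w f (x + 0 *\<^sub>R w)) (at 0 within {-1..1})"
      by (intro has_vector_derivative_diff smooth_line_derivative[OF f _ w]) auto
    ultimately show ?thesis
      using vector_derivative_unique_within[of 0 "{-1..1::real}"]
      by (simp add: at_within_Icc_at)
  qed
  have "((\<lambda>s. integral {0..s} (\<lambda>\<sigma>. pderiv_dir w (pderiv_dir v f) (x + \<sigma> *\<^sub>R v))) has_vector_derivative
     pderiv_dir w (pderiv_dir v f) (x + 0 *\<^sub>R v)) (at 0 within {0..1})"
    by (rule integral_has_vector_derivative)
      (auto intro!: continuous_on_compose2[OF smooth_on_continuous[OF fwv]] continuous_intros)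
  moreover have "((\<lambda>s. pderiv_dir w f (x + s *\<^sub>R v) - pderiv_dir w f x) has_vector_derivative
      pderiv_dir v (pderiv_dir w f) (x + 0 *\<^sub>R v) - 0) (at 0 within {0..1})"
    by (intro has_vector_derivative_diff smooth_line_derivative[OF fw _ v]) auto
  ultimately have "((\<lambda>s. pderiv_dir w f (x + s *\<^sub>R v) - pderiv_dir w f x) has_vector_derivative
     pderiv_dir w (pderiv_dir v f) x) (at 0 within {0..1})"
    "((\<lambda>s. pderiv_dir w f (x + s *\<^sub>R v) - pderiv_dir w f x) has_vector_derivative
     pderiv_dir v (pderiv_dir w f) x) (at 0 within {0..1})"
    using has_vector_derivative_transform[of 0 "{0..1}" "\<lambda>s. pderiv_dir w f (x + s *\<^sub>R v) - pderiv_dir w f x" "\<lambda>s. integral {0..s} (\<lambda>\<sigma>. pderiv_dir w (pderiv_dir v f) (x + \<sigma> *\<^sub>R v))"]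
     2 by auto
  then show "pderiv_dir v (pderiv_dir w f) x = pderiv_dir w (pderiv_dir v f) x"
    using vector_derivative_unique_within[of 0 "{0..1::real}"] trivial_limit_within
    by (metis atLeastAtMost_iff islimpt_Icc less_eq_real_def zero_less_one)
qed

section \<open>Continuous functionals on test functions\<close>

text \<open>Test functions are filtered by the radius of a ball containing the support, so that
  continuity can be stated with one constant and one order for each radius.\<close>

definition tf :: "real \<Rightarrow> ('a::euclidean_space \<Rightarrow> complex) set" where
  "tf R = {f. smooth f \<and> (\<forall>x. norm x > R \<longrightarrow> f x = 0)}"

lemma tfI: "smooth f \<Longrightarrow> (\<And>x. norm x > R \<Longrightarrow> f x = 0) \<Longrightarrow> f \<in> tf R"
  and tf_smooth: "f \<in> tf R \<Longrightarrow> smooth f"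
  and tf_smooth_on: "f \<in> tf R \<Longrightarrow> smooth_on UNIV f"
  and tf_zero: "f \<in> tf R \<Longrightarrow> norm x > R \<Longrightarrow> f x = 0"
  by (auto simp: tf_def smooth_iff)

lemma tf_mono: "f \<in> tf R \<Longrightarrow> R \<le> S \<Longrightarrow> f \<in> tf S"
  unfolding tf_def mem_Collect_eq using order_le_less_trans by blast

lemma fsupp_zero: "x \<notin> fsupp f \<Longrightarrow> f x = 0"
  using closure_subset[of "{x. f x \<noteq> 0}"] unfolding fsupp_def by blast

lemma fsupp_subset_closed:
  assumes "closed K" "\<And>x. x \<notin> K \<Longrightarrow> f x = 0" shows "fsupp f \<subseteq> K"
  unfolding fsupp_def using assms by (intro closure_minimal) auto

lemma tf_test: assumes "f \<in> tf R" shows "f \<in> test_functions" "fsupp f \<subseteq> cball 0 R"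
proof -
  show *: "fsupp f \<subseteq> cball 0 R"
    by (rule fsupp_subset_closed) (use tf_zero[OF assms] in force)+
  then have "compact (fsupp f)"
    using compact_Int_closed[OF compact_cball, of "fsupp f" 0 R] by (simp add: fsupp_def Int_absorb1)
  then show "f \<in> test_functions" using assms by (simp add: test_functions_def tf_smooth)
qed

lemma test_tf:
  assumes "f \<in> test_functions" "fsupp f \<subseteq> cball 0 R" shows "f \<in> tf R"
proof (rule tfI)
  fix x :: 'a assume "R < norm x"
  then have "x \<notin> fsupp f" using assms(2) by (auto simp: subset_iff)
  then show "f x = 0" by (rule fsupp_zero)
qed (use assms in \<open>auto simp: test_functions_def\<close>)

lemma compact_subset_cball:
  assumes "compact (K :: 'a::real_normed_vector set)" obtains R where "R > 0" "K \<subseteq> cball 0 R"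
  using bounded_subset_ballD[OF compact_imp_bounded[OF assms], of 0] ball_subset_cball by blast

lemma test_functions_tf:
  assumes "f \<in> test_functions" obtains R where "R > 0" "f \<in> tf R"
  using assms compact_subset_cball[of "fsupp f"] test_tf[OF assms] unfolding test_functions_def by blast

lemma tf_add: "f \<in> tf R \<Longrightarrow> g \<in> tf R \<Longrightarrow> (\<lambda>x. f x + g x) \<in> tf R"
  by (auto simp: tf_def smooth_iff smooth_on_add)

lemma tf_cmult: "f \<in> tf R \<Longrightarrow> (\<lambda>x. c * f x) \<in> tf R"
  by (auto simp: tf_def smooth_iff smooth_on_mult)

lemma tf_mult: "smooth g \<Longrightarrow> f \<in> tf R \<Longrightarrow> (\<lambda>x. g x * f x) \<in> tf R"
  by (auto simp: tf_def smooth_iff smooth_on_mult)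

lemma tf_sum: "finite I \<Longrightarrow> (\<And>i. i \<in> I \<Longrightarrow> f i \<in> tf R) \<Longrightarrow> (\<lambda>x. \<Sum>i\<in>I. f i x) \<in> tf R"
  by (auto simp: tf_def smooth_iff smooth_on_sum)

lemma tf_pderivs:
  assumes "f \<in> tf R" "set vs \<subseteq> Basis" shows "pderivs vs f \<in> tf R"
proof (rule tfI)
  show "smooth (pderivs vs f)" using assms tf_smooth_on[of f] by (simp add: smooth_iff smooth_on_pderivs)
next
  fix x :: 'a assume "R < norm x"
  then have "pderivs vs f x = pderivs vs (\<lambda>x. 0) x"
    using tf_zero[OF assms(1)]
    by (intro pderivs_cong[of "{x. R < norm x}"]) (auto intro!: open_Collect_less continuous_intros)
  then show "pderivs vs f x = 0" by (simp add: pderivs_const)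
qed

lemma tf_pderiv_dir: "f \<in> tf R \<Longrightarrow> v \<in> Basis \<Longrightarrow> pderiv_dir v f \<in> tf R"
  using tf_pderivs[of f R "[v]"] by simp

lemma tf_continuous: "f \<in> tf R \<Longrightarrow> continuous_on S f"
  using smooth_on_continuous tf_smooth_on continuous_on_subset by blast

lemma tf_bounded:
  assumes "f \<in> tf R" shows "bdd_above (range (\<lambda>x. cmod (f x)))"
proof -
  have "compact ((\<lambda>x. cmod (f x)) ` cball 0 R)"
    by (intro compact_continuous_image continuous_intros tf_continuous[OF assms] compact_cball)
  then have "bdd_above ((\<lambda>x. cmod (f x)) ` cball 0 R)"
    by (intro bounded_imp_bdd_above compact_imp_bounded)
  then obtain B where B: "\<And>x. norm x \<le> R \<Longrightarrow> cmod (f x) \<le> B"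
    unfolding bdd_above_def by (metis imageI mem_cball_0)
  have "cmod (f x) \<le> max B 0" for x
    using B[of x] tf_zero[OF assms, of x] by (cases "norm x \<le> R") auto
  then show ?thesis by (auto simp: bdd_above_def)
qed

text \<open>This is the seminorm sum occurring in \<open>distribution\<close>, used as a norm on
  each \<open>tf R\<close>.\<close>

definition sem :: "nat \<Rightarrow> ('a::euclidean_space \<Rightarrow> complex) \<Rightarrow> real" where
  "sem N f = (\<Sum>vs | set vs \<subseteq> Basis \<and> length vs \<le> N. SUP x. cmod (pderivs vs f x))"

lemma finite_multi: "finite {vs. set vs \<subseteq> (Basis :: 'a::euclidean_space set) \<and> length vs \<le> N}"
  by (rule finite_lists_length_le) simp

lemma SUP_nonneg_norm:
  assumes "f \<in> tf R" "set vs \<subseteq> Basis" shows "0 \<le> (SUP x. cmod (pderivs vs f x))"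
  by (rule order_trans[OF norm_ge_zero cSUP_upper[OF UNIV_I tf_bounded[OF tf_pderivs[OF assms]]]])

lemma sem_nonneg: "f \<in> tf R \<Longrightarrow> 0 \<le> sem N f"
  unfolding sem_def by (intro sum_nonneg) (auto intro: SUP_nonneg_norm)

lemma pderivs_le_sem:
  assumes "f \<in> tf R" "set vs \<subseteq> Basis" "length vs \<le> N"
  shows "cmod (pderivs vs f x) \<le> sem N f"
proof -
  have "cmod (pderivs vs f x) \<le> (SUP x. cmod (pderivs vs f x))"
    by (rule cSUP_upper[OF UNIV_I tf_bounded[OF tf_pderivs[OF assms(1,2)]]])
  also have "\<dots> \<le> sem N f"
    unfolding sem_def using assms
    by (intro member_le_sum[of vs]) (auto intro: SUP_nonneg_norm finite_multi)
  finally show ?thesis .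
qed

lemma sem_le:
  fixes f :: "'a::euclidean_space \<Rightarrow> complex"
  assumes "\<And>vs x. set vs \<subseteq> Basis \<Longrightarrow> length vs \<le> N \<Longrightarrow> cmod (pderivs vs f x) \<le> (B::real)"
  shows "sem N f \<le> real (card {vs. set vs \<subseteq> (Basis :: 'a set) \<and> length vs \<le> N}) * B"
proof -
  have "sem N f \<le> (\<Sum>vs | set vs \<subseteq> (Basis :: 'a set) \<and> length vs \<le> N. B)"
    unfolding sem_def using assms by (intro sum_mono cSUP_least) auto
  then show ?thesis by simp
qed

text \<open>Continuous linear operators that do not enlarge the ball of support. Keeping the same
  \<open>R\<close> lets them be composed with each other and with functionals; partial derivatives,
  polynomial factors and \<open>Qop\<close> are of this kind.\<close>

definition cop :: "(('a::euclidean_space \<Rightarrow> complex) \<Rightarrow> 'a \<Rightarrow> complex) \<Rightarrow> bool" where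
  "cop A \<longleftrightarrow> (\<forall>R>0. (\<forall>f\<in>tf R. A f \<in> tf R) \<and>
     (\<forall>f\<in>tf R. \<forall>g\<in>tf R. A (\<lambda>x. f x + g x) = (\<lambda>x. A f x + A g x)) \<and>
     (\<forall>f\<in>tf R. \<forall>c. A (\<lambda>x. c * f x) = (\<lambda>x. c * A f x)) \<and>
     (\<forall>N. \<exists>C\<ge>0. \<exists>M. \<forall>f\<in>tf R. sem N (A f) \<le> C * sem M f))"

definition cfn :: "(('a::euclidean_space \<Rightarrow> complex) \<Rightarrow> complex) \<Rightarrow> bool" where
  "cfn T \<longleftrightarrow> (\<forall>R>0. 
     (\<forall>f\<in>tf R. \<forall>g\<in>tf R. T (\<lambda>x. f x + g x) = T f + T g) \<and>
     (\<forall>f\<in>tf R. \<forall>c. T (\<lambda>x. c * f x) = c * T f) \<and>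
     (\<exists>C\<ge>0. \<exists>M. \<forall>f\<in>tf R. cmod (T f) \<le> C * sem M f))"

lemma cop_tf: "cop A \<Longrightarrow> R > 0 \<Longrightarrow> f \<in> tf R \<Longrightarrow> A f \<in> tf R"
  and cop_add: "cop A \<Longrightarrow> R > 0 \<Longrightarrow> f \<in> tf R \<Longrightarrow> g \<in> tf R \<Longrightarrow> A (\<lambda>x. f x + g x) = (\<lambda>x. A f x + A g x)"
  and cop_cmult: "cop A \<Longrightarrow> R > 0 \<Longrightarrow> f \<in> tf R \<Longrightarrow> A (\<lambda>x. c * f x) = (\<lambda>x. c * A f x)"
  and cop_bound: "cop A \<Longrightarrow> R > 0 \<Longrightarrow> \<exists>C\<ge>0. \<exists>M. \<forall>f\<in>tf R. sem N (A f) \<le> C * sem M f"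
  unfolding cop_def by blast+

lemma cfn_add: "cfn T \<Longrightarrow> R > 0 \<Longrightarrow> f \<in> tf R \<Longrightarrow> g \<in> tf R \<Longrightarrow> T (\<lambda>x. f x + g x) = T f + T g"
  and cfn_cmult: "cfn T \<Longrightarrow> R > 0 \<Longrightarrow> f \<in> tf R \<Longrightarrow> T (\<lambda>x. c * f x) = c * T f"
  and cfn_bound: "cfn T \<Longrightarrow> R > 0 \<Longrightarrow> \<exists>C\<ge>0. \<exists>M. \<forall>f\<in>tf R. cmod (T f) \<le> C * sem M f"
  unfolding cfn_def by blast+

lemma tf_0: "(\<lambda>x. 0) \<in> tf R"
  by (auto simp: tf_def smooth_iff)

lemma cfn_zero: "cfn T \<Longrightarrow> T (\<lambda>x. 0) = 0"
  using cfn_cmult[of T 1 "\<lambda>x. 0" 0] tf_0[of 1] by simp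

lemma cfn_sum:
  assumes "cfn T" "R > 0" "finite I" "\<And>i. i \<in> I \<Longrightarrow> f i \<in> tf R"
  shows "T (\<lambda>x. \<Sum>i\<in>I. f i x) = (\<Sum>i\<in>I. T (f i))"
  using assms(3,4)
proof (induction I rule: finite_induct)
  case (insert i I)
  then show ?case using cfn_add[OF assms(1,2), of "f i"] by (simp add: tf_sum)
qed (simp add: cfn_zero assms)

lemma cop_comp: assumes A: "cop A" and B: "cop B" shows "cop (\<lambda>f. A (B f))"
  unfolding cop_def
proof (intro allI impI conjI ballI)
  fix R :: real and N :: nat assume R: "R > 0"
  obtain C M where C: "C \<ge> 0" "\<forall>f\<in>tf R. sem N (A f) \<le> C * sem M f"
    using cop_bound[OF A R] by blast
  obtain C' M' where C': "C' \<ge> 0" "\<forall>f\<in>tf R. sem M (B f) \<le> C' * sem M' f"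
    using cop_bound[OF B R] by blast
  have "sem N (A (B f)) \<le> (C * C') * sem M' f" if "f \<in> tf R" for f
    using order_trans[OF C(2)[rule_format, OF cop_tf[OF B R that]] mult_left_mono[OF C'(2)[rule_format, OF that] C(1)]]
    by (simp add: mult.assoc)
  then show "\<exists>C\<ge>0. \<exists>M. \<forall>f\<in>tf R. sem N (A (B f)) \<le> C * sem M f"
    using C(1) C'(1) by (intro exI[of _ "C * C'"]) auto
qed (use cop_tf[OF A] cop_tf[OF B] cop_add[OF A] cop_add[OF B] cop_cmult[OF A] cop_cmult[OF B] in auto)

lemma cfn_comp: assumes T: "cfn T" and B: "cop B" shows "cfn (\<lambda>f. T (B f))"
  unfolding cfn_def
proof (intro allI impI conjI ballI)
  fix R :: real assume R: "R > 0"
  obtain C M where C: "C \<ge> 0" "\<forall>f\<in>tf R. cmod (T f) \<le> C * sem M f"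
    using cfn_bound[OF T R] by blast
  obtain C' M' where C': "C' \<ge> 0" "\<forall>f\<in>tf R. sem M (B f) \<le> C' * sem M' f"
    using cop_bound[OF B R] by blast
  have "cmod (T (B f)) \<le> (C * C') * sem M' f" if "f \<in> tf R" for f
    using order_trans[OF C(2)[rule_format, OF cop_tf[OF B R that]] mult_left_mono[OF C'(2)[rule_format, OF that] C(1)]]
    by (simp add: mult.assoc)
  then show "\<exists>C\<ge>0. \<exists>M. \<forall>f\<in>tf R. cmod (T (B f)) \<le> C * sem M f"
    using C(1) C'(1) by (intro exI[of _ "C * C'"]) auto
qed (use cop_tf[OF B] cfn_add[OF T] cop_add[OF B] cfn_cmult[OF T] cop_cmult[OF B] in auto)

lemma sem_mono: "f \<in> tf R \<Longrightarrow> M \<le> N \<Longrightarrow> sem M f \<le> sem N f"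
  unfolding sem_def by (intro sum_mono2 finite_multi) (auto intro: SUP_nonneg_norm)

lemma cfn_plus: assumes T: "cfn T" and S: "cfn S" shows "cfn (\<lambda>f. T f + S f)"
  unfolding cfn_def
proof (intro allI impI conjI ballI)
  fix R :: real assume R: "R > 0"
  obtain C M where C: "C \<ge> 0" "\<forall>f\<in>tf R. cmod (T f) \<le> C * sem M f"
    using cfn_bound[OF T R] by blast
  obtain C' M' where C': "C' \<ge> 0" "\<forall>f\<in>tf R. cmod (S f) \<le> C' * sem M' f"
    using cfn_bound[OF S R] by blast
  have "cmod (T f + S f) \<le> (C + C') * sem (max M M') f" if f: "f \<in> tf R" for f
  proof -
    have "cmod (T f + S f) \<le> C * sem M f + C' * sem M' f"
      using C(2) C'(2) f by (intro norm_triangle_le add_mono) auto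
    also have "\<dots> \<le> C * sem (max M M') f + C' * sem (max M M') f"
      using C(1) C'(1) by (intro add_mono mult_left_mono sem_mono[OF f]) auto
    finally show ?thesis by (simp add: distrib_right)
  qed
  then show "\<exists>C\<ge>0. \<exists>M. \<forall>f\<in>tf R. cmod (T f + S f) \<le> C * sem M f"
    using C(1) C'(1) by (intro exI[of _ "C + C'"]) auto
qed (use cfn_add[OF T] cfn_add[OF S] cfn_cmult[OF T] cfn_cmult[OF S] in \<open>auto simp: algebra_simps\<close>)

lemma cfn_scale: assumes T: "cfn T" shows "cfn (\<lambda>f. c * T f)"
  unfolding cfn_def
proof (intro allI impI conjI ballI)
  fix R :: real assume R: "R > 0"
  obtain C M where C: "C \<ge> 0" "\<forall>f\<in>tf R. cmod (T f) \<le> C * sem M f"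
    using cfn_bound[OF T R] by blast
  have "cmod (c * T f) \<le> (cmod c * C) * sem M f" if f: "f \<in> tf R" for f
    using mult_left_mono[OF C(2)[rule_format, OF f] norm_ge_zero[of c]] by (simp add: norm_mult mult.assoc)
  then show "\<exists>C\<ge>0. \<exists>M. \<forall>f\<in>tf R. cmod (c * T f) \<le> C * sem M f"
    using C(1) by (intro exI[of _ "cmod c * C"]) auto
qed (use cfn_add[OF T] cfn_cmult[OF T] in \<open>auto simp: algebra_simps\<close>)

lemma cfn_0: "cfn (\<lambda>f. 0)"
  unfolding cfn_def by (auto intro!: exI[of _ "0::real"])

lemma cfn_sum_fun: "(\<And>i. i \<in> I \<Longrightarrow> cfn (T i)) \<Longrightarrow> cfn (\<lambda>f. \<Sum>i\<in>I. T i f)"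
  by (induction I rule: infinite_finite_induct) (auto intro: cfn_0 cfn_plus)

lemma cfn_eval: "cfn (\<lambda>f. f x)"
  unfolding cfn_def
proof (intro allI impI conjI ballI)
  fix R :: real 
  have "cmod (f x) \<le> 1 * sem 0 f" if "f \<in> tf R" for f
    using pderivs_le_sem[OF that, of "[]" 0 x] by simp
  then show "\<exists>C\<ge>0. \<exists>M. \<forall>f\<in>tf R. cmod (f x) \<le> C * sem M f"
    by (intro exI[of _ "1::real"]) auto
qed auto

text \<open>Since \<open>sem N\<close> is a finite sum of suprema, a uniform bound on the single
  derivatives suffices; the number of lists enters the constant.\<close>

lemma copI:
  assumes "\<And>R f. R > 0 \<Longrightarrow> f \<in> tf R \<Longrightarrow> A f \<in> tf R"
    "\<And>R f g. R > 0 \<Longrightarrow> f \<in> tf R \<Longrightarrow> g \<in> tf R \<Longrightarrow> A (\<lambda>x. f x + g x) = (\<lambda>x. A f x + A g x)"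
    "\<And>R f c. R > 0 \<Longrightarrow> f \<in> tf R \<Longrightarrow> A (\<lambda>x. c * f x) = (\<lambda>x. c * A f x)"
    "\<And>R N. R > 0 \<Longrightarrow> \<exists>C\<ge>0. \<exists>M. \<forall>f\<in>tf R. \<forall>vs x. set vs \<subseteq> Basis \<longrightarrow> length vs \<le> N \<longrightarrow>
        cmod (pderivs vs (A f) x) \<le> C * sem M f"
  shows "cop (A :: ('a::euclidean_space \<Rightarrow> complex) \<Rightarrow> 'a \<Rightarrow> complex)"
  unfolding cop_def
proof (intro allI impI conjI ballI)
  fix R :: real and N :: nat assume R: "R > 0"
  obtain C M where C: "C \<ge> 0" "\<forall>f\<in>tf R. \<forall>vs x. set vs \<subseteq> Basis \<longrightarrow> length vs \<le> N \<longrightarrow>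
        cmod (pderivs vs (A f) x) \<le> C * sem M f" using assms(4)[OF R] by blast
  define c where "c = real (card {vs. set vs \<subseteq> (Basis :: 'a set) \<and> length vs \<le> N})"
  have "sem N (A f) \<le> (c * C) * sem M f" if "f \<in> tf R" for f
    using sem_le[of N "A f" "C * sem M f"] C(2) that by (simp add: c_def mult.assoc)
  then show "\<exists>C\<ge>0. \<exists>M. \<forall>f\<in>tf R. sem N (A f) \<le> C * sem M f"
    using C(1) by (intro exI[of _ "c * C"]) (auto simp: c_def)
qed (use assms in auto)

lemma cop_id: "cop (\<lambda>f. f)"
proof (rule copI)
  fix R :: real and N
  show "\<exists>C\<ge>0. \<exists>M. \<forall>f\<in>tf R. \<forall>vs x. set vs \<subseteq> Basis \<longrightarrow> length vs \<le> N \<longrightarrow>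
      cmod (pderivs vs f x) \<le> C * sem M f"
    by (intro exI[of _ "1::real"] exI[of _ N]) (auto intro: pderivs_le_sem)
qed auto

lemma cop_pderiv:
  fixes v :: "'a::euclidean_space"
  assumes "v \<in> Basis" shows "cop (pderiv_dir v)"
proof (rule copI)
  show "pderiv_dir v (\<lambda>x. f x + g x) = (\<lambda>x. pderiv_dir v f x + pderiv_dir v g x)"
    if "f \<in> tf R" "g \<in> tf R" for f g R
    using smooth_on_differentiable[OF tf_smooth_on] that by (intro ext pderiv_dir_add) auto
  show "pderiv_dir v (\<lambda>x. c * f x) = (\<lambda>x. c * pderiv_dir v f x)" if "f \<in> tf R" for f c R
    using smooth_on_differentiable[OF tf_smooth_on] that by (intro ext, subst pderiv_dir_mult) auto
  show "\<exists>C\<ge>0. \<exists>M. \<forall>f\<in>tf R. \<forall>vs x. set vs \<subseteq> Basis \<longrightarrow> length vs \<le> N \<longrightarrow>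
        cmod (pderivs vs (pderiv_dir v f) x) \<le> C * sem M f" for R N
  proof (intro exI[of _ "1::real"] exI[of _ "Suc N"] conjI ballI allI impI)
    fix f :: "'a \<Rightarrow> complex" and vs :: "'a list" and x assume "f \<in> tf R" "set vs \<subseteq> Basis" "length vs \<le> N"
    then show "cmod (pderivs vs (pderiv_dir v f) x) \<le> 1 * sem (Suc N) f"
      using pderivs_le_sem[of f R "vs @ [v]" "Suc N" x] assms by (simp add: pderivs_append)
  qed simp
qed (use assms tf_pderiv_dir in blast)

lemma cop_pderivs: "set vs \<subseteq> Basis \<Longrightarrow> cop (pderivs vs)"
proof (induction vs)
  case Nil
  then show ?case using cop_id by (simp add: pderivs_def)
next
  case (Cons v vs)
  have "pderivs (v # vs) = (\<lambda>f. pderiv_dir v (pderivs vs f))" by (rule ext) simp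
  then show ?case using cop_comp[OF cop_pderiv, of v "pderivs vs"] Cons by simp
qed

lemma cop_plus:
  fixes A B :: "('a::euclidean_space \<Rightarrow> complex) \<Rightarrow> 'a \<Rightarrow> complex"
  assumes A: "cop A" and B: "cop B" shows "cop (\<lambda>f x. A f x + B f x)"
proof (rule copI)
  fix R :: real and N assume R: "R > 0"
  obtain C M where C: "C \<ge> 0" "\<forall>f\<in>tf R. sem N (A f) \<le> C * sem M f"
    using cop_bound[OF A R] by blast
  obtain C' M' where C': "C' \<ge> 0" "\<forall>f\<in>tf R. sem N (B f) \<le> C' * sem M' f"
    using cop_bound[OF B R] by blast
  have "cmod (pderivs vs (\<lambda>x. A f x + B f x) x) \<le> (C + C') * sem (max M M') f"
    if f: "f \<in> tf R" and vs: "set vs \<subseteq> Basis" "length vs \<le> N" for f vs x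
  proof -
    have "cmod (pderivs vs (\<lambda>x. A f x + B f x) x) = cmod (pderivs vs (A f) x + pderivs vs (B f) x)"
      using tf_smooth_on[OF cop_tf[OF A R f]] tf_smooth_on[OF cop_tf[OF B R f]] vs
      by (subst pderivs_add[of UNIV]) auto
    also have "\<dots> \<le> sem N (A f) + sem N (B f)"
      using pderivs_le_sem[OF cop_tf[OF A R f] vs] pderivs_le_sem[OF cop_tf[OF B R f] vs]
      by (intro norm_triangle_le add_mono) auto
    also have "\<dots> \<le> C * sem M f + C' * sem M' f" using C(2) C'(2) f by (intro add_mono) auto
    also have "\<dots> \<le> C * sem (max M M') f + C' * sem (max M M') f"
      using C(1) C'(1) by (intro add_mono mult_left_mono sem_mono[OF f]) auto
    finally show ?thesis by (simp add: distrib_right)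
  qed
  then show "\<exists>C\<ge>0. \<exists>M. \<forall>f\<in>tf R. \<forall>vs x. set vs \<subseteq> Basis \<longrightarrow> length vs \<le> N \<longrightarrow>
     cmod (pderivs vs (\<lambda>x. A f x + B f x) x) \<le> C * sem M f"
    using C(1) C'(1) by (intro exI[of _ "C + C'"] exI[of _ "max M M'"] conjI) auto
next
  fix R :: real and f :: "'a \<Rightarrow> complex" assume "R > 0" "f \<in> tf R"
  then show "(\<lambda>x. A f x + B f x) \<in> tf R" by (intro tf_add cop_tf[OF A] cop_tf[OF B]) auto
qed (use cop_add[OF A] cop_add[OF B] cop_cmult[OF A] cop_cmult[OF B] in \<open>auto simp: algebra_simps\<close>)

lemma cop_0: "cop (\<lambda>f x. 0)"
  by (rule copI) (auto intro!: exI[of _ "0::real"] tf_0 simp: pderivs_const)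

lemma cop_sum: "(\<And>i. i \<in> I \<Longrightarrow> cop (A i)) \<Longrightarrow> cop (\<lambda>f x. \<Sum>i\<in>I. A i f x)"
  by (induction I rule: infinite_finite_induct) (auto intro: cop_0 cop_plus)

text \<open>The derivative applied first is the last entry of the list. Splitting it off there
  leaves shorter lists, applied to x_b times a derivative and to \<open>f\<close>, and no
  derivatives have to be commuted.\<close>

lemma pderivs_mult_inner:
  assumes f: "smooth f" and vs: "set vs \<subseteq> Basis" "v \<in> Basis"
  shows "pderivs (vs @ [v]) (\<lambda>x. complex_of_real (x \<bullet> b) * f x) x =
    pderivs vs (\<lambda>x. complex_of_real (x \<bullet> b) * pderiv_dir v f x) x + of_real (v \<bullet> b) * pderivs vs f x"
proof -
  have f': "smooth_on UNIV f" using f by (simp add: smooth_iff)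
  have "pderiv_dir v (\<lambda>x. complex_of_real (x \<bullet> b) * f x) = (\<lambda>x. complex_of_real (x \<bullet> b) * pderiv_dir v f x + of_real (v \<bullet> b) * f x)"
    using smooth_on_differentiable[OF f'] 
    by (intro ext, subst pderiv_dir_mult) (auto intro: differentiableI[OF has_derivative_inner_complex] simp: pderiv_dir_inner)
  then have "pderivs (vs @ [v]) (\<lambda>x. complex_of_real (x \<bullet> b) * f x) x =
     pderivs vs (\<lambda>x. complex_of_real (x \<bullet> b) * pderiv_dir v f x + of_real (v \<bullet> b) * f x) x"
    by (simp add: pderivs_append)
  also have "\<dots> = pderivs vs (\<lambda>x. complex_of_real (x \<bullet> b) * pderiv_dir v f x) x + pderivs vs (\<lambda>x. of_real (v \<bullet> b) * f x) x"
    using vs f' by (intro pderivs_add[of UNIV] smooth_on_mult smooth_on_pderiv_dir) auto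
  also have "pderivs vs (\<lambda>x. of_real (v \<bullet> b) * f x) x = of_real (v \<bullet> b) * pderivs vs f x"
    using vs f' by (intro pderivs_cmult[of UNIV]) auto
  finally show ?thesis .
qed

lemma cop_inner:
  assumes b: "b \<in> Basis" shows "cop (\<lambda>f x. complex_of_real (x \<bullet> b) * f x)"
proof (rule copI)
  fix R :: real and N assume R: "R > 0"
  \<comment> \<open>On the support |x_b| is at most \<open>R\<close>, and each of the
    \<open>length vs\<close> derivatives can hit the coordinate once; hence the constant
    \<open>R + length vs\<close>.\<close>
  have "cmod (pderivs vs (\<lambda>x. complex_of_real (x \<bullet> b) * f x) x) \<le> (R + length vs) * sem (length vs) f"
    if f: "f \<in> tf R" and vs: "set vs \<subseteq> Basis" for f :: "'a \<Rightarrow> complex" and vs x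
    using f vs
  proof (induction vs arbitrary: f rule: rev_induct)
    case Nil
    have "\<bar>x \<bullet> b\<bar> * cmod (f x) \<le> R * sem 0 f"
    proof (cases "norm x \<le> R")
      case True
      then show ?thesis using Basis_le_norm[OF b, of x] pderivs_le_sem[OF Nil(1), of "[]" 0 x]
        by (intro mult_mono) auto
    next
      case False
      then show ?thesis using tf_zero[OF Nil(1), of x] sem_nonneg[OF Nil(1), of 0] R by auto
    qed
    then show ?case by (simp add: norm_mult)
  next
    case (snoc v vs)
    have "cmod (pderivs (vs @ [v]) (\<lambda>x. complex_of_real (x \<bullet> b) * f x) x) \<le>
      cmod (pderivs vs (\<lambda>x. complex_of_real (x \<bullet> b) * pderiv_dir v f x) x) + cmod (of_real (v \<bullet> b) * pderivs vs f x)"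
      using snoc by (subst pderivs_mult_inner) (auto simp: tf_smooth intro: norm_triangle_ineq)
    also have "\<dots> \<le> (R + length vs) * sem (length vs) (pderiv_dir v f) + 1 * sem (Suc (length vs)) f"
    proof (intro add_mono)
      show "cmod (pderivs vs (\<lambda>x. complex_of_real (x \<bullet> b) * pderiv_dir v f x) x) \<le> (R + length vs) * sem (length vs) (pderiv_dir v f)"
        using snoc by (intro snoc.IH tf_pderiv_dir) auto
      have "\<bar>v \<bullet> b\<bar> \<le> 1" using snoc.prems b by (simp add: inner_Basis)
      then show "cmod (of_real (v \<bullet> b) * pderivs vs f x) \<le> 1 * sem (Suc (length vs)) f"
        using snoc.prems pderivs_le_sem[of f R vs "Suc (length vs)" x] unfolding norm_mult
        by (intro mult_mono) auto
    qed
    also have "sem (length vs) (pderiv_dir v f) \<le> sem (Suc (length vs)) f"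
    proof -
      \<comment> \<open>Appending \<open>v\<close> maps these lists injectively to lists one longer,
        so the left sum is a part of the right one.\<close>
      let ?S = "{ws. set ws \<subseteq> (Basis :: 'a set) \<and> length ws \<le> length vs}"
      have inj: "inj_on (\<lambda>ws. ws @ [v]) ?S" by (auto simp: inj_on_def)
      have "sem (length vs) (pderiv_dir v f) = (\<Sum>ws\<in>(\<lambda>ws. ws @ [v]) ` ?S. SUP x. cmod (pderivs ws f x))"
        unfolding sem_def by (subst sum.reindex[OF inj]) (simp add: pderivs_append o_def)
      also have "\<dots> \<le> sem (Suc (length vs)) f"
        unfolding sem_def using snoc.prems
        by (intro sum_mono2 finite_multi) (auto intro!: SUP_nonneg_norm[of f R])
      finally show ?thesis .
    qed
    finally have "cmod (pderivs (vs @ [v]) (\<lambda>x. complex_of_real (x \<bullet> b) * f x) x) \<le> (R + length vs) * sem (Suc (length vs)) f + 1 * sem (Suc (length vs)) f"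
      using R by (simp add: mult_left_mono)
    then show ?case by (simp add: algebra_simps)
  qed
  moreover have "(R + length vs) * sem (length vs) f \<le> (R + N) * sem N f"
    if f: "f \<in> tf R" and vs: "length vs \<le> N" for f :: "'a \<Rightarrow> complex" and vs :: "'a list"
    using R vs by (intro mult_mono sem_mono[OF f] sem_nonneg[OF f]) auto
  ultimately have "cmod (pderivs vs (\<lambda>x. complex_of_real (x \<bullet> b) * f x) x) \<le> (R + N) * sem N f"
    if "f \<in> tf R" "set vs \<subseteq> Basis" "length vs \<le> N" for f :: "'a \<Rightarrow> complex" and vs x
    using that by (meson order_trans)
  then show "\<exists>C\<ge>0. \<exists>M. \<forall>f\<in>tf R. \<forall>vs x. set vs \<subseteq> Basis \<longrightarrow> length vs \<le> N \<longrightarrow>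
        cmod (pderivs vs (\<lambda>x. complex_of_real (x \<bullet> b) * f x) x) \<le> C * sem M f"
    using R by (intro exI[of _ "R + N"] exI[of _ N] conjI ballI allI impI) auto
next
  fix R :: real and f :: "'a \<Rightarrow> complex" assume "R > 0" "f \<in> tf R"
  then show "(\<lambda>x. complex_of_real (x \<bullet> b) * f x) \<in> tf R"
    by (intro tf_mult) (auto simp: smooth_iff)
qed (auto simp: algebra_simps)

lemma cop_norm_sq: "cop (\<lambda>f x. complex_of_real ((norm x)\<^sup>2) * f x)"
proof -
  have "(\<lambda>f x. complex_of_real ((norm x)\<^sup>2) * f x) = 
     (\<lambda>f x::'a. \<Sum>b\<in>Basis. complex_of_real (x \<bullet> b) * (complex_of_real (x \<bullet> b) * f x))"
  proof (intro ext)
    fix f :: "'a \<Rightarrow> complex" and x :: 'a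
    show "complex_of_real ((norm x)\<^sup>2) * f x = (\<Sum>b\<in>Basis. complex_of_real (x \<bullet> b) * (complex_of_real (x \<bullet> b) * f x))"
      unfolding power2_norm_eq_inner by (subst euclidean_inner) (simp add: sum_distrib_right mult.assoc)
  qed
  moreover have "cop (\<lambda>f x::'a. \<Sum>b\<in>Basis. complex_of_real (x \<bullet> b) * (complex_of_real (x \<bullet> b) * f x))"
    by (intro cop_sum cop_comp[OF cop_inner cop_inner])
  ultimately show ?thesis by simp
qed

lemma cop_norm_sq_power: "cop (\<lambda>f x. complex_of_real ((norm x)\<^sup>2) ^ k * f x)"
proof (induction k)
  case (Suc k)
  show ?case using cop_comp[OF cop_norm_sq Suc] by (simp add: mult.assoc)
qed (simp add: cop_id)

abbreviation en :: "'b::euclidean_space \<times> real" where "en \<equiv> (0, 1)"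

lemma en_Basis [simp]: "en \<in> Basis" by (simp add: Basis_prod_def)

section \<open>Odd parts divided by the last coordinate\<close>

definition sc :: "real \<Rightarrow> 'b::euclidean_space \<times> real \<Rightarrow> 'b \<times> real" where
  "sc t x = (fst x, t * snd x)"

text \<open>The diagonal entries of the map \<open>sc t\<close>. They enter the chain rule for
  averages and, at t = -1, the change of variables under reflection.\<close>

definition wt :: "real \<Rightarrow> 'b::euclidean_space \<times> real \<Rightarrow> real" where
  "wt t b = (if b = en then t else 1)"

lemma sc_inner: "b \<in> Basis \<Longrightarrow> sc t h \<bullet> b = wt t b * (h \<bullet> b)"
  by (auto simp: sc_def wt_def Basis_prod_def inner_prod_def)

lemma norm_sc_minus1 [simp]: "norm (sc (-1) x) = norm x" and sc_1 [simp]: "sc 1 x = x"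
  by (auto simp: sc_def norm_prod_def)

text \<open>These averages are closed under partial derivatives: by the chain rule a derivative in
  the last direction produces one more factor t, any other derivative none. This yields smoothness
  across the hyperplane of the odd part divided by x_n.\<close>

definition avg :: "nat \<Rightarrow> ('b::euclidean_space \<times> real \<Rightarrow> complex) \<Rightarrow> 'b \<times> real \<Rightarrow> complex" where
  "avg k f x = integral {-1..1} (\<lambda>t. of_real (t ^ k) * f (sc t x))"

lemma continuous_on_sc: "continuous_on S (\<lambda>p. sc (fst p) (snd p))"
  unfolding sc_def by (intro continuous_intros)

lemma continuous_on_sc1: "continuous_on S (\<lambda>t. sc t x)"
  unfolding sc_def by (intro continuous_intros)

lemma avg_integrable:
  "smooth f \<Longrightarrow> (\<lambda>t. of_real (t ^ k) * f (sc t x)) integrable_on {-1..1}"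
  by (intro integrable_continuous_real continuous_intros
      continuous_on_compose2[OF smooth_on_continuous[of UNIV f] continuous_on_sc1])
    (auto simp: smooth_iff)

text \<open>Differentiation under the integral. The derivative of the integrand is assembled as a
  continuous family \<open>fx\<close> of bounded linear maps, the form required by the Leibniz rule,
  and evaluated coordinatewise afterwards.\<close>

lemma avg_has_derivative:
  fixes f :: "'b::euclidean_space \<times> real \<Rightarrow> complex"
  assumes f: "smooth f"
  shows "(avg k f has_derivative (\<lambda>h. \<Sum>b\<in>Basis. (h \<bullet> b) *\<^sub>R avg (if b = en then Suc k else k) (pderiv_dir b f) x)) (at x)"
proof -
  have f': "smooth_on UNIV f" using f by (simp add: smooth_iff)
  define c where "c = (\<lambda>b x t. of_real (t ^ k * wt t b) * pderiv_dir b f (sc t x))"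
  define fx where "fx = (\<lambda>x t. \<Sum>b\<in>Basis. blinfun_compose (blinfun_scaleR_left (c b x t)) (blinfun_inner_left b))"
  have cc: "continuous_on (UNIV \<times> cbox (-1) 1) (\<lambda>(x,t). c b x t)" if "b \<in> Basis" for b
  proof -
    have "continuous_on UNIV (pderiv_dir b f)"
      using smooth_on_continuous[OF smooth_on_pderiv_dir[OF f' that]] .
    then have "continuous_on (UNIV \<times> cbox (-1) 1) (\<lambda>p. pderiv_dir b f (sc (snd p) (fst p)))"
      by (rule continuous_on_compose2) (auto simp: sc_def intro!: continuous_intros)
    moreover have "continuous_on (UNIV \<times> cbox (-1) 1) (\<lambda>p. complex_of_real (snd p ^ k * wt (snd p) b))"
      unfolding wt_def by (cases "b = en") (auto intro!: continuous_intros)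
    ultimately show ?thesis
      unfolding c_def split_beta by (rule continuous_on_mult[rotated])
  qed
  have cfx: "continuous_on (UNIV \<times> cbox (-1) 1) (\<lambda>(x,t). fx x t)"
    using cc unfolding fx_def split_beta by (intro continuous_intros) auto
  have fx_app: "blinfun_apply (fx x t) = (\<lambda>h. \<Sum>b\<in>Basis. (h \<bullet> b) *\<^sub>R c b x t)" for x t
    unfolding fx_def by (rule ext) (simp add: blinfun.sum_left)
  have "((\<lambda>x. integral (cbox (-1) 1) (\<lambda>t. of_real (t ^ k) * f (sc t x))) has_derivative
     integral (cbox (-1) 1) (fx x)) (at x within UNIV)"
  proof (rule leibniz_rule[OF _ _ cfx])
    fix x :: "'b \<times> real" and t
    have "(sc t has_derivative sc t) (at x)"
      unfolding sc_def by (auto intro!: derivative_eq_intros)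
    from has_derivative_compose[OF this smooth_has_derivative[OF f', of "sc t x", OF UNIV_I]]
    have "((\<lambda>x. f (sc t x)) has_derivative (\<lambda>h. \<Sum>b\<in>Basis. (sc t h \<bullet> b) *\<^sub>R pderiv_dir b f (sc t x))) (at x)" .
    then have "((\<lambda>x. of_real (t ^ k) * f (sc t x)) has_derivative (\<lambda>h. of_real (t^k) * (\<Sum>b\<in>Basis. (sc t h \<bullet> b) *\<^sub>R pderiv_dir b f (sc t x)))) (at x)"
      by (rule has_derivative_mult_right)
    moreover have "(\<lambda>h. of_real (t^k) * (\<Sum>b\<in>Basis. (sc t h \<bullet> b) *\<^sub>R pderiv_dir b f (sc t x))) = blinfun_apply (fx x t)"
      unfolding fx_app by (rule ext) (auto simp: sum_distrib_left c_def sc_inner scaleR_conv_of_real intro!: sum.cong)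
    ultimately show "((\<lambda>x. of_real (t ^ k) * f (sc t x)) has_derivative blinfun_apply (fx x t)) (at x within UNIV)"
      by simp
  next
    fix x show "(\<lambda>t. of_real (t ^ k) * f (sc t x)) integrable_on cbox (-1) 1"
      using avg_integrable[OF f] by simp
  qed auto
  moreover have "blinfun_apply (integral (cbox (-1) 1) (fx x)) h = (\<Sum>b\<in>Basis. (h \<bullet> b) *\<^sub>R avg (if b = en then Suc k else k) (pderiv_dir b f) x)" for h
  proof -
    have "continuous_on (cbox (-1) 1) (fx x)"
      using continuous_on_compose2[OF cfx continuous_on_Pair[OF continuous_on_const continuous_on_id], where s="cbox (-1) 1"] by fastforce
    then have "blinfun_apply (integral (cbox (-1) 1) (fx x)) h = integral (cbox (-1) 1) (\<lambda>t. fx x t h)"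
      by (intro blinfun_apply_integral integrable_continuous)
    also have "\<dots> = integral (cbox (-1) 1) (\<lambda>t. \<Sum>b\<in>Basis. (h \<bullet> b) *\<^sub>R c b x t)"
      by (simp add: fx_app)
    also have "\<dots> = (\<Sum>b\<in>Basis. integral (cbox (-1) 1) (\<lambda>t. (h \<bullet> b) *\<^sub>R c b x t))"
    proof (rule integral_sum)
      fix b :: "'b \<times> real" assume "b \<in> Basis"
      then have "continuous_on (cbox (-1) 1) (c b x)"
        using continuous_on_compose2[OF cc continuous_on_Pair[OF continuous_on_const continuous_on_id], of b, where s="cbox (-1) 1"] by fastforce
      then show "(\<lambda>t. (h \<bullet> b) *\<^sub>R c b x t) integrable_on cbox (-1) 1"
        by (intro integrable_continuous continuous_intros)
    qed simp
    also have "\<dots> = (\<Sum>b\<in>Basis. (h \<bullet> b) *\<^sub>R avg (if b = en then Suc k else k) (pderiv_dir b f) x)"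
      by (rule sum.cong) (auto simp: avg_def c_def wt_def mult.commute)
    finally show ?thesis .
  qed
  then have "blinfun_apply (integral (cbox (-1) 1) (fx x)) = (\<lambda>h. \<Sum>b\<in>Basis. (h \<bullet> b) *\<^sub>R avg (if b = en then Suc k else k) (pderiv_dir b f) x)"
    by (rule ext)
  ultimately show ?thesis
    unfolding avg_def[abs_def] by (simp add: avg_def[abs_def])
qed

lemma pderiv_dir_avg:
  fixes v :: "'b::euclidean_space \<times> real"
  assumes f: "smooth f" and v: "v \<in> Basis"
  shows "pderiv_dir v (avg k f) = avg (if v = en then Suc k else k) (pderiv_dir v f)"
proof
  fix x
  have "pderiv_dir v (avg k f) x = (\<Sum>b\<in>Basis. (v \<bullet> b) *\<^sub>R avg (if b = en then Suc k else k) (pderiv_dir b f) x)"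
    by (rule pderiv_dir_eq[OF avg_has_derivative[OF f]])
  also have "\<dots> = (\<Sum>b\<in>Basis. if b = v then avg (if b = en then Suc k else k) (pderiv_dir b f) x else 0)"
    using v by (intro sum.cong) (auto simp: inner_Basis)
  finally show "pderiv_dir v (avg k f) x = avg (if v = en then Suc k else k) (pderiv_dir v f) x"
    using v by simp
qed

lemma smooth_pderiv: "smooth f \<Longrightarrow> v \<in> Basis \<Longrightarrow> smooth (pderiv_dir v f)"
  by (simp add: smooth_iff smooth_on_pderiv_dir)

lemma smooth_avg:
  fixes f :: "'b::euclidean_space \<times> real \<Rightarrow> complex"
  assumes "smooth f" shows "smooth (avg k f)"
  unfolding smooth_iff
proof (rule smooth_on_coinduct[of UNIV _ "{avg k f | k f. smooth f}"])
  fix g :: "'b \<times> real \<Rightarrow> complex" and v :: "'b \<times> real"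
  assume "g \<in> {avg k f | k f. smooth f}" "v \<in> Basis"
  then obtain k f where g: "g = avg k f" "smooth f" by blast
  show "\<exists>h\<in>{avg k f | k f. smooth f}. \<forall>x\<in>UNIV. pderiv_dir v g x = h x"
    using pderiv_dir_avg[OF g(2) \<open>v \<in> Basis\<close>, of k] smooth_pderiv[OF g(2) \<open>v \<in> Basis\<close>] g(1)
    by blast
next
  fix g :: "'b \<times> real \<Rightarrow> complex" and x
  assume "g \<in> {avg k f | k f. smooth f}"
  then show "g differentiable at x" using differentiableI[OF avg_has_derivative] by blast
qed (use assms in auto)

lemma pderivs_avg:
  fixes f :: "'b::euclidean_space \<times> real \<Rightarrow> complex"
  assumes "smooth f" "set vs \<subseteq> Basis"
  shows "\<exists>m. pderivs vs (avg k f) = avg m (pderivs vs f)"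
  using assms(2)
proof (induction vs)
  case (Cons v vs)
  then obtain m where m: "pderivs vs (avg k f) = avg m (pderivs vs f)" by auto
  have "smooth (pderivs vs f)" using assms Cons.prems by (simp add: smooth_iff smooth_on_pderivs)
  from pderiv_dir_avg[OF this] m Cons.prems show ?case by auto
qed auto

lemma norm_avg_le:
  assumes "smooth f" "\<And>y. cmod (f y) \<le> B" shows "cmod (avg k f x) \<le> 2 * B"
proof -
  have B: "0 \<le> B" using order_trans[OF norm_ge_zero assms(2)] .
  have "norm (integral {-1..1} (\<lambda>t. of_real (t ^ k) * f (sc t x))) \<le> B * (1 - (-1))"
  proof (rule integral_bound)
    show "continuous_on {-1..1} (\<lambda>t. complex_of_real (t ^ k) * f (sc t x))"
      using assms(1) by (intro continuous_intros
      continuous_on_compose2[OF smooth_on_continuous[of UNIV f] continuous_on_sc1]) (auto simp: smooth_iff)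
    fix t :: real assume "t \<in> {-1..1}"
    then have "\<bar>t ^ k\<bar> \<le> 1" by (simp add: power_abs power_le_one abs_le_iff)
    then show "norm (of_real (t ^ k) * f (sc t x)) \<le> B"
      using assms(2)[of "sc t x"] mult_mono[of "\<bar>t ^ k\<bar>" 1 "cmod (f (sc t x))" B] B by (simp add: norm_mult norm_power power_abs)
  qed simp
  then show ?thesis by (simp add: avg_def)
qed

text \<open>Hadamard's lemma: this is (f(x', x_n) - f(x', -x_n)) / (2 x_n), written as an integral
  so that no division by x_n occurs.\<close>

definition Qop :: "('b::euclidean_space \<times> real \<Rightarrow> complex) \<Rightarrow> 'b \<times> real \<Rightarrow> complex" where
  "Qop f x = avg 0 (pderiv_dir en f) x / 2"

text \<open>The odd part of the normal derivative, divided by x_n.\<close>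

definition Pop :: "('b::euclidean_space \<times> real \<Rightarrow> complex) \<Rightarrow> 'b \<times> real \<Rightarrow> complex" where
  "Pop f = Qop (pderiv_dir en f)"

lemma Qop_mult:
  fixes f :: "'b::euclidean_space \<times> real \<Rightarrow> complex"
  assumes f: "smooth f"
  shows "of_real (snd x) * Qop f x = (f x - f (sc (-1) x)) / 2"
proof -
  have f': "smooth_on UNIV f" using f by (simp add: smooth_iff)
  have d: "((\<lambda>t. f (sc t x)) has_vector_derivative of_real (snd x) * pderiv_dir en f (sc t x)) (at t within S)" for t S
  proof -
    have "((\<lambda>s. f ((fst x, 0) + s *\<^sub>R en)) has_vector_derivative pderiv_dir en f ((fst x, 0) + (t * snd x) *\<^sub>R en)) (at (t * snd x) within (\<lambda>t. t * snd x) ` S)"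
      by (rule smooth_line_derivative[OF f']) auto
    moreover have "((\<lambda>t. t * snd x) has_vector_derivative snd x) (at t within S)"
      by (auto intro!: derivative_eq_intros simp: has_vector_derivative_def)
    ultimately have "((\<lambda>s. f ((fst x, 0) + s *\<^sub>R en)) \<circ> (\<lambda>t. t * snd x) has_vector_derivative
        snd x *\<^sub>R pderiv_dir en f ((fst x, 0) + (t * snd x) *\<^sub>R en)) (at t within S)"
      by (intro vector_diff_chain_within) auto
    then show ?thesis by (simp add: o_def sc_def scaleR_conv_of_real)
  qed
  have "((\<lambda>t. of_real (snd x) * pderiv_dir en f (sc t x)) has_integral (f (sc 1 x) - f (sc (-1) x))) {-1..1}"
    by (rule fundamental_theorem_of_calculus) (auto intro: d)
  from integral_unique[OF this]
  have "of_real (snd x) * integral {-1..1} (\<lambda>t. pderiv_dir en f (sc t x)) = f x - f (sc (-1) x)"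
    by simp
  then show ?thesis by (simp add: Qop_def avg_def)
qed

lemma Qop_zero:
  assumes "f \<in> tf R" "norm x > R" "snd x = 0 \<Longrightarrow> Qop f x = 0"
  shows "Qop f x = 0"
  using Qop_mult[OF tf_smooth[OF assms(1)], of x] tf_zero[OF assms(1), of x] tf_zero[OF assms(1), of "sc (-1) x"] assms by auto

lemma cop_Qop: "cop (Qop :: ('b::euclidean_space \<times> real \<Rightarrow> complex) \<Rightarrow> 'b \<times> real \<Rightarrow> complex)"
proof (rule copI)
  fix R :: real and f :: "'b \<times> real \<Rightarrow> complex" assume "R > 0" and f: "f \<in> tf R"
  have sm: "smooth (\<lambda>x. Qop f x)"
    unfolding Qop_def using smooth_avg[OF smooth_pderiv[OF tf_smooth[OF f] en_Basis], of 0]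
      smooth_on_mult[of UNIV "\<lambda>x. 1/2" "avg 0 (pderiv_dir en f)"] by (simp add: smooth_iff)
  show "Qop f \<in> tf R"
  proof (rule tfI)
    fix x :: "'b \<times> real" assume x: "R < norm x"
    show "Qop f x = 0"
    proof (rule Qop_zero[OF f x])
      \<comment> \<open>On the hyperplane the quotient formula gives no information, but there the
        segment of the points \<open>sc t x\<close> degenerates to \<open>x\<close> itself.\<close>
      assume "snd x = 0"
      then have "sc t x = x" for t by (simp add: sc_def prod_eq_iff)
      then show "Qop f x = 0" using tf_zero[OF tf_pderiv_dir[OF f en_Basis] x]
        by (simp add: Qop_def avg_def)
    qed
  qed (use sm in simp)
next
  fix R :: real and f g :: "'b \<times> real \<Rightarrow> complex" assume R: "R > 0" and f: "f \<in> tf R" and g: "g \<in> tf R"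
  show "Qop (\<lambda>x. f x + g x) = (\<lambda>x. Qop f x + Qop g x)"
    unfolding Qop_def cop_add[OF cop_pderiv[OF en_Basis] R f g] avg_def
    using avg_integrable[OF smooth_pderiv[OF tf_smooth[OF f] en_Basis], of 0]
      avg_integrable[OF smooth_pderiv[OF tf_smooth[OF g] en_Basis], of 0]
    by (simp add: distrib_left Henstock_Kurzweil_Integration.integral_add add_divide_distrib)
next
  fix R :: real and f :: "'b \<times> real \<Rightarrow> complex" and c assume R: "R > 0" and f: "f \<in> tf R" 
  show "Qop (\<lambda>x. c * f x) = (\<lambda>x. c * Qop f x)"
    unfolding Qop_def cop_cmult[OF cop_pderiv[OF en_Basis] R f] avg_def by simp
next
  fix R :: real and N 
  show "\<exists>C\<ge>0. \<exists>M. \<forall>f\<in>tf R. \<forall>vs x. set vs \<subseteq> (Basis :: ('b \<times> real) set) \<longrightarrow> length vs \<le> N \<longrightarrow>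
        cmod (pderivs vs (Qop f) x) \<le> C * sem M f"
  proof (rule exI[of _ "1::real"], intro conjI exI[of _ "Suc N"] ballI allI impI)
    fix f :: "'b \<times> real \<Rightarrow> complex" and vs :: "('b \<times> real) list" and x
    assume f: "f \<in> tf R" and vs: "set vs \<subseteq> Basis" "length vs \<le> N"
    note sm = smooth_pderiv[OF tf_smooth[OF f] en_Basis]
    \<comment> \<open>Since |t| is at most 1 on the interval of integration, one bound holds for
      every exponent \<open>m\<close>.\<close>
    obtain m where m: "pderivs vs (avg 0 (pderiv_dir en f)) = avg m (pderivs vs (pderiv_dir en f))"
      using pderivs_avg[OF sm vs(1)] by blast
    have "pderivs vs (Qop f) x = (1/2) * pderivs vs (avg 0 (pderiv_dir en f)) x"
      using pderivs_cmult[of UNIV "avg 0 (pderiv_dir en f)" vs x "1/2"] smooth_avg[OF sm] vs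
      by (simp add: smooth_iff Qop_def[abs_def])
    moreover have "cmod (avg m (pderivs vs (pderiv_dir en f)) x) \<le> 2 * sem (Suc N) f"
      using tf_smooth[OF tf_pderivs[OF tf_pderiv_dir[OF f en_Basis] vs(1)]] vs
       pderivs_le_sem[OF f, of "vs @ [en]" "Suc N"]
      by (intro norm_avg_le) (auto simp: pderivs_append)
    ultimately have "pderivs vs (Qop f) x = avg m (pderivs vs (pderiv_dir en f)) x / 2"
      "cmod (avg m (pderivs vs (pderiv_dir en f)) x) \<le> 2 * sem (Suc N) f"
      using m by simp_all
    then show "cmod (pderivs vs (Qop f) x) \<le> 1 * sem (Suc N) f"
      by (simp only: norm_divide) simp
  qed simp
qed

lemma cop_Pop: "cop Pop"
  unfolding Pop_def using cop_comp[OF cop_Qop cop_pderiv[OF en_Basis]] .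

definition lap :: "('a::euclidean_space \<Rightarrow> complex) \<Rightarrow> 'a \<Rightarrow> complex" where
  "lap f x = (\<Sum>b\<in>Basis. pderiv_dir b (pderiv_dir b f) x)"

lemma cop_lap: "cop lap"
  unfolding lap_def using cop_sum[of Basis "\<lambda>b f. pderiv_dir b (pderiv_dir b f)"] cop_comp[OF cop_pderiv cop_pderiv]
  by blast

section \<open>Holomorphic functions of two complex variables\<close>

definition hol2 :: "(complex \<times> complex) set \<Rightarrow> (complex \<times> complex \<Rightarrow> complex) \<Rightarrow> bool" where
  "hol2 D f \<longleftrightarrow> (\<forall>p\<in>D. \<exists>a b. (f has_derivative (\<lambda>h. a * fst h + b * snd h)) (at p))"

lemma entire2_iff: "entire2 f \<longleftrightarrow> hol2 UNIV f"
  by (simp add: entire2_def hol2_def)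

lemma hol2_const: "hol2 D (\<lambda>p. c)"
  unfolding hol2_def by (auto intro!: exI[of _ "0::complex"])

lemma hol2_fst: "hol2 D fst"
  unfolding hol2_def by (intro ballI exI[of _ "1::complex"] exI[of _ "0::complex"]) (auto intro!: derivative_eq_intros)

lemma hol2_snd: "hol2 D snd"
  unfolding hol2_def by (rule ballI, rule exI[of _ "0::complex"], rule exI[of _ "1::complex"]) (auto intro!: derivative_eq_intros)

lemma hol2_add: assumes "hol2 D f" "hol2 D g" shows "hol2 D (\<lambda>p. f p + g p)"
  unfolding hol2_def
proof
  fix p assume "p \<in> D"
  then obtain a b c d where "(f has_derivative (\<lambda>h. a * fst h + b * snd h)) (at p)"
    "(g has_derivative (\<lambda>h. c * fst h + d * snd h)) (at p)" using assms unfolding hol2_def by blast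
  from has_derivative_add[OF this] 
  have "((\<lambda>p. f p + g p) has_derivative (\<lambda>h. (a + c) * fst h + (b + d) * snd h)) (at p)"
    by (rule has_derivative_eq_rhs) (auto simp: algebra_simps)
  then show "\<exists>a b. ((\<lambda>p. f p + g p) has_derivative (\<lambda>h. a * fst h + b * snd h)) (at p)" by blast
qed

lemma hol2_mult: assumes "hol2 D f" "hol2 D g" shows "hol2 D (\<lambda>p. f p * g p)"
  unfolding hol2_def
proof
  fix p assume "p \<in> D"
  then obtain a b c d where "(f has_derivative (\<lambda>h. a * fst h + b * snd h)) (at p)"
    "(g has_derivative (\<lambda>h. c * fst h + d * snd h)) (at p)" using assms unfolding hol2_def by blast
  from has_derivative_mult[OF this] 
  have "((\<lambda>p. f p * g p) has_derivative (\<lambda>h. (f p * c + a * g p) * fst h + (f p * d + b * g p) * snd h)) (at p)"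
    by (rule has_derivative_eq_rhs) (auto simp: algebra_simps)
  then show "\<exists>a b. ((\<lambda>p. f p * g p) has_derivative (\<lambda>h. a * fst h + b * snd h)) (at p)" by blast
qed

lemma hol2_cmult: "hol2 D f \<Longrightarrow> hol2 D (\<lambda>p. c * f p)"
  by (rule hol2_mult[OF hol2_const])

lemma hol2_diff: "hol2 D f \<Longrightarrow> hol2 D g \<Longrightarrow> hol2 D (\<lambda>p. f p - g p)"
  using hol2_add[OF _ hol2_cmult[of D g "-1"], of f] by simp

lemma hol2_divide_const: "hol2 D f \<Longrightarrow> hol2 D (\<lambda>p. f p / c)"
  using hol2_cmult[of D f "1/c"] by simp

lemma hol2_sum: "(\<And>i. i \<in> I \<Longrightarrow> hol2 D (f i)) \<Longrightarrow> hol2 D (\<lambda>p. \<Sum>i\<in>I. f i p)"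
  by (induction I rule: infinite_finite_induct) (auto intro: hol2_const hol2_add)

lemma hol2_compose1:
  assumes "hol2 D f" "g holomorphic_on UNIV" shows "hol2 D (\<lambda>p. g (f p))"
  unfolding hol2_def
proof
  fix p assume "p \<in> D"
  then obtain a b where f: "(f has_derivative (\<lambda>h. a * fst h + b * snd h)) (at p)"
    using assms unfolding hol2_def by blast
  have "(g has_field_derivative deriv g (f p)) (at (f p))"
    using assms(2) by (simp add: holomorphic_derivI)
  from has_derivative_compose[OF f this[unfolded has_field_derivative_def]]
  have "((\<lambda>p. g (f p)) has_derivative (\<lambda>h. (deriv g (f p) * a) * fst h + (deriv g (f p) * b) * snd h)) (at p)"
    by (rule has_derivative_eq_rhs) (auto simp: algebra_simps)
  then show "\<exists>a b. ((\<lambda>p. g (f p)) has_derivative (\<lambda>h. a * fst h + b * snd h)) (at p)" by blast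
qed

lemma hol2_compose2:
  assumes "hol2 D f" "hol2 E u" "hol2 E v" "\<And>p. p \<in> E \<Longrightarrow> (u p, v p) \<in> D"
  shows "hol2 E (\<lambda>p. f (u p, v p))"
  unfolding hol2_def
proof
  fix p assume p: "p \<in> E"
  then obtain a b a' b' where u: "(u has_derivative (\<lambda>h. a * fst h + b * snd h)) (at p)"
    and v: "(v has_derivative (\<lambda>h. a' * fst h + b' * snd h)) (at p)"
    using assms unfolding hol2_def by blast
  obtain c d where f: "(f has_derivative (\<lambda>h. c * fst h + d * snd h)) (at (u p, v p))"
    using assms(1,4) p unfolding hol2_def by blast
  from has_derivative_compose[OF has_derivative_Pair[OF u v] f]
  have "((\<lambda>p. f (u p, v p)) has_derivative (\<lambda>h. (c * a + d * a') * fst h + (c * b + d * b') * snd h)) (at p)"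
    by (rule has_derivative_eq_rhs) (auto simp: algebra_simps)
  then show "\<exists>a b. ((\<lambda>p. f (u p, v p)) has_derivative (\<lambda>h. a * fst h + b * snd h)) (at p)" by blast
qed

lemma hol2_slice:
  assumes "hol2 D f" "open S" "u holomorphic_on S" "v holomorphic_on S" "\<And>t. t \<in> S \<Longrightarrow> (u t, v t) \<in> D"
  shows "(\<lambda>t. f (u t, v t)) holomorphic_on S"
proof (rule holomorphic_onI)
  fix t assume t: "t \<in> S"
  have u: "(u has_field_derivative deriv u t) (at t)" and v: "(v has_field_derivative deriv v t) (at t)"
    using assms t holomorphic_derivI by blast+
  obtain c d where f: "(f has_derivative (\<lambda>h. c * fst h + d * snd h)) (at (u t, v t))"
    using assms(1,5) t unfolding hol2_def by blast
  from has_derivative_compose[OF has_derivative_Pair[OF u[unfolded has_field_derivative_def] v[unfolded has_field_derivative_def]] f]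
  have "((\<lambda>p. f (u p, v p)) has_derivative (*) (c * deriv u t + d * deriv v t)) (at t)"
    by (rule has_derivative_eq_rhs) (auto simp: algebra_simps)
  then show "(\<lambda>t. f (u t, v t)) field_differentiable at t within S"
    unfolding field_differentiable_def has_field_derivative_def using has_derivative_at_withinI by blast
qed

lemma hol2_cong:
  assumes "open D" "hol2 D f" "\<And>p. p \<in> D \<Longrightarrow> f p = g p" shows "hol2 D g"
  using assms has_derivative_transform_within_open unfolding hol2_def by blast

lemma hol2_subset: "hol2 D f \<Longrightarrow> E \<subseteq> D \<Longrightarrow> hol2 E f"
  unfolding hol2_def by blast

lemma hol2_continuous: "hol2 D f \<Longrightarrow> continuous_on D f"
  unfolding hol2_def
  by (meson continuous_at_imp_continuous_on has_derivative_continuous)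

text \<open>Restrict to the complex line through \<open>p\<close> and a point of
  \<open>\<Omega>\<close>. The preimage of \<open>D\<close> under its parametrization is convex,
  hence connected, and that of \<open>\<Omega>\<close> is open and nonempty, so the identity theorem
  in one variable applies.\<close>

lemma hol2_identity:
  assumes D: "open D" "convex D" and f: "hol2 D f" "hol2 D g" and \<Omega>: "open \<Omega>" "\<Omega> \<subseteq> D" "\<Omega> \<noteq> {}"
    and eq: "\<And>p. p \<in> \<Omega> \<Longrightarrow> f p = g p" and p: "p \<in> D"
  shows "f p = g p"
proof -
  obtain q where q: "q \<in> \<Omega>" using \<Omega> by blast
  define u where "u = (\<lambda>t. fst q + t * (fst p - fst q))"
  define v where "v = (\<lambda>t. snd q + t * (snd p - snd q))"
  define L where "L = (\<lambda>t. (u t, v t))"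
  have hu: "u holomorphic_on A" and hv: "v holomorphic_on A" for A
    unfolding u_def v_def by (auto intro!: holomorphic_intros)
  have cL: "continuous_on UNIV L" unfolding L_def u_def v_def by (intro continuous_intros)
  have oT: "open (L -` D)" "open (L -` \<Omega>)" using open_vimage[OF _ cL] D(1) \<Omega>(1) by auto
  have L: "L ((1 - s) *\<^sub>R x + s *\<^sub>R y) = (1 - s) *\<^sub>R L x + s *\<^sub>R L y" for s x y
    by (auto simp: L_def u_def v_def algebra_simps scaleR_conv_of_real)
  have "convex (L -` D)"
    unfolding convex_alt using D(2)[unfolded convex_alt] by (auto simp: L)
  then have con: "connected (L -` D)" by (rule convex_connected)
  have "f (L 1) = g (L 1)"
  proof (rule analytic_continuation_open[OF oT(2) oT(1) _ con, of "\<lambda>t. f (L t)" "\<lambda>t. g (L t)"])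
    show "(\<lambda>t. f (L t)) holomorphic_on L -` D" "(\<lambda>t. g (L t)) holomorphic_on L -` D"
      unfolding L_def by (rule hol2_slice[OF _ oT(1)[unfolded L_def] hu hv]; use f in auto)+
    have "L 0 = q" by (simp add: L_def u_def v_def)
    then show "L -` \<Omega> \<noteq> {}" using q by (metis empty_iff vimage_eq)
  qed (use oT \<Omega> eq p in \<open>auto simp: L_def u_def v_def\<close>)
  then show ?thesis by (simp add: L_def u_def v_def)
qed

lemma exp_remainder: "norm (exp w - 1 - w) \<le> (norm w)\<^sup>2 * exp (norm w)" for w :: complex
  using Taylor_exp_field[of w 1] by (simp add: power2_eq_square algebra_simps)

text \<open>Differentiation under the integral without an explicit dominating function:
  integrability at the four corners of a square around \<open>p\<close> controls the integrand times
  exp(\<delta> (|A| + |B|)), and this exponential dominates all polynomial factors that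
  arise.\<close>

lemma exp_integral_hol2:
  fixes A B :: "'a::euclidean_space \<Rightarrow> real" and g :: "'a \<Rightarrow> complex"
  assumes [measurable]: "A \<in> borel_measurable M" "B \<in> borel_measurable M" "g \<in> borel_measurable M"
    and D: "open D"
    and int: "\<And>p. p \<in> D \<Longrightarrow> integrable M (\<lambda>x. exp (fst p * of_real (A x) + snd p * of_real (B x)) * g x)"
  shows "hol2 D (\<lambda>p. \<integral>x. exp (fst p * of_real (A x) + snd p * of_real (B x)) * g x \<partial>M)"
  unfolding hol2_def
proof
  fix p assume p: "p \<in> D"
  define E where "E = (\<lambda>p x. exp (fst p * of_real (A x) + snd p * of_real (B x)) * g x)"
  define F where "F = (\<lambda>p. \<integral>x. E p x \<partial>M)"
  define Y where "Y = (\<lambda>x. \<bar>A x\<bar> + \<bar>B x\<bar>)"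
  have [measurable]: "E p \<in> borel_measurable M" for p unfolding E_def by measurable
  have [measurable]: "Y \<in> borel_measurable M" unfolding Y_def by measurable
  obtain e where e: "e > 0" "ball p e \<subseteq> D" using D p open_contains_ball by blast
  \<comment> \<open>Half the radius, so that the corners, at distance sqrt 2 times \<delta>, stay
    inside the ball.\<close>
  define \<delta> where "\<delta> = e / 2"
  have \<delta>: "\<delta> > 0" using e by (simp add: \<delta>_def)
  define c where "c = (\<lambda>s t::real. p + (of_real (s * \<delta>), of_real (t * \<delta>)))"
  have cD: "c s t \<in> D" if "\<bar>s\<bar> = 1" "\<bar>t\<bar> = 1" for s t
  proof -
    have "norm (complex_of_real (s * \<delta>), complex_of_real (t * \<delta>)) = sqrt (2 * \<delta>\<^sup>2)"
      using that \<delta> by (simp add: norm_prod_def norm_mult power_mult_distrib)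
    also have "\<dots> < e" 
    proof -
      have "2 * \<delta>\<^sup>2 < e\<^sup>2" using e by (simp add: \<delta>_def power2_eq_square)
      then show ?thesis using e by (simp add: real_less_lsqrt)
    qed
    finally have "dist (c s t) p < e" by (simp add: c_def dist_norm)
    then have "c s t \<in> ball p e" by (simp add: dist_commute)
    then show ?thesis using e by blast
  qed
  define H where "H = (\<lambda>x. norm (E (c 1 1) x) + norm (E (c 1 (-1)) x) + norm (E (c (-1) 1) x) + norm (E (c (-1) (-1)) x))"
  have intE: "integrable M (E q)" if "q \<in> D" for q using int[OF that] by (simp add: E_def)
  have H: "integrable M H"
    unfolding H_def by (intro Bochner_Integration.integrable_add integrable_norm intE cD) auto
  have Ec: "norm (E (c s t) x) = norm (E p x) * exp (s * \<delta> * A x + t * \<delta> * B x)" for s t x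
    by (simp add: E_def c_def norm_mult exp_add algebra_simps norm_exp_eq_Re flip: exp_add)
  \<comment> \<open>Choose the corner whose signs agree with those of \<open>A x\<close> and
    \<open>B x\<close>, taking +1 where they vanish.\<close>
  have EH: "norm (E p x) * exp (\<delta> * Y x) \<le> H x" for x
  proof -
    have "norm (E p x) * exp (\<delta> * Y x) = norm (E (c (sgn (A x) + (if A x = 0 then 1 else 0)) (sgn (B x) + (if B x = 0 then 1 else 0))) x)"
      unfolding Ec Y_def by (auto simp: abs_if sgn_if algebra_simps)
    also have "\<dots> \<le> H x" unfolding H_def by (auto simp: sgn_if)
    finally show ?thesis .
  qed
  have Y0: "Y x \<ge> 0" for x by (simp add: Y_def)
  have Y1: "Y x \<le> exp (\<delta> * Y x) / \<delta>" for x
  proof -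
    have "\<delta> * Y x \<le> exp (\<delta> * Y x)" using exp_ge_add_one_self[of "\<delta> * Y x"] by linarith
    then show ?thesis using \<delta> by (simp add: field_simps)
  qed
  \<comment> \<open>Only half of the exponential gain is spent on the quadratic factor; the other
    half is kept for exp |w| in the Taylor remainder.\<close>
  have Y2: "(Y x)\<^sup>2 \<le> 8 / \<delta>\<^sup>2 * exp (\<delta> / 2 * Y x)" for x
  proof -
    have "(\<delta> / 2 * Y x)\<^sup>2 / 2 \<le> exp (\<delta> / 2 * Y x)"
    proof -
      have n: "0 \<le> \<delta> / 2 * Y x" using Y0[of x] \<delta> by simp
      show ?thesis using exp_lower_Taylor_quadratic[OF n] n by linarith
    qed
    then show ?thesis using \<delta> by (simp add: field_simps power2_eq_square)
  qed
  have AEint: "integrable M (\<lambda>x. of_real (f x) * E p x)" if [measurable]: "f \<in> borel_measurable M" and "\<And>x. \<bar>f x\<bar> \<le> Y x" for f :: "'a \<Rightarrow> real"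
  proof (rule Bochner_Integration.integrable_bound[of M "\<lambda>x. H x / \<delta>"])
    show "AE x in M. norm (of_real (f x) * E p x) \<le> norm (H x / \<delta>)"
    proof (rule AE_I2)
      fix x
      have "norm (of_real (f x) * E p x) \<le> (exp (\<delta> * Y x) / \<delta>) * norm (E p x)"
        unfolding norm_mult norm_of_real by (rule mult_right_mono[OF order_trans[OF that(2)[of x] Y1[of x]] norm_ge_zero])
      also have "\<dots> \<le> H x / \<delta>" using EH[of x] \<delta> by (simp add: field_simps)
      finally show "norm (of_real (f x) * E p x) \<le> norm (H x / \<delta>)"
        unfolding real_norm_def by (rule order_trans[OF _ abs_ge_self])
    qed
  qed (use H in simp_all)
  define a where "a = (\<integral>x. of_real (A x) * E p x \<partial>M)"
  define b where "b = (\<integral>x. of_real (B x) * E p x \<partial>M)"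
  define K where "K = 8 / \<delta>\<^sup>2 * (\<integral>x. H x \<partial>M)"
  have ia: "integrable M (\<lambda>x. of_real (A x) * E p x)" and ib: "integrable M (\<lambda>x. of_real (B x) * E p x)"
    by (rule AEint; simp add: Y_def)+
  have main: "norm (F (p + h) - F p - (a * fst h + b * snd h)) \<le> K * (norm h)\<^sup>2" if h: "norm h \<le> \<delta> / 2" for h
  proof -
    define w where "w = (\<lambda>x. fst h * of_real (A x) + snd h * of_real (B x))"
    have hd: "norm (fst h) \<le> norm h" "norm (snd h) \<le> norm h" using norm_fst_le[of "fst h" "snd h"] norm_snd_le[of "snd h" "fst h"] by simp_all
    have w: "norm (w x) \<le> norm h * Y x" for x
    proof -
      have "norm (w x) \<le> norm (fst h) * \<bar>A x\<bar> + norm (snd h) * \<bar>B x\<bar>"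
        unfolding w_def by (rule order_trans[OF norm_triangle_ineq]) (simp add: norm_mult)
      also have "\<dots> \<le> norm h * \<bar>A x\<bar> + norm h * \<bar>B x\<bar>" using hd by (intro add_mono mult_right_mono) auto
      finally show ?thesis by (simp add: Y_def algebra_simps)
    qed
    have w': "norm (w x) \<le> \<delta> / 2 * Y x" for x
      using order_trans[OF w mult_right_mono[OF h Y0]] .
    have Eh: "E (p + h) x = E p x * exp (w x)" for x
      by (simp add: E_def w_def exp_add[symmetric] algebra_simps)
    have pt: "norm (E p x * (exp (w x) - 1 - w x)) \<le> 8 / \<delta>\<^sup>2 * (norm h)\<^sup>2 * H x" for x
    proof -
      have "norm (E p x * (exp (w x) - 1 - w x)) \<le> norm (E p x) * ((norm (w x))\<^sup>2 * exp (norm (w x)))"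
        unfolding norm_mult by (intro mult_left_mono exp_remainder) auto
      also have "\<dots> \<le> norm (E p x) * ((norm h * Y x)\<^sup>2 * exp (\<delta> / 2 * Y x))"
        using w[of x] w'[of x] by (intro mult_left_mono mult_mono power_mono) auto
      also have "\<dots> = norm (E p x) * (norm h)\<^sup>2 * ((Y x)\<^sup>2 * exp (\<delta> / 2 * Y x))"
        by (simp add: power_mult_distrib)
      also have "\<dots> \<le> norm (E p x) * (norm h)\<^sup>2 * ((8 / \<delta>\<^sup>2 * exp (\<delta> / 2 * Y x)) * exp (\<delta> / 2 * Y x))"
        using Y2[of x] by (intro mult_left_mono mult_right_mono) auto
      also have "\<dots> = 8 / \<delta>\<^sup>2 * (norm h)\<^sup>2 * (norm (E p x) * exp (\<delta> * Y x))"
        by (simp add: exp_add[symmetric] mult.assoc mult.left_commute)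
      also have "\<dots> \<le> 8 / \<delta>\<^sup>2 * (norm h)\<^sup>2 * H x" using EH[of x] \<delta> by (intro mult_left_mono) auto
      finally show ?thesis .
    qed
    have [measurable]: "w \<in> borel_measurable M" unfolding w_def by measurable
    have iw: "integrable M (\<lambda>x. E p x * w x)"
    proof -
      have "integrable M (\<lambda>x. fst h * (of_real (A x) * E p x) + snd h * (of_real (B x) * E p x))"
        using ia ib by simp
      then show ?thesis by (simp add: w_def algebra_simps)
    qed
    have ir: "integrable M (\<lambda>x. E p x * (exp (w x) - 1 - w x))"
    proof (rule Bochner_Integration.integrable_bound[of M "\<lambda>x. 8 / \<delta>\<^sup>2 * (norm h)\<^sup>2 * H x"])
      show "AE x in M. norm (E p x * (exp (w x) - 1 - w x)) \<le> norm (8 / \<delta>\<^sup>2 * (norm h)\<^sup>2 * H x)"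
        unfolding real_norm_def by (rule AE_I2) (rule order_trans[OF pt abs_ge_self])
    qed (use H in simp_all)
    have "F (p + h) = (\<integral>x. E p x + E p x * w x + E p x * (exp (w x) - 1 - w x) \<partial>M)"
      unfolding F_def Eh by (simp add: algebra_simps)
    also have "\<dots> = F p + (\<integral>x. E p x * w x \<partial>M) + (\<integral>x. E p x * (exp (w x) - 1 - w x) \<partial>M)"
      using iw ir intE[OF p] by (simp add: F_def)
    also have "(\<integral>x. E p x * w x \<partial>M) = (\<integral>x. fst h * (of_real (A x) * E p x) + snd h * (of_real (B x) * E p x) \<partial>M)"
      by (simp add: w_def algebra_simps)
    also have "\<dots> = a * fst h + b * snd h"
      using ia ib by (simp add: a_def b_def)
    finally have "norm (F (p + h) - F p - (a * fst h + b * snd h)) = norm (\<integral>x. E p x * (exp (w x) - 1 - w x) \<partial>M)"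
      by simp
    also have "\<dots> \<le> (\<integral>x. 8 / \<delta>\<^sup>2 * (norm h)\<^sup>2 * H x \<partial>M)"
      by (rule Bochner_Integration.integral_norm_bound_integral) (use ir H pt in simp_all)
    also have "\<dots> = K * (norm h)\<^sup>2" by (simp add: K_def)
    finally show ?thesis .
  qed
  have "(F has_derivative (\<lambda>h. a * fst h + b * snd h)) (at p)"
    unfolding has_derivative_at
  proof (intro conjI)
    show "bounded_linear (\<lambda>h. a * fst h + b * snd h)"
      by (intro bounded_linear_intros)
    show "(\<lambda>h. norm (F (p + h) - F p - (a * fst h + b * snd h)) / norm h) \<midarrow>0\<rightarrow> 0"
    proof (rule tendsto_sandwich[of "\<lambda>h. 0" _ _ "\<lambda>h. K * norm h"])
      have "eventually (\<lambda>h. norm h < \<delta> / 2) (at (0::complex\<times>complex))"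
        using \<delta> by (auto simp: eventually_at dist_norm intro!: exI[of _ "\<delta> / 2"])
      then show "eventually (\<lambda>h. norm (F (p + h) - F p - (a * fst h + b * snd h)) / norm h \<le> K * norm h) (at 0)"
      proof eventually_elim
        case (elim h)
        then show ?case using main[of h] by (cases "h = 0") (auto simp: field_simps power2_eq_square)
      qed
      show "((\<lambda>h. K * norm h) \<longlongrightarrow> 0) (at (0::complex\<times>complex))"
        by (auto intro!: tendsto_eq_intros)
    qed auto
  qed
  then show "\<exists>a b. ((\<lambda>p. \<integral>x. exp (fst p * of_real (A x) + snd p * of_real (B x)) * g x \<partial>M) has_derivative (\<lambda>h. a * fst h + b * snd h)) (at p)"
    unfolding F_def E_def by blast
qed

section \<open>Integrals of derivatives and local integrability of the kernel\<close>

lemma integrable_continuous_compact_support: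
  fixes F :: "'a::euclidean_space \<Rightarrow> 'b::{banach, second_countable_topology}"
  assumes "continuous_on UNIV F" "\<And>x. norm x > R \<Longrightarrow> F x = 0"
  shows "integrable lborel F"
proof -
  have "integrable lborel (\<lambda>x. indicator (cball 0 R) x *\<^sub>R F x)"
    by (rule borel_integrable_compact[OF compact_cball continuous_on_subset[OF assms(1)]]) simp
  moreover have "(\<lambda>x. indicator (cball 0 R) x *\<^sub>R F x) = F"
    using assms(2) by (auto simp: fun_eq_iff indicator_def)
  ultimately show ?thesis by simp
qed

lemma tf_integrable: "f \<in> tf R \<Longrightarrow> integrable lborel f"
  by (rule integrable_continuous_compact_support[of _ R]) (auto intro: tf_continuous tf_zero)

lemma integral_lborel_translate:
  fixes F :: "'a::euclidean_space \<Rightarrow> 'b::{banach, second_countable_topology}"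
  assumes "F \<in> borel_measurable borel"
  shows "(\<integral>x. F (c + x) \<partial>lborel) = (\<integral>x. F x \<partial>lborel)"
proof -
  have "(\<integral>x. F x \<partial>lborel) = (\<integral>x. F x \<partial>distr lborel borel ((+) c))"
    by (simp add: lborel_distr_plus)
  also have "\<dots> = (\<integral>x. F (c + x) \<partial>lborel)"
    using assms by (subst integral_distr) auto
  finally show ?thesis by simp
qed

text \<open>Difference quotients along \<open>b\<close> have integral 0 by translation invariance.
  They are bounded by the supremum of |D|, vanish outside a common ball and converge pointwise, so
  dominated convergence applies. Differentiability along the single direction \<open>b\<close> is
  all that a kernel has to provide.\<close>

lemma integral_directional_derivative:
  fixes F D :: "'a::euclidean_space \<Rightarrow> complex"
  assumes d: "\<And>x. ((\<lambda>s. F (x + s *\<^sub>R b)) has_vector_derivative D x) (at 0)"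
    and cF: "continuous_on UNIV F" and cD: "continuous_on UNIV D"
    and z: "\<And>x. norm x > R \<Longrightarrow> F x = 0"
  shows "(\<integral>x. D x \<partial>lborel) = 0"
proof -
  have Dz: "D x = 0" if x: "norm x > R" for x
  proof -
    have "continuous_on UNIV (\<lambda>s. norm (x + s *\<^sub>R b))" by (intro continuous_intros)
    then have "open {s. norm (x + s *\<^sub>R b) > R}"
      by (intro open_Collect_less) (auto intro!: continuous_intros)
    from has_vector_derivative_transform_within_open[OF d[of x] this, of "\<lambda>s. 0"]
    have "((\<lambda>s. 0) has_vector_derivative D x) (at (0::real))" using x z by simp
    then show ?thesis using vector_derivative_unique_at has_vector_derivative_const by blast
  qed
  have "compact (D ` cball 0 R)" by (intro compact_continuous_image compact_cball continuous_on_subset[OF cD]) auto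
  then obtain B where B: "\<And>x. x \<in> cball 0 R \<Longrightarrow> norm (D x) \<le> B" "B > 0"
    using compact_imp_bounded bounded_pos by (metis imageI)
  have DB: "norm (D x) \<le> B" for x
    using B(1)[of x] Dz[of x] B(2) by (cases "norm x \<le> R") auto
  have d': "((\<lambda>s. F (x + s *\<^sub>R b)) has_vector_derivative D (x + t *\<^sub>R b)) (at t within S)" for x t S
  proof -
    have "((\<lambda>s. s - t) has_vector_derivative 1) (at t within S)" by (auto intro!: derivative_eq_intros)
    then have "((\<lambda>s. F ((x + t *\<^sub>R b) + s *\<^sub>R b)) \<circ> (\<lambda>s. s - t) has_vector_derivative 1 *\<^sub>R D (x + t *\<^sub>R b)) (at t within S)"
      by (rule vector_diff_chain_within) (use d[of "x + t *\<^sub>R b"] has_vector_derivative_at_within in auto)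
    then show ?thesis by (simp add: o_def algebra_simps)
  qed
  define g where "g = (\<lambda>k x. real (Suc k) *\<^sub>R (F ((1 / real (Suc k)) *\<^sub>R b + x) - F x))"
  have [measurable]: "F \<in> borel_measurable borel" "D \<in> borel_measurable borel"
    using cF cD borel_measurable_continuous_onI by blast+
  have iF: "integrable lborel F"
    by (rule integrable_continuous_compact_support[OF cF z])
  have iF': "integrable lborel (\<lambda>x. F (c + x))" for c
    by (rule integrable_continuous_compact_support[of _ "R + norm c"])
      (auto intro!: continuous_on_compose2[OF cF] continuous_intros z simp: add.commute intro: order.strict_trans2[OF _ norm_diff_ineq])
  have int0: "(\<integral>x. g k x \<partial>lborel) = 0" for k
    unfolding g_def using iF iF' by (simp add: integral_lborel_translate)
  have gB: "norm (g k x) \<le> B" for k x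
  proof -
    have "((\<lambda>t. D (x + t *\<^sub>R b)) has_integral F (x + (1 / real (Suc k)) *\<^sub>R b) - F (x + 0 *\<^sub>R b)) {0..1 / real (Suc k)}"
      by (rule fundamental_theorem_of_calculus) (auto intro: d')
    then have "F (x + (1 / real (Suc k)) *\<^sub>R b) - F x = integral {0..1 / real (Suc k)} (\<lambda>t. D (x + t *\<^sub>R b))"
      by (simp add: integral_unique)
    also have "norm \<dots> \<le> B * (1 / real (Suc k) - 0)"
      by (rule integral_bound) (auto intro!: DB continuous_on_compose2[OF cD] continuous_intros)
    finally have "norm (F ((1 / real (Suc k)) *\<^sub>R b + x) - F x) * real (Suc k) \<le> B"
      by (simp add: field_simps add.commute del: of_nat_Suc)
    then show ?thesis by (simp add: g_def mult.commute del: of_nat_Suc)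
  qed
  have gz: "g k x = 0" if "norm x > R + norm b" for k x
  proof -
    have "norm ((1 / real (Suc k)) *\<^sub>R b) \<le> norm b" by (simp add: field_simps mult_left_le_one_le)
    then have "norm ((1 / real (Suc k)) *\<^sub>R b + x) > R"
      using that norm_diff_ineq[of x "(1 / real (Suc k)) *\<^sub>R b"] by (simp add: add.commute)
    moreover have "norm x > R" using that norm_ge_zero[of b] by linarith
    ultimately show ?thesis using z by (simp add: g_def)
  qed
  have lim: "(\<lambda>k. g k x) \<longlonglongrightarrow> D x" for x
  proof -
    have "(\<lambda>h. norm (F (x + h *\<^sub>R b) - F x - h *\<^sub>R D x) / norm h) \<midarrow>0\<rightarrow> 0"
      using d[of x] unfolding has_vector_derivative_def has_derivative_at by simp
    moreover have "filterlim (\<lambda>k. 1 / real (Suc k)) (at 0) sequentially"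
      using LIMSEQ_Suc[OF lim_1_over_n] by (auto simp: filterlim_at)
    ultimately have "(\<lambda>k. norm (F (x + (1 / real (Suc k)) *\<^sub>R b) - F x - (1 / real (Suc k)) *\<^sub>R D x) / norm (1 / real (Suc k))) \<longlonglongrightarrow> 0"
      by (rule filterlim_compose)
    moreover have "norm (F (x + (1 / real (Suc k)) *\<^sub>R b) - F x - (1 / real (Suc k)) *\<^sub>R D x) / norm (1 / real (Suc k)) = norm (g k x - D x)" for k
    proof -
      have "g k x - D x = real (Suc k) *\<^sub>R (F (x + (1 / real (Suc k)) *\<^sub>R b) - F x - (1 / real (Suc k)) *\<^sub>R D x)"
        by (simp add: g_def scaleR_right_diff_distrib add.commute)
      then have "norm (g k x - D x) = real (Suc k) * norm (F (x + (1 / real (Suc k)) *\<^sub>R b) - F x - (1 / real (Suc k)) *\<^sub>R D x)"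
        by (simp only: norm_scaleR)
      then show ?thesis by (simp add: mult.commute del: of_nat_Suc)
    qed
    ultimately have "(\<lambda>k. norm (g k x - D x)) \<longlonglongrightarrow> 0" by simp
    then show ?thesis using Lim_null tendsto_norm_zero_iff by blast
  qed
  have "(\<lambda>k. \<integral>x. g k x \<partial>lborel) \<longlonglongrightarrow> (\<integral>x. D x \<partial>lborel)"
  proof (rule integral_dominated_convergence[where w="\<lambda>x. B * indicator (cball 0 (R + norm b)) x"])
    show "integrable lborel (\<lambda>x. B * indicator (cball 0 (R + norm b)) x)" 
      using emeasure_bounded_finite[of "cball 0 (R + norm b)"] by auto
    show "AE x in lborel. norm (g k x) \<le> B * indicator (cball 0 (R + norm b)) x" for k
      using gB[of k] gz[of _ k] by (intro AE_I2) (auto simp: indicator_def not_le)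
    show "AE x in lborel. (\<lambda>k. g k x) \<longlonglongrightarrow> D x" by (intro AE_I2 lim)
    show "g k \<in> borel_measurable lborel" for k unfolding g_def by measurable
  qed simp
  then show ?thesis using int0 LIMSEQ_unique[OF _ tendsto_const] by (simp add: LIMSEQ_const_iff)
qed

lemma AE_coord_nonzero: "AE x in (lborel :: 'a::euclidean_space measure). \<forall>b\<in>Basis. x \<bullet> b \<noteq> 0"
proof (rule AE_finite_allI)
  fix b :: 'a assume b: "b \<in> Basis"
  have "negligible {x. x \<bullet> b = 0}" using negligible_standard_hyperplane[OF b] .
  then have "{x. x \<bullet> b = 0} \<in> null_sets (lborel :: 'a measure)"
    unfolding negligible_iff_null_sets by (subst (asm) null_sets_completion_iff) (simp_all add: closed_hyperplane borel_closed inner_commute)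
  then show "AE x in lborel. x \<bullet> b \<noteq> 0" by (rule AE_I') auto
qed simp

lemma nn_powr_1d:
  fixes e R :: real
  assumes "e > -1" "R \<ge> 0"
  shows "(\<integral>\<^sup>+t. ennreal (indicator {-R..R} t * \<bar>t\<bar> powr e) \<partial>lborel) < \<infinity>"
proof -
  define f where "f = (\<lambda>t. if t \<in> {0..R} then t powr e else 0)"
  have fm[measurable]: "f \<in> borel_measurable borel" unfolding f_def by measurable
  have "(f has_integral (R powr (e+1) / (e+1))) UNIV"
    unfolding f_def by (rule iffD2[OF has_integral_restrict_UNIV has_integral_powr_from_0[OF assms]])
  then have 1: "(\<integral>\<^sup>+t. ennreal (f t) \<partial>lborel) = ennreal (R powr (e+1) / (e+1))"
    by (intro nn_integral_has_integral_lborel) (auto simp: f_def)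
  have 2: "(\<integral>\<^sup>+t. ennreal (f (-t)) \<partial>lborel) = ennreal (R powr (e+1) / (e+1))"
    using nn_integral_real_affine[of "\<lambda>t. ennreal (f t)" "-1" 0] 1 by simp
  have "(\<integral>\<^sup>+t. ennreal (indicator {-R..R} t * \<bar>t\<bar> powr e) \<partial>lborel) \<le> (\<integral>\<^sup>+t. ennreal (f t) + ennreal (f (-t)) \<partial>lborel)"
    by (intro nn_integral_mono) (auto simp: f_def indicator_def abs_if)
  also have "\<dots> = ennreal (R powr (e+1) / (e+1)) + ennreal (R powr (e+1) / (e+1))"
    using 1 2 by (subst nn_integral_add) auto
  also have "\<dots> < \<infinity>" by (simp add: ennreal_add_less_top)
  finally show ?thesis .
qed

text \<open>A negative power of |x| is distributed over the coordinates: |x| dominates every |x_b|,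
  so the weight is bounded by a product of one-dimensional powers, each integrable because its
  exponent exceeds -1. The share \<theta> of each coordinate is below 1 because \<beta> > 0.\<close>

lemma kernel_integrable:
  fixes \<alpha> \<beta> R :: real
  defines "n \<equiv> real DIM('b::euclidean_space) + 1"
  assumes \<alpha>: "\<alpha> > -1" and \<beta>: "\<beta> > 0" and R: "R > 0"
  shows "integrable lborel (\<lambda>x::'b \<times> real. indicator (cball 0 R) x * (\<bar>snd x\<bar> powr \<alpha> * norm x powr (\<beta> - \<alpha> - n)))"
proof -
  define \<gamma> where "\<gamma> = n + \<alpha> - \<beta>"
  \<comment> \<open>For positive \<gamma> the power -\<gamma> of |x| splits into n - 1 factors with
    exponent -\<theta> and one with exponent -\<theta> (1 + \<alpha>), given to the last coordinate,
    whose total exponent is then (1 + \<alpha>) (1 - \<theta>) - 1. Otherwise |x|^(-\<gamma>) is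
    bounded on the ball and \<theta> = 0.\<close>
  define \<theta> where "\<theta> = max 0 \<gamma> / (n + \<alpha>)"
  define C where "C = (if \<gamma> \<le> 0 then R powr (-\<gamma>) else 1)"
  have n: "n \<ge> 1" by (simp add: n_def)
  then have na: "n + \<alpha> > 0" using \<alpha> by simp
  have \<theta>: "0 \<le> \<theta>" "\<theta> < 1" using na n \<beta> \<alpha> by (auto simp: \<theta>_def \<gamma>_def field_simps)
  define ex where "ex = (\<lambda>b::'b \<times> real. if b = en then \<alpha> - \<theta> * (1 + \<alpha>) else - \<theta>)"
  have "\<theta> * (1 + \<alpha>) < 1 + \<alpha>" using \<theta> \<alpha> by simp
  then have ex: "ex b > -1" for b using \<theta> by (auto simp: ex_def)
  define h where "h = (\<lambda>b t. ennreal (indicator {-R..R} t * \<bar>t\<bar> powr (ex b)))"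
  have hm: "h b \<in> borel_measurable borel" for b unfolding h_def by measurable
  have card: "card (Basis - {en :: 'b \<times> real}) = DIM('b)" by (simp add: card_Diff_singleton)
  have pt: "\<bar>snd x\<bar> powr \<alpha> * norm x powr (\<beta> - \<alpha> - n) \<le> C * (\<Prod>b\<in>Basis. \<bar>x \<bullet> b\<bar> powr ex b)"
    if nz: "\<forall>b\<in>Basis. x \<bullet> b \<noteq> 0" and xR: "norm x \<le> R" for x :: "'b \<times> real"
  proof -
    have u: "snd x \<noteq> 0" using nz en_Basis by (metis inner_Pair_0(1) inner_real_def mult.right_neutral snd_conv inner_commute inner_prod_def inner_zero_right add_0 fst_conv)
    have nx: "norm x > 0" using u by auto
    have split: "(\<Prod>b\<in>Basis. \<bar>x \<bullet> b\<bar> powr ex b) = \<bar>snd x\<bar> powr (\<alpha> - \<theta> * (1 + \<alpha>)) * (\<Prod>b\<in>Basis - {en}. \<bar>x \<bullet> b\<bar> powr (-\<theta>))"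
      by (subst prod.remove[OF finite_Basis en_Basis]) (auto simp: ex_def inner_prod_def intro!: prod.cong)
    show ?thesis
    proof (cases "\<gamma> \<le> 0")
      case True
      then have [simp]: "\<theta> = 0" by (simp add: \<theta>_def)
      have "(\<Prod>b\<in>Basis - {en}. \<bar>x \<bullet> b\<bar> powr (-\<theta>)) = 1" using nz by (intro prod.neutral) auto
      moreover have "norm x powr (-\<gamma>) \<le> C" using True nx xR
        by (auto simp: C_def intro!: powr_mono2)
      moreover have "\<beta> - \<alpha> - n = -\<gamma>" by (simp add: \<gamma>_def)
      ultimately show ?thesis unfolding split by (simp add: mult.commute mult_right_mono)
    next
      case False
      have e: "\<beta> - \<alpha> - n = - (\<theta> * (1 + \<alpha>)) + DIM('b) * (- \<theta>)"
      proof -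
        have "\<theta> * (n + \<alpha>) = \<gamma>" using False na by (simp add: \<theta>_def)
        then show ?thesis by (simp add: \<gamma>_def n_def algebra_simps)
      qed
      have "norm x powr (\<beta> - \<alpha> - n) = norm x powr (- (\<theta> * (1 + \<alpha>))) * (norm x powr (-\<theta>)) ^ DIM('b)"
        unfolding e powr_add mult.commute[of "real DIM('b)"] powr_powr[symmetric]
        using nx by (subst powr_realpow) auto
      also have "(norm x powr (-\<theta>)) ^ DIM('b) = (\<Prod>b\<in>Basis - {en :: 'b \<times> real}. norm x powr (-\<theta>))"
        by (simp add: card)
      also have "norm x powr (- (\<theta> * (1 + \<alpha>))) * (\<Prod>b\<in>Basis - {en :: 'b \<times> real}. norm x powr (-\<theta>)) \<le>
          \<bar>snd x\<bar> powr (- (\<theta> * (1 + \<alpha>))) * (\<Prod>b\<in>Basis - {en}. \<bar>x \<bullet> b\<bar> powr (-\<theta>))"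
      proof (intro mult_mono prod_mono conjI)
        show "norm x powr (- (\<theta> * (1 + \<alpha>))) \<le> \<bar>snd x\<bar> powr (- (\<theta> * (1 + \<alpha>)))"
          using norm_snd_le[of "snd x" "fst x"] u \<theta> \<alpha> by (intro powr_mono2') auto
        fix b :: "'b \<times> real" assume "b \<in> Basis - {en}"
        then show "norm x powr (-\<theta>) \<le> \<bar>x \<bullet> b\<bar> powr (-\<theta>)"
          using Basis_le_norm[of b x] nz \<theta> by (intro powr_mono2') auto
      qed (auto intro!: prod_nonneg)
      finally have "\<bar>snd x\<bar> powr \<alpha> * norm x powr (\<beta> - \<alpha> - n) \<le> \<bar>snd x\<bar> powr \<alpha> * (\<bar>snd x\<bar> powr (- (\<theta> * (1 + \<alpha>))) * (\<Prod>b\<in>Basis - {en}. \<bar>x \<bullet> b\<bar> powr (-\<theta>)))"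
        by (rule mult_left_mono) auto
      then show ?thesis unfolding split using False powr_add[of "\<bar>snd x\<bar>" \<alpha> "- (\<theta> * (1 + \<alpha>))"]
        by (simp add: C_def mult.assoc)
    qed
  qed
  show ?thesis
  proof (rule integrableI_bounded)
    have "(\<integral>\<^sup>+(x::'b \<times> real). ennreal (norm (indicator (cball 0 R) x * (\<bar>snd x\<bar> powr \<alpha> * norm x powr (\<beta> - \<alpha> - n)))) \<partial>lborel)
      \<le> (\<integral>\<^sup>+(x::'b \<times> real). ennreal C * (\<Prod>b\<in>Basis. h b (x \<bullet> b)) \<partial>lborel)"
    proof (rule nn_integral_mono_AE)
      show "AE x::'b \<times> real in lborel. ennreal (norm (indicator (cball 0 R) x * (\<bar>snd x\<bar> powr \<alpha> * norm x powr (\<beta> - \<alpha> - n)))) \<le> ennreal C * (\<Prod>b\<in>Basis. h b (x \<bullet> b))"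
        using AE_coord_nonzero
      proof eventually_elim
        case (elim x)
        show ?case
        proof (cases "norm x \<le> R")
          case True
          have "(\<Prod>b\<in>Basis. h b (x \<bullet> b)) = ennreal (\<Prod>b\<in>Basis. \<bar>x \<bullet> b\<bar> powr ex b)"
          proof -
            have "x \<bullet> b \<in> {-R..R}" if "b \<in> Basis" for b
              using Basis_le_norm[OF that, of x] True by (auto simp: abs_le_iff)
            then have "(\<Prod>b\<in>Basis. h b (x \<bullet> b)) = (\<Prod>b\<in>Basis. ennreal (\<bar>x \<bullet> b\<bar> powr ex b))"
              by (intro prod.cong) (auto simp: h_def)
            then show ?thesis by (simp add: prod_ennreal)
          qed
          then show ?thesis using pt[OF elim True] True
            by (auto simp: ennreal_mult'[symmetric] C_def prod_nonneg intro!: ennreal_leI)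
        qed auto
      qed
    qed
    also have "\<dots> = ennreal C * (\<Prod>b\<in>(Basis :: ('b \<times> real) set). \<integral>\<^sup>+t. h b t \<partial>lborel)"
      using hm by (subst nn_integral_cmult) (auto simp: nn_integral_lborel_prod)
    also have "\<dots> < \<infinity>"
    proof -
      have "(\<integral>\<^sup>+t. h b t \<partial>lborel) < \<infinity>" for b
        unfolding h_def using nn_powr_1d[OF ex, of R b] R by simp
      then have "(\<Prod>b\<in>I. \<integral>\<^sup>+t. h b t \<partial>lborel) < \<infinity>" for I
        by (induction I rule: infinite_finite_induct) (auto simp: ennreal_mult_less_top)
      then show ?thesis by (simp add: ennreal_mult_less_top)
    qed
    finally show "(\<integral>\<^sup>+(x::'b \<times> real). ennreal (norm (indicator (cball 0 R) x * (\<bar>snd x\<bar> powr \<alpha> * norm x powr (\<beta> - \<alpha> - n)))) \<partial>lborel) < \<infinity>" .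
  next
    have [measurable]: "(snd :: 'b \<times> real \<Rightarrow> real) \<in> borel_measurable borel"
      by (intro borel_measurable_continuous_onI continuous_intros)
    have "(\<lambda>x::'b \<times> real. \<bar>snd x\<bar> powr \<alpha> * norm x powr (\<beta> - \<alpha> - n)) \<in> borel_measurable borel"
      by measurable
    then show "(\<lambda>x::'b \<times> real. indicator (cball 0 R) x * (\<bar>snd x\<bar> powr \<alpha> * norm x powr (\<beta> - \<alpha> - n))) \<in> borel_measurable lborel"
      by (intro borel_measurable_times borel_measurable_indicator) auto
  qed
qed

section \<open>The even scalar kernel and its continuation\<close>

definition AP :: "complex \<Rightarrow> real \<Rightarrow> complex" where
  "AP a t = complex_of_real \<bar>t\<bar> powr a"

definition SP :: "complex \<Rightarrow> real \<Rightarrow> complex" where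
  "SP a t = of_real (sgn t) * complex_of_real \<bar>t\<bar> powr a"

definition W :: "complex \<Rightarrow> 'a::real_normed_vector \<Rightarrow> complex" where
  "W s x = complex_of_real (norm x) powr s"

text \<open>Zero raised to any complex power is 0, the exponent 0 included. Formulas that hold for
  nonzero arguments therefore need a separate look at 0 or an argument by null sets.\<close>

lemma AP_0 [simp]: "AP a 0 = 0" and SP_0 [simp]: "SP a 0 = 0"
  and W_0 [simp]: "W s 0 = 0"
  by (simp_all add: AP_def SP_def W_def)

lemma norm_AP: "norm (AP a t) = \<bar>t\<bar> powr Re a"
  by (cases "t = 0") (simp_all add: AP_def norm_powr_real_powr)

lemma norm_SP: "norm (SP a t) = \<bar>t\<bar> powr Re a"
  by (cases "t = 0") (simp_all add: SP_def norm_mult norm_powr_real_powr abs_sgn_eq)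

lemma norm_W: "norm (W s x) = norm x powr Re s"
  by (cases "x = 0") (simp_all add: W_def norm_powr_real_powr)

lemma of_real_mult_SP: "of_real t * SP a t = AP (a + 1) t"
  by (cases "t = 0") (auto simp: AP_def SP_def powr_add sgn_if)

lemma SP_minus [simp]: "SP a (- t) = - SP a t" and AP_minus [simp]: "AP a (- t) = AP a t"
  by (auto simp: SP_def AP_def sgn_if)

lemma AP_pos: "t > 0 \<Longrightarrow> AP a t = complex_of_real t powr a"
  and SP_pos: "t > 0 \<Longrightarrow> SP a t = complex_of_real t powr a"
  by (simp_all add: AP_def SP_def)

lemma powr_vector_derivative:
  assumes "t > 0"
  shows "((\<lambda>t. complex_of_real t powr a) has_vector_derivative a * complex_of_real t powr (a - 1)) (at t)"
proof -
  have "((\<lambda>w. w powr a) has_field_derivative a * complex_of_real t powr (a - 1)) (at (complex_of_real t))"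
    using assms by (intro has_field_derivative_powr) auto
  moreover have "(complex_of_real has_vector_derivative 1) (at t)"
    using has_vector_derivative_of_real[of "\<lambda>t. t" 1 "at t"] by (auto intro!: derivative_eq_intros)
  ultimately have "((\<lambda>w. w powr a) \<circ> complex_of_real has_vector_derivative 1 * (a * complex_of_real t powr (a - 1))) (at t)"
    by (rule field_vector_diff_chain_at[rotated])
  then show ?thesis by (simp add: o_def)
qed

lemma has_vector_derivative_power_zero:
  assumes f: "\<And>t. norm (f t) \<le> \<bar>t\<bar> powr r" and r: "r > 1" "f 0 = 0"
  shows "(f has_vector_derivative (0::complex)) (at 0)"
  unfolding has_vector_derivative_def has_derivative_at
proof (intro conjI)
  have "((\<lambda>h. \<bar>h\<bar> powr (r - 1)) \<longlongrightarrow> 0) (at (0::real))"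
  proof -
    have "((\<lambda>h. \<bar>h\<bar> powr (r - 1)) \<longlongrightarrow> \<bar>0\<bar> powr (r - 1)) (at (0::real))"
      using r by (intro tendsto_powr' tendsto_intros) auto
    then show ?thesis by simp
  qed
  then show "(\<lambda>h. norm (f (0 + h) - f 0 - h *\<^sub>R 0) / norm h) \<midarrow>0\<rightarrow> 0"
  proof (rule Lim_null_comparison[rotated])
    show "\<forall>\<^sub>F h in at 0. norm (norm (f (0 + h) - f 0 - h *\<^sub>R 0) / norm h) \<le> \<bar>h\<bar> powr (r - 1)"
      unfolding eventually_at
    proof (intro exI[of _ 1] conjI ballI impI)
      fix h :: real assume "h \<noteq> 0 \<and> dist h 0 < 1"
      then have "\<bar>h\<bar> powr r / \<bar>h\<bar> = \<bar>h\<bar> powr (r - 1)" by (simp add: powr_diff)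
      then show "norm (norm (f (0 + h) - f 0 - h *\<^sub>R 0) / norm h) \<le> \<bar>h\<bar> powr (r - 1)"
        using f[of h] r(2) divide_right_mono[OF f[of h] abs_ge_zero[of h]] by simp
    qed simp
  qed
qed simp

lemma AP_derivative:
  assumes "Re a > 1"
  shows "(AP a has_vector_derivative a * SP (a - 1) t) (at t)"
    and "(SP a has_vector_derivative a * AP (a - 1) t) (at t)"
proof -
  have pos: "(AP a has_vector_derivative a * SP (a - 1) t) (at t) \<and> (SP a has_vector_derivative a * AP (a - 1) t) (at t)"
    if t: "t > 0" for t
    using has_vector_derivative_transform_within_open[OF powr_vector_derivative[OF t, of a] open_greaterThan[of 0], of "AP a"]
     has_vector_derivative_transform_within_open[OF powr_vector_derivative[OF t, of a] open_greaterThan[of 0], of "SP a"] t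
    by (simp add: AP_pos SP_pos)
  have "(AP a has_vector_derivative a * SP (a - 1) t) (at t) \<and> (SP a has_vector_derivative a * AP (a - 1) t) (at t)"
  proof (cases t "0::real" rule: linorder_cases)
    case equal
    then show ?thesis using assms
      by (auto intro!: has_vector_derivative_power_zero[where r="Re a"] simp: norm_AP norm_SP)
  next
    case less
    have m: "(uminus has_vector_derivative -1) (at t)" by (auto intro!: derivative_eq_intros)
    from pos[of "-t"] less
    have "(AP a \<circ> uminus has_vector_derivative - 1 *\<^sub>R (a * SP (a - 1) (- t))) (at t)"
      "(SP a \<circ> uminus has_vector_derivative - 1 *\<^sub>R (a * AP (a - 1) (- t))) (at t)"
      by (intro vector_diff_chain_at m; simp)+
    from this(1) has_vector_derivative_minus[OF this(2)] show ?thesis by (simp add: o_def)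
  qed (use pos in auto)
  then show "(AP a has_vector_derivative a * SP (a - 1) t) (at t)"
    "(SP a has_vector_derivative a * AP (a - 1) t) (at t)" by auto
qed

lemma continuous_AP: "Re a > 1 \<Longrightarrow> continuous_on S f \<Longrightarrow> continuous_on S (\<lambda>x. AP a (f x))"
  and continuous_SP: "Re a > 1 \<Longrightarrow> continuous_on S f \<Longrightarrow> continuous_on S (\<lambda>x. SP a (f x))"
proof -
  assume a: "Re a > 1" and f: "continuous_on S f"
  have "continuous_on UNIV (AP a)" "continuous_on UNIV (SP a)"
    by (intro continuous_at_imp_continuous_on ballI has_vector_derivative_continuous[OF AP_derivative(1)[OF a]]
       has_vector_derivative_continuous[OF AP_derivative(2)[OF a]])+
  from continuous_on_compose2[OF this(1) f] continuous_on_compose2[OF this(2) f]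
  show "continuous_on S (\<lambda>x. AP a (f x))" "continuous_on S (\<lambda>x. SP a (f x))" by auto
qed

text \<open>Writing |x|^s as a power of the inner product of x with itself replaces the norm, which
  is not differentiable at 0, by a polynomial.\<close>

lemma W_eq_AP: "W s x = AP (s / 2) (x \<bullet> x)"
proof (cases "x = 0")
  case False
  have "Ln (complex_of_real (x \<bullet> x)) = 2 * Ln (complex_of_real (norm x))"
  proof -
    have "Ln (complex_of_real (x \<bullet> x)) = of_real (ln (x \<bullet> x))" using False by (intro Ln_of_real) simp
    moreover have "Ln (complex_of_real (norm x)) = of_real (ln (norm x))" using False by (intro Ln_of_real) simp
    moreover have "ln (x \<bullet> x) = 2 * ln (norm x)"
      using False ln_realpow[of "norm x" 2] by (simp add: power2_norm_eq_inner)
    ultimately show ?thesis by simp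
  qed
  then show ?thesis using False by (simp add: W_def AP_def powr_def)
qed simp

lemma W_eq_SP: "W s x = SP (s / 2) (x \<bullet> x)"
  unfolding W_eq_AP by (cases "x = 0") (simp_all add: AP_pos SP_pos)

lemma continuous_W: "Re s > 2 \<Longrightarrow> continuous_on S (W s :: 'a::real_inner \<Rightarrow> _)"
  unfolding W_eq_AP[abs_def] by (intro continuous_AP continuous_intros) auto

lemma W_line_derivative:
  fixes x b :: "'a::real_inner"
  assumes "Re s > 2"
  shows "((\<lambda>t. W s (x + t *\<^sub>R b)) has_vector_derivative s * of_real (x \<bullet> b) * W (s - 2) x) (at 0)"
proof -
  have "((\<lambda>t. (x + t *\<^sub>R b) \<bullet> (x + t *\<^sub>R b)) has_vector_derivative 2 * (x \<bullet> b)) (at 0)"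
    unfolding has_real_derivative_iff_has_vector_derivative[symmetric] inner_add
    by (auto intro!: derivative_eq_intros simp: inner_commute)
  moreover have "(AP (s / 2) has_vector_derivative (s / 2) * SP (s / 2 - 1) ((x + 0 *\<^sub>R b) \<bullet> (x + 0 *\<^sub>R b))) (at ((x + 0 *\<^sub>R b) \<bullet> (x + 0 *\<^sub>R b)))"
    using assms by (intro AP_derivative) simp
  ultimately have "(AP (s / 2) \<circ> (\<lambda>t. (x + t *\<^sub>R b) \<bullet> (x + t *\<^sub>R b)) has_vector_derivative
     (2 * (x \<bullet> b)) *\<^sub>R ((s / 2) * SP (s / 2 - 1) ((x + 0 *\<^sub>R b) \<bullet> (x + 0 *\<^sub>R b)))) (at 0)"
    by (intro vector_diff_chain_at)
  moreover have "SP (s / 2 - 1) (x \<bullet> x) = W (s - 2) x" by (simp add: W_eq_SP diff_divide_distrib)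
  moreover have "(\<lambda>t. W s (x + t *\<^sub>R b)) = AP (s / 2) \<circ> (\<lambda>t. (x + t *\<^sub>R b) \<bullet> (x + t *\<^sub>R b))"
    by (simp add: fun_eq_iff W_eq_AP)
  ultimately show ?thesis
    by (simp add: scaleR_conv_of_real ac_simps)
qed

lemma norm_sq_W: "of_real ((norm x)\<^sup>2) * W (s - 2) x = W s x"
proof (cases "x = 0")
  case False
  have "W s x = complex_of_real (norm x) powr (s - 2 + 2)" by (simp add: W_def)
  also have "\<dots> = W (s - 2) x * complex_of_real (norm x) powr 2" unfolding powr_add W_def ..
  also have "complex_of_real (norm x) powr 2 = complex_of_real (norm x) ^ 2"
    using False powr_nat'[of "complex_of_real (norm x)" 2] by simp
  finally show ?thesis by simp
qed simp

abbreviation dm :: "'b::euclidean_space itself \<Rightarrow> complex" where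
  "dm _ \<equiv> of_nat (DIM('b) + 1)"

definition Ker :: "complex \<Rightarrow> complex \<Rightarrow> 'b::euclidean_space \<times> real \<Rightarrow> complex" where
  "Ker a z x = AP a (snd x) * W (z - a - dm TYPE('b)) x"

text \<open>In terms of the paper, \<open>a = \<lambda> + \<nu> + 1/2\<close> is the exponent of \<open>\<bar>x\<^sub>n\<bar>\<close> and \<open>z = \<lambda> - \<nu> + 1/2\<close>
  is the degree of homogeneity of the kernel plus \<open>n\<close>.\<close>

definition II :: "complex \<Rightarrow> complex \<Rightarrow> ('b::euclidean_space \<times> real \<Rightarrow> complex) \<Rightarrow> complex" where
  "II a z f = (\<integral>x. Ker a z x * f x \<partial>lborel)"

lemma SP_line_derivative:
  assumes "Re a > 1"
  shows "((\<lambda>t. SP a (snd (x + t *\<^sub>R b))) has_vector_derivative a * of_real (snd b) * AP (a - 1) (snd x)) (at 0)"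
    and "((\<lambda>t. AP a (snd (x + t *\<^sub>R b))) has_vector_derivative a * of_real (snd b) * SP (a - 1) (snd x)) (at 0)"
proof -
  have l: "((\<lambda>t. snd (x + t *\<^sub>R b)) has_vector_derivative snd b) (at 0)"
    by (auto intro!: derivative_eq_intros simp: has_vector_derivative_def)
  have "(AP a \<circ> (\<lambda>t. snd (x + t *\<^sub>R b)) has_vector_derivative snd b *\<^sub>R (a * SP (a - 1) (snd (x + 0 *\<^sub>R b)))) (at 0)"
    "(SP a \<circ> (\<lambda>t. snd (x + t *\<^sub>R b)) has_vector_derivative snd b *\<^sub>R (a * AP (a - 1) (snd (x + 0 *\<^sub>R b)))) (at 0)"
    by (intro vector_diff_chain_at l AP_derivative[OF assms])+
  then show "((\<lambda>t. SP a (snd (x + t *\<^sub>R b))) has_vector_derivative a * of_real (snd b) * AP (a - 1) (snd x)) (at 0)"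
    "((\<lambda>t. AP a (snd (x + t *\<^sub>R b))) has_vector_derivative a * of_real (snd b) * SP (a - 1) (snd x)) (at 0)"
    by (simp_all add: o_def scaleR_conv_of_real ac_simps)
qed

text \<open>The reflection scales the coordinates by +1 and -1, so the density in the affine change
  of variables is 1.\<close>

lemma integral_reflect:
  fixes g :: "'b::euclidean_space \<times> real \<Rightarrow> complex"
  assumes [measurable]: "g \<in> borel_measurable borel"
  shows "(\<integral>x. g (sc (-1) x) \<partial>lborel) = (\<integral>x. g x \<partial>lborel)"
proof -
  have T: "(\<lambda>x::'b \<times> real. 0 + (\<Sum>j\<in>Basis. (wt (-1) j * (x \<bullet> j)) *\<^sub>R j)) = sc (-1)"
  proof
    fix x :: "'b \<times> real"
    show "0 + (\<Sum>j\<in>Basis. (wt (-1) j * (x \<bullet> j)) *\<^sub>R j) = sc (-1) x"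
      using euclidean_representation[of "sc (-1) x"] by (simp add: sc_inner)
  qed
  have [measurable]: "sc (-1) \<in> borel_measurable (borel :: ('b \<times> real) measure)"
    using continuous_on_sc[of UNIV] 
    by (intro borel_measurable_continuous_onI) (auto simp: sc_def intro!: continuous_intros)
  have "(lborel :: ('b \<times> real) measure) = density (distr lborel borel (sc (-1))) (\<lambda>_. (\<Prod>j\<in>(Basis::('b \<times> real) set). \<bar>wt (-1) j\<bar>))"
    unfolding T[symmetric] by (rule lborel_affine_euclidean) (simp add: wt_def)
  also have "(\<Prod>j\<in>(Basis::('b \<times> real) set). \<bar>wt (-1) j\<bar>) = 1"
    by (rule prod.neutral) (simp add: wt_def)
  finally have "(lborel :: ('b \<times> real) measure) = distr lborel borel (sc (-1))" by (simp add: density_1)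
  then have "(\<integral>x. g x \<partial>lborel) = (\<integral>x. g x \<partial>distr lborel borel (sc (-1)))" by simp
  also have "\<dots> = (\<integral>x. g (sc (-1) x) \<partial>lborel)" by (subst integral_distr) auto
  finally show ?thesis by simp
qed

lemma integrable_reflect:
  fixes g :: "'b::euclidean_space \<times> real \<Rightarrow> complex"
  assumes "integrable lborel g"
  shows "integrable lborel (\<lambda>x. g (sc (-1) x))"
proof -
  have T: "(\<lambda>x::'b \<times> real. 0 + (\<Sum>j\<in>Basis. (wt (-1) j * (x \<bullet> j)) *\<^sub>R j)) = sc (-1)"
  proof
    fix x :: "'b \<times> real"
    show "0 + (\<Sum>j\<in>Basis. (wt (-1) j * (x \<bullet> j)) *\<^sub>R j) = sc (-1) x"
      using euclidean_representation[of "sc (-1) x"] by (simp add: sc_inner)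
  qed
  have [measurable]: "sc (-1) \<in> borel_measurable (borel :: ('b \<times> real) measure)"
    by (intro borel_measurable_continuous_onI) (auto simp: sc_def intro!: continuous_intros)
  have "(lborel :: ('b \<times> real) measure) = density (distr lborel borel (sc (-1))) (\<lambda>_. (\<Prod>j\<in>(Basis::('b \<times> real) set). \<bar>wt (-1) j\<bar>))"
    unfolding T[symmetric] by (rule lborel_affine_euclidean) (simp add: wt_def)
  also have "(\<Prod>j\<in>(Basis::('b \<times> real) set). \<bar>wt (-1) j\<bar>) = 1"
    by (rule prod.neutral) (simp add: wt_def)
  finally have *: "(lborel :: ('b \<times> real) measure) = distr lborel borel (sc (-1))" by (simp add: density_1)
  have "integrable (distr lborel borel (sc (-1))) g" using assms * by simp
  then show ?thesis using assms by (subst (asm) integrable_distr_eq) auto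
qed

text \<open>Averaging the integral with its reflection replaces \<open>h\<close> by its odd part,
  which is x_n times \<open>Qop h\<close>.\<close>

lemma odd_kernel_Qop:
  fixes k h :: "'b::euclidean_space \<times> real \<Rightarrow> complex"
  assumes int: "integrable lborel (\<lambda>x. k x * h x)" and odd: "\<And>x. k (sc (-1) x) = - k x" and h: "smooth h"
  shows "(\<integral>x. k x * h x \<partial>lborel) = (\<integral>x. k x * (of_real (snd x) * Qop h x) \<partial>lborel)"
proof -
  have i: "integrable lborel (\<lambda>x. - (k x * h (sc (-1) x)))"
    using integrable_reflect[OF int] by (simp add: odd)
  have r: "(\<integral>x. - (k x * h (sc (-1) x)) \<partial>lborel) = (\<integral>x. k x * h x \<partial>lborel)"
    using integral_reflect[of "\<lambda>x. k x * h x"] int by (simp add: odd borel_measurable_integrable)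
  have "(\<integral>x. k x * (of_real (snd x) * Qop h x) \<partial>lborel) = (\<integral>x. (k x * h x + - (k x * h (sc (-1) x))) / 2 \<partial>lborel)"
    by (simp add: Qop_mult[OF h] algebra_simps)
  also have "\<dots> = ((\<integral>x. k x * h x \<partial>lborel) + (\<integral>x. - (k x * h (sc (-1) x)) \<partial>lborel)) / 2"
    by (simp only: integral_divide_zero Bochner_Integration.integral_add[OF int i])
  also have "\<dots> = (\<integral>x. k x * h x \<partial>lborel)" unfolding r by simp
  finally show ?thesis by simp
qed

lemma sc_m1: "snd (sc (-1) x) = - snd x" "fst (sc (-1) x) = fst x"
  by (simp_all add: sc_def)

lemma W_reflect [simp]: "W s (sc (-1) x) = W s x"
  by (simp add: W_def)

section \<open>Integration by parts and the two kernel identities\<close>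

lemma integrable_cont_tf:
  "continuous_on UNIV K \<Longrightarrow> f \<in> tf R \<Longrightarrow> integrable lborel (\<lambda>x. K x * f x)"
  by (rule integrable_continuous_compact_support[of _ R]) (auto intro!: continuous_on_mult intro: tf_continuous simp: tf_zero)

lemma ibp_kernel:
  fixes K K' :: "'a::euclidean_space \<Rightarrow> complex"
  assumes "continuous_on UNIV K" "continuous_on UNIV K'"
    and d: "\<And>x. ((\<lambda>t. K (x + t *\<^sub>R b)) has_vector_derivative K' x) (at 0)"
    and f: "f \<in> tf R" and b: "b \<in> Basis"
  shows "(\<integral>x. K x * pderiv_dir b f x \<partial>lborel) = - (\<integral>x. K' x * f x \<partial>lborel)"
proof -
  have "(\<integral>x. K x * pderiv_dir b f x + K' x * f x \<partial>lborel) = 0"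
  proof (rule integral_directional_derivative[where F="\<lambda>x. K x * f x" and b=b and R=R])
    fix x
    have "((\<lambda>t. f (x + t *\<^sub>R b)) has_vector_derivative pderiv_dir b f (x + 0 *\<^sub>R b)) (at 0)"
      by (rule smooth_line_derivative[OF tf_smooth_on[OF f]]) (use b in auto)
    from has_vector_derivative_mult[OF d[of x] this]
    show "((\<lambda>t. K (x + t *\<^sub>R b) * f (x + t *\<^sub>R b)) has_vector_derivative K x * pderiv_dir b f x + K' x * f x) (at 0)"
      by simp
  qed (use assms in \<open>auto intro!: continuous_on_mult continuous_on_add intro: tf_continuous tf_pderiv_dir simp: tf_zero\<close>)
  then show ?thesis
    using integrable_cont_tf[OF assms(1) tf_pderiv_dir[OF f b]] integrable_cont_tf[OF assms(2) f]
    by (simp add: eq_neg_iff_add_eq_0)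
qed

text \<open>\<open>U\<close> and \<open>V\<close> are the even and the odd kernel with both
  exponents as free parameters. Differentiating the power of x_n exchanges them and lowers
  \<open>c\<close> by 1; differentiating the power of |x| lowers \<open>s\<close> by 2 and produces
  a coordinate.\<close>

definition U :: "complex \<Rightarrow> complex \<Rightarrow> 'b::euclidean_space \<times> real \<Rightarrow> complex" where
  "U c s x = AP c (snd x) * W s x"

definition V :: "complex \<Rightarrow> complex \<Rightarrow> 'b::euclidean_space \<times> real \<Rightarrow> complex" where
  "V c s x = SP c (snd x) * W s x"

lemma UV_continuous [continuous_intros]:
  assumes "Re c > 1" "Re s > 2" shows "continuous_on S (U c s)" "continuous_on S (V c s)"
  unfolding U_def[abs_def] V_def[abs_def] using assms
  by (auto intro!: continuous_intros continuous_AP continuous_SP continuous_W)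

lemma UV_line_derivative:
  assumes "Re c > 1" "Re s > 2"
  shows "((\<lambda>t. U c s (x + t *\<^sub>R b)) has_vector_derivative
      c * of_real (snd b) * V (c - 1) s x + s * of_real (x \<bullet> b) * U c (s - 2) x) (at 0)"
    and "((\<lambda>t. V c s (x + t *\<^sub>R b)) has_vector_derivative
      c * of_real (snd b) * U (c - 1) s x + s * of_real (x \<bullet> b) * V c (s - 2) x) (at 0)"
  using has_vector_derivative_mult[OF SP_line_derivative(2)[OF assms(1), of x b] W_line_derivative[OF assms(2), of x b]]
   has_vector_derivative_mult[OF SP_line_derivative(1)[OF assms(1), of x b] W_line_derivative[OF assms(2), of x b]]
  by (simp_all add: U_def V_def ac_simps)

lemma u_V: "of_real (snd x) * V c s x = U (c + 1) s x"
  unfolding U_def V_def by (simp add: of_real_mult_SP flip: mult.assoc)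

lemma snd_Basis_sum:
  fixes g :: "'b::euclidean_space \<times> real \<Rightarrow> complex"
  shows "(\<Sum>b\<in>Basis. of_real (snd b) * g b) = g en"
proof -
  have "(\<Sum>b\<in>Basis. of_real (snd b) * g b) = (\<Sum>b\<in>Basis. if b = en then g b else 0)"
    by (rule sum.cong) (auto simp: Basis_prod_def)
  then show ?thesis by simp
qed

lemma inner_sum_sq: "(\<Sum>b\<in>Basis. of_real (x \<bullet> b) * of_real (x \<bullet> b)) = complex_of_real ((norm x)\<^sup>2)"
  unfolding power2_norm_eq_inner by (subst (3) euclidean_inner) simp

lemma inner_snd_sum:
  fixes x :: "'b::euclidean_space \<times> real"
  shows "(\<Sum>b\<in>Basis. of_real (snd b) * complex_of_real (x \<bullet> b)) = of_real (snd x)"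
  by (subst snd_Basis_sum) (simp add: inner_prod_def)

lemma norm_sq_U: "of_real ((norm x)\<^sup>2) * U c (s - 2) x = U c s x"
  using norm_sq_W[of x s] by (simp add: U_def ac_simps)

text \<open>The normal derivative of \<open>V (a + 1) s\<close> is (a + 1) \<open>U a s\<close> plus
  s \<open>U (a + 2) (s - 2)\<close>, since the coordinate x_n turns the odd power back into an even
  one.\<close>

lemma relation_first:
  fixes f :: "'b::euclidean_space \<times> real \<Rightarrow> complex"
  assumes a: "Re a > 1" and s: "Re s > 4" and f: "f \<in> tf R"
  shows "(a + 1) * (\<integral>x. U a s x * f x \<partial>lborel) + s * (\<integral>x. U (a + 2) (s - 2) x * f x \<partial>lborel)
     + (\<integral>x. V (a + 1) s x * pderiv_dir en f x \<partial>lborel) = 0"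
proof -
  have K': "(a + 1) * of_real (snd (en::'b \<times> real)) * U (a + 1 - 1) s x + s * of_real (x \<bullet> en) * V (a + 1) (s - 2) x
      = (a + 1) * U a s x + s * U (a + 2) (s - 2) x" for x :: "'b \<times> real"
    using u_V[of x "a + 1" "s - 2"] by (simp add: inner_prod_def mult.assoc add.assoc)
  have "(\<integral>x. V (a + 1) s x * pderiv_dir en f x \<partial>lborel) = - (\<integral>x. ((a + 1) * U a s x + s * U (a + 2) (s - 2) x) * f x \<partial>lborel)"
  proof (rule ibp_kernel[OF _ _ _ f en_Basis])
    show "((\<lambda>t. V (a + 1) s (x + t *\<^sub>R en)) has_vector_derivative (a + 1) * U a s x + s * U (a + 2) (s - 2) x) (at 0)" for x :: "'b \<times> real"
    proof -
      have "((\<lambda>t. V (a + 1) s (x + t *\<^sub>R en)) has_vector_derivative (a + 1) * of_real (snd (en::'b \<times> real)) * U (a + 1 - 1) s x + s * of_real (x \<bullet> en) * V (a + 1) (s - 2) x) (at 0)"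
        using a s by (intro UV_line_derivative(2)) auto
      then show ?thesis unfolding K' .
    qed
  qed (use a s in \<open>auto intro!: continuous_intros\<close>)
  also have "(\<integral>x. ((a + 1) * U a s x + s * U (a + 2) (s - 2) x) * f x \<partial>lborel) =
     (\<integral>x. (a + 1) * (U a s x * f x) + s * (U (a + 2) (s - 2) x * f x) \<partial>lborel)"
    by (simp add: algebra_simps)
  also have "\<dots> = (a + 1) * (\<integral>x. U a s x * f x \<partial>lborel) + s * (\<integral>x. U (a + 2) (s - 2) x * f x \<partial>lborel)"
    using a s integrable_cont_tf[OF UV_continuous(1)[of a s] f] integrable_cont_tf[OF UV_continuous(1)[of "a+2" "s-2"] f]
    by simp
  finally show ?thesis by simp
qed

text \<open>Integrating by parts once in each direction, the power of x_n gives the normal term and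
  the power of |x| the Euler term \<open>E\<close>. A second integration by parts evaluates
  \<open>E\<close> by Euler's identity, as \<open>U (a + 2) (s - 2)\<close> is homogeneous of degree
  a + s.\<close>

lemma relation_laplace:
  fixes f :: "'b::euclidean_space \<times> real \<Rightarrow> complex"
  assumes a: "Re a > 1" and s: "Re s > 6" and f: "f \<in> tf R"
  shows "(\<integral>x. U (a + 2) s x * lap f x \<partial>lborel) = - (a + 2) * (\<integral>x. V (a + 1) s x * pderiv_dir en f x \<partial>lborel)
     + s * (dm TYPE('b) + a + s) * (\<integral>x. U (a + 2) (s - 2) x * f x \<partial>lborel)"
proof -
  define E where "E = (\<Sum>b\<in>Basis. \<integral>x. of_real (x \<bullet> b) * U (a + 2) (s - 2) x * pderiv_dir b f x \<partial>lborel)"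
  note fb = tf_pderiv_dir[OF f]
  have cI: "continuous_on UNIV (\<lambda>x. complex_of_real (x \<bullet> b))" for b :: "'b \<times> real"
    by (intro continuous_intros)
  have 1: "(\<integral>x. U (a + 2) s x * lap f x \<partial>lborel) = - (a + 2) * (\<integral>x. V (a + 1) s x * pderiv_dir en f x \<partial>lborel) - s * E"
  proof -
    have "(\<integral>x. U (a + 2) s x * lap f x \<partial>lborel) = (\<Sum>b\<in>Basis. \<integral>x. U (a + 2) s x * pderiv_dir b (pderiv_dir b f) x \<partial>lborel)"
      unfolding lap_def sum_distrib_left using a s
      by (intro Bochner_Integration.integral_sum integrable_cont_tf[of _ _ R]) (auto intro!: continuous_intros fb tf_pderiv_dir)
    also have "\<dots> = (\<Sum>b\<in>Basis. - (\<integral>x. ((a + 2) * of_real (snd b) * V (a + 1) s x + s * of_real (x \<bullet> b) * U (a + 2) (s - 2) x) * pderiv_dir b f x \<partial>lborel))"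
    proof (rule sum.cong[OF refl])
      fix b :: "'b \<times> real" assume b: "b \<in> Basis"
      show "(\<integral>x. U (a + 2) s x * pderiv_dir b (pderiv_dir b f) x \<partial>lborel) = - (\<integral>x. ((a + 2) * of_real (snd b) * V (a + 1) s x + s * of_real (x \<bullet> b) * U (a + 2) (s - 2) x) * pderiv_dir b f x \<partial>lborel)"
      proof (rule ibp_kernel[OF _ _ _ fb[OF b] b])
        show "((\<lambda>t. U (a + 2) s (x + t *\<^sub>R b)) has_vector_derivative (a + 2) * of_real (snd b) * V (a + 1) s x + s * of_real (x \<bullet> b) * U (a + 2) (s - 2) x) (at 0)" for x :: "'b \<times> real"
          using UV_line_derivative(1)[of "a + 2" s x b] a s by (simp add: add.commute)
      qed (use a s in \<open>auto intro!: continuous_intros\<close>)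
    qed
    also have "\<dots> = (\<Sum>b\<in>Basis. - (a + 2) * (of_real (snd b) * (\<integral>x. V (a + 1) s x * pderiv_dir b f x \<partial>lborel)) - s * (\<integral>x. of_real (x \<bullet> b) * U (a + 2) (s - 2) x * pderiv_dir b f x \<partial>lborel))"
    proof (rule sum.cong[OF refl])
      fix b :: "'b \<times> real" assume b: "b \<in> Basis"
      have i1: "integrable lborel (\<lambda>x. V (a + 1) s x * pderiv_dir b f x)"
        using a s by (intro integrable_cont_tf[OF _ fb[OF b]] continuous_intros) auto
      have i2: "integrable lborel (\<lambda>x. (of_real (x \<bullet> b) * U (a + 2) (s - 2) x) * pderiv_dir b f x)"
        using a s by (intro integrable_cont_tf[OF _ fb[OF b]] continuous_intros) auto
      have "(\<integral>x. ((a + 2) * of_real (snd b) * V (a + 1) s x + s * of_real (x \<bullet> b) * U (a + 2) (s - 2) x) * pderiv_dir b f x \<partial>lborel) =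
         (\<integral>x. ((a + 2) * of_real (snd b)) * (V (a + 1) s x * pderiv_dir b f x) + s * ((of_real (x \<bullet> b) * U (a + 2) (s - 2) x) * pderiv_dir b f x) \<partial>lborel)"
        by (simp add: algebra_simps)
      also have "\<dots> = ((a + 2) * of_real (snd b)) * (\<integral>x. V (a + 1) s x * pderiv_dir b f x \<partial>lborel) + s * (\<integral>x. (of_real (x \<bullet> b) * U (a + 2) (s - 2) x) * pderiv_dir b f x \<partial>lborel)"
        by (simp only: Bochner_Integration.integral_add[OF integrable_mult_right[OF i1] integrable_mult_right[OF i2]] integral_mult_right_zero)
      finally show "- (\<integral>x. ((a + 2) * of_real (snd b) * V (a + 1) s x + s * of_real (x \<bullet> b) * U (a + 2) (s - 2) x) * pderiv_dir b f x \<partial>lborel) =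
        - (a + 2) * (of_real (snd b) * (\<integral>x. V (a + 1) s x * pderiv_dir b f x \<partial>lborel)) - s * (\<integral>x. of_real (x \<bullet> b) * U (a + 2) (s - 2) x * pderiv_dir b f x \<partial>lborel)"
        by (simp add: algebra_simps)
    qed
    also have "\<dots> = - (a + 2) * (\<integral>x. V (a + 1) s x * pderiv_dir en f x \<partial>lborel) - s * E"
      unfolding sum_subtractf sum_distrib_left[symmetric] E_def by (subst snd_Basis_sum) simp
    finally show ?thesis .
  qed
  have 2: "E = - ((dm TYPE('b) + a + s) * (\<integral>x. U (a + 2) (s - 2) x * f x \<partial>lborel))"
  proof -
    \<comment> \<open>\<open>K' b\<close> is the derivative along \<open>b\<close> of x_b times the
      kernel. Summed over the basis this is the divergence of the radial field x U, which equals n +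
      a + s times the kernel.\<close>
    define K' where "K' = (\<lambda>(b::'b \<times> real) x. U (a + 2) (s - 2) x + of_real (x \<bullet> b) * ((a + 2) * of_real (snd b) * V (a + 1) (s - 2) x + (s - 2) * of_real (x \<bullet> b) * U (a + 2) (s - 4) x))"
    have cK: "continuous_on UNIV (K' b)" for b :: "'b \<times> real"
      unfolding K'_def using a s by (intro continuous_intros) auto
    have pt: "(\<Sum>b\<in>Basis. K' b x * f x) = (dm TYPE('b) + a + s) * (U (a + 2) (s - 2) x * f x)" for x :: "'b \<times> real"
    proof -
      have "(\<Sum>b\<in>Basis. K' b x) = dm TYPE('b) * U (a + 2) (s - 2) x + (a + 2) * V (a + 1) (s - 2) x * (\<Sum>b\<in>Basis. of_real (snd b) * of_real (x \<bullet> b))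
          + (s - 2) * U (a + 2) (s - 4) x * (\<Sum>b\<in>Basis. of_real (x \<bullet> b) * of_real (x \<bullet> b))"
      proof -
        have "K' b x = U (a + 2) (s - 2) x + (a + 2) * V (a + 1) (s - 2) x * (of_real (snd b) * of_real (x \<bullet> b))
            + (s - 2) * U (a + 2) (s - 4) x * (of_real (x \<bullet> b) * of_real (x \<bullet> b))" for b
          unfolding K'_def by (simp add: algebra_simps)
        then show ?thesis by (simp add: sum.distrib sum_distrib_left[symmetric])
      qed
      also have "\<dots> = dm TYPE('b) * U (a + 2) (s - 2) x + (a + 2) * (of_real (snd x) * V (a + 1) (s - 2) x)
          + (s - 2) * (of_real ((norm x)\<^sup>2) * U (a + 2) (s - 2 - 2) x)"
        unfolding inner_snd_sum inner_sum_sq by (simp add: algebra_simps)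
      also have "\<dots> = (dm TYPE('b) + a + s) * U (a + 2) (s - 2) x"
        unfolding u_V norm_sq_U by (simp add: algebra_simps)
      finally show ?thesis by (simp add: sum_distrib_right[symmetric])
    qed
    have "E = (\<Sum>b\<in>Basis. - (\<integral>x. K' b x * f x \<partial>lborel))"
      unfolding E_def
    proof (rule sum.cong[OF refl])
      fix b :: "'b \<times> real" assume b: "b \<in> Basis"
      show "(\<integral>x. of_real (x \<bullet> b) * U (a + 2) (s - 2) x * pderiv_dir b f x \<partial>lborel) = - (\<integral>x. K' b x * f x \<partial>lborel)"
      proof (rule ibp_kernel[OF _ cK _ f b])
        fix x :: "'b \<times> real"
        have "((\<lambda>t. complex_of_real ((x + t *\<^sub>R b) \<bullet> b)) has_vector_derivative of_real (b \<bullet> b)) (at 0)"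
          unfolding inner_add_left inner_scaleR_left of_real_add of_real_mult
          by (auto intro!: derivative_eq_intros simp: has_vector_derivative_def scaleR_conv_of_real)
        moreover have "((\<lambda>t. U (a + 2) (s - 2) (x + t *\<^sub>R b)) has_vector_derivative
            (a + 2) * of_real (snd b) * V (a + 2 - 1) (s - 2) x + (s - 2) * of_real (x \<bullet> b) * U (a + 2) (s - 2 - 2) x) (at 0)"
          using a s by (intro UV_line_derivative(1)) auto
        ultimately show "((\<lambda>t. of_real ((x + t *\<^sub>R b) \<bullet> b) * U (a + 2) (s - 2) (x + t *\<^sub>R b)) has_vector_derivative K' b x) (at 0)"
          by (rule has_vector_derivative_eq_rhs[OF has_vector_derivative_mult])
            (use b in \<open>simp add: K'_def algebra_simps\<close>)
      qed (use a s in \<open>auto intro!: continuous_intros\<close>)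
    qed
    also have "\<dots> = - (\<integral>x. (\<Sum>b\<in>Basis. K' b x * f x) \<partial>lborel)"
      by (subst Bochner_Integration.integral_sum) (auto intro: integrable_cont_tf[OF cK f] simp: sum_negf)
    also have "\<dots> = - (\<integral>x. (dm TYPE('b) + a + s) * (U (a + 2) (s - 2) x * f x) \<partial>lborel)"
      by (simp only: pt)
    finally show ?thesis by simp
  qed
  show ?thesis unfolding 1 2 by (simp add: algebra_simps)
qed

text \<open>The odd kernel sees only the odd part of the normal derivative, which is x_n
  \<open>Pop f\<close>; the factor x_n makes the kernel even. Thus every term of the two identities
  is an integral against an even kernel.\<close>

lemma V_Pop:
  fixes f :: "'b::euclidean_space \<times> real \<Rightarrow> complex"
  assumes a: "Re a > 1" and s: "Re s > 4" and f: "f \<in> tf R"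
  shows "(\<integral>x. V (a + 1) s x * pderiv_dir en f x \<partial>lborel) = (\<integral>x. U (a + 2) s x * Pop f x \<partial>lborel)"
proof -
  note f' = tf_pderiv_dir[OF f en_Basis]
  have "(\<integral>x. V (a + 1) s x * pderiv_dir en f x \<partial>lborel) = (\<integral>x. V (a + 1) s x * (of_real (snd x) * Qop (pderiv_dir en f) x) \<partial>lborel)"
    using a s by (intro odd_kernel_Qop integrable_cont_tf[OF _ f'] continuous_intros tf_smooth[OF f'])
      (auto simp: V_def sc_m1)
  also have "\<dots> = (\<integral>x. (of_real (snd x) * V (a + 1) s x) * Pop f x \<partial>lborel)"
    by (simp add: Pop_def ac_simps)
  finally show ?thesis by (simp add: u_V add.assoc)
qed

section \<open>Continuation of the normalized even kernel\<close>

lemma norm_Ker: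
  fixes x :: "'b::euclidean_space \<times> real"
  shows "norm (Ker a z x) = \<bar>snd x\<bar> powr Re a * norm x powr (Re z - Re a - (real DIM('b) + 1))"
  by (simp add: Ker_def norm_mult norm_AP norm_W add.commute)

lemma measurable_snd_euclidean [measurable]:
  "(snd :: 'b::euclidean_space \<times> real \<Rightarrow> real) \<in> borel_measurable borel"
  by (intro borel_measurable_continuous_onI continuous_intros)

lemma AP_measurable [measurable]: "AP a \<in> borel_measurable borel"
  and SP_measurable [measurable]: "SP a \<in> borel_measurable borel"
  unfolding AP_def[abs_def] SP_def[abs_def] by measurable

lemma W_measurable [measurable]: "W s \<in> borel_measurable borel"
  unfolding W_def[abs_def] by measurable

lemma Ker_measurable [measurable]: "Ker a z \<in> borel_measurable (borel :: ('b::euclidean_space \<times> real) measure)"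
  unfolding Ker_def[abs_def] by measurable

lemma kernel_bounded_integrable:
  fixes k h :: "'b::euclidean_space \<times> real \<Rightarrow> complex"
  assumes a: "\<alpha> > -1" and z: "\<beta> > 0" and R: "R > 0"
    and [measurable]: "k \<in> borel_measurable borel" "h \<in> borel_measurable borel"
    and k: "\<And>x. norm x \<le> R \<Longrightarrow> norm (k x) \<le> \<bar>snd x\<bar> powr \<alpha> * norm x powr (\<beta> - \<alpha> - (real DIM('b) + 1))"
    and h: "\<And>x. norm (h x) \<le> B" "\<And>x. norm x > R \<Longrightarrow> h x = 0"
  shows "integrable lborel (\<lambda>x. k x * h x)"
    and "norm (\<integral>x. k x * h x \<partial>lborel) \<le> (\<integral>(x::'b \<times> real). indicator (cball 0 R) x * (\<bar>snd x\<bar> powr \<alpha> * norm x powr (\<beta> - \<alpha> - (real DIM('b) + 1))) \<partial>lborel) * B"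
proof -
  let ?k = "\<lambda>x::'b \<times> real. indicator (cball 0 R) x * (\<bar>snd x\<bar> powr \<alpha> * norm x powr (\<beta> - \<alpha> - (real DIM('b) + 1)))"
  have ik: "integrable lborel (\<lambda>x. ?k x * B)"
    by (intro integrable_mult_left kernel_integrable a z R)
  have B: "B \<ge> 0" using order_trans[OF norm_ge_zero h(1)] .
  have le: "norm (k x * h x) \<le> ?k x * B" for x
  proof (cases "norm x \<le> R")
    case True
    then show ?thesis using mult_mono[OF k[OF True] h(1)[of x]] by (simp add: norm_mult)
  qed (use h(2) in auto)
  show i: "integrable lborel (\<lambda>x. k x * h x)"
  proof (rule Bochner_Integration.integrable_bound[OF ik])
    show "AE x in lborel. norm (k x * h x) \<le> norm (?k x * B)"
      unfolding real_norm_def by (rule AE_I2) (rule order_trans[OF le abs_ge_self])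
  qed measurable
  have "norm (\<integral>x. k x * h x \<partial>lborel) \<le> (\<integral>x. ?k x * B \<partial>lborel)"
    by (rule Bochner_Integration.integral_norm_bound_integral[OF i ik le])
  also have "\<dots> = (\<integral>x. ?k x \<partial>lborel) * B" by simp
  finally show "norm (\<integral>x. k x * h x \<partial>lborel) \<le> (\<integral>x. ?k x \<partial>lborel) * B" .
qed

lemma tf_measurable: "f \<in> tf R \<Longrightarrow> f \<in> borel_measurable borel"
  by (intro borel_measurable_continuous_onI tf_continuous)

lemma Ker_integrable:
  fixes f :: "'b::euclidean_space \<times> real \<Rightarrow> complex"
  assumes "Re a > -1" "Re z > 0" "R > 0" "f \<in> tf R"
  shows "integrable lborel (\<lambda>x. Ker a z x * f x)"
  using pderivs_le_sem[OF assms(4), of "[]" 0]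
  by (intro kernel_bounded_integrable(1)[OF assms(1-3), where B="sem 0 f"])
    (auto simp: tf_measurable[OF assms(4)] norm_Ker tf_zero[OF assms(4)])

lemma cfn_II:
  assumes "Re a > -1" "Re z > 0" shows "cfn (II a z :: ('b::euclidean_space \<times> real \<Rightarrow> complex) \<Rightarrow> complex)"
  unfolding cfn_def
proof (intro allI impI conjI ballI)
  fix R :: real and f g :: "'b \<times> real \<Rightarrow> complex" assume R: "R > 0" "f \<in> tf R" "g \<in> tf R"
  show "II a z (\<lambda>x. f x + g x) = II a z f + II a z g"
    using Ker_integrable[OF assms R(1,2)] Ker_integrable[OF assms R(1,3)] by (simp add: II_def distrib_left)
next
  fix R :: real and f :: "'b \<times> real \<Rightarrow> complex" and c
  show "II a z (\<lambda>x. c * f x) = c * II a z f" by (simp add: II_def mult.left_commute)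
next
  fix R :: real assume R: "R > 0"
  let ?C = "(\<integral>(x::'b \<times> real). indicator (cball 0 R) x * (\<bar>snd x\<bar> powr Re a * norm x powr (Re z - Re a - (real DIM('b) + 1))) \<partial>lborel)"
  have "cmod (II a z f) \<le> ?C * sem 0 f" if f: "f \<in> tf R" for f :: "'b \<times> real \<Rightarrow> complex"
    unfolding II_def
    by (rule kernel_bounded_integrable(2)[OF assms R, of "Ker a z" f "sem 0 f"])
      (use pderivs_le_sem[OF f, of "[]" 0] in \<open>auto simp: tf_measurable[OF f] norm_Ker tf_zero[OF f]\<close>)
  moreover have "0 \<le> ?C" by (intro Bochner_Integration.integral_nonneg) auto
  ultimately show "\<exists>C\<ge>0. \<exists>M. \<forall>f\<in>(tf R :: ('b \<times> real \<Rightarrow> complex) set). cmod (II a z f) \<le> C * sem M f"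
    by (intro exI[of _ "?C"] conjI exI[of _ "0::nat"] ballI) simp_all
qed

text \<open>The parameters at which level \<open>N\<close> of the recursion is a convergent
  integral, each level raising both parameters by 2. These sets are open and convex, as the identity
  theorem wants them, and they exhaust all parameters.\<close>

definition dom :: "nat \<Rightarrow> (complex \<times> complex) set" where
  "dom N = {p. Re (fst p) > -1 - 2 * real N \<and> Re (snd p) > -2 * real N}"

lemma dom_iff: "(a, z) \<in> dom N \<longleftrightarrow> Re a > -1 - 2 * real N \<and> Re z > -2 * real N"
  by (simp add: dom_def)

lemma open_dom: "open (dom N)"
  unfolding dom_def by (intro open_Collect_conj open_Collect_less continuous_intros)

lemma convex_dom: "convex (dom N)"
proof -
  have "dom N = {p. Re (fst p) > -1 - 2 * real N} \<inter> {p. Re (snd p) > -2 * real N}" by (auto simp: dom_def)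
  moreover have "linear (\<lambda>p::complex\<times>complex. Re (fst p))" "linear (\<lambda>p::complex\<times>complex. Re (snd p))"
    by (auto intro!: linearI)
  from convex_linear_vimage[OF this(1), of "{-1 - 2 * real N<..}"] convex_linear_vimage[OF this(2), of "{- 2 * real N<..}"]
  have "convex {p::complex\<times>complex. Re (fst p) > -1 - 2 * real N}" "convex {p::complex\<times>complex. Re (snd p) > -2 * real N}"
    by (simp_all add: vimage_def)
  ultimately show ?thesis by (simp add: convex_Int)
qed

lemma AE_snd_nonzero: "AE (x::'b::euclidean_space \<times> real) in lborel. snd x \<noteq> 0"
  using AE_coord_nonzero
proof eventually_elim
  case (elim x)
  then have "x \<bullet> en \<noteq> 0" using en_Basis by blast
  then show ?case by (simp add: inner_prod_def)
qed

text \<open>Exhibits the kernel as the exponential of a linear form in (a, z), the shape treated in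
  \<open>exp_integral_hol2\<close>. The excluded hyperplane is a null set.\<close>

lemma Ker_exp:
  fixes x :: "'b::euclidean_space \<times> real"
  assumes "snd x \<noteq> 0"
  shows "Ker a z x = exp (a * of_real (ln \<bar>snd x\<bar> - ln (norm x)) + z * of_real (ln (norm x))) * W (- dm TYPE('b)) x"
proof -
  have "x \<noteq> 0" using assms by auto
  then have "complex_of_real \<bar>snd x\<bar> \<noteq> 0" "complex_of_real (norm x) \<noteq> 0" using assms by auto
  then show ?thesis using \<open>x \<noteq> 0\<close> assms
    by (simp add: Ker_def AP_def W_def powr_def Ln_of_real exp_add[symmetric] algebra_simps)
qed

lemma II_hol2:
  fixes f :: "'b::euclidean_space \<times> real \<Rightarrow> complex"
  assumes D: "open D" and fm: "f \<in> borel_measurable borel"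
    and int: "\<And>p. p \<in> D \<Longrightarrow> integrable lborel (\<lambda>x. Ker (fst p) (snd p) x * f x)"
  shows "hol2 D (\<lambda>p. II (fst p) (snd p) f)"
proof -
  define E where "E = (\<lambda>p x. exp (fst p * of_real (ln \<bar>snd x\<bar> - ln (norm x)) + snd p * of_real (ln (norm x))) * (W (- dm TYPE('b)) x * f x))"
  have AE: "AE x in lborel. Ker (fst p) (snd p) x * f x = E p x" for p
    using AE_snd_nonzero by eventually_elim (simp add: E_def Ker_exp)
  have [measurable]: "E p \<in> borel_measurable borel" for p unfolding E_def using fm by measurable
  have "hol2 D (\<lambda>p. \<integral>x. E p x \<partial>lborel)"
    unfolding E_def
  proof (rule exp_integral_hol2[OF _ _ _ D])
    fix p assume "p \<in> D"
    have "integrable lborel (E p)"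
      by (rule integrable_cong_AE_imp[OF int[OF \<open>p \<in> D\<close>]]) (use AE in \<open>auto elim: eventually_mono\<close>)
    then show "integrable lborel (\<lambda>x. exp (fst p * of_real (ln \<bar>snd x\<bar> - ln (norm x)) + snd p * of_real (ln (norm x))) * (W (- dm TYPE('b)) x * f x))"
      by (simp add: E_def)
  qed (use fm in measurable)
  moreover have "(\<integral>x. E p x \<partial>lborel) = II (fst p) (snd p) f" for p
    unfolding II_def using fm by (intro integral_cong_AE) (auto intro: eventually_mono[OF AE[of p]])
  ultimately show ?thesis by simp
qed

definition gf :: "complex \<Rightarrow> complex \<Rightarrow> complex" where
  "gf a z = rGamma ((a + 1) / 2) * rGamma (z / 2)"

lemma hol2_rGamma: "hol2 D u \<Longrightarrow> hol2 D (\<lambda>p. rGamma (u p))"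
  by (rule hol2_compose1) (auto intro: holomorphic_rGamma)

lemma gf_hol2: "hol2 D (\<lambda>p. gf (fst p) (snd p))"
  unfolding gf_def by (intro hol2_mult hol2_rGamma hol2_divide_const hol2_add hol2_fst hol2_snd hol2_const)

text \<open>On even kernels \<open>Pop\<close> acts as \<open>x\<^sub>n\<^sup>-\<^sup>1\<partial>\<^sub>n\<close>.  The adjoint of \<open>\<Delta> + (a + z + 2) x\<^sub>n\<^sup>-\<^sup>1\<partial>\<^sub>n\<close> maps the
  kernel at \<open>(a + 2, z + 2)\<close> to \<open>- (a + 1) z\<close> times the kernel at \<open>(a, z)\<close>, and the Gamma factors in
  \<open>gf\<close> absorb \<open>(a + 1) z / 4\<close>.\<close>

fun Gc :: "nat \<Rightarrow> complex \<Rightarrow> complex \<Rightarrow> ('b::euclidean_space \<times> real \<Rightarrow> complex) \<Rightarrow> complex" where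
  "Gc 0 a z f = gf a z * II a z f"
| "Gc (Suc N) a z f = (-1/4) * (Gc N (a + 2) (z + 2) (lap f) + (a + z + 2) * Gc N (a + 2) (z + 2) (Pop f))"

lemma cfn_Gc: "(a, z) \<in> dom N \<Longrightarrow> cfn (Gc N a z :: ('b::euclidean_space \<times> real \<Rightarrow> complex) \<Rightarrow> complex)"
proof (induction N arbitrary: a z)
  case 0
  then show ?case using cfn_scale[OF cfn_II[of a z], of "gf a z"] by (simp add: dom_iff)
next
  case (Suc N)
  then have c: "cfn (Gc N (a + 2) (z + 2) :: ('b \<times> real \<Rightarrow> complex) \<Rightarrow> complex)" by (simp add: dom_iff)
  have "cfn (\<lambda>f::'b \<times> real \<Rightarrow> complex. (-1/4) * (Gc N (a + 2) (z + 2) (lap f) + (a + z + 2) * Gc N (a + 2) (z + 2) (Pop f)))"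
    by (intro cfn_scale cfn_plus cfn_comp[OF c] cop_lap cop_Pop)
  then show ?case by (simp only: Gc.simps)
qed

lemma tf_lap: "R > 0 \<Longrightarrow> f \<in> tf R \<Longrightarrow> lap f \<in> tf R" and tf_Pop: "R > 0 \<Longrightarrow> g \<in> tf R \<Longrightarrow> Pop g \<in> tf R"
  and tf_Qop: "R > 0 \<Longrightarrow> g \<in> tf R \<Longrightarrow> Qop g \<in> tf R"
  using cop_tf[OF cop_lap] cop_tf[OF cop_Pop] cop_tf[OF cop_Qop] by blast+

lemma Gc_hol2:
  fixes f :: "'b::euclidean_space \<times> real \<Rightarrow> complex"
  shows "R > 0 \<Longrightarrow> f \<in> tf R \<Longrightarrow> hol2 (dom N) (\<lambda>p. Gc N (fst p) (snd p) f)"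
proof (induction N arbitrary: f)
  case 0
  then have "hol2 (dom 0) (\<lambda>p. II (fst p) (snd p) f)"
    by (intro II_hol2 open_dom tf_measurable Ker_integrable[of _ _ R]) (auto simp: dom_def)
  then show ?case by (simp add: hol2_mult gf_hol2)
next
  case (Suc N)
  have s: "hol2 (dom (Suc N)) (\<lambda>p. Gc N (fst p + 2) (snd p + 2) g)" if "g \<in> tf R" for g :: "'b \<times> real \<Rightarrow> complex"
  proof -
    have u: "hol2 (dom (Suc N)) (\<lambda>p. fst p + 2)" and v: "hol2 (dom (Suc N)) (\<lambda>p. snd p + 2)"
      by (intro hol2_add hol2_fst hol2_snd hol2_const)+
    show ?thesis
      using hol2_compose2[OF Suc.IH[OF Suc.prems(1) that] u v] by (simp add: dom_def)
  qed
  have "hol2 (dom (Suc N)) (\<lambda>p. (-1/4) * (Gc N (fst p + 2) (snd p + 2) (lap f) + (fst p + snd p + 2) * Gc N (fst p + 2) (snd p + 2) (Pop f)))"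
    using Suc.prems by (intro hol2_cmult hol2_add hol2_mult s hol2_fst hol2_snd hol2_const tf_lap tf_Pop)
  then show ?case by (simp only: Gc.simps)
qed

text \<open>Parameters at which both integrations by parts are legitimate, with \<open>n\<close> the
  dimension. An open nonempty set of them is enough to propagate the identities by
  \<open>hol2_identity\<close>.\<close>

definition nice :: "complex \<Rightarrow> (complex \<times> complex) set" where
  "nice n = {p. Re (fst p) > 1 \<and> Re (snd p - fst p - n) > 6}"

lemma open_nice: "open (nice n)"
  unfolding nice_def by (intro open_Collect_conj open_Collect_less continuous_intros)

lemma nice_nonempty: "nice n \<noteq> {}"
proof -
  have "(2, 9 + n) \<in> nice n" by (simp add: nice_def)
  then show ?thesis by blast
qed

lemma nice_dom: "nice (dm TYPE('b::euclidean_space)) \<subseteq> dom N"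
  by (auto simp: nice_def dom_def)

lemma II_U:
  fixes f :: "'b::euclidean_space \<times> real \<Rightarrow> complex"
  shows "II a z f = (\<integral>x. U a (z - a - dm TYPE('b)) x * f x \<partial>lborel)"
  by (simp add: II_def Ker_def U_def)

lemma rGamma_shift: "rGamma (w / 2) = (w / 2) * rGamma ((w + 2) / 2)" for w :: complex
  using rGamma_plus1[of "w / 2"] by (simp add: add_divide_distrib)

text \<open>The integrals \<open>X\<close>, \<open>Y\<close>, \<open>M\<close>, \<open>L\<close>
  satisfy the linear relations \<open>1\<close> and \<open>2\<close>. The first identity is
  \<open>1\<close> after normalization. For the second, multiplying \<open>1\<close> by z and
  inserting \<open>2\<close> eliminates \<open>X\<close>, and the remaining factor (a + 1) z / 4 is
  taken up by the reciprocal Gamma functions.\<close>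

lemma Gc_relations_nice:
  fixes f :: "'b::euclidean_space \<times> real \<Rightarrow> complex"
  assumes p: "(a, z) \<in> nice (dm TYPE('b))" and f: "f \<in> tf R"
  shows "Gc 0 a z f = (-1/2) * ((z - a - dm TYPE('b)) * Gc 0 (a + 2) z f + (z / 2) * Gc 0 (a + 2) (z + 2) (Pop f))"
    and "Gc 0 a z f = (-1/4) * (Gc 0 (a + 2) (z + 2) (lap f) + (a + z + 2) * Gc 0 (a + 2) (z + 2) (Pop f))"
proof -
  define s where "s = z - a - dm TYPE('b)"
  have a: "Re a > 1" and s: "Re s > 6" using p by (auto simp: nice_def s_def)
  define X where "X = (\<integral>x. U (a + 2) (s - 2) x * f x \<partial>lborel)"
  define Y where "Y = (\<integral>x. U a s x * f x \<partial>lborel)"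
  define M where "M = (\<integral>x. U (a + 2) s x * Pop f x \<partial>lborel)"
  define L where "L = (\<integral>x. U (a + 2) s x * lap f x \<partial>lborel)"
  have e: "z - (a + 2) - dm TYPE('b) = s - 2" "(z + 2) - (a + 2) - dm TYPE('b) = s" "z - a - dm TYPE('b) = s"
    by (simp_all add: s_def)
  have II: "II a z f = Y" "II (a + 2) z f = X" "II (a + 2) (z + 2) (Pop f) = M" "II (a + 2) (z + 2) (lap f) = L"
    unfolding II_U e X_def Y_def M_def L_def by simp_all
  have MV: "(\<integral>x. V (a + 1) s x * pderiv_dir en f x \<partial>lborel) = M"
    unfolding M_def using V_Pop[OF a _ f, of s] s by simp
  have 1: "(a + 1) * Y + s * X + M = 0"
    using relation_first[OF a _ f, of s] s unfolding MV by (simp add: X_def Y_def)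
  have 2: "L = - (a + 2) * M + s * z * X"
    using relation_laplace[OF a s f] unfolding MV by (simp add: L_def X_def s_def)
  have ga: "rGamma ((a + 1) / 2) = ((a + 1) / 2) * rGamma ((a + 2 + 1) / 2)"
    using rGamma_shift[of "a + 1"] by (simp add: ac_simps)
  have gz: "rGamma (z / 2) = (z / 2) * rGamma ((z + 2) / 2)" by (rule rGamma_shift)
  have "(a + 1) * Y = ((a + 1) * Y + s * X + M) - s * X - M" by simp
  then have Y: "(a + 1) * Y = - s * X - M" unfolding 1 by simp
  show "Gc 0 a z f = (-1/2) * ((z - a - dm TYPE('b)) * Gc 0 (a + 2) z f + (z / 2) * Gc 0 (a + 2) (z + 2) (Pop f))"
  proof -
    have "Gc 0 a z f = rGamma ((a + 2 + 1) / 2) * rGamma (z / 2) * ((a + 1) * Y) / 2"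
      unfolding Gc.simps gf_def II ga by simp
    also have "\<dots> = (-1/2) * (s * (rGamma ((a + 2 + 1) / 2) * rGamma (z / 2) * X) + rGamma ((a + 2 + 1) / 2) * rGamma (z / 2) * M)"
    proof -
      have "A * (- s * X - M) / 2 = (-1/2) * (s * (A * X) + A * M)" for A by (simp add: field_simps)
      then show ?thesis unfolding Y .
    qed
    also have "rGamma ((a + 2 + 1) / 2) * rGamma (z / 2) * M = (z / 2) * (rGamma ((a + 2 + 1) / 2) * rGamma ((z + 2) / 2) * M)"
      by (subst gz) simp
    finally show ?thesis unfolding Gc.simps gf_def II e .
  qed
  show "Gc 0 a z f = (-1/4) * (Gc 0 (a + 2) (z + 2) (lap f) + (a + z + 2) * Gc 0 (a + 2) (z + 2) (Pop f))"
  proof -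
    have "Gc 0 a z f = rGamma ((a + 2 + 1) / 2) * rGamma ((z + 2) / 2) * (z * ((a + 1) * Y)) / 4"
      unfolding Gc.simps gf_def II ga gz by simp
    also have "z * ((a + 1) * Y) = - (L + (a + z + 2) * M)"
      unfolding Y 2 by (simp add: algebra_simps)
    finally have *: "Gc 0 a z f = rGamma ((a + 2 + 1) / 2) * rGamma ((z + 2) / 2) * (- (L + (a + z + 2) * M)) / 4" .
    have "A * (- (L + c * M)) / 4 = (-1/4) * (A * L + c * (A * M))" for A c by (simp add: field_simps)
    with * show ?thesis unfolding Gc.simps gf_def II by metis
  qed
qed

text \<open>At level 0 both sides are holomorphic on \<open>dom 0\<close> and agree on
  \<open>nice\<close>; at higher levels both sides are the same recursion applied to equal
  values.\<close>

lemma Gc_Suc: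
  fixes f :: "'b::euclidean_space \<times> real \<Rightarrow> complex"
  shows "R > 0 \<Longrightarrow> f \<in> tf R \<Longrightarrow> (a, z) \<in> dom N \<Longrightarrow> Gc (Suc N) a z f = Gc N a z f"
proof (induction N arbitrary: a z f)
  case 0
  have "Gc (Suc 0) (fst (a, z)) (snd (a, z)) f = Gc 0 (fst (a, z)) (snd (a, z)) f"
  proof (rule hol2_identity[OF open_dom[of 0] convex_dom _ _ open_nice nice_dom nice_nonempty])
    show "hol2 (dom 0) (\<lambda>p. Gc (Suc 0) (fst p) (snd p) f)"
      by (rule hol2_subset[OF Gc_hol2[OF 0(1,2)]]) (auto simp: dom_def)
    show "Gc (Suc 0) (fst p) (snd p) f = Gc 0 (fst p) (snd p) f" if "p \<in> nice (dm TYPE('b))" for p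
      unfolding Gc.simps(2) using Gc_relations_nice(2)[of "fst p" "snd p" f R] that 0 by simp
  qed (use 0 Gc_hol2 in blast)+
  then show ?case by simp
next
  case (Suc N)
  then have d: "(a + 2, z + 2) \<in> dom N" by (simp add: dom_iff)
  have "Gc (Suc N) (a + 2) (z + 2) (lap f) = Gc N (a + 2) (z + 2) (lap f)"
    "Gc (Suc N) (a + 2) (z + 2) (Pop f) = Gc N (a + 2) (z + 2) (Pop f)"
    by (intro Suc.IH tf_lap tf_Pop Suc.prems d)+
  then show ?case by (simp only: Gc.simps)
qed

lemma Gc_add:
  assumes "R > 0" "f \<in> tf R" "(a, z) \<in> dom N" shows "Gc (N + k) a z f = Gc N a z f"
proof (induction k)
  case (Suc k)
  have "(a, z) \<in> dom (N + k)" using assms by (simp add: dom_iff)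
  then show ?case using Gc_Suc[OF assms(1,2), of a z "N + k"] Suc by simp
qed simp

text \<open>Some level whose domain contains (a, z). The value of \<open>G\<close> does not depend
  on the choice, by \<open>Gc_add\<close>.\<close>

definition lev :: "complex \<Rightarrow> complex \<Rightarrow> nat" where
  "lev a z = Suc (nat \<lceil>norm a + norm z\<rceil>)"

definition G :: "complex \<Rightarrow> complex \<Rightarrow> ('b::euclidean_space \<times> real \<Rightarrow> complex) \<Rightarrow> complex" where
  "G a z f = Gc (lev a z) a z f"

lemma lev_dom: "(a, z) \<in> dom (lev a z)"
proof -
  have "real (lev a z) > norm a + norm z" unfolding lev_def by linarith
  then show ?thesis using abs_Re_le_cmod[of a] abs_Re_le_cmod[of z] norm_ge_zero[of a] norm_ge_zero[of z]
    unfolding dom_iff by linarith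
qed

lemma G_eq:
  assumes "R > 0" "f \<in> tf R" "(a, z) \<in> dom N" shows "G a z f = Gc N a z f"
proof (cases "N \<le> lev a z")
  case True
  then show ?thesis using Gc_add[OF assms, of "lev a z - N"] by (simp add: G_def)
next
  case False
  then show ?thesis using Gc_add[OF assms(1,2) lev_dom, of a z "N - lev a z"] by (simp add: G_def)
qed

lemma cfn_G: "cfn (G a z)"
  unfolding G_def[abs_def] by (rule cfn_Gc[OF lev_dom])

lemma G_hol2:
  assumes "R > 0" "f \<in> tf R" shows "hol2 UNIV (\<lambda>p. G (fst p) (snd p) f)"
  unfolding hol2_def
proof
  fix p
  let ?N = "lev (fst p) (snd p)"
  have p: "p \<in> dom ?N" using lev_dom[of "fst p" "snd p"] by simp
  have "hol2 (dom ?N) (\<lambda>p. G (fst p) (snd p) f)"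
    by (rule hol2_cong[OF open_dom Gc_hol2[OF assms]]) (simp add: G_eq[OF assms])
  then show "\<exists>a b. ((\<lambda>p. G (fst p) (snd p) f) has_derivative (\<lambda>h. a * fst h + b * snd h)) (at p)"
    using p unfolding hol2_def by blast
qed

lemma G_integral:
  "R > 0 \<Longrightarrow> f \<in> tf R \<Longrightarrow> Re a > -1 \<Longrightarrow> Re z > 0 \<Longrightarrow> G a z f = gf a z * II a z f"
  using G_eq[of R f a z 0] by (simp add: dom_iff)

lemma G_shift_both:
  assumes "R > 0" "f \<in> tf R"
  shows "G a z f = (-1/4) * (G (a + 2) (z + 2) (lap f) + (a + z + 2) * G (a + 2) (z + 2) (Pop f))"
proof -
  let ?N = "lev a z"
  have d: "(a, z) \<in> dom (Suc ?N)" "(a + 2, z + 2) \<in> dom ?N"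
    using lev_dom[of a z] by (auto simp: dom_iff)
  show ?thesis
    using G_eq[OF assms d(1)] G_eq[OF assms(1) tf_lap[OF assms] d(2)] G_eq[OF assms(1) tf_Pop[OF assms] d(2)]
    by (simp only: Gc.simps)
qed

lemma G_compose_hol2:
  "R > 0 \<Longrightarrow> f \<in> tf R \<Longrightarrow> hol2 D u \<Longrightarrow> hol2 D v \<Longrightarrow> hol2 D (\<lambda>p. G (u p) (v p) f)"
  using hol2_compose2[OF G_hol2, of R f D u v] by simp

text \<open>In contrast to \<open>G_shift_both\<close>, the first term keeps z in place, and its
  coefficient z - a - n vanishes when the exponent of |x| is 0.\<close>

lemma G_shift_first:
  fixes f :: "'b::euclidean_space \<times> real \<Rightarrow> complex"
  assumes R: "R > 0" and f: "f \<in> tf R"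
  shows "G a z f = (-1/2) * ((z - a - dm TYPE('b)) * G (a + 2) z f + (z / 2) * G (a + 2) (z + 2) (Pop f))"
proof -
  have "G (fst (a, z)) (snd (a, z)) f = (-1/2) * ((snd (a, z) - fst (a, z) - dm TYPE('b)) * G (fst (a, z) + 2) (snd (a, z)) f
     + (snd (a, z) / 2) * G (fst (a, z) + 2) (snd (a, z) + 2) (Pop f))"
  proof (rule hol2_identity[OF open_UNIV convex_UNIV G_hol2[OF R f] _ open_nice subset_UNIV nice_nonempty])
    show "hol2 UNIV (\<lambda>p. (-1/2) * ((snd p - fst p - dm TYPE('b)) * G (fst p + 2) (snd p) f
       + (snd p / 2) * G (fst p + 2) (snd p + 2) (Pop f)))"
      by (intro hol2_cmult hol2_add hol2_mult hol2_diff hol2_divide_const G_compose_hol2[OF R] hol2_fst hol2_snd hol2_const f tf_Pop R)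
    fix p assume p: "p \<in> nice (dm TYPE('b))"
    then have d: "(fst p, snd p) \<in> dom 0" "(fst p + 2, snd p) \<in> dom 0" "(fst p + 2, snd p + 2) \<in> dom 0"
      using nice_dom[of 0] by (auto simp: dom_def)
    show "G (fst p) (snd p) f = (-1/2) * ((snd p - fst p - dm TYPE('b)) * G (fst p + 2) (snd p) f
       + (snd p / 2) * G (fst p + 2) (snd p + 2) (Pop f))"
      using Gc_relations_nice(1)[of "fst p" "snd p" f R] p f
      unfolding G_eq[OF R f d(1)] G_eq[OF R f d(2)] G_eq[OF R tf_Pop[OF R f] d(3)] by (simp del: Gc.simps)
  qed auto
  then show ?thesis by simp
qed

section \<open>Values at the poles\<close>

definition Mb :: "'a::euclidean_space \<Rightarrow> real \<Rightarrow> ennreal" where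
  "Mb b a = (\<integral>\<^sup>+x. ennreal (\<bar>x \<bullet> b\<bar> powr a) * indicator (cball 0 1) x \<partial>lborel)"

lemma Mb_scale:
  fixes b :: "'a::euclidean_space"
  assumes t: "t > 0"
  shows "(\<integral>\<^sup>+x. ennreal (\<bar>x \<bullet> b\<bar> powr a) * indicator {x. (norm x)\<^sup>2 \<le> t} x \<partial>lborel)
     = ennreal (t powr ((a + DIM('a)) / 2)) * Mb b a"
proof -
  define c where "c = sqrt t"
  have c: "c > 0" "c\<^sup>2 = t" using t by (auto simp: c_def)
  have [measurable]: "{x::'a. (norm x)\<^sup>2 \<le> t} \<in> sets borel"
    by (intro borel_closed closed_Collect_le continuous_intros)
  have "(\<integral>\<^sup>+x. ennreal (\<bar>x \<bullet> b\<bar> powr a) * indicator {x. (norm x)\<^sup>2 \<le> t} x \<partial>lborel)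
     = (\<integral>\<^sup>+x. ennreal (\<bar>x \<bullet> b\<bar> powr a) * indicator {x. (norm x)\<^sup>2 \<le> t} x \<partial>density (distr lborel borel (\<lambda>x::'a. 0 + c *\<^sub>R x)) (\<lambda>_. \<bar>c\<bar> ^ DIM('a)))"
    using lborel_affine[of c "0::'a"] c by simp
  also have "\<dots> = (\<integral>\<^sup>+x. ennreal (c ^ DIM('a)) * (ennreal (\<bar>(c *\<^sub>R x) \<bullet> b\<bar> powr a) * indicator {x. (norm x)\<^sup>2 \<le> t} (c *\<^sub>R x)) \<partial>lborel)"
    using c by (subst nn_integral_density; simp add: nn_integral_distr)
  also have "\<dots> = (\<integral>\<^sup>+x. ennreal (c ^ DIM('a) * c powr a) * (ennreal (\<bar>x \<bullet> b\<bar> powr a) * indicator (cball 0 1) x) \<partial>lborel)"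
  proof (rule nn_integral_cong)
    fix x :: 'a
    have "(c * norm x)\<^sup>2 \<le> t \<longleftrightarrow> norm x \<le> 1"
      using c abs_le_square_iff[of "c * norm x" c] by simp
    then show "ennreal (c ^ DIM('a)) * (ennreal (\<bar>(c *\<^sub>R x) \<bullet> b\<bar> powr a) * indicator {x. (norm x)\<^sup>2 \<le> t} (c *\<^sub>R x))
      = ennreal (c ^ DIM('a) * c powr a) * (ennreal (\<bar>x \<bullet> b\<bar> powr a) * indicator (cball 0 1) x)"
      using c by (auto simp: indicator_def abs_mult powr_mult ennreal_mult mult.assoc)
  qed
  also have "\<dots> = ennreal (c ^ DIM('a) * c powr a) * Mb b a"
  proof -
    have [measurable]: "cball 0 1 \<in> sets (borel :: 'a measure)" by simp
    show ?thesis unfolding Mb_def by (rule nn_integral_cmult) measurable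
  qed
  also have "c ^ DIM('a) * c powr a = t powr ((a + DIM('a)) / 2)"
  proof -
    have "c ^ DIM('a) * c powr a = c powr (real DIM('a) + a)" using c by (simp add: powr_add powr_realpow)
    also have "\<dots> = (t powr (1/2)) powr (real DIM('a) + a)" using t by (simp add: c_def powr_half_sqrt)
    finally show ?thesis by (simp add: powr_powr add.commute)
  qed
  finally show ?thesis .
qed

text \<open>After exchanging the integrals, a radial factor given as the integral of
  \<open>h\<close> over t >= |x|^2 becomes an integral over balls of squared radius t, each
  evaluated by scaling. It is used for an exponential \<open>h\<close>, which determines
  \<open>Mb\<close>, and for a power, which gives the kernel on the unit ball.\<close>

lemma layer_cake:
  fixes b :: "'a::euclidean_space" and h :: "real \<Rightarrow> ennreal"
  assumes [measurable]: "h \<in> borel_measurable borel"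
  shows "(\<integral>\<^sup>+x. ennreal (\<bar>x \<bullet> b\<bar> powr a) * (\<integral>\<^sup>+t. h t * indicator {(norm x)\<^sup>2..} t * indicator {0<..} t \<partial>lborel) \<partial>lborel)
     = (\<integral>\<^sup>+t. h t * ennreal (t powr ((a + DIM('a)) / 2)) * indicator {0<..} t \<partial>lborel) * Mb b a"
proof -
  have [measurable]: "{p::'a \<times> real. (norm (fst p))\<^sup>2 \<le> snd p} \<in> sets borel"
    by (intro borel_closed closed_Collect_le continuous_intros)
  then have m[measurable]: "{p::'a \<times> real. (norm (fst p))\<^sup>2 \<le> snd p} \<in> sets (lborel \<Otimes>\<^sub>M lborel)"
    unfolding lborel_prod sets_lborel .
  let ?F = "\<lambda>x t. ennreal (\<bar>x \<bullet> b\<bar> powr a) * (h t * indicator {p. (norm (fst p))\<^sup>2 \<le> snd p} (x, t) * indicator {0<..} t)"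
  have "(\<integral>\<^sup>+x. ennreal (\<bar>x \<bullet> b\<bar> powr a) * (\<integral>\<^sup>+t. h t * indicator {(norm x)\<^sup>2..} t * indicator {0<..} t \<partial>lborel) \<partial>lborel)
     = (\<integral>\<^sup>+x. \<integral>\<^sup>+t. ?F x t \<partial>lborel \<partial>lborel)"
    by (intro nn_integral_cong, subst nn_integral_cmult[symmetric]) (auto simp: indicator_def intro!: nn_integral_cong)
  also have "\<dots> = (\<integral>\<^sup>+t. \<integral>\<^sup>+x. ?F x t \<partial>lborel \<partial>lborel)"
    by (rule lborel_pair.Fubini') measurable
  also have "\<dots> = (\<integral>\<^sup>+t. h t * ennreal (t powr ((a + DIM('a)) / 2)) * indicator {0<..} t * Mb b a \<partial>lborel)"
  proof (rule nn_integral_cong)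
    fix t :: real
    show "(\<integral>\<^sup>+x. ?F x t \<partial>lborel) = h t * ennreal (t powr ((a + DIM('a)) / 2)) * indicator {0<..} t * Mb b a"
    proof (cases "t > 0")
      case True
      have [measurable]: "{x::'a. (norm x)\<^sup>2 \<le> t} \<in> sets borel"
        by (intro borel_closed closed_Collect_le continuous_intros)
      have "(\<integral>\<^sup>+x. ?F x t \<partial>lborel) = (\<integral>\<^sup>+x. h t * (ennreal (\<bar>x \<bullet> b\<bar> powr a) * indicator {x. (norm x)\<^sup>2 \<le> t} x) \<partial>lborel)"
        using True by (intro nn_integral_cong) (auto simp: indicator_def mult_ac)
      also have "\<dots> = h t * (\<integral>\<^sup>+x. ennreal (\<bar>x \<bullet> b\<bar> powr a) * indicator {x. (norm x)\<^sup>2 \<le> t} x \<partial>lborel)"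
        by (rule nn_integral_cmult) measurable
      finally show ?thesis using True by (simp add: Mb_scale mult_ac)
    qed simp
  qed
  also have "\<dots> = (\<integral>\<^sup>+t. h t * ennreal (t powr ((a + DIM('a)) / 2)) * indicator {0<..} t \<partial>lborel) * Mb b a"
    by (rule nn_integral_multc) measurable
  finally show ?thesis .
qed

lemma nn_Gamma:
  fixes c :: real
  assumes "c > -1"
  shows "(\<integral>\<^sup>+t. ennreal (exp (- t)) * ennreal (t powr c) * indicator {0<..} t \<partial>lborel) = ennreal (Gamma (c + 1))"
proof -
  define f where "f = (\<lambda>t. if t \<in> {0..} then t powr (c + 1 - 1) / exp t else 0)"
  have "(f has_integral Gamma (c + 1)) UNIV"
    unfolding f_def by (rule iffD2[OF has_integral_restrict_UNIV Gamma_integral_real]) (use assms in simp)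
  then have 1: "(\<integral>\<^sup>+t. ennreal (f t) \<partial>lborel) = ennreal (Gamma (c + 1))"
    by (intro nn_integral_has_integral_lborel) (auto simp: f_def)
  have "(\<integral>\<^sup>+t. ennreal (f t) \<partial>lborel) = (\<integral>\<^sup>+t. ennreal (exp (- t)) * ennreal (t powr c) * indicator {0<..} t \<partial>lborel)"
    by (intro nn_integral_cong) (auto simp: f_def indicator_def exp_minus field_simps ennreal_mult'[symmetric])
  then show ?thesis using 1 by simp
qed

lemma gauss_layer:
  fixes b :: "'a::euclidean_space" and a :: real
  assumes "a \<ge> 0"
  shows "(\<integral>\<^sup>+x. ennreal (\<bar>x \<bullet> b\<bar> powr a) * ennreal (exp (- (norm x)\<^sup>2)) \<partial>lborel) = ennreal (Gamma ((a + DIM('a)) / 2 + 1)) * Mb b a"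
proof -
  have e: "(\<integral>\<^sup>+t. ennreal (exp (- t)) * indicator {r..} t * indicator {0<..} t \<partial>lborel) = ennreal (exp (- r))" if "r \<ge> 0" for r :: real
  proof -
    have "(\<integral>\<^sup>+t. ennreal (exp (- t)) * indicator {r..} t * indicator {0<..} t \<partial>lborel) = (\<integral>\<^sup>+t. ennreal (exp (- t)) * indicator {r..} t \<partial>lborel)"
      using that AE_lborel_singleton[of "0::real"] by (intro nn_integral_cong_AE) (auto elim!: eventually_mono simp: indicator_def)
    also have "\<dots> = ennreal (0 - (- exp (- r)))"
    proof (rule nn_integral_FTC_atLeast)
      show "((\<lambda>x. - exp (- x)) \<longlongrightarrow> 0) (at_top::real filter)"
        using tendsto_minus[OF filterlim_compose[OF exp_at_bot filterlim_uminus_at_bot_at_top]] by simp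
    qed (auto intro!: derivative_eq_intros)
    finally show ?thesis by simp
  qed
  have "(\<integral>\<^sup>+x. ennreal (\<bar>x \<bullet> b\<bar> powr a) * ennreal (exp (- (norm x)\<^sup>2)) \<partial>lborel) =
     (\<integral>\<^sup>+x. ennreal (\<bar>x \<bullet> b\<bar> powr a) * (\<integral>\<^sup>+t. ennreal (exp (- t)) * indicator {(norm x)\<^sup>2..} t * indicator {0<..} t \<partial>lborel) \<partial>lborel)"
    by (simp add: e)
  also have "\<dots> = (\<integral>\<^sup>+t. ennreal (exp (- t)) * ennreal (t powr ((a + DIM('a)) / 2)) * indicator {0<..} t \<partial>lborel) * Mb b a"
    by (rule layer_cake) measurable
  also have "(\<integral>\<^sup>+t. ennreal (exp (- t)) * ennreal (t powr ((a + DIM('a)) / 2)) * indicator {0<..} t \<partial>lborel) = ennreal (Gamma ((a + DIM('a)) / 2 + 1))"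
    by (rule nn_Gamma) (use assms in \<open>auto intro: order.strict_trans2[of _ 0]\<close>)
  finally show ?thesis .
qed

lemma Mb_real:
  fixes a :: real
  assumes "a \<ge> 0" shows "Mb (1::real) a = ennreal (2 / (a + 1))"
proof -
  define f where "f = (\<lambda>t::real. if t \<in> {0..1} then t powr a else 0)"
  have [measurable]: "f \<in> borel_measurable borel" unfolding f_def by measurable
  have "(f has_integral (1 powr (a+1) / (a+1))) UNIV"
    unfolding f_def by (rule iffD2[OF has_integral_restrict_UNIV has_integral_powr_from_0]) (use assms in auto)
  then have 1: "(\<integral>\<^sup>+t. ennreal (f t) \<partial>lborel) = ennreal (1 / (a+1))"
    using nn_integral_has_integral_lborel[of f "1 / (a+1)"] by (auto simp: f_def)
  have 2: "(\<integral>\<^sup>+t. ennreal (f (-t)) \<partial>lborel) = ennreal (1 / (a+1))"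
    using nn_integral_real_affine[of "\<lambda>t. ennreal (f t)" "-1" 0] 1 by simp
  have "Mb (1::real) a = (\<integral>\<^sup>+t. ennreal (f t) + ennreal (f (-t)) \<partial>lborel)"
    unfolding Mb_def using AE_lborel_singleton[of "0::real"]
    by (intro nn_integral_cong_AE) (auto elim!: eventually_mono simp: indicator_def f_def abs_if)
  also have "\<dots> = ennreal (1 / (a+1)) + ennreal (1 / (a+1))"
    using 1 2 by (subst nn_integral_add) auto
  also have "\<dots> = ennreal (2 / (a + 1))" using assms by (simp flip: ennreal_plus add: add_divide_distrib[symmetric])
  finally show ?thesis .
qed

lemma gauss_1d:
  fixes a :: real
  assumes "a \<ge> 0"
  shows "(\<integral>\<^sup>+t. ennreal (\<bar>t\<bar> powr a * exp (- t\<^sup>2)) \<partial>lborel) = ennreal (Gamma ((a + 1) / 2))"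
proof -
  have "(\<integral>\<^sup>+t. ennreal (\<bar>t\<bar> powr a * exp (- t\<^sup>2)) \<partial>lborel) = ennreal (Gamma ((a + 1) / 2 + 1)) * ennreal (2 / (a + 1))"
    using gauss_layer[OF assms, of "1::real"] Mb_real[OF assms] by (simp add: ennreal_mult')
  also have "\<dots> = ennreal (Gamma ((a + 1) / 2 + 1) * (2 / (a + 1)))"
    using assms by (intro ennreal_mult''[symmetric]) auto
  also have "Gamma ((a + 1) / 2 + 1) = ((a + 1) / 2) * Gamma ((a + 1) / 2)"
    using assms Gamma_plus1[of "(a + 1) / 2"] by (force simp: nonpos_Ints_def)
  finally show ?thesis using assms by simp
qed

text \<open>The Gaussian integral is a product over the coordinates: Gamma((a+1)/2) for the last one
  and sqrt(pi) for each tangential one. Dividing by the Gamma factor of \<open>gauss_layer\<close>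
  isolates \<open>Mb\<close>.\<close>

lemma Mb_en:
  fixes a :: real
  assumes a: "a \<ge> 0"
  shows "Mb (en :: 'b::euclidean_space \<times> real) a =
    ennreal (Gamma ((a + 1) / 2) * pi powr (DIM('b) / 2) / Gamma ((a + (DIM('b) + 1)) / 2 + 1))"
proof -
  define ex where "ex = (\<lambda>b::'b \<times> real. if b = en then a else 0)"
  define h where "h = (\<lambda>b t. ennreal (\<bar>t\<bar> powr (ex b) * exp (- t\<^sup>2)))"
  define g where "g = Gamma ((a + DIM('b \<times> real)) / 2 + 1)"
  have g: "g > 0" unfolding g_def using a by (intro Gamma_real_pos) (auto intro: add_nonneg_pos)
  have "ennreal g * Mb (en :: 'b \<times> real) a = (\<integral>\<^sup>+x. ennreal (\<bar>x \<bullet> en\<bar> powr a) * ennreal (exp (- (norm x)\<^sup>2)) \<partial>(lborel :: ('b \<times> real) measure))"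
    unfolding gauss_layer[OF a] g_def ..
  also have "\<dots> = (\<integral>\<^sup>+x. (\<Prod>b\<in>Basis. h b (x \<bullet> b)) \<partial>lborel)"
  proof (rule nn_integral_cong_AE)
    show "AE (x::'b \<times> real) in lborel. ennreal (\<bar>x \<bullet> en\<bar> powr a) * ennreal (exp (- (norm x)\<^sup>2)) = (\<Prod>b\<in>Basis. h b (x \<bullet> b))"
      using AE_coord_nonzero
    proof eventually_elim
      case (elim x)
      have "(\<Prod>b\<in>Basis. h b (x \<bullet> b)) = ennreal ((\<Prod>b\<in>Basis. \<bar>x \<bullet> b\<bar> powr ex b) * (\<Prod>b\<in>Basis. exp (- (x \<bullet> b)\<^sup>2)))"
        unfolding h_def by (subst prod_ennreal) (auto simp: prod.distrib)
      also have "(\<Prod>b\<in>Basis. \<bar>x \<bullet> b\<bar> powr ex b) = \<bar>x \<bullet> en\<bar> powr a"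
      proof -
        have "(\<Prod>b\<in>Basis. \<bar>x \<bullet> b\<bar> powr ex b) = \<bar>x \<bullet> en\<bar> powr ex en * (\<Prod>b\<in>Basis - {en}. \<bar>x \<bullet> b\<bar> powr ex b)"
          by (rule prod.remove) auto
        also have "(\<Prod>b\<in>Basis - {en}. \<bar>x \<bullet> b\<bar> powr ex b) = 1"
          using elim by (intro prod.neutral) (auto simp: ex_def)
        finally show ?thesis by (simp add: ex_def)
      qed
      also have "(\<Prod>b\<in>Basis. exp (- (x \<bullet> b)\<^sup>2)) = exp (- (norm x)\<^sup>2)"
        unfolding power2_norm_eq_inner euclidean_inner[of x x]
        by (simp add: exp_sum[symmetric] sum_negf[symmetric] power2_eq_square)
      finally show ?case by (simp add: ennreal_mult')
    qed
  qed
  also have "\<dots> = (\<Prod>b\<in>(Basis :: ('b \<times> real) set). \<integral>\<^sup>+t. h b t \<partial>lborel)"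
    by (rule nn_integral_lborel_prod) (auto simp: h_def)
  also have "\<dots> = (\<Prod>b\<in>(Basis :: ('b \<times> real) set). ennreal (Gamma ((ex b + 1) / 2)))"
    unfolding h_def using a by (intro prod.cong gauss_1d) (auto simp: ex_def)
  also have "\<dots> = ennreal (\<Prod>b\<in>(Basis :: ('b \<times> real) set). Gamma ((ex b + 1) / 2))"
    using a by (intro prod_ennreal) (auto simp: ex_def intro!: less_imp_le Gamma_real_pos)
  also have "(\<Prod>b\<in>(Basis :: ('b \<times> real) set). Gamma ((ex b + 1) / 2)) = Gamma ((a + 1) / 2) * (\<Prod>b\<in>(Basis :: ('b \<times> real) set) - {en}. Gamma ((ex b + 1) / 2))"
    by (subst prod.remove[OF finite_Basis en_Basis]) (simp add: ex_def)
  also have "(\<Prod>b\<in>(Basis :: ('b \<times> real) set) - {en}. Gamma ((ex b + 1) / 2)) = (\<Prod>b\<in>(Basis :: ('b \<times> real) set) - {en}. sqrt pi)"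
    by (intro prod.cong) (auto simp: ex_def Gamma_one_half_real)
  also have "\<dots> = pi powr (DIM('b) / 2)"
    by (simp add: card_Diff_singleton powr_half_sqrt[symmetric] powr_realpow[symmetric] powr_powr)
  finally have eq: "ennreal g * Mb (en :: 'b \<times> real) a = ennreal (Gamma ((a + 1) / 2) * pi powr (DIM('b) / 2))" .
  have "Mb (en :: 'b \<times> real) a = ennreal (1 / g) * (ennreal g * Mb (en :: 'b \<times> real) a)"
    using g by (simp add: mult.assoc[symmetric] ennreal_mult'[symmetric])
  also have "\<dots> = ennreal (1 / g * (Gamma ((a + 1) / 2) * pi powr (DIM('b) / 2)))"
    unfolding eq using g by (intro ennreal_mult'[symmetric]) auto
  finally show ?thesis by (simp add: g_def algebra_simps)
qed

text \<open>On the punctured unit ball |x|^(-2w) is 1 plus the integral of w t^(-w-1) from |x|^2 to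
  1, so \<open>layer_cake\<close> applies again. The factor 1/z in the result is the simple pole
  that 1 / Gamma(z/2) cancels.\<close>

lemma ball_kernel:
  fixes a z :: real
  assumes a: "a \<ge> 0" and z: "0 < z" "z < 1"
  shows "(\<integral>\<^sup>+(x::'b::euclidean_space \<times> real). ennreal (\<bar>x \<bullet> en\<bar> powr a * norm x powr (z - a - (real DIM('b) + 1))) * indicator (cball 0 1) x \<partial>lborel)
    = ennreal ((a + (real DIM('b) + 1)) / z) * Mb (en :: 'b \<times> real) a"
proof -
  define n where "n = real DIM('b \<times> real)"
  have n: "n = real DIM('b) + 1" by (simp add: n_def)
  \<comment> \<open>Chosen such that z - a - n = -2w.\<close>
  define w where "w = (n + a - z) / 2"
  have w: "w > 0" using a z unfolding w_def n by simp
  define h where "h = (\<lambda>t. ennreal (w * t powr (- w - 1)) * indicator {..1} t)"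
  have [measurable]: "h \<in> borel_measurable borel" unfolding h_def by measurable
  have e: "(\<integral>\<^sup>+t. h t * indicator {r..} t * indicator {0<..} t \<partial>lborel) = ennreal (r powr (- w) - 1)" if r: "0 < r" "r \<le> 1" for r
  proof -
    have "((\<lambda>t. w * t powr (- w - 1)) has_integral (- (1 powr (- w)) - (- (r powr (- w))))) {r..1}"
      using r by (intro fundamental_theorem_of_calculus)
        (auto intro!: derivative_eq_intros simp: has_real_derivative_iff_has_vector_derivative[symmetric])
    then have "((\<lambda>t. if t \<in> {r..1} then w * t powr (- w - 1) else 0) has_integral (r powr (- w) - 1)) UNIV"
      by (intro iffD2[OF has_integral_restrict_UNIV]) simp
    then have "(\<integral>\<^sup>+t. ennreal (if t \<in> {r..1} then w * t powr (- w - 1) else 0) \<partial>lborel) = ennreal (r powr (- w) - 1)"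
      using w by (intro nn_integral_has_integral_lborel) auto
    moreover have "(\<integral>\<^sup>+t. ennreal (if t \<in> {r..1} then w * t powr (- w - 1) else 0) \<partial>lborel) = (\<integral>\<^sup>+t. h t * indicator {r..} t * indicator {0<..} t \<partial>lborel)"
      using r by (intro nn_integral_cong) (auto simp: h_def indicator_def)
    ultimately show ?thesis by simp
  qed
  have [measurable]: "(\<lambda>x::'b \<times> real. (\<integral>\<^sup>+t. h t * indicator {(norm x)\<^sup>2..} t * indicator {0<..} t \<partial>lborel)) \<in> borel_measurable borel"
  proof -
    have [measurable]: "{p::('b \<times> real) \<times> real. (norm (fst p))\<^sup>2 \<le> snd p} \<in> sets borel"
      by (intro borel_closed closed_Collect_le continuous_intros)
    then have m[measurable]: "{p::('b \<times> real) \<times> real. (norm (fst p))\<^sup>2 \<le> snd p} \<in> sets (lborel \<Otimes>\<^sub>M lborel)"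
      unfolding lborel_prod sets_lborel .
    have "(\<lambda>x::'b \<times> real. (\<integral>\<^sup>+t. h t * indicator {p. (norm (fst p))\<^sup>2 \<le> snd p} (x, t) * indicator {0<..} t \<partial>lborel)) \<in> borel_measurable lborel"
      by measurable
    moreover have "indicator {p. (norm (fst p))\<^sup>2 \<le> snd p} (x, t) = (indicator {(norm x)\<^sup>2..} t :: ennreal)" for x :: "'b \<times> real" and t
      by (simp add: indicator_def)
    ultimately show ?thesis by simp
  qed
  have "(\<integral>\<^sup>+(x::'b \<times> real). ennreal (\<bar>x \<bullet> en\<bar> powr a * norm x powr (z - a - (real DIM('b) + 1))) * indicator (cball 0 1) x \<partial>lborel)
    = (\<integral>\<^sup>+(x::'b \<times> real). ennreal (\<bar>x \<bullet> en\<bar> powr a) * indicator (cball 0 1) x +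
        ennreal (\<bar>x \<bullet> en\<bar> powr a) * (\<integral>\<^sup>+t. h t * indicator {(norm x)\<^sup>2..} t * indicator {0<..} t \<partial>lborel) \<partial>lborel)"
  proof (rule nn_integral_cong_AE)
    show "AE (x::'b \<times> real) in lborel. ennreal (\<bar>x \<bullet> en\<bar> powr a * norm x powr (z - a - (real DIM('b) + 1))) * indicator (cball 0 1) x = 
       ennreal (\<bar>x \<bullet> en\<bar> powr a) * indicator (cball 0 1) x + ennreal (\<bar>x \<bullet> en\<bar> powr a) * (\<integral>\<^sup>+t. h t * indicator {(norm x)\<^sup>2..} t * indicator {0<..} t \<partial>lborel)"
      using AE_lborel_singleton[of "0 :: 'b \<times> real"]
    proof eventually_elim
      case (elim x)
      show ?case
      proof (cases "norm x \<le> 1")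
        case True
        have r: "0 < (norm x)\<^sup>2" "(norm x)\<^sup>2 \<le> 1" using elim True by (auto simp: power_le_one)
        have p: "((norm x)\<^sup>2) powr (- w) = norm x powr (z - a - (real DIM('b) + 1))"
        proof -
          have "((norm x)\<^sup>2) powr (- w) = (norm x powr 2) powr (- w)" using elim by (simp add: powr_numeral)
          also have "\<dots> = norm x powr (2 * (- w))" by (rule powr_powr)
          also have "2 * (- w) = z - a - (real DIM('b) + 1)" unfolding w_def n by (simp add: field_simps)
          finally show ?thesis .
        qed
        have ge: "norm x powr (z - a - (real DIM('b) + 1)) \<ge> 1"
        proof -
          have "1 powr (- w) \<le> ((norm x)\<^sup>2) powr (- w)" using r w by (intro powr_mono2') auto
          then show ?thesis by (simp add: p)
        qed
        have "ennreal (\<bar>x \<bullet> en\<bar> powr a) * 1 + ennreal (\<bar>x \<bullet> en\<bar> powr a) * ennreal (norm x powr (z - a - (real DIM('b) + 1)) - 1)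
          = ennreal (\<bar>x \<bullet> en\<bar> powr a) * (ennreal 1 + ennreal (norm x powr (z - a - (real DIM('b) + 1)) - 1))"
          by (simp add: distrib_left)
        also have "ennreal 1 + ennreal (norm x powr (z - a - (real DIM('b) + 1)) - 1) = ennreal (norm x powr (z - a - (real DIM('b) + 1)))"
          using ge by (subst ennreal_plus[symmetric]) auto
        finally show ?thesis using True by (simp add: e[OF r] p ennreal_mult')
      next
        case False
        then have "1 < (norm x)\<^sup>2" by (simp add: one_less_power)
        then have "(\<integral>\<^sup>+t. h t * indicator {(norm x)\<^sup>2..} t * indicator {0<..} t \<partial>lborel) = 0"
          by (subst nn_integral_cong[of _ _ "\<lambda>t. 0"]) (auto simp: h_def indicator_def)
        then show ?thesis using False by simp
      qed
    qed
  qed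
  also have "\<dots> = Mb (en :: 'b \<times> real) a + (\<integral>\<^sup>+t. h t * ennreal (t powr ((a + DIM('b \<times> real)) / 2)) * indicator {0<..} t \<partial>lborel) * Mb (en :: 'b \<times> real) a"
  proof -
    have [measurable]: "cball 0 1 \<in> sets (borel :: ('b \<times> real) measure)" by simp
    have m1: "(\<lambda>x::'b \<times> real. ennreal (\<bar>x \<bullet> en\<bar> powr a) * indicator (cball 0 1) x) \<in> borel_measurable lborel"
      by measurable
    have m2: "(\<lambda>x::'b \<times> real. ennreal (\<bar>x \<bullet> en\<bar> powr a) * (\<integral>\<^sup>+t. h t * indicator {(norm x)\<^sup>2..} t * indicator {0<..} t \<partial>lborel)) \<in> borel_measurable lborel"
      by measurable
    show ?thesis
      unfolding nn_integral_add[OF m1 m2] layer_cake[OF \<open>h \<in> borel_measurable borel\<close>] Mb_def[symmetric] ..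
  qed
  also have "(\<integral>\<^sup>+t. h t * ennreal (t powr ((a + DIM('b \<times> real)) / 2)) * indicator {0<..} t \<partial>lborel) = ennreal (2 * w / z)"
  proof -
    have "((\<lambda>t. w * t powr (z / 2 - 1)) has_integral w * (1 powr (z / 2 - 1 + 1) / (z / 2 - 1 + 1))) {0..1}"
      using z by (intro has_integral_mult_right has_integral_powr_from_0) auto
    then have "((\<lambda>t. if t \<in> {0..1} then w * t powr (z / 2 - 1) else 0) has_integral (2 * w / z)) UNIV"
      by (intro iffD2[OF has_integral_restrict_UNIV]) (simp add: mult.commute)
    then have "(\<integral>\<^sup>+t. ennreal (if t \<in> {0..1} then w * t powr (z / 2 - 1) else 0) \<partial>lborel) = ennreal (2 * w / z)"
      using w by (intro nn_integral_has_integral_lborel) auto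
    moreover have "(\<integral>\<^sup>+t. ennreal (if t \<in> {0..1} then w * t powr (z / 2 - 1) else 0) \<partial>lborel) = 
       (\<integral>\<^sup>+t. h t * ennreal (t powr ((a + DIM('b \<times> real)) / 2)) * indicator {0<..} t \<partial>lborel)"
    proof (intro nn_integral_cong)
      fix t :: real
      have "t powr (- w - 1) * t powr ((a + n) / 2) = t powr (z / 2 - 1)"
      proof -
        have "- w - 1 + (a + n) / 2 = z / 2 - 1" by (simp add: w_def field_simps)
        then show ?thesis by (simp only: powr_add[symmetric])
      qed
      then show "ennreal (if t \<in> {0..1} then w * t powr (z / 2 - 1) else 0) = h t * ennreal (t powr ((a + DIM('b \<times> real)) / 2)) * indicator {0<..} t"
        unfolding n_def[symmetric] using w
        by (cases "t > 0") (auto simp: h_def indicator_def ennreal_mult'[symmetric] mult.assoc)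
    qed
    ultimately show ?thesis by simp
  qed
  also have "Mb (en :: 'b \<times> real) a + ennreal (2 * w / z) * Mb (en :: 'b \<times> real) a = (ennreal 1 + ennreal (2 * w / z)) * Mb (en :: 'b \<times> real) a"
    by (simp add: distrib_right)
  also have "ennreal 1 + ennreal (2 * w / z) = ennreal ((a + (real DIM('b) + 1)) / z)"
    using w z by (subst ennreal_plus[symmetric]) (auto simp: w_def n field_simps)
  finally show ?thesis .
qed

lemma tf_lipschitz:
  fixes f :: "'a::euclidean_space \<Rightarrow> complex"
  assumes f: "f \<in> tf R"
  shows "norm (f x - f y) \<le> (real DIM('a) * sem 1 f) * norm (x - y)"
proof (rule differentiable_bound[of UNIV f "\<lambda>x v. \<Sum>b\<in>Basis. (v \<bullet> b) *\<^sub>R pderiv_dir b f x"])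
  fix x :: 'a
  show "(f has_derivative (\<lambda>v. \<Sum>b\<in>Basis. (v \<bullet> b) *\<^sub>R pderiv_dir b f x)) (at x within UNIV)"
    using smooth_has_derivative[OF tf_smooth_on[OF f], of x] by simp
  show "onorm (\<lambda>v. \<Sum>b\<in>Basis. (v \<bullet> b) *\<^sub>R pderiv_dir b f x) \<le> real DIM('a) * sem 1 f"
  proof (rule onorm_le)
    fix v :: 'a
    have "norm (\<Sum>b\<in>Basis. (v \<bullet> b) *\<^sub>R pderiv_dir b f x) \<le> (\<Sum>b\<in>(Basis::'a set). norm v * sem 1 f)"
    proof (rule sum_norm_le)
      fix b :: 'a assume b: "b \<in> Basis"
      show "norm ((v \<bullet> b) *\<^sub>R pderiv_dir b f x) \<le> norm v * sem 1 f"
        using Basis_le_norm[OF b, of v] pderivs_le_sem[OF f, of "[b]" 1 x] b by (auto intro!: mult_mono)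
    qed
    then show "norm (\<Sum>b\<in>Basis. (v \<bullet> b) *\<^sub>R pderiv_dir b f x) \<le> real DIM('a) * sem 1 f * norm v"
      by (simp add: ac_simps)
  qed
qed auto

lemma Ker_of_real:
  fixes x :: "'b::euclidean_space \<times> real"
  shows "Ker (of_real a) (of_real z) x = of_real (\<bar>x \<bullet> en\<bar> powr a * norm x powr (z - a - (real DIM('b) + 1)))"
proof -
  have "of_real z - of_real a - dm TYPE('b) = complex_of_real (z - a - (real DIM('b) + 1))" by simp
  then show ?thesis unfolding Ker_def AP_def W_def
    by (simp add: powr_of_real inner_prod_def del: of_real_diff of_real_add)
qed

text \<open>Subtract f(0) times the indicator of the unit ball. The difference is O(|x|), so its
  integral stays bounded as z tends to 0 and is killed by the zero of 1 / Gamma(z/2); the subtracted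
  part is the explicit pole of \<open>ball_kernel\<close>.\<close>

lemma G_at_zero_real:
  fixes f :: "'b::euclidean_space \<times> real \<Rightarrow> complex" and a :: real
  assumes a: "a > 0" and R: "R > 0" and f: "f \<in> tf R"
  shows "G (of_real a) 0 f = of_real (pi powr (real DIM('b) / 2)) * rGamma ((of_real a + dm TYPE('b)) / 2) * f 0"
proof -
  define n where "n = real DIM('b) + 1"
  define m where "m = Gamma ((a + 1) / 2) * pi powr (DIM('b) / 2) / Gamma ((a + n) / 2 + 1)"
  have n: "n > 0" by (simp add: n_def)
  have "(a + n) / 2 + 1 > 0" "(a + 1) / 2 > 0" using a n by (auto intro: add_pos_pos divide_pos_pos)
  then have m0: "m \<ge> 0" unfolding m_def by (intro divide_nonneg_pos mult_nonneg_nonneg less_imp_le[OF Gamma_real_pos] Gamma_real_pos) auto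
  have M: "Mb (en :: 'b \<times> real) a = ennreal m" using Mb_en[of a, where 'b='b] a by (simp add: m_def n_def add.commute)
  define g where "g = (\<lambda>z (x::'b \<times> real). \<bar>x \<bullet> en\<bar> powr a * norm x powr (z - a - n) * indicator (cball 0 1) x)"
  have J: "has_bochner_integral lborel (g z) ((a + n) / z * m)" if z: "0 < z" "z < 1" for z
  proof (rule has_bochner_integral_nn_integral)
    have [measurable]: "cball 0 1 \<in> sets (borel :: ('b \<times> real) measure)" by simp
    show "g z \<in> borel_measurable lborel" unfolding g_def by measurable
    have "(\<integral>\<^sup>+x. ennreal (g z x) \<partial>lborel) = (\<integral>\<^sup>+(x::'b \<times> real). ennreal (\<bar>x \<bullet> en\<bar> powr a * norm x powr (z - a - (real DIM('b) + 1))) * indicator (cball 0 1) x \<partial>lborel)"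
      by (intro nn_integral_cong) (auto simp: g_def n_def indicator_def)
    also have "\<dots> = ennreal ((a + n) / z * m)"
      unfolding ball_kernel[OF less_imp_le[OF a] z] M n_def using m0 by (rule ennreal_mult''[symmetric])
    finally show "(\<integral>\<^sup>+x. ennreal (g z x) \<partial>lborel) = ennreal ((a + n) / z * m)" .
  qed (use a z n m0 in \<open>auto simp: g_def\<close>)
  \<comment> \<open>The ball has to contain the support of \<open>f\<close> and the unit ball of the
    subtracted term; R' >= 1 also gives |x|^z <= R' on it for 0 < z < 1.\<close>
  define R' where "R' = max R 1"
  have R': "R' \<ge> 1" "R' > 0" "R \<le> R'" by (auto simp: R'_def)
  define C where "C = real DIM('b \<times> real) * sem 1 f + sem 0 f"
  have C: "C \<ge> 0" unfolding C_def using sem_nonneg[OF f] by (intro add_nonneg_nonneg mult_nonneg_nonneg) auto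
  have fC: "norm (f x - f 0 * indicator (cball 0 1) x) \<le> C * norm x" for x
  proof (cases "norm x \<le> 1")
    case True
    have "norm (f x - f 0) \<le> (real DIM('b \<times> real) * sem 1 f) * norm (x - 0)" by (rule tf_lipschitz[OF f])
    also have "\<dots> \<le> C * norm x" unfolding C_def using sem_nonneg[OF f, of 0] by (simp add: distrib_right)
    finally show ?thesis using True by simp
  next
    case False
    have "norm (f x) \<le> sem 0 f * 1" using pderivs_le_sem[OF f, of "[]" 0 x] by simp
    also have "\<dots> \<le> C * norm x" using False sem_nonneg[OF f] unfolding C_def by (intro mult_mono) auto
    finally show ?thesis using False by simp
  qed
  have [measurable]: "f \<in> borel_measurable borel" by (rule tf_measurable[OF f])
  define B where "B = (\<integral>(x::'b \<times> real). indicator (cball 0 R') x * (\<bar>snd x\<bar> powr a * norm x powr (1 - a - (real DIM('b) + 1))) \<partial>lborel) * (R' * C)"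
  have err: "norm (II (of_real a) (of_real z) f - f 0 * of_real ((a + n) / z * m)) \<le> B" if z: "0 < z" "z < 1" for z
  proof -
    \<comment> \<open>A factor |x| / R' is moved from the difference to the kernel: \<open>h\<close>
      stays bounded, and \<open>k\<close> is bounded, uniformly in z, by the integrable weight with
      \<beta> = 1.\<close>
    define k where "k = (\<lambda>x::'b \<times> real. Ker (of_real a) (of_real z) x * of_real (norm x / R'))"
    define h where "h = (\<lambda>x. of_real (R' / norm x) * (f x - f 0 * indicator (cball 0 1) x))"
    have gK: "of_real (g z x) = Ker (of_real a) (of_real z) x * indicator (cball 0 1) x" for x
      by (simp add: g_def Ker_of_real n_def indicator_def)
    have kh: "k x * h x = Ker (of_real a) (of_real z) x * f x - f 0 * of_real (g z x)" for x
      unfolding gK using R'(2) by (cases "x = 0") (simp_all add: k_def h_def Ker_def field_simps)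
    have [measurable]: "cball 0 1 \<in> sets (borel :: ('b \<times> real) measure)" by simp
    have B': "norm (\<integral>x. k x * h x \<partial>lborel) \<le> B"
      unfolding B_def
    proof (rule kernel_bounded_integrable(2))
      show "k \<in> borel_measurable borel" unfolding k_def by measurable
      show "h \<in> borel_measurable borel" unfolding h_def by measurable
      fix x :: "'b \<times> real"
      show "norm (h x) \<le> R' * C"
      proof (cases "x = 0")
        case False
        have "norm (h x) = R' / norm x * norm (f x - f 0 * indicator (cball 0 1) x)"
          using R'(2) by (simp add: h_def norm_mult norm_divide)
        also have "\<dots> \<le> R' / norm x * (C * norm x)" using R'(2) by (intro mult_left_mono fC) auto
        finally show ?thesis using False by simp
      qed (use C R' in \<open>simp add: h_def\<close>)
      show "h x = 0" if "norm x > R'"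
        using that R' tf_zero[OF f, of x] by (simp add: h_def)
      assume x: "norm x \<le> R'"
      show "norm (k x) \<le> \<bar>snd x\<bar> powr a * norm x powr (1 - a - (real DIM('b) + 1))"
      proof (cases "x = 0")
        case False
        have "norm x powr z \<le> R' powr 1"
          using order_trans[OF powr_mono2[of z "norm x" R'] powr_mono[of z 1 R']] x z R' by simp
        then have le: "norm x powr z / R' \<le> 1" using R' by simp
        have "norm (k x) = \<bar>snd x\<bar> powr a * (norm x powr (z - a - (real DIM('b) + 1)) * norm x powr 1) / R'"
          using R'(2) by (simp add: k_def norm_mult norm_Ker norm_divide)
        also have "norm x powr (z - a - (real DIM('b) + 1)) * norm x powr 1 = norm x powr (1 - a - (real DIM('b) + 1)) * norm x powr z"
          by (simp only: powr_add[symmetric]) (simp add: algebra_simps)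
        also have "\<bar>snd x\<bar> powr a * (norm x powr (1 - a - (real DIM('b) + 1)) * norm x powr z) / R' = 
           (\<bar>snd x\<bar> powr a * norm x powr (1 - a - (real DIM('b) + 1))) * (norm x powr z / R')" by simp
        also have "\<dots> \<le> (\<bar>snd x\<bar> powr a * norm x powr (1 - a - (real DIM('b) + 1))) * 1"
          by (rule mult_left_mono[OF le]) simp
        finally show ?thesis by simp
      qed (simp add: k_def)
    qed (use a R' in auto)
    have "(\<integral>x. k x * h x \<partial>lborel) = II (of_real a) (of_real z) f - f 0 * (\<integral>x. of_real (g z x) \<partial>lborel)"
      unfolding kh II_def
    proof -
      have i: "integrable lborel (\<lambda>x. f 0 * complex_of_real (g z x))"
        using J[OF z] by (intro integrable_mult_right integrable_of_real) (simp add: has_bochner_integral_iff)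
      have "integrable lborel (\<lambda>x. Ker (of_real a) (of_real z) x * f x)"
        using a z by (intro Ker_integrable[OF _ _ R f]) auto
      from Bochner_Integration.integral_diff[OF this i] show "(\<integral>x. Ker (of_real a) (of_real z) x * f x - f 0 * complex_of_real (g z x) \<partial>lborel) =
         (\<integral>x. Ker (of_real a) (of_real z) x * f x \<partial>lborel) - f 0 * (\<integral>x. complex_of_real (g z x) \<partial>lborel)"
        by simp
    qed
    also have "(\<integral>x. complex_of_real (g z x) \<partial>lborel) = of_real ((a + n) / z * m)"
      using J[OF z] by (simp add: has_bochner_integral_iff)
    finally show ?thesis using B' by simp
  qed
  define z where "z = (\<lambda>k. 1 / real (k + 2))"
  have z: "0 < z k" "z k < 1" for k by (auto simp: z_def)
  have zl: "z \<longlonglongrightarrow> 0" unfolding z_def using LIMSEQ_ignore_initial_segment[OF lim_1_over_n, of 2] by simp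
  define er where "er = (\<lambda>k. II (of_real a) (of_real (z k)) f - f 0 * of_real ((a + n) / z k * m))"
  have erb: "norm (er k) \<le> B" for k unfolding er_def by (rule err[OF z])
  have Gz: "G (of_real a) (of_real (z k)) f = rGamma ((of_real a + 1) / 2) * rGamma ((of_real (z k) + 2) / 2) * (f 0 * of_real ((a + n) * m / 2) + of_real (z k) / 2 * er k)" for k
  proof -
    have "of_real (z k) * II (of_real a) (of_real (z k)) f = f 0 * of_real ((a + n) * m) + of_real (z k) * er k"
      unfolding er_def using z(1)[of k] by (simp add: field_simps)
    then have II: "of_real (z k) / 2 * II (of_real a) (of_real (z k)) f = f 0 * of_real ((a + n) * m / 2) + of_real (z k) / 2 * er k"
      by (simp add: field_simps)
    have "G (of_real a) (of_real (z k)) f = gf (of_real a) (of_real (z k)) * II (of_real a) (of_real (z k)) f"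
      using a z by (intro G_integral[OF R f]) auto
    also have "\<dots> = rGamma ((of_real a + 1) / 2) * rGamma ((of_real (z k) + 2) / 2) * (of_real (z k) / 2 * II (of_real a) (of_real (z k)) f)"
      unfolding gf_def rGamma_shift[of "of_real (z k)"] by simp
    finally show ?thesis unfolding II .
  qed
  have lz: "(\<lambda>k. complex_of_real (z k)) \<longlonglongrightarrow> 0" using tendsto_of_real[OF zl, where 'a=complex] by simp
  have l1: "(\<lambda>k. rGamma ((complex_of_real (z k) + 2) / 2)) \<longlonglongrightarrow> rGamma ((0 + 2) / 2)"
  proof -
    have "isCont rGamma ((0 + 2) / 2 :: complex)"
      using holomorphic_on_imp_continuous_on[OF holomorphic_rGamma[of UNIV]] by (simp add: continuous_on_eq_continuous_at)
    moreover have "(\<lambda>k. (complex_of_real (z k) + 2) / 2) \<longlonglongrightarrow> (0 + 2) / 2"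
      by (intro tendsto_divide tendsto_add lz tendsto_const) auto
    ultimately show ?thesis by (rule isCont_tendsto_compose)
  qed
  have l2: "(\<lambda>k. complex_of_real (z k) / 2 * er k) \<longlonglongrightarrow> 0"
  proof (rule Lim_null_comparison)
    show "\<forall>\<^sub>F k in sequentially. norm (complex_of_real (z k) / 2 * er k) \<le> z k / 2 * B"
    proof (intro always_eventually allI)
      fix k
      have "norm (complex_of_real (z k) / 2 * er k) = z k / 2 * norm (er k)" using z(1)[of k] by (simp add: norm_mult norm_divide)
      also have "\<dots> \<le> z k / 2 * B" using z(1)[of k] by (intro mult_left_mono erb) auto
      finally show "norm (complex_of_real (z k) / 2 * er k) \<le> z k / 2 * B" .
    qed
    show "(\<lambda>k. z k / 2 * B) \<longlonglongrightarrow> 0" using tendsto_mult[OF tendsto_divide[OF zl tendsto_const[of "2::real"]] tendsto_const[of B]] by simp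
  qed
  have "(\<lambda>k. G (of_real a) (of_real (z k)) f) \<longlonglongrightarrow> rGamma ((of_real a + 1) / 2) * rGamma ((0 + 2) / 2) * (f 0 * of_real ((a + n) * m / 2) + 0)"
    unfolding Gz by (rule tendsto_mult[OF tendsto_mult[OF tendsto_const l1] tendsto_add[OF tendsto_const l2]])
  moreover have "(\<lambda>k. G (of_real a) (of_real (z k)) f) \<longlonglongrightarrow> G (of_real a) 0 f"
  proof -
    have "(\<lambda>w. G (of_real a) w f) holomorphic_on UNIV"
      using hol2_slice[OF G_hol2[OF R f] open_UNIV, of "\<lambda>w. of_real a" "\<lambda>w. w"] by (simp add: holomorphic_on_ident)
    from holomorphic_on_imp_continuous_on[OF this] have "isCont (\<lambda>w. G (of_real a) w f) 0"
      by (simp add: continuous_on_eq_continuous_at)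
    from isCont_tendsto_compose[OF this lz] show ?thesis .
  qed
  ultimately have "G (of_real a) 0 f = rGamma ((of_real a + 1) / 2) * rGamma ((0 + 2) / 2) * (f 0 * of_real ((a + n) * m / 2) + 0)"
    using LIMSEQ_unique by blast
  then have "G (of_real a) 0 f = rGamma ((of_real a + 1) / 2) * (f 0 * of_real ((a + n) * m / 2))"
    by (simp add: rGamma_inverse_Gamma)
  also have "of_real ((a + n) * m / 2) = complex_of_real (Gamma ((a + 1) / 2)) * of_real (pi powr (DIM('b) / 2)) * of_real (rGamma ((a + n) / 2))"
  proof -
    have "Gamma ((a + n) / 2 + 1) = (a + n) / 2 * Gamma ((a + n) / 2)"
      using a n by (intro Gamma_plus1) (auto simp: nonpos_Ints_def)
    then have "(a + n) * m / 2 = Gamma ((a + 1) / 2) * pi powr (DIM('b) / 2) * rGamma ((a + n) / 2)"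
      using a n by (simp add: m_def rGamma_inverse_Gamma divide_simps)
    then show ?thesis by simp
  qed
  also have "complex_of_real (rGamma ((a + n) / 2)) = rGamma ((of_real a + dm TYPE('b)) / 2)"
    by (simp add: n_def rGamma_complex_of_real[symmetric] add.commute)
  also have "rGamma ((of_real a + 1) / 2) * (f 0 * (complex_of_real (Gamma ((a + 1) / 2)) * of_real (pi powr (DIM('b) / 2)) * rGamma ((of_real a + dm TYPE('b)) / 2)))
     = (rGamma ((of_real a + 1) / 2) * Gamma ((of_real a + 1) / 2)) * (of_real (pi powr (real DIM('b) / 2)) * rGamma ((of_real a + dm TYPE('b)) / 2) * f 0)"
    by (simp add: Gamma_complex_of_real[symmetric])
  also have "rGamma ((of_real a + 1) / 2) * Gamma ((complex_of_real a + 1) / 2) = 1"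
  proof -
    have "(complex_of_real a + 1) / 2 = of_real ((a + 1) / 2)" by simp
    then have "Gamma ((complex_of_real a + 1) / 2) = of_real (Gamma ((a + 1) / 2))"
      by (simp only: Gamma_complex_of_real)
    moreover have "Gamma ((a + 1) / 2) > 0" using a by (intro Gamma_real_pos) auto
    ultimately show ?thesis by (simp add: rGamma_inverse_Gamma)
  qed
  finally show ?thesis by simp
qed

text \<open>Both sides are entire in \<open>a\<close> and agree on the positive reals, which
  accumulate at 1.\<close>

lemma G_at_zero:
  fixes f :: "'b::euclidean_space \<times> real \<Rightarrow> complex"
  assumes R: "R > 0" and f: "f \<in> tf R"
  shows "G a 0 f = of_real (pi powr (real DIM('b) / 2)) * rGamma ((a + dm TYPE('b)) / 2) * f 0"
proof -
  let ?F = "\<lambda>a. G a 0 f - of_real (pi powr (real DIM('b) / 2)) * rGamma ((a + dm TYPE('b)) / 2) * f 0"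
  have "?F a = 0"
  proof (rule analytic_continuation[of ?F UNIV "complex_of_real ` {0<..}" 1])
    have "(\<lambda>a. G a 0 f) holomorphic_on UNIV"
      using hol2_slice[OF G_hol2[OF R f] open_UNIV, of "\<lambda>a. a" "\<lambda>a. 0"] by (simp add: holomorphic_on_ident)
    then show "?F holomorphic_on UNIV"
      by (auto intro!: holomorphic_intros holomorphic_on_compose_gen[OF _ holomorphic_rGamma, unfolded o_def])
    have "(\<lambda>k. complex_of_real (1 + 1 / real (Suc k))) \<longlonglongrightarrow> of_real (1 + 0)"
      by (intro tendsto_of_real tendsto_add tendsto_const LIMSEQ_Suc[OF lim_1_over_n])
    then have A: "(\<lambda>k. complex_of_real (1 + 1 / real (Suc k))) \<longlonglongrightarrow> 1" by (simp only: add_0_right of_real_1)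
    have B: "complex_of_real (1 + 1 / real (Suc k)) \<in> complex_of_real ` {0<..} - {1}" for k
    proof -
      have "0 < 1 + 1 / real (Suc k)" "1 + 1 / real (Suc k) \<noteq> 1" by (simp_all add: add_pos_pos)
      then show ?thesis using of_real_eq_1_iff[where 'a=complex, of "1 + 1 / real (Suc k)"] by blast
    qed
    show "1 islimpt complex_of_real ` {0<..}"
      unfolding islimpt_sequential
      by (rule exI[of _ "\<lambda>k. complex_of_real (1 + 1 / real (Suc k))"], rule conjI, rule allI, rule B, rule A)
  qed (use G_at_zero_real[OF _ R f] in auto)
  then show ?thesis by simp
qed

section \<open>Derivatives at the origin: the values at z = -2l\<close>

abbreviation Dn :: "nat \<Rightarrow> ('b::euclidean_space \<times> real \<Rightarrow> complex) \<Rightarrow> 'b \<times> real \<Rightarrow> complex" where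
  "Dn m f \<equiv> pderivs (replicate m en) f"

definition lapp :: "('b::euclidean_space \<times> real \<Rightarrow> complex) \<Rightarrow> 'b \<times> real \<Rightarrow> complex" where
  "lapp f x = (\<Sum>i\<in>Basis. pderiv_dir (i, 0) (pderiv_dir (i, 0) f) x)"

lemma pair_Basis [simp]: "i \<in> Basis \<Longrightarrow> (i, 0) \<in> Basis"
  by (simp add: Basis_prod_def)

lemma set_Dn [simp]: "set (replicate m (en :: 'b::euclidean_space \<times> real)) \<subseteq> Basis"
  by (auto dest: in_set_replicate[THEN iffD1])

lemma Dn_add: "Dn m (Dn k f) = Dn (m + k) f"
  by (simp add: replicate_add pderivs_append)

lemma Dn_Suc: "Dn (Suc m) f = Dn m (pderiv_dir en f)"
  using Dn_add[of m 1 f] by simp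

lemma lap_eq:
  fixes x :: "'b::euclidean_space \<times> real"
  shows "lap f x = lapp f x + pderiv_dir en (pderiv_dir en f) x"
proof -
  have "(Basis :: ('b \<times> real) set) = (\<lambda>i. (i, 0)) ` Basis \<union> {en}" by (simp add: Basis_prod_def)
  moreover have "(\<Sum>b\<in>(\<lambda>i::'b. (i, 0::real)) ` Basis \<union> {en}. pderiv_dir b (pderiv_dir b f) x) =
      (\<Sum>b\<in>(\<lambda>i::'b. (i, 0::real)) ` Basis. pderiv_dir b (pderiv_dir b f) x) + pderiv_dir en (pderiv_dir en f) x"
    by (subst sum.union_disjoint) auto
  moreover have "(\<Sum>b\<in>(\<lambda>i::'b. (i, 0::real)) ` Basis. pderiv_dir b (pderiv_dir b f) x) = lapp f x"
    unfolding lapp_def by (subst sum.reindex) (auto simp: inj_on_def)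
  ultimately show ?thesis unfolding lap_def by simp
qed

lemma smooth_pderivs: "smooth f \<Longrightarrow> set vs \<subseteq> Basis \<Longrightarrow> smooth (pderivs vs f)"
  by (simp add: smooth_iff smooth_on_pderivs)

lemma smooth_sum: "finite I \<Longrightarrow> (\<And>i. i \<in> I \<Longrightarrow> smooth (f i)) \<Longrightarrow> smooth (\<lambda>x. \<Sum>i\<in>I. f i x)"
  by (simp add: smooth_iff smooth_on_sum)

lemma smooth_cmult: "smooth f \<Longrightarrow> smooth (\<lambda>x. c * f x)"
  by (simp add: smooth_iff smooth_on_mult)

lemma smooth_lapp: "smooth f \<Longrightarrow> smooth (lapp f)"
  unfolding lapp_def[abs_def] by (intro smooth_sum smooth_pderiv) auto

lemma smooth_lappn: "smooth f \<Longrightarrow> smooth ((lapp ^^ j) f)"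
  by (induction j) (auto intro: smooth_lapp)

lemma pderivs_sum':
  "finite I \<Longrightarrow> (\<And>i. i \<in> I \<Longrightarrow> smooth (f i)) \<Longrightarrow> set vs \<subseteq> Basis \<Longrightarrow>
    pderivs vs (\<lambda>x. \<Sum>i\<in>I. f i x) = (\<lambda>x. \<Sum>i\<in>I. pderivs vs (f i) x)"
  by (rule ext) (rule pderivs_sum[of UNIV], auto simp: smooth_iff)

lemma pderiv_dir_pderivs_commute:
  "smooth f \<Longrightarrow> v \<in> Basis \<Longrightarrow> set vs \<subseteq> Basis \<Longrightarrow> pderiv_dir v (pderivs vs f) = pderivs vs (pderiv_dir v f)"
proof (induction vs)
  case (Cons w vs)
  then have "pderiv_dir v (pderiv_dir w (pderivs vs f)) = pderiv_dir w (pderiv_dir v (pderivs vs f))"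
    by (intro pderiv_dir_commute smooth_pderivs) auto
  then show ?case using Cons by simp
qed simp

lemma pderivs_lapp:
  assumes f: "smooth f" and vs: "set vs \<subseteq> Basis"
  shows "pderivs vs (lapp f) = lapp (pderivs vs f)"
proof
  fix x
  have "pderivs vs (lapp f) x = (\<Sum>i\<in>Basis. pderivs vs (pderiv_dir (i, 0) (pderiv_dir (i, 0) f)) x)"
    unfolding lapp_def[abs_def] using f vs by (subst pderivs_sum') (auto intro!: smooth_pderiv)
  also have "\<dots> = lapp (pderivs vs f) x"
    unfolding lapp_def using f vs
    by (intro sum.cong) (auto simp: pderiv_dir_pderivs_commute smooth_pderiv)
  finally show "pderivs vs (lapp f) x = lapp (pderivs vs f) x" .
qed

lemma pderivs_lappn:
  "smooth f \<Longrightarrow> set vs \<subseteq> Basis \<Longrightarrow> pderivs vs ((lapp ^^ j) f) = (lapp ^^ j) (pderivs vs f)"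
  by (induction j) (auto simp: pderivs_lapp smooth_lappn)

lemma lappn_pderiv: "smooth f \<Longrightarrow> v \<in> Basis \<Longrightarrow> (lapp ^^ j) (pderiv_dir v f) = pderiv_dir v ((lapp ^^ j) f)"
  using pderivs_lappn[of f "[v]"] by simp

lemma pderiv_dir_cmult: "smooth f \<Longrightarrow> pderiv_dir v (\<lambda>x. c * f x) = (\<lambda>x. c * pderiv_dir v f x)"
  by (rule ext, subst pderiv_dir_mult) (auto simp: smooth_iff intro: smooth_on_differentiable)

lemma pderivs_cmult': "smooth f \<Longrightarrow> set vs \<subseteq> Basis \<Longrightarrow> pderivs vs (\<lambda>x. c * f x) = (\<lambda>x. c * pderivs vs f x)"
  by (rule ext, rule pderivs_cmult[of UNIV]) (auto simp: smooth_iff)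

lemma lapp_cmult: "smooth f \<Longrightarrow> lapp (\<lambda>x. c * f x) = (\<lambda>x. c * lapp f x)"
  unfolding lapp_def by (simp add: pderiv_dir_cmult smooth_pderiv sum_distrib_left)

lemma lappn_cmult: "smooth f \<Longrightarrow> (lapp ^^ j) (\<lambda>x. c * f x) = (\<lambda>x. c * (lapp ^^ j) f x)"
  by (induction j) (auto simp: lapp_cmult smooth_lappn)

lemma Dn_avg: "smooth f \<Longrightarrow> Dn m (avg k f) = avg (k + m) (Dn m f)"
  by (induction m) (auto simp: pderiv_dir_avg smooth_pderivs)

lemma lapp_avg:
  assumes f: "smooth f" shows "lapp (avg k f) = avg k (lapp f)"
proof
  fix x :: "'a \<times> real"
  have "lapp (avg k f) x = (\<Sum>i\<in>Basis. avg k (pderiv_dir (i, 0) (pderiv_dir (i, 0) f)) x)"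
    unfolding lapp_def using f by (intro sum.cong) (auto simp: pderiv_dir_avg smooth_pderiv)
  also have "\<dots> = avg k (lapp f) x"
    unfolding avg_def lapp_def sum_distrib_left using f
    by (intro Henstock_Kurzweil_Integration.integral_sum[symmetric] avg_integrable smooth_pderiv) auto
  finally show "lapp (avg k f) x = avg k (lapp f) x" .
qed

lemma lappn_avg: "smooth f \<Longrightarrow> (lapp ^^ j) (avg k f) = avg k ((lapp ^^ j) f)"
  by (induction j) (auto simp: lapp_avg smooth_lappn)

lemma avg_hyperplane:
  assumes "snd x = 0" shows "avg (2 * m) f x = 2 / of_nat (2 * m + 1) * f x"
proof -
  have x: "sc t x = x" for t using assms by (simp add: sc_def prod_eq_iff)
  have "((\<lambda>t. t ^ (2 * m)) has_integral (1 ^ (2 * m + 1) / (2 * m + 1) - (-1) ^ (2 * m + 1) / (2 * m + 1))) {-1..1::real}"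
  proof (rule fundamental_theorem_of_calculus)
    fix t :: real
    show "((\<lambda>t. t ^ (2 * m + 1) / real (2 * m + 1)) has_vector_derivative t ^ (2 * m)) (at t within {-1..1})"
      unfolding has_real_derivative_iff_has_vector_derivative[symmetric]
      by (rule derivative_eq_intros refl | simp del: of_nat_add of_nat_mult of_nat_Suc)+
  qed simp
  then have "((\<lambda>t. complex_of_real (t ^ (2 * m))) has_integral of_real (1 ^ (2 * m + 1) / (2 * m + 1) - (-1) ^ (2 * m + 1) / (2 * m + 1))) {-1..1::real}"
    by (rule has_integral_of_real)
  from has_integral_mult_left[OF this, of "f x"]
  have "((\<lambda>t. complex_of_real (t ^ (2 * m)) * f x) has_integral (2 / of_nat (2 * m + 1)) * f x) {-1..1::real}"
    by (simp add: add_divide_distrib[symmetric])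
  then show ?thesis unfolding avg_def x by (rule integral_unique)
qed

text \<open>On the hyperplane, dividing the odd part by x_n shifts the Taylor coefficients in x_n;
  the average of t^(2m) supplies the factor 1 / (2m+1). Tangential derivatives commute with the
  average.\<close>

lemma lappn_Qop:
  assumes f: "smooth f" and x: "snd x = 0"
  shows "(lapp ^^ j) (Dn (2 * m) (Qop f)) x = (lapp ^^ j) (Dn (2 * m + 1) f) x / of_nat (2 * m + 1)"
proof -
  note f' = smooth_pderiv[OF f en_Basis]
  have Q: "Qop f = (\<lambda>x. (1/2) * avg 0 (pderiv_dir en f) x)" by (simp add: Qop_def[abs_def])
  have "(lapp ^^ j) (Dn (2 * m) (Qop f)) x = (1/2) * (lapp ^^ j) (Dn (2 * m) (avg 0 (pderiv_dir en f))) x"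
    unfolding Q pderivs_cmult'[OF smooth_avg[OF f'] set_Dn] lappn_cmult[OF smooth_pderivs[OF smooth_avg[OF f'] set_Dn]] ..
  also have "\<dots> = (1/2) * avg (2 * m) ((lapp ^^ j) (Dn (2 * m) (pderiv_dir en f))) x"
    unfolding Dn_avg[OF f'] lappn_avg[OF smooth_pderivs[OF f' set_Dn]] by simp
  also have "\<dots> = (lapp ^^ j) (Dn (2 * m) (pderiv_dir en f)) x / of_nat (2 * m + 1)"
    by (subst avg_hyperplane[OF x]) simp
  finally show ?thesis using Dn_Suc[of "2 * m" f] by simp
qed

lemma lappn_Pop:
  assumes f: "smooth f" and x: "snd x = 0"
  shows "(lapp ^^ j) (Dn (2 * m) (Pop f)) x = (lapp ^^ j) (Dn (2 * m + 2) f) x / of_nat (2 * m + 1)"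
  unfolding Pop_def using lappn_Qop[OF smooth_pderiv[OF f en_Basis] x, of j m] Dn_Suc[of "2 * m + 1" f] by simp

lemma cop_lapp: "cop lapp"
  unfolding lapp_def[abs_def] by (intro cop_sum cop_comp[OF cop_pderiv cop_pderiv]) auto

lemma cop_lappn: "cop (\<lambda>f. (lapp ^^ j) f)"
  by (induction j) (auto intro: cop_id cop_comp[OF cop_lapp])

lemma cfn_lappn_Dn: "cfn (\<lambda>f. (lapp ^^ j) (Dn m f) x)"
  using cfn_comp[OF cfn_eval cop_comp[OF cop_lappn cop_pderivs[OF set_Dn]]] .

text \<open>With m = l - j these are the coefficients in the e_n-sum of the family C, where y stands
  for nu + 1/2 - l.\<close>

definition bco :: "nat \<Rightarrow> nat \<Rightarrow> complex \<Rightarrow> complex" where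
  "bco l m y = 4 ^ m * pochhammer y m / (fact (l - m) * fact (2 * m))"

definition Tl :: "nat \<Rightarrow> complex \<Rightarrow> ('b::euclidean_space \<times> real \<Rightarrow> complex) \<Rightarrow> complex" where
  "Tl l y f = (\<Sum>m\<le>l. bco l m y * (lapp ^^ (l - m)) (Dn (2 * m) f) 0)"

lemma cfn_Tl: "cfn (Tl l y)"
  unfolding Tl_def[abs_def] by (intro cfn_sum_fun cfn_scale cfn_lappn_Dn)

text \<open>The coefficient comparison behind \<open>Tl_rec\<close>. The tangential Laplacian gives
  the first term; the second normal derivative and \<open>Pop\<close> together give the second one,
  since 1 + (2y - 1 - 2l) / (2m+1) = (2m + 2y - 2l) / (2m+1).\<close>

lemma bco_rec:
  assumes m: "m < l"
  shows "of_nat (Suc l) * bco (Suc l) (Suc m) y = bco l (Suc m) (y + 1) +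
     bco l m (y + 1) * (2 * of_nat m + 2 * y - 2 * of_nat l) / of_nat (2 * m + 1)"
proof -
  obtain k where l: "l = Suc (m + k)" using m less_iff_Suc_add by auto
  define F where "F = (fact k :: complex)"
  define H where "H = (fact (2 * m) :: complex)"
  define P where "P = pochhammer (y + 1) m"
  define K where "K = (of_nat (Suc k) :: complex)"
  define M where "M = (of_nat (Suc m) :: complex)"
  define M1 where "M1 = (of_nat (2 * m + 1) :: complex)"
  have nz: "F \<noteq> 0" "H \<noteq> 0" "K \<noteq> 0" "M \<noteq> 0" "M1 \<noteq> 0"
    unfolding F_def H_def K_def M_def M1_def by (simp_all del: of_nat_Suc add: of_nat_eq_0_iff del: of_nat_add of_nat_mult)
  have f: "fact (2 * Suc m) = 2 * M * M1 * H"
    unfolding M_def M1_def H_def by (simp add: algebra_simps)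
  have b1: "bco (Suc l) (Suc m) y = 4 * 4 ^ m * (y * P) / (K * F * (2 * M * M1 * H))"
    unfolding bco_def f by (simp add: l pochhammer_rec P_def K_def F_def)
  have b2: "bco l (Suc m) (y + 1) = 4 * 4 ^ m * (P * (y + M)) / (F * (2 * M * M1 * H))"
    unfolding bco_def f by (simp add: l pochhammer_Suc P_def M_def F_def add.assoc)
  have b3: "bco l m (y + 1) = 4 ^ m * P / (K * F * H)"
    unfolding bco_def by (simp add: l P_def K_def F_def H_def)
  have e: "of_nat (Suc l) = K + M" "2 * of_nat m + 2 * y - 2 * of_nat l = 2 * y - 2 * K" "of_nat (2 * m + 1) = M1"
    by (simp_all add: l K_def M_def M1_def algebra_simps)
  show ?thesis
    unfolding b1 b2 b3 e using nz by (simp add: divide_simps) (simp add: algebra_simps)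
qed

lemma bco_rec_last: "of_nat (Suc l) * bco (Suc l) (Suc l) y = bco l l (y + 1) * (2 * y) / of_nat (2 * l + 1)"
proof -
  define H where "H = (fact (2 * l) :: complex)"
  define P where "P = pochhammer (y + 1) l"
  define M where "M = (of_nat (Suc l) :: complex)"
  define M1 where "M1 = (of_nat (2 * l + 1) :: complex)"
  have nz: "H \<noteq> 0" "M \<noteq> 0" "M1 \<noteq> 0"
    unfolding H_def M_def M1_def by (simp_all del: of_nat_Suc add: of_nat_eq_0_iff del: of_nat_add of_nat_mult)
  have f: "fact (2 * Suc l) = 2 * M * M1 * H"
    unfolding M_def M1_def H_def by (simp add: algebra_simps)
  have b1: "bco (Suc l) (Suc l) y = 4 * 4 ^ l * (y * P) / (2 * M * M1 * H)"
    unfolding bco_def f by (simp add: pochhammer_rec P_def)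
  have b2: "bco l l (y + 1) = 4 ^ l * P / H" unfolding bco_def by (simp add: P_def H_def)
  show ?thesis unfolding b1 b2 M_def[symmetric] M1_def[symmetric] using nz by (simp add: divide_simps)
qed

lemma lapp_add:
  assumes "smooth u" "smooth v" shows "lapp (\<lambda>x. u x + v x) = (\<lambda>x. lapp u x + lapp v x)"
proof -
  have a: "pderiv_dir w (\<lambda>x. u x + v x) = (\<lambda>x. pderiv_dir w u x + pderiv_dir w v x)"
    if "smooth u" "smooth v" for u v :: "'a \<times> real \<Rightarrow> complex" and w
    using that by (intro ext pderiv_dir_add) (auto simp: smooth_iff intro: smooth_on_differentiable)
  show ?thesis unfolding lapp_def using assms by (simp add: a smooth_pderiv sum.distrib)
qed

lemma lappn_add:
  assumes "smooth u" "smooth v"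
  shows "(lapp ^^ j) (\<lambda>x. u x + v x) = (\<lambda>x. (lapp ^^ j) u x + (lapp ^^ j) v x)"
  by (induction j) (auto simp: lapp_add smooth_lappn assms)

text \<open>This is the recursion \<open>G_shift_both\<close> at z = -2(l+1) and y = (a+1)/2, where
  a + z + 2 = 2y - 1 - 2l. On the right the coefficients m = 0 and m = l + 1 receive only one of the
  two contributions and are treated separately.\<close>

lemma Tl_rec:
  fixes f :: "'b::euclidean_space \<times> real \<Rightarrow> complex"
  assumes f: "smooth f"
  shows "Tl l (y + 1) (lap f) + (2 * y - 1 - 2 * of_nat l) * Tl l (y + 1) (Pop f) = of_nat (Suc l) * Tl (Suc l) y f"
proof -
  define X where "X = (\<lambda>m. (lapp ^^ (Suc l - m)) (Dn (2 * m) f) 0)"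
  have smn: "smooth (Dn m f)" for m using f by (simp add: smooth_pderivs)
  have lap: "(lapp ^^ (l - m)) (Dn (2 * m) (lap f)) 0 = X m + X (Suc m)" if "m \<le> l" for m
  proof -
    have l: "lap f = (\<lambda>x. lapp f x + Dn 2 f x)" by (rule ext) (simp add: lap_eq numeral_2_eq_2)
    have "Dn (2 * m) (lap f) = (\<lambda>x. Dn (2 * m) (lapp f) x + Dn (2 * m) (Dn 2 f) x)"
      unfolding l using smooth_lapp[OF f] smn[of 2]
      by (intro ext pderivs_add[of UNIV]) (auto simp: smooth_iff)
    also have "\<dots> = (\<lambda>x. lapp (Dn (2 * m) f) x + Dn (2 * Suc m) f x)"
      using f by (simp add: pderivs_lapp Dn_add)
    finally have "Dn (2 * m) (lap f) = (\<lambda>x. lapp (Dn (2 * m) f) x + Dn (2 * Suc m) f x)" .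
    then have "(lapp ^^ (l - m)) (Dn (2 * m) (lap f)) 0 = (lapp ^^ (l - m)) (lapp (Dn (2 * m) f)) 0 + (lapp ^^ (l - m)) (Dn (2 * Suc m) f) 0"
      by (simp only: lappn_add[OF smooth_lapp[OF smn] smn])
    moreover have "(lapp ^^ (l - m)) (lapp (Dn (2 * m) f)) 0 = X m" using that by (simp add: X_def funpow_swap1 Suc_diff_le)
    moreover have "(lapp ^^ (l - m)) (Dn (2 * Suc m) f) 0 = X (Suc m)" by (simp add: X_def)
    ultimately show ?thesis by simp
  qed
  have pop: "(lapp ^^ (l - m)) (Dn (2 * m) (Pop f)) 0 = X (Suc m) / of_nat (2 * m + 1)" for m
    using lappn_Pop[OF f, of 0 "l - m" m] by (simp add: X_def)
  have nz: "(of_nat (2 * m + 1) :: complex) \<noteq> 0" for m using of_nat_eq_0_iff[of "2 * m + 1", where 'a=complex] by simp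
  have "Tl l (y + 1) (lap f) + (2 * y - 1 - 2 * of_nat l) * Tl l (y + 1) (Pop f)
     = (\<Sum>m\<le>l. bco l m (y + 1) * (X m + X (Suc m)) + (2 * y - 1 - 2 * of_nat l) * (bco l m (y + 1) * (X (Suc m) / of_nat (2 * m + 1))))"
    unfolding Tl_def sum_distrib_left sum.distrib[symmetric] by (intro sum.cong) (auto simp: lap pop)
  also have "\<dots> = (\<Sum>m\<le>l. bco l m (y + 1) * X m) + (\<Sum>m\<le>l. bco l m (y + 1) * (2 * of_nat m + 2 * y - 2 * of_nat l) / of_nat (2 * m + 1) * X (Suc m))"
    unfolding sum.distrib[symmetric]
  proof (rule sum.cong[OF refl])
    fix m
    have "b * (x + x') + c * (b * (x' / d)) = b * x + b * (d + c) / d * x'" if "d \<noteq> 0" for b x x' c d :: complex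
      using that by (simp add: field_simps)
    from this[OF nz[of m], of "bco l m (y + 1)" "X m" "X (Suc m)" "2 * y - 1 - 2 * of_nat l"]
    show "bco l m (y + 1) * (X m + X (Suc m)) + (2 * y - 1 - 2 * of_nat l) * (bco l m (y + 1) * (X (Suc m) / of_nat (2 * m + 1)))
      = bco l m (y + 1) * X m + bco l m (y + 1) * (2 * of_nat m + 2 * y - 2 * of_nat l) / of_nat (2 * m + 1) * X (Suc m)"
      by (simp add: algebra_simps)
  qed
  also have "(\<Sum>m\<le>l. bco l m (y + 1) * X m) = bco l 0 (y + 1) * X 0 + (\<Sum>m<l. bco l (Suc m) (y + 1) * X (Suc m))"
    by (rule sum.atMost_shift)
  also have "(\<Sum>m\<le>l. bco l m (y + 1) * (2 * of_nat m + 2 * y - 2 * of_nat l) / of_nat (2 * m + 1) * X (Suc m))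
     = (\<Sum>m<l. bco l m (y + 1) * (2 * of_nat m + 2 * y - 2 * of_nat l) / of_nat (2 * m + 1) * X (Suc m)) + of_nat (Suc l) * bco (Suc l) (Suc l) y * X (Suc l)"
    unfolding lessThan_Suc_atMost[symmetric] sum.lessThan_Suc bco_rec_last by simp
  also have "bco l 0 (y + 1) * X 0 + (\<Sum>m<l. bco l (Suc m) (y + 1) * X (Suc m)) +
     ((\<Sum>m<l. bco l m (y + 1) * (2 * of_nat m + 2 * y - 2 * of_nat l) / of_nat (2 * m + 1) * X (Suc m)) + of_nat (Suc l) * bco (Suc l) (Suc l) y * X (Suc l))
     = bco l 0 (y + 1) * X 0 + (\<Sum>m<l. of_nat (Suc l) * bco (Suc l) (Suc m) y * X (Suc m)) + of_nat (Suc l) * bco (Suc l) (Suc l) y * X (Suc l)"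
  proof -
    have "(\<Sum>m<l. of_nat (Suc l) * bco (Suc l) (Suc m) y * X (Suc m)) = (\<Sum>m<l. bco l (Suc m) (y + 1) * X (Suc m)) +
       (\<Sum>m<l. bco l m (y + 1) * (2 * of_nat m + 2 * y - 2 * of_nat l) / of_nat (2 * m + 1) * X (Suc m))"
      unfolding sum.distrib[symmetric] by (intro sum.cong refl) (simp only: lessThan_iff bco_rec distrib_right)
    then show ?thesis by (simp only: add.assoc)
  qed
  also have "bco l 0 (y + 1) = of_nat (Suc l) * bco (Suc l) 0 y"
    by (simp add: bco_def divide_simps del: of_nat_Suc)
  also have "of_nat (Suc l) * bco (Suc l) 0 y * X 0 + (\<Sum>m<l. of_nat (Suc l) * bco (Suc l) (Suc m) y * X (Suc m)) + of_nat (Suc l) * bco (Suc l) (Suc l) y * X (Suc l)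
    = of_nat (Suc l) * (\<Sum>m\<le>Suc l. bco (Suc l) m y * X m)"
    by (subst sum.atMost_shift) (simp add: sum_distrib_left distrib_left mult.assoc)
  finally show ?thesis by (simp add: Tl_def X_def)
qed

text \<open>Collects pi^(d/2) from the value at z = 0, where d = n - 1, and the factor -(i+1)/4 from
  each step i to i + 1 of the recursion.\<close>

definition gam :: "nat \<Rightarrow> nat \<Rightarrow> complex" where
  "gam d l = (-1) ^ l * fact l * of_real (pi powr (real d / 2)) / 4 ^ l"

text \<open>Each step trades (a, z) for (a + 2, z + 2). This leaves a - z, and with it the argument
  (a + 2l + n)/2 of the Gamma function, unchanged, so that only the constant and the differential
  operator evolve.\<close>

lemma G_at_minus_even:
  fixes f :: "'b::euclidean_space \<times> real \<Rightarrow> complex"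
  assumes R: "R > 0"
  shows "f \<in> tf R \<Longrightarrow> G a (- 2 * of_nat l) f = gam DIM('b) l * rGamma ((a + 2 * of_nat l + dm TYPE('b)) / 2) * Tl l ((a + 1) / 2) f"
proof (induction l arbitrary: a f)
  case 0
  then show ?case using G_at_zero[OF R, of f a] by (simp add: gam_def Tl_def bco_def)
next
  case (Suc l)
  define y where "y = (a + 1) / 2"
  define r where "r = rGamma ((a + 2 * of_nat (Suc l) + dm TYPE('b)) / 2)"
  have e: "- 2 * of_nat (Suc l) + 2 = (- 2 * of_nat l :: complex)" "(a + 2 + 1) / 2 = y + 1"
    "a + 2 + 2 * of_nat l + dm TYPE('b) = a + 2 * of_nat (Suc l) + dm TYPE('b)"
    "a + - 2 * of_nat (Suc l) + 2 = 2 * y - 1 - 2 * of_nat l"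
    by (simp_all add: y_def field_simps)
  have "G a (- 2 * of_nat (Suc l)) f = (-1/4) * (G (a + 2) (- 2 * of_nat l) (lap f) + (2 * y - 1 - 2 * of_nat l) * G (a + 2) (- 2 * of_nat l) (Pop f))"
    using G_shift_both[OF R Suc.prems, of a "- 2 * of_nat (Suc l)"] unfolding e .
  also have "\<dots> = (-1/4) * gam DIM('b) l * r * (Tl l (y + 1) (lap f) + (2 * y - 1 - 2 * of_nat l) * Tl l (y + 1) (Pop f))"
    unfolding Suc.IH[OF tf_lap[OF R Suc.prems]] Suc.IH[OF tf_Pop[OF R Suc.prems]] e r_def
    by (simp add: algebra_simps)
  also have "\<dots> = ((-1/4) * gam DIM('b) l * of_nat (Suc l)) * r * Tl (Suc l) y f"
    unfolding Tl_rec[OF tf_smooth[OF Suc.prems]] by simp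
  also have "(-1/4) * gam DIM('b) l * of_nat (Suc l) = gam DIM('b) (Suc l)"
    by (simp add: gam_def field_simps)
  finally show ?case by (simp add: r_def y_def)
qed

section \<open>Integrals over the hyperplane: the values at a = -1 - 2k\<close>

lemma pair_ne_0 [simp]: "x' \<noteq> 0 \<Longrightarrow> (x', u) \<noteq> 0"
  by (simp add: zero_prod_def)

lemma integral_lborel_prod:
  fixes f :: "'b::euclidean_space \<times> real \<Rightarrow> complex"
  assumes "integrable lborel f"
  shows "(\<integral>x. f x \<partial>lborel) = (\<integral>x'. \<integral>u. f (x', u) \<partial>lborel \<partial>lborel)"
  using lborel_pair.integral_fst'[of f] assms by (simp add: lborel_prod)

lemma AE_nonzero: "AE (x::'b::euclidean_space) in lborel. x \<noteq> 0"
  by (rule AE_lborel_singleton)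

lemma sgn_line_integral:
  fixes F D :: "real \<Rightarrow> complex"
  assumes d: "\<And>u. (F has_vector_derivative D u) (at u)" and c: "continuous_on UNIV D"
    and z: "\<And>u. \<bar>u\<bar> > R \<Longrightarrow> F u = 0" "\<And>u. \<bar>u\<bar> > R \<Longrightarrow> D u = 0"
  shows "(\<integral>u. of_real (sgn u) * D u \<partial>lborel) = - 2 * F 0"
proof -
  define S where "S = max R 0 + 1"
  have S: "S > 0" "S > R" by (auto simp: S_def)
  have iD: "integrable lborel D" by (rule integrable_continuous_compact_support[OF c, of R]) (use z in auto)
  have [measurable]: "D \<in> borel_measurable borel" using c by (rule borel_measurable_continuous_onI)
  have i: "integrable lborel (\<lambda>u. of_real (sgn u) * D u)"
    by (rule Bochner_Integration.integrable_bound[OF iD]) (auto simp: norm_mult abs_sgn_eq)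
  have 1: "((\<lambda>u. of_real (sgn u) * D u) has_integral (F S - F 0)) {0..S}"
  proof (rule has_integral_spike_finite[of "{0}"])
    show "(D has_integral (F S - F 0)) {0..S}"
      using S by (intro fundamental_theorem_of_calculus) (auto intro: d has_vector_derivative_at_within)
  qed auto
  have 2: "((\<lambda>u. of_real (sgn u) * D u) has_integral - (F 0 - F (-S))) {-S..0}"
  proof (rule has_integral_spike_finite[of "{0}"])
    have "(D has_integral (F 0 - F (-S))) {-S..0}"
      using S by (intro fundamental_theorem_of_calculus) (auto intro: d has_vector_derivative_at_within)
    then show "((\<lambda>u. - D u) has_integral - (F 0 - F (-S))) {-S..0}" by (rule has_integral_neg)
  qed auto
  have "((\<lambda>u. of_real (sgn u) * D u) has_integral (- (F 0 - F (-S)) + (F S - F 0))) {-S..S}"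
    by (rule has_integral_combine[OF _ _ 2 1]) (use S in auto)
  then have "((\<lambda>u. of_real (sgn u) * D u) has_integral (- 2 * F 0)) {-S..S}"
    using z(1)[of S] z(1)[of "-S"] S by simp
  then have "((\<lambda>u. of_real (sgn u) * D u) has_integral (- 2 * F 0)) UNIV"
    by (rule has_integral_on_superset) (use z(2) S in auto)
  then show ?thesis using integral_lborel[OF i] by (simp add: integral_unique)
qed

text \<open>Fubini along vertical lines, with the fundamental theorem on either half line. The line
  over x' = 0 meets the origin, where powers of |x| need not be smooth; it is left out as a null
  set.\<close>

lemma sgn_integral:
  fixes F D :: "'b::euclidean_space \<times> real \<Rightarrow> complex"
  assumes i: "integrable lborel (\<lambda>x. of_real (sgn (snd x)) * D x)"
    and d: "\<And>x' u. x' \<noteq> 0 \<Longrightarrow> ((\<lambda>u. F (x', u)) has_vector_derivative D (x', u)) (at u)"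
    and c: "\<And>x'. x' \<noteq> 0 \<Longrightarrow> continuous_on UNIV (\<lambda>u. D (x', u))"
    and z: "\<And>x. norm x > R \<Longrightarrow> F x = 0" "\<And>x. norm x > R \<Longrightarrow> D x = 0"
    and m: "(\<lambda>x'. F (x', 0)) \<in> borel_measurable borel"
  shows "(\<integral>x. of_real (sgn (snd x)) * D x \<partial>lborel) = - 2 * (\<integral>x'. F (x', 0) \<partial>lborel)"
proof -
  have eq: "(\<integral>u. of_real (sgn u) * D (x', u) \<partial>lborel) = - 2 * F (x', 0)" if x': "x' \<noteq> 0" for x'
  proof (rule sgn_line_integral[OF d[OF x'] c[OF x']])
    fix u :: real assume u: "\<bar>u\<bar> > R"
    have "norm (x', u) > R" using u norm_snd_le[of u x'] by simp
    then show "F (x', u) = 0" "D (x', u) = 0" using z by auto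
  qed
  have m2: "(\<lambda>x'. \<integral>u. of_real (sgn u) * D (x', u) \<partial>lborel) \<in> borel_measurable lborel"
  proof -
    have "integrable (lborel \<Otimes>\<^sub>M lborel) (\<lambda>x. of_real (sgn (snd x)) * D x)" using i by (simp add: lborel_prod)
    from borel_measurable_integrable[OF lborel_pair.integrable_fst'[OF this]] show ?thesis by simp
  qed
  have "(\<integral>x. of_real (sgn (snd x)) * D x \<partial>lborel) = (\<integral>x'. \<integral>u. of_real (sgn u) * D (x', u) \<partial>lborel \<partial>lborel)"
    using integral_lborel_prod[OF i] by simp
  also have "\<dots> = (\<integral>x'. - 2 * F (x', 0) \<partial>lborel)"
    using m m2 eq by (intro integral_cong_AE) (auto intro: eventually_mono[OF AE_nonzero])
  finally show ?thesis by simp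
qed

lemma AP_derivative_pos:
  assumes "t > 0" shows "(AP a has_vector_derivative a * AP (a - 1) t) (at t)"
  using has_vector_derivative_transform_within_open[OF powr_vector_derivative[OF assms, of a] open_greaterThan[of 0], of "AP a"] assms
  by (simp add: AP_pos)

lemma W_has_derivative:
  fixes x :: "'a::euclidean_space"
  assumes "x \<noteq> 0"
  shows "(W s has_derivative (\<lambda>v. s * of_real (x \<bullet> v) * W (s - 2) x)) (at x)"
proof -
  have "((\<lambda>x. x \<bullet> x) has_derivative (\<lambda>v. 2 * (x \<bullet> v))) (at x)"
    by (auto intro!: derivative_eq_intros simp: inner_commute)
  moreover have "(AP (s / 2) has_derivative (\<lambda>h. h *\<^sub>R (s / 2 * AP (s / 2 - 1) (x \<bullet> x)))) (at (x \<bullet> x))"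
    using AP_derivative_pos[of "x \<bullet> x" "s / 2"] assms by (simp add: has_vector_derivative_def)
  ultimately have "((\<lambda>x. AP (s / 2) (x \<bullet> x)) has_derivative (\<lambda>v. (2 * (x \<bullet> v)) *\<^sub>R (s / 2 * AP (s / 2 - 1) (x \<bullet> x)))) (at x)"
    by (rule has_derivative_compose)
  moreover have "AP (s / 2 - 1) (x \<bullet> x) = W (s - 2) x" by (simp add: W_eq_AP diff_divide_distrib)
  moreover have "(\<lambda>x::'a. AP (s / 2) (x \<bullet> x)) = W s" by (simp add: fun_eq_iff W_eq_AP)
  ultimately show ?thesis by (simp add: scaleR_conv_of_real mult_ac)
qed

lemma pderiv_dir_W: "x \<noteq> 0 \<Longrightarrow> pderiv_dir v (W s) x = s * of_real (x \<bullet> v) * W (s - 2) x"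
  by (rule pderiv_dir_eq[OF W_has_derivative])

lemma open_U0 [simp]: "open (- {0 :: 'a::euclidean_space})" by (simp add: open_Compl)

text \<open>A derivative of \<open>W s\<close> is a linear function times \<open>W (s - 2)\<close>,
  so all powers of |x| together with the smooth functions generate an algebra closed under
  derivatives.\<close>

lemma smooth_on_W: "smooth_on (- {0}) (W s :: 'a::euclidean_space \<Rightarrow> complex)"
proof (rule smooth_on_alg[of _ _ "range W \<union> {f. smooth_on (- {0}) f}"])
  fix g :: "'a \<Rightarrow> complex" and v :: 'a
  assume "g \<in> range W \<union> {f. smooth_on (- {0}) f}" "v \<in> Basis"
  then show "\<exists>h\<in>alg (range W \<union> {f. smooth_on (- {0}) f}). \<forall>x\<in>- {0}. pderiv_dir v g x = h x"
  proof (elim UnE)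
    assume "g \<in> range W"
    then obtain s where g: "g = W s" by auto
    have "(\<lambda>x::'a. (s * of_real (x \<bullet> v)) * W (s - 2) x) \<in> alg (range W \<union> {f. smooth_on (- {0}) f})"
      by (intro alg.mult alg.const alg.base) auto
    then show ?thesis
      by (intro bexI[of _ "\<lambda>x::'a. (s * of_real (x \<bullet> v)) * W (s - 2) x"]) (simp_all add: g pderiv_dir_W)
  qed (auto intro!: bexI[OF _ alg.base] smooth_on_pderiv_dir)
next
  fix g :: "'a \<Rightarrow> complex" and x :: 'a
  assume "g \<in> range W \<union> {f. smooth_on (- {0}) f}" "x \<in> - {0}"
  then show "g differentiable (at x)" by (auto intro: differentiableI[OF W_has_derivative] smooth_on_differentiable[of "- {0}"])
qed (auto intro: alg.base)

abbreviation U0 :: "('b::euclidean_space \<times> real) set" where "U0 \<equiv> - {0}"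

lemma smooth_on_UNIV_D: "smooth f \<Longrightarrow> smooth_on S f"
  by (rule smooth_on_subset[of UNIV]) (simp_all add: smooth_iff)

lemma smooth_snd: "smooth (\<lambda>x::'b::euclidean_space \<times> real. complex_of_real (snd x))"
  using smooth_on_inner[of UNIV en] by (simp add: smooth_iff inner_prod_def)

lemma pderiv_en_snd: "pderiv_dir en (\<lambda>x::'b::euclidean_space \<times> real. complex_of_real (snd x)) x = 1"
  using pderiv_dir_inner[of en en x] by (simp add: inner_prod_def)

lemma Dn_snd_mult:
  fixes g :: "'b::euclidean_space \<times> real \<Rightarrow> complex"
  assumes U: "open T" and g: "smooth_on T g" and x: "x \<in> T"
  shows "Dn (Suc m) (\<lambda>x. of_real (snd x) * g x) x = of_real (snd x) * Dn (Suc m) g x + of_nat (Suc m) * Dn m g x"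
  using x
proof (induction m arbitrary: x)
  case 0
  show ?case
    using pderiv_dir_mult[OF smooth_on_differentiable[OF smooth_on_UNIV_D[OF smooth_snd] UNIV_I[of x]] smooth_on_differentiable[OF g 0], of en]
    by (simp add: pderiv_en_snd)
next
  case (Suc m)
  have d: "Dn j g differentiable (at x)" for j using smooth_on_differentiable[OF smooth_on_pderivs[OF g set_Dn]] Suc by blast
  have d': "(\<lambda>x::'b \<times> real. complex_of_real (snd x)) differentiable (at x)"
    using smooth_on_differentiable[OF smooth_on_UNIV_D[OF smooth_snd]] by blast
  have "Dn (Suc (Suc m)) (\<lambda>x. of_real (snd x) * g x) x = pderiv_dir en (Dn (Suc m) (\<lambda>x. of_real (snd x) * g x)) x" by simp
  also have "\<dots> = pderiv_dir en (\<lambda>x. of_real (snd x) * Dn (Suc m) g x + of_nat (Suc m) * Dn m g x) x"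
    by (rule pderiv_dir_cong[OF U _ Suc.prems]) (rule Suc.IH)
  also have "\<dots> = pderiv_dir en (\<lambda>x. of_real (snd x) * Dn (Suc m) g x) x + pderiv_dir en (\<lambda>x. of_nat (Suc m) * Dn m g x) x"
    using d[of m] d[of "Suc m"] d' by (intro pderiv_dir_add differentiable_mult) auto
  also have "\<dots> = of_real (snd x) * Dn (Suc (Suc m)) g x + Dn (Suc m) g x + of_nat (Suc m) * Dn (Suc m) g x"
    using d[of m] d[of "Suc m"] d' by (simp add: pderiv_dir_mult pderiv_en_snd)
  finally show ?case by (simp add: algebra_simps)
qed

lemma sc_m1_U0: "x \<noteq> 0 \<Longrightarrow> sc (-1) x \<noteq> 0"
  by (auto simp: sc_def prod_eq_iff)

lemma Dn_reflect:
  fixes g :: "'b::euclidean_space \<times> real \<Rightarrow> complex"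
  assumes g: "smooth_on U0 g" and x: "x \<in> U0"
  shows "Dn m (\<lambda>x. g (sc (-1) x)) x = (-1) ^ m * Dn m g (sc (-1) x)"
  using x
proof (induction m arbitrary: x)
  case (Suc m)
  have "(Dn m g has_derivative (\<lambda>v. pderiv_dir v (Dn m g) (sc (-1) x))) (at (sc (-1) x))"
    using Suc.prems sc_m1_U0[of x] by (intro has_derivative_pderiv_dir smooth_on_differentiable[OF smooth_on_pderivs[OF g set_Dn]]) auto
  moreover have "(sc (-1) has_derivative sc (-1)) (at x)" unfolding sc_def by (auto intro!: derivative_eq_intros)
  ultimately have d: "((\<lambda>x. Dn m g (sc (-1) x)) has_derivative (\<lambda>v. pderiv_dir (sc (-1) v) (Dn m g) (sc (-1) x))) (at x)"
    using has_derivative_compose by blast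
  have lin: "linear (\<lambda>v. pderiv_dir v (Dn m g) (sc (-1) x))"
    using \<open>(Dn m g has_derivative _) _\<close> has_derivative_linear by blast
  have "Dn (Suc m) (\<lambda>x. g (sc (-1) x)) x = pderiv_dir en (\<lambda>x. (-1) ^ m * Dn m g (sc (-1) x)) x"
    unfolding replicate_Suc pderivs_Cons by (rule pderiv_dir_cong[OF open_U0 _ Suc.prems]) (rule Suc.IH)
  also have "\<dots> = (-1) ^ m * pderiv_dir (sc (-1) en) (Dn m g) (sc (-1) x)"
    by (rule pderiv_dir_eq) (rule has_derivative_mult_right[OF d])
  also have "sc (-1) en = - (en :: 'b \<times> real)" by (simp add: sc_def prod_eq_iff)
  also have "pderiv_dir (- en) (Dn m g) (sc (-1) x) = - pderiv_dir en (Dn m g) (sc (-1) x)"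
    using linear_neg[OF lin, of en] .
  finally show ?case by simp
qed simp

lemma Dn_odd_even:
  fixes g :: "'b::euclidean_space \<times> real \<Rightarrow> complex"
  assumes g: "smooth_on U0 g" and e: "\<And>x. g (sc (-1) x) = g x" and x: "x' \<noteq> 0"
  shows "Dn (2 * k + 1) g (x', 0) = 0"
proof -
  have "Dn (2 * k + 1) g (x', 0) = (-1) ^ (2 * k + 1) * Dn (2 * k + 1) g (sc (-1) (x', 0))"
    using Dn_reflect[OF g, of "(x', 0)" "2 * k + 1"] x unfolding e by (simp add: zero_prod_def del: pderivs_Cons replicate.simps)
  also have "sc (-1) (x', 0) = (x', 0)" by (simp add: sc_def)
  finally show ?thesis by simp
qed

lemma smooth_reflect:
  fixes f :: "'b::euclidean_space \<times> real \<Rightarrow> complex"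
  assumes "smooth f" "smooth (Qop f)" shows "smooth (\<lambda>x. f x - of_real (snd x) * Qop f x)"
proof -
  have "smooth_on UNIV (\<lambda>x. f x + (-1) * (of_real (snd x) * Qop f x))"
    by (intro smooth_on_add smooth_on_mult smooth_on_const) (use assms smooth_snd in \<open>simp_all add: smooth_iff\<close>)
  then show ?thesis by (simp add: smooth_iff)
qed

text \<open>Split f = E + x_n \<open>Qop f\<close> with \<open>E\<close> even. An odd normal
  derivative of the even function w E vanishes on the hyperplane, and in the Leibniz expansion of
  x_n times w \<open>Qop f\<close> a single term survives there.\<close>

lemma Dn_odd_weight:
  fixes f w :: "'b::euclidean_space \<times> real \<Rightarrow> complex"
  assumes w: "smooth_on U0 w" "\<And>x. w (sc (-1) x) = w x"
    and R: "R > 0" and f: "f \<in> tf R" and x: "x' \<noteq> 0"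
  shows "Dn (2 * k + 1) (\<lambda>x. w x * f x) (x', 0) = of_nat (2 * k + 1) * Dn (2 * k) (\<lambda>x. w x * Qop f x) (x', 0)"
proof -
  define E where "E = (\<lambda>x. f x - of_real (snd x) * Qop f x)"
  have smQ: "smooth (Qop f)" by (rule tf_smooth[OF tf_Qop[OF R f]])
  have smE: "smooth E" unfolding E_def by (rule smooth_reflect[OF tf_smooth[OF f] smQ])
  have E: "E x = (f x + f (sc (-1) x)) / 2" for x
    unfolding E_def using Qop_mult[OF tf_smooth[OF f], of x] by (simp add: field_simps)
  have sW: "smooth_on U0 (\<lambda>x. w x * g x)" if "smooth g" for g
    using that by (intro smooth_on_mult w smooth_on_UNIV_D) auto
  have "(\<lambda>x. w x * f x) = (\<lambda>x. w x * E x + of_real (snd x) * (w x * Qop f x))"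
    by (simp add: E_def algebra_simps fun_eq_iff)
  then have "Dn (2 * k + 1) (\<lambda>x. w x * f x) (x', 0) = Dn (2 * k + 1) (\<lambda>x. w x * E x) (x', 0) + Dn (2 * k + 1) (\<lambda>x. of_real (snd x) * (w x * Qop f x)) (x', 0)"
    using x by (simp only:, intro pderivs_add[of U0] sW smE smooth_on_mult[OF _ _ sW[OF smQ]] smooth_on_UNIV_D[OF smooth_snd]) auto
  also have "Dn (2 * k + 1) (\<lambda>x. w x * E x) (x', 0) = 0"
    by (rule Dn_odd_even[OF sW[OF smE] _ x]) (use w(2) in \<open>simp add: E sc_def\<close>)
  also have "Dn (2 * k + 1) (\<lambda>x. of_real (snd x) * (w x * Qop f x)) (x', 0) = of_nat (2 * k + 1) * Dn (2 * k) (\<lambda>x. w x * Qop f x) (x', 0)"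
    using Dn_snd_mult[OF open_U0 sW[OF smQ], of "(x', 0)" "2 * k"] x by (simp del: pderivs_Cons replicate.simps)
  finally show ?thesis by simp
qed

lemmas Dn_odd_W = Dn_odd_weight[OF smooth_on_W W_reflect]

lemma pderiv_en_W_mult:
  fixes f :: "'b::euclidean_space \<times> real \<Rightarrow> complex"
  assumes "smooth f" "x \<noteq> 0"
  shows "pderiv_dir en (\<lambda>x. W s x * f x) x = s * (of_real (snd x) * (W (s - 2) x * f x)) + W s x * pderiv_dir en f x"
  using smooth_on_differentiable[OF smooth_on_W] smooth_on_differentiable[OF smooth_on_UNIV_D[OF assms(1), of UNIV]] assms(2)
  by (subst pderiv_dir_mult) (auto simp: pderiv_dir_W inner_prod_def)

text \<open>The counterpart of \<open>G_shift_first\<close> on the hyperplane: two normal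
  derivatives are traded for the exponent s - 2 or for \<open>Pop\<close>.\<close>

lemma Dn_W_rec:
  fixes f :: "'b::euclidean_space \<times> real \<Rightarrow> complex"
  assumes R: "R > 0" and f: "f \<in> tf R" and x: "x' \<noteq> 0"
  shows "Dn (2 * Suc k) (\<lambda>x. W s x * f x) (x', 0) = of_nat (2 * k + 1) *
     (s * Dn (2 * k) (\<lambda>x. W (s - 2) x * f x) (x', 0) + Dn (2 * k) (\<lambda>x. W s x * Pop f x) (x', 0))"
proof -
  have sW: "smooth_on U0 (\<lambda>x. W s x * g x)" if "smooth g" for g s
    using that by (intro smooth_on_mult smooth_on_W smooth_on_UNIV_D) auto
  note f' = tf_pderiv_dir[OF f en_Basis]
  have s1: "smooth_on U0 (\<lambda>x. of_real (snd x) * (W (s - 2) x * f x))"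
    using tf_smooth[OF f] by (intro smooth_on_mult sW smooth_on_UNIV_D[OF smooth_snd]) auto
  have "Dn (2 * Suc k) (\<lambda>x. W s x * f x) (x', 0) = Dn (2 * k + 1) (pderiv_dir en (\<lambda>x. W s x * f x)) (x', 0)"
    using Dn_Suc[of "2 * k + 1" "\<lambda>x. W s x * f x"] by simp
  also have "\<dots> = Dn (2 * k + 1) (\<lambda>x. s * (of_real (snd x) * (W (s - 2) x * f x)) + W s x * pderiv_dir en f x) (x', 0)"
    by (rule pderivs_cong[OF open_U0]) (use pderiv_en_W_mult[OF tf_smooth[OF f]] x in auto)
  also have "\<dots> = Dn (2 * k + 1) (\<lambda>x. s * (of_real (snd x) * (W (s - 2) x * f x))) (x', 0) + Dn (2 * k + 1) (\<lambda>x. W s x * pderiv_dir en f x) (x', 0)"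
    by (rule pderivs_add[of U0]) (use x tf_smooth[OF f'] in \<open>auto intro!: smooth_on_mult[OF open_U0 _ s1] sW\<close>)
  also have "Dn (2 * k + 1) (\<lambda>x. s * (of_real (snd x) * (W (s - 2) x * f x))) (x', 0) = s * Dn (2 * k + 1) (\<lambda>x. of_real (snd x) * (W (s - 2) x * f x)) (x', 0)"
    by (rule pderivs_cmult[OF open_U0 s1]) (use x in auto)
  also have "Dn (2 * k + 1) (\<lambda>x. of_real (snd x) * (W (s - 2) x * f x)) (x', 0) = of_nat (2 * k + 1) * Dn (2 * k) (\<lambda>x. W (s - 2) x * f x) (x', 0)"
    using Dn_snd_mult[OF open_U0 sW[OF tf_smooth[OF f]], of "(x', 0)" "2 * k"] x by (simp del: pderivs_Cons replicate.simps)
  also have "Dn (2 * k + 1) (\<lambda>x. W s x * pderiv_dir en f x) (x', 0) = of_nat (2 * k + 1) * Dn (2 * k) (\<lambda>x. W s x * Pop f x) (x', 0)"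
    unfolding Pop_def by (rule Dn_odd_W[OF R f' x])
  finally show ?thesis by (simp add: algebra_simps)
qed

lemma measurable_emb [measurable]: "(\<lambda>x'::'b::euclidean_space. (x', 0::real)) \<in> borel_measurable borel"
  by (intro borel_measurable_continuous_onI continuous_intros)

lemma W_slice_measurable:
  fixes f :: "'b::euclidean_space \<times> real \<Rightarrow> complex"
  assumes "f \<in> borel_measurable borel"
  shows "(\<lambda>x'. W s (x', 0::real) * f (x', 0)) \<in> borel_measurable borel"
  by (intro borel_measurable_times measurable_compose[OF measurable_emb W_measurable] measurable_compose[OF measurable_emb assms])

lemma integrable_bounded_ball:
  fixes g :: "'a::euclidean_space \<Rightarrow> complex"
  assumes [measurable]: "g \<in> borel_measurable borel" and "\<And>x. norm (g x) \<le> B" "\<And>x. norm x > R \<Longrightarrow> g x = 0"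
  shows "integrable lborel g"
proof (rule Bochner_Integration.integrable_bound[of _ "\<lambda>x. B * indicator (cball 0 R) x"])
  show "integrable lborel (\<lambda>x::'a. B * indicator (cball 0 R) x)"
    using emeasure_bounded_finite[of "cball 0 R :: 'a set"] by auto
  show "AE x in lborel. norm (g x) \<le> norm (B * indicator (cball 0 R) x)"
  proof (rule AE_I2)
    fix x show "norm (g x) \<le> norm (B * indicator (cball 0 R) x)"
      using assms(2)[of x] assms(3)[of x] by (cases "norm x \<le> R") (auto intro: order_trans)
  qed
qed measurable

lemma norm_W_le: "0 \<le> Re s \<Longrightarrow> norm x \<le> R \<Longrightarrow> norm (W s x) \<le> R powr Re s"
  unfolding norm_W by (intro powr_mono2) auto

text \<open>The value at x' = 0 is set to 0, because the weight need not be differentiable at the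
  origin. The recursion removes two normal derivatives at the cost of lowering s by at most 2, and
  ends with a bounded integrand.\<close>

lemma Dn_W_integrable:
  fixes f :: "'b::euclidean_space \<times> real \<Rightarrow> complex"
  assumes R: "R > 0"
  shows "f \<in> tf R \<Longrightarrow> Re s > 2 * real k \<Longrightarrow> integrable lborel (\<lambda>x'. if x' = 0 then 0 else Dn (2 * k) (\<lambda>x. W s x * f x) (x', 0))"
proof (induction k arbitrary: f s)
  case 0
  have [measurable]: "f \<in> borel_measurable borel" by (rule tf_measurable[OF 0(1)])
  show ?case
  proof (rule integrable_bounded_ball[where R=R and B="R powr Re s * sem 0 f"])
    fix x' :: 'b
    show "norm (if x' = 0 then 0 else Dn (2 * 0) (\<lambda>x. W s x * f x) (x', 0)) \<le> R powr Re s * sem 0 f"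
    proof (cases "norm x' \<le> R")
      case True
      then have "norm (W s (x', 0::real)) \<le> R powr Re s" using 0 by (intro norm_W_le) (auto simp: norm_prod_def)
      then show ?thesis using pderivs_le_sem[OF 0(1), of "[]" 0 "(x', 0)"] sem_nonneg[OF 0(1), of 0]
        by (auto simp: norm_mult intro!: mult_mono mult_nonneg_nonneg)
    next
      case False
      then have "f (x', 0) = 0" by (intro tf_zero[OF 0(1)]) (simp add: norm_prod_def)
      then show ?thesis using sem_nonneg[OF 0(1), of 0] by simp
    qed
    show "norm x' > R \<Longrightarrow> (if x' = 0 then 0 else Dn (2 * 0) (\<lambda>x. W s x * f x) (x', 0)) = 0"
      using tf_zero[OF 0(1), of "(x', 0)"] by (simp add: norm_prod_def)
  next
    have "(\<lambda>x'::'b. if x' = 0 then 0 else W s (x', 0::real) * f (x', 0)) \<in> borel_measurable borel"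
      using W_slice_measurable[OF \<open>f \<in> borel_measurable borel\<close>] by (intro measurable_If) auto
    then show "(\<lambda>x'. if x' = 0 then 0 else Dn (2 * 0) (\<lambda>x. W s x * f x) (x', 0)) \<in> borel_measurable borel"
      by (simp only: mult_0_right replicate_0 pderivs_Nil)
  qed
next
  case (Suc k)
  have 1: "integrable lborel (\<lambda>x'. if x' = 0 then 0 else Dn (2 * k) (\<lambda>x. W (s - 2) x * f x) (x', 0))"
    using Suc.prems by (intro Suc.IH) auto
  have 2: "integrable lborel (\<lambda>x'. if x' = 0 then 0 else Dn (2 * k) (\<lambda>x. W s x * Pop f x) (x', 0))"
    using Suc.prems by (intro Suc.IH tf_Pop[OF R]) auto
  have eq: "(\<lambda>x'. if x' = 0 then 0 else Dn (2 * Suc k) (\<lambda>x. W s x * f x) (x', 0)) = (\<lambda>x'. of_nat (2 * k + 1) *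
     (s * (if x' = 0 then 0 else Dn (2 * k) (\<lambda>x. W (s - 2) x * f x) (x', 0)) + (if x' = 0 then 0 else Dn (2 * k) (\<lambda>x. W s x * Pop f x) (x', 0))))"
    using Dn_W_rec[OF R Suc.prems(1)] by (intro ext) (simp del: pderivs_Cons replicate.simps mult_Suc_right)
  show ?case unfolding eq by (intro integrable_mult_right Bochner_Integration.integrable_add 1 2)
qed

definition BB :: "nat \<Rightarrow> complex \<Rightarrow> ('b::euclidean_space \<times> real \<Rightarrow> complex) \<Rightarrow> complex" where
  "BB k s f = (\<integral>x'. (if x' = 0 then 0 else Dn (2 * k) (\<lambda>x. W s x * f x) (x', 0)) \<partial>lborel)"

lemma BB_rec:
  fixes f :: "'b::euclidean_space \<times> real \<Rightarrow> complex"
  assumes R: "R > 0" and f: "f \<in> tf R" and s: "Re s > 2 * real (Suc k)"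
  shows "BB (Suc k) s f = of_nat (2 * k + 1) * (s * BB k (s - 2) f + BB k s (Pop f))"
proof -
  have 1: "integrable lborel (\<lambda>x'. if x' = 0 then 0 else Dn (2 * k) (\<lambda>x. W (s - 2) x * f x) (x', 0))"
    using s f by (intro Dn_W_integrable[OF R]) auto
  have 2: "integrable lborel (\<lambda>x'. if x' = 0 then 0 else Dn (2 * k) (\<lambda>x. W s x * Pop f x) (x', 0))"
    using s by (intro Dn_W_integrable[OF R] tf_Pop[OF R] f) auto
  have eq: "(\<lambda>x'. if x' = 0 then 0 else Dn (2 * Suc k) (\<lambda>x. W s x * f x) (x', 0)) = (\<lambda>x'. of_nat (2 * k + 1) *
     (s * (if x' = 0 then 0 else Dn (2 * k) (\<lambda>x. W (s - 2) x * f x) (x', 0)) + (if x' = 0 then 0 else Dn (2 * k) (\<lambda>x. W s x * Pop f x) (x', 0))))"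
    using Dn_W_rec[OF R f] by (intro ext) (simp del: pderivs_Cons replicate.simps mult_Suc_right)
  show ?thesis
    unfolding BB_def eq by (simp only: integral_mult_right_zero Bochner_Integration.integral_add[OF integrable_mult_right[OF 1] 2])
qed

lemma SP_zero: "SP 0 t = of_real (sgn t)"
  by (cases "t = 0") (simp_all add: SP_def)

text \<open>One step of \<open>G_shift_first\<close> leads to a = 1, where |x_n| = sgn(x_n) x_n. The
  two integrals combine to that of sgn(x_n) times the normal derivative of W f, which is -2 times an
  integral over the hyperplane; this cancels the factor -1/2 of the recursion.\<close>

lemma G_minus_one:
  fixes f :: "'b::euclidean_space \<times> real \<Rightarrow> complex"
  assumes R: "R > 0" and f: "f \<in> tf R" and z: "Re z > real DIM('b) + 1"
  shows "G (-1) z f = rGamma (z / 2) * BB 0 (z + 1 - dm TYPE('b)) f"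
proof -
  define s where "s = z + 1 - dm TYPE('b)"
  have s: "Re s > 1" using z by (simp add: s_def)
  have e: "z - -1 - dm TYPE('b) = s" "z - 1 - dm TYPE('b) = s - 2" "z + 2 - 1 - dm TYPE('b) = s" "(-1::complex) + 2 = 1"
    by (simp_all add: s_def)
  note f' = tf_pderiv_dir[OF f en_Basis]
  have [measurable]: "f \<in> borel_measurable borel" "pderiv_dir en f \<in> borel_measurable borel" by (rule tf_measurable[OF f] tf_measurable[OF f'])+
  define D where "D = (\<lambda>x. s * (of_real (snd x) * (W (s - 2) x * f x)) + W s x * pderiv_dir en f x)"
  have b1: "norm (SP 0 (snd x) * (of_real (snd x) * (W (s - 2) x * f x))) \<le> R powr (Re s - 1) * sem 0 f" for x :: "'b \<times> real"
  proof (cases "norm x \<le> R \<and> x \<noteq> 0")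
    case True
    have "\<bar>snd x\<bar> * norm x powr (Re s - 2) \<le> norm x * norm x powr (Re s - 2)"
      using norm_snd_le[of "snd x" "fst x"] by (intro mult_right_mono) auto
    also have "\<dots> = norm x powr (Re s - 1)" using True powr_add[of "norm x" 1 "Re s - 2"] by (simp add: powr_one)
    also have "\<dots> \<le> R powr (Re s - 1)" using True s by (intro powr_mono2) auto
    finally have "(\<bar>snd x\<bar> * norm x powr (Re s - 2)) * norm (f x) \<le> R powr (Re s - 1) * sem 0 f"
      using pderivs_le_sem[OF f, of "[]" 0 x] by (intro mult_mono) auto
    moreover have "\<bar>sgn (snd x)\<bar> * ((\<bar>snd x\<bar> * norm x powr (Re s - 2)) * norm (f x)) \<le> (\<bar>snd x\<bar> * norm x powr (Re s - 2)) * norm (f x)"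
      by (intro mult_left_le_one_le) (auto simp: abs_sgn_eq)
    ultimately show ?thesis by (simp add: SP_zero norm_mult norm_W mult.assoc)
  qed (use tf_zero[OF f, of x] sem_nonneg[OF f, of 0] in auto)
  have b2: "norm (SP 0 (snd x) * (W s x * pderiv_dir en f x)) \<le> R powr Re s * sem 0 (pderiv_dir en f)" for x :: "'b \<times> real"
  proof (cases "norm x \<le> R")
    case True
    have "norm (W s x) * norm (pderiv_dir en f x) \<le> R powr Re s * sem 0 (pderiv_dir en f)"
      using True s pderivs_le_sem[OF f', of "[]" 0 x] by (intro mult_mono norm_W_le) auto
    moreover have "\<bar>sgn (snd x)\<bar> * (norm (W s x) * norm (pderiv_dir en f x)) \<le> norm (W s x) * norm (pderiv_dir en f x)"
      by (intro mult_left_le_one_le) (auto simp: abs_sgn_eq)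
    ultimately show ?thesis by (simp add: SP_zero norm_mult)
  qed (use tf_zero[OF f', of x] sem_nonneg[OF f', of 0] in auto)
  have i1: "integrable lborel (\<lambda>x. SP 0 (snd x) * (of_real (snd x) * (W (s - 2) x * f x)))"
    by (rule integrable_bounded_ball[OF _ b1, where R=R]) (use tf_zero[OF f] in \<open>simp_all\<close>)
  have i2: "integrable lborel (\<lambda>x. SP 0 (snd x) * (W s x * pderiv_dir en f x))"
    by (rule integrable_bounded_ball[OF _ b2, where R=R]) (use tf_zero[OF f'] in \<open>simp_all\<close>)
  have II1: "II 1 z f = (\<integral>x. SP 0 (snd x) * (of_real (snd x) * (W (s - 2) x * f x)) \<partial>lborel)"
    unfolding II_def Ker_def e by (intro Bochner_Integration.integral_cong) (auto simp: of_real_mult_SP[of _ 0, simplified, symmetric] mult_ac)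
  have II2: "II 1 (z + 2) (Pop f) = (\<integral>x. SP 0 (snd x) * (W s x * pderiv_dir en f x) \<partial>lborel)"
  proof -
    have "(\<integral>x. (SP 0 (snd x) * W s x) * pderiv_dir en f x \<partial>lborel) = (\<integral>x. (SP 0 (snd x) * W s x) * (of_real (snd x) * Qop (pderiv_dir en f) x) \<partial>lborel)"
      by (rule odd_kernel_Qop) (use i2 tf_smooth[OF f'] in \<open>auto simp: sc_m1 mult.assoc\<close>)
    also have "\<dots> = II 1 (z + 2) (Pop f)"
      unfolding II_def Ker_def e Pop_def by (intro Bochner_Integration.integral_cong) (auto simp: of_real_mult_SP[of _ 0, simplified, symmetric] mult_ac)
    finally show ?thesis by (simp add: mult.assoc)
  qed
  have "G (-1) z f = (-1/2) * (s * G 1 z f + (z / 2) * G 1 (z + 2) (Pop f))"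
    using G_shift_first[OF R f, of "-1" z] unfolding e .
  also have "G 1 z f = rGamma (z / 2) * II 1 z f"
    using z by (subst G_integral[OF R f]) (auto simp: gf_def rGamma_inverse_Gamma)
  also have "(z / 2) * G 1 (z + 2) (Pop f) = rGamma (z / 2) * II 1 (z + 2) (Pop f)"
    using z by (subst G_integral[OF R tf_Pop[OF R f]]) (auto simp: gf_def rGamma_inverse_Gamma[of 1] rGamma_shift[of z])
  also have "s * (rGamma (z / 2) * II 1 z f) + rGamma (z / 2) * II 1 (z + 2) (Pop f) = rGamma (z / 2) * (\<integral>x. of_real (sgn (snd x)) * D x \<partial>lborel)"
  proof -
    have "(\<integral>x. of_real (sgn (snd x)) * D x \<partial>lborel) = (\<integral>x. s * (SP 0 (snd x) * (of_real (snd x) * (W (s - 2) x * f x))) + SP 0 (snd x) * (W s x * pderiv_dir en f x) \<partial>lborel)"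
      unfolding D_def SP_zero by (simp add: algebra_simps)
    also have "\<dots> = s * II 1 z f + II 1 (z + 2) (Pop f)"
      unfolding II1 II2 by (simp only: Bochner_Integration.integral_add[OF integrable_mult_right[OF i1] i2] integral_mult_right_zero)
    finally show ?thesis by (simp add: algebra_simps)
  qed
  also have "(\<integral>x. of_real (sgn (snd x)) * D x \<partial>lborel) = - 2 * (\<integral>x'. W s (x', 0::real) * f (x', 0) \<partial>lborel)"
  proof (rule sgn_integral[where R=R])
    have "integrable lborel (\<lambda>x. s * (SP 0 (snd x) * (of_real (snd x) * (W (s - 2) x * f x))) + SP 0 (snd x) * (W s x * pderiv_dir en f x))"
      by (intro Bochner_Integration.integrable_add integrable_mult_right i1 i2)
    then show "integrable lborel (\<lambda>x. of_real (sgn (snd x)) * D x)"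
      by (simp add: D_def SP_zero algebra_simps)
    fix x' :: 'b and u :: real assume x': "x' \<noteq> 0"
    have sW: "smooth_on U0 (\<lambda>x. W t x * g x)" if "smooth g" for g t
      using that by (intro smooth_on_mult smooth_on_W smooth_on_UNIV_D) auto
    have "((\<lambda>t. (\<lambda>x. W s x * f x) ((x', 0) + t *\<^sub>R en)) has_vector_derivative pderiv_dir en (\<lambda>x. W s x * f x) ((x', 0) + u *\<^sub>R en)) (at u)"
      by (rule smooth_line_derivative[OF sW[OF tf_smooth[OF f]]]) (use x' in auto)
    then show "((\<lambda>u. W s (x', u) * f (x', u)) has_vector_derivative D (x', u)) (at u)"
      using pderiv_en_W_mult[OF tf_smooth[OF f], of "(x', u)" s] x' by (simp add: D_def)
    have "smooth_on U0 D" unfolding D_def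
      by (intro smooth_on_add smooth_on_mult[OF open_U0 smooth_on_const] smooth_on_mult[OF open_U0 smooth_on_UNIV_D[OF smooth_snd]] sW tf_smooth[OF f] tf_smooth[OF f'] open_U0)
    moreover have "continuous_on UNIV (\<lambda>u::real. (x', u))" by (intro continuous_on_Pair continuous_on_const continuous_on_id)
    ultimately show "continuous_on UNIV (\<lambda>u. D (x', u))"
      by (rule continuous_on_compose2[OF smooth_on_continuous]) (use x' in auto)
  next
    show "(\<lambda>x'. W s (x', 0::real) * f (x', 0)) \<in> borel_measurable borel" by (rule W_slice_measurable) measurable
  qed (auto simp: D_def tf_zero[OF f] tf_zero[OF f'])
  also have "(\<integral>x'. W s (x', 0::real) * f (x', 0) \<partial>lborel) = BB 0 s f"
  proof -
    have m1: "(\<lambda>x'::'b. W s (x', 0::real) * f (x', 0)) \<in> borel_measurable lborel"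
      using W_slice_measurable[OF \<open>f \<in> borel_measurable borel\<close>] by simp
    have m2: "(\<lambda>x'::'b. if x' = 0 then 0 else W s (x', 0::real) * f (x', 0)) \<in> borel_measurable lborel"
      by (intro measurable_If m1) auto
    have ae: "AE x' in lborel. W s (x', 0::real) * f (x', 0) = (if x' = 0 then 0 else W s (x', 0::real) * f (x', 0))"
      by (rule eventually_mono[OF AE_nonzero]) simp
    show ?thesis
      unfolding BB_def mult_0_right replicate_0 pderivs_Nil by (rule integral_cong_AE[OF m1 m2 ae])
  qed
  finally show ?thesis by (simp add: s_def)
qed

text \<open>Induction by \<open>G_shift_first\<close> and \<open>BB_rec\<close>. The step from k to
  k + 1 contributes -1 / (2 (2k+1)), and the product of these factors is (-1)^k k! / (2k)!.\<close>

lemma G_at_odd: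
  fixes f :: "'b::euclidean_space \<times> real \<Rightarrow> complex"
  assumes R: "R > 0"
  shows "f \<in> tf R \<Longrightarrow> Re z > real DIM('b) + 1 \<Longrightarrow>
    G (- 1 - 2 * of_nat k) z f = (-1) ^ k * fact k / fact (2 * k) * rGamma (z / 2) * BB k (z + 1 + 2 * of_nat k - dm TYPE('b)) f"
proof (induction k arbitrary: f z)
  case 0
  then show ?case using G_minus_one[OF R 0] by simp
next
  case (Suc k)
  define s where "s = z + 1 + 2 * of_nat (Suc k) - dm TYPE('b)"
  define c where "c = ((-1) ^ k * fact k / fact (2 * k) :: complex)"
  have e: "z - (- 1 - 2 * of_nat (Suc k)) - dm TYPE('b) = s" "- 1 - 2 * of_nat (Suc k) + 2 = (- 1 - 2 * of_nat k :: complex)"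
    "z + 1 + 2 * of_nat k - dm TYPE('b) = s - 2" "z + 2 + 1 + 2 * of_nat k - dm TYPE('b) = s"
    by (simp_all add: s_def algebra_simps)
  have s: "Re s > 2 * real (Suc k)" using Suc.prems by (simp add: s_def)
  have z2: "Re (z + 2) > real DIM('b) + 1" using Suc.prems by simp
  have "G (- 1 - 2 * of_nat (Suc k)) z f = (-1/2) * (s * G (- 1 - 2 * of_nat k) z f + (z / 2) * G (- 1 - 2 * of_nat k) (z + 2) (Pop f))"
    using G_shift_first[OF R Suc.prems(1), of "- 1 - 2 * of_nat (Suc k)" z] unfolding e .
  also have "\<dots> = (-1/2) * (s * (c * rGamma (z / 2) * BB k (s - 2) f) + (z / 2) * (c * rGamma ((z + 2) / 2) * BB k s (Pop f)))"
    unfolding Suc.IH[OF Suc.prems] Suc.IH[OF tf_Pop[OF R Suc.prems(1)] z2] e c_def ..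
  also have "(z / 2) * (c * rGamma ((z + 2) / 2) * BB k s (Pop f)) = c * rGamma (z / 2) * BB k s (Pop f)"
    unfolding rGamma_shift[of z] by simp
  also have "(-1/2) * (s * (c * rGamma (z / 2) * BB k (s - 2) f) + c * rGamma (z / 2) * BB k s (Pop f))
     = ((-1/2) * c) * rGamma (z / 2) * (s * BB k (s - 2) f + BB k s (Pop f))" by (simp add: algebra_simps)
  also have "s * BB k (s - 2) f + BB k s (Pop f) = BB (Suc k) s f / of_nat (2 * k + 1)"
    using BB_rec[OF R Suc.prems(1) s] of_nat_eq_0_iff[of "2 * k + 1", where 'a=complex] by (simp add: field_simps)
  also have "((-1/2) * c) * rGamma (z / 2) * (BB (Suc k) s f / of_nat (2 * k + 1)) = ((-1/2) * c / of_nat (2 * k + 1)) * rGamma (z / 2) * BB (Suc k) s f"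
    by simp
  also have "(-1/2) * c / of_nat (2 * k + 1) = (-1) ^ Suc k * fact (Suc k) / fact (2 * Suc k)"
  proof -
    define K where "K = (of_nat (Suc k) :: complex)"
    define M where "M = (of_nat (2 * k + 1) :: complex)"
    have nz: "K \<noteq> 0" "M \<noteq> 0" "(fact (2 * k) :: complex) \<noteq> 0"
      unfolding K_def M_def by (simp_all del: of_nat_Suc add: of_nat_eq_0_iff del: of_nat_add of_nat_mult)
    have f1: "fact (2 * Suc k) = 2 * K * M * (fact (2 * k) :: complex)" by (simp add: K_def M_def algebra_simps)
    have f2: "fact (Suc k) = K * (fact k :: complex)" by (simp add: K_def)
    show ?thesis unfolding c_def f1 f2 M_def[symmetric] using nz by (simp add: divide_simps)
  qed
  finally show ?case by (simp add: s_def)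
qed

section \<open>The line z = a + n: powers of x_n alone\<close>

lemma Re_pos_not_nonpos_Ints: "Re w > 0 \<Longrightarrow> w \<notin> \<int>\<^sub>\<le>\<^sub>0"
  by (auto simp: nonpos_Ints_def)

text \<open>Multiplying \<open>G\<close> on the line z = a + n by Gamma(z/2) makes sense only off
  the poles of Gamma. There the first term of \<open>G_shift_first\<close> drops and the other
  carries the factor z/2, which the functional equation of Gamma absorbs; after \<open>N\<close>
  steps the Gamma factor is regular for Re (a + n) > -2N.\<close>

definition HN :: "nat \<Rightarrow> complex \<Rightarrow> ('b::euclidean_space \<times> real \<Rightarrow> complex) \<Rightarrow> complex" where
  "HN N a f = (-1/2) ^ N * Gamma ((a + 2 * of_nat N + dm TYPE('b)) / 2) * G (a + 2 * of_nat N) (a + 2 * of_nat N + dm TYPE('b)) ((Pop ^^ N) f)"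

lemma cop_Popn: "cop (\<lambda>f. (Pop ^^ N) f)"
  by (induction N) (auto intro: cop_id cop_comp[OF cop_Pop])

lemma tf_Popn: "R > 0 \<Longrightarrow> f \<in> tf R \<Longrightarrow> (Pop ^^ N) f \<in> tf R"
  using cop_tf[OF cop_Popn] .

lemma HN_Suc:
  fixes f :: "'b::euclidean_space \<times> real \<Rightarrow> complex"
  assumes R: "R > 0" and f: "f \<in> tf R" and a: "Re (a + 2 * of_nat N + dm TYPE('b)) > 0"
  shows "HN (Suc N) a f = HN N a f"
proof -
  define c where "c = a + 2 * of_nat N"
  define g where "g = (Pop ^^ N) f"
  define w where "w = (c + dm TYPE('b)) / 2"
  have w: "Re w > 0" using a by (simp add: w_def c_def)
  have g: "g \<in> tf R" unfolding g_def by (rule tf_Popn[OF R f])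
  have e: "a + 2 * of_nat (Suc N) = c + 2" "c + 2 + dm TYPE('b) = c + dm TYPE('b) + 2" "(c + dm TYPE('b) + 2) / 2 = w + 1"
    by (simp_all add: c_def w_def field_simps)
  have "G c (c + dm TYPE('b)) g = (-1/2) * (w * G (c + 2) (c + dm TYPE('b) + 2) (Pop g))"
    using G_shift_first[OF R g, of c "c + dm TYPE('b)"] by (simp add: w_def)
  then have "HN N a f = (-1/2) ^ N * Gamma w * ((-1/2) * (w * G (c + 2) (c + dm TYPE('b) + 2) (Pop g)))"
    unfolding HN_def c_def[symmetric] g_def[symmetric] w_def by simp
  also have "\<dots> = (-1/2) ^ Suc N * (w * Gamma w) * G (c + 2) (c + dm TYPE('b) + 2) (Pop g)" by simp
  also have "w * Gamma w = Gamma (w + 1)"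
    using w by (intro Gamma_plus1[symmetric] Re_pos_not_nonpos_Ints)
  also have "(-1/2) ^ Suc N * Gamma (w + 1) * G (c + 2) (c + dm TYPE('b) + 2) (Pop g) = HN (Suc N) a f"
    unfolding HN_def e g_def by simp
  finally show ?thesis ..
qed

lemma HN_add:
  fixes f :: "'b::euclidean_space \<times> real \<Rightarrow> complex"
  assumes R: "R > 0" and f: "f \<in> tf R" and a: "Re (a + 2 * of_nat N + dm TYPE('b)) > 0"
  shows "HN (N + k) a f = HN N a f"
proof (induction k)
  case (Suc k)
  have "Re (a + 2 * of_nat (N + k) + dm TYPE('b)) > 0" using a by simp
  from HN_Suc[OF R f this] Suc show ?case by simp
qed simp

text \<open>The entire continuation of |x_n|^a / Gamma((a+1)/2), see \<open>H0_G0\<close> and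
  \<open>H0_holomorphic\<close>.\<close>

definition H0 :: "complex \<Rightarrow> ('b::euclidean_space \<times> real \<Rightarrow> complex) \<Rightarrow> complex" where
  "H0 a f = HN (nat \<lceil>norm a\<rceil>) a f"

lemma H0_lev: "Re (a + 2 * of_nat (nat \<lceil>norm a\<rceil>) + dm TYPE('b::euclidean_space)) > 0"
proof -
  define k where "k = nat \<lceil>norm a\<rceil>"
  have "real k \<ge> norm a" unfolding k_def by linarith
  then have "Re a + 2 * real k + (real DIM('b) + 1) > 0" using abs_Re_le_cmod[of a] norm_ge_zero[of a] by linarith
  then show ?thesis unfolding k_def[symmetric] by (simp add: add.commute add.left_commute)
qed

lemma H0_eq:
  fixes f :: "'b::euclidean_space \<times> real \<Rightarrow> complex"
  assumes R: "R > 0" and f: "f \<in> tf R" and a: "Re (a + 2 * of_nat N + dm TYPE('b)) > 0"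
  shows "H0 a f = HN N a f"
proof -
  define k where "k = nat \<lceil>norm a\<rceil>"
  have k: "Re (a + 2 * of_nat k + dm TYPE('b)) > 0" unfolding k_def by (rule H0_lev)
  have "HN k a f = HN N a f"
  proof (cases "N \<le> k")
    case True
    then show ?thesis using HN_add[OF R f a, of "k - N"] by simp
  next
    case False
    then show ?thesis using HN_add[OF R f k, of "N - k"] by simp
  qed
  then show ?thesis by (simp add: H0_def k_def)
qed

lemma cfn_H0: "cfn (H0 a)"
  unfolding H0_def[abs_def] HN_def[abs_def] by (intro cfn_scale cfn_comp[OF cfn_G] cop_Popn)

lemma H0_holomorphic:
  fixes f :: "'b::euclidean_space \<times> real \<Rightarrow> complex"
  assumes R: "R > 0" and f: "f \<in> tf R"
  shows "(\<lambda>a. H0 a f) holomorphic_on UNIV"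
proof (rule holomorphic_onI)
  fix a :: complex
  define N where "N = nat \<lceil>norm a\<rceil>"
  define S where "S = {a. Re (a + 2 * of_nat N + dm TYPE('b)) > 0}"
  have S: "open S" unfolding S_def by (intro open_Collect_less continuous_intros)
  have a: "a \<in> S" using H0_lev[of a, where 'b='b] by (simp add: S_def N_def)
  have "(\<lambda>a. HN N a f) holomorphic_on S"
    unfolding HN_def
  proof (intro holomorphic_on_mult holomorphic_on_const)
    show "(\<lambda>a. Gamma ((a + 2 * of_nat N + dm TYPE('b)) / 2)) holomorphic_on S"
      by (rule holomorphic_on_compose_gen[of _ S Gamma "{w. Re w > 0}", unfolded o_def])
        (auto intro!: holomorphic_intros holomorphic_Gamma simp: S_def nonpos_Ints_def)
    show "(\<lambda>a. G (a + 2 * of_nat N) (a + 2 * of_nat N + dm TYPE('b)) ((Pop ^^ N) f)) holomorphic_on S"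
    proof -
      have u: "(\<lambda>a. a + 2 * of_nat N) holomorphic_on S" and v: "(\<lambda>a. a + 2 * of_nat N + dm TYPE('b)) holomorphic_on S"
        by (intro holomorphic_intros)+
      from hol2_slice[OF G_hol2[OF R tf_Popn[OF R f]] S u v] show ?thesis by simp
    qed
  qed
  then have "(\<lambda>a. H0 a f) holomorphic_on S"
    by (rule holomorphic_transform) (use H0_eq[OF R f] in \<open>auto simp: S_def\<close>)
  then show "(\<lambda>a. H0 a f) field_differentiable at a within UNIV"
    using a S by (simp add: holomorphic_on_open field_differentiable_def)
qed

lemma H0_shift:
  fixes f :: "'b::euclidean_space \<times> real \<Rightarrow> complex"
  assumes R: "R > 0" and f: "f \<in> tf R"
  shows "H0 a f = (-1/2) * H0 (a + 2) (Pop f)"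
proof -
  define N where "N = nat \<lceil>norm (a + 2)\<rceil>"
  have e: "a + 2 + 2 * of_nat N = a + 2 * of_nat (Suc N)" by simp
  have p: "Re (a + 2 * of_nat (Suc N) + dm TYPE('b)) > 0" using H0_lev[of "a + 2", where 'b='b] unfolding N_def[symmetric] e .
  have "H0 (a + 2) (Pop f) = HN N (a + 2) (Pop f)" by (simp add: H0_def N_def)
  moreover have "HN (Suc N) a f = (-1/2) * HN N (a + 2) (Pop f)"
    unfolding HN_def e by (simp only: funpow_Suc_right o_def power_Suc mult.assoc)
  ultimately show ?thesis using H0_eq[OF R f p] by simp
qed

lemma H0_G0:
  fixes f :: "'b::euclidean_space \<times> real \<Rightarrow> complex"
  assumes R: "R > 0" and f: "f \<in> tf R" and a: "Re a > -1"
  shows "H0 a f = rGamma ((a + 1) / 2) * II a (a + dm TYPE('b)) f"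
proof -
  have p: "Re (a + dm TYPE('b)) > 0" using a by simp
  then have "(a + dm TYPE('b)) / 2 \<notin> \<int>\<^sub>\<le>\<^sub>0" by (intro Re_pos_not_nonpos_Ints) simp
  then have "Gamma ((a + dm TYPE('b)) / 2) * rGamma ((a + dm TYPE('b)) / 2) = 1"
    by (simp add: rGamma_inverse_Gamma Gamma_eq_zero_iff)
  then show ?thesis
    using H0_eq[OF R f, of a 0] p G_integral[OF R f a p] by (simp add: HN_def gf_def mult_ac)
qed

lemma W_even: "x \<noteq> 0 \<Longrightarrow> W (2 * of_nat j) x = of_real ((norm x)\<^sup>2) ^ j"
proof (induction j)
  case (Suc j)
  then show ?case using norm_sq_W[of x "2 * of_nat (Suc j)"] by (simp add: algebra_simps)
qed (simp add: W_def)

lemma tf_norm_sq_power: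
  fixes f :: "'b::euclidean_space \<Rightarrow> complex"
  shows "R > 0 \<Longrightarrow> f \<in> tf R \<Longrightarrow> (\<lambda>x. complex_of_real ((norm x)\<^sup>2) ^ j * f x) \<in> tf R"
  using cop_tf[OF cop_norm_sq_power] .

text \<open>At these parameters the power of |x| is the polynomial |x|^(2j) off the origin, so it
  can be handed to the test function.\<close>

lemma II_even_norm:
  fixes f :: "'b::euclidean_space \<times> real \<Rightarrow> complex"
  assumes f: "f \<in> tf R"
  shows "II a (a + dm TYPE('b) + 2 * of_nat j) f = II a (a + dm TYPE('b)) (\<lambda>x. of_real ((norm x)\<^sup>2) ^ j * f x)"
proof -
  let ?h = "\<lambda>x. complex_of_real ((norm x)\<^sup>2) ^ j * f x"
  have [measurable]: "f \<in> borel_measurable borel" by (rule tf_measurable[OF f])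
    show ?thesis
      unfolding II_def
    proof (rule integral_cong_AE)
      show "AE x in lborel. Ker a (a + dm TYPE('b) + 2 * of_nat j) x * f x = Ker a (a + dm TYPE('b)) x * ?h x"
        using AE_snd_nonzero
      proof eventually_elim
        case (elim x)
        then have "x \<noteq> 0" by auto
        then show ?case using W_even[of x j] W_even[of x 0] by (simp add: Ker_def)
      qed
      show "(\<lambda>x. Ker a (a + dm TYPE('b) + 2 * of_nat j) x * f x) \<in> borel_measurable lborel" by measurable
      show "(\<lambda>x. Ker a (a + dm TYPE('b)) x * ?h x) \<in> borel_measurable lborel" by measurable
    qed
qed

text \<open>Both sides are entire in \<open>a\<close>, and for Re a > 0 they are the same integral
  with the same Gamma factors.\<close>

lemma G_even_norm:
  fixes f :: "'b::euclidean_space \<times> real \<Rightarrow> complex"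
  assumes R: "R > 0" and f: "f \<in> tf R"
  shows "G a (a + dm TYPE('b) + 2 * of_nat j) f =
     rGamma ((a + dm TYPE('b) + 2 * of_nat j) / 2) * H0 a (\<lambda>x. of_real ((norm x)\<^sup>2) ^ j * f x)"
proof -
  let ?h = "\<lambda>x. complex_of_real ((norm x)\<^sup>2) ^ j * f x"
  have h: "?h \<in> tf R" by (rule tf_norm_sq_power[OF R f])
  have [measurable]: "f \<in> borel_measurable borel" by (rule tf_measurable[OF f])
  show ?thesis
  proof (rule analytic_continuation_open[of "{a. Re a > 0}" UNIV "\<lambda>a. G a (a + dm TYPE('b) + 2 * of_nat j) f"])
    show "(\<lambda>a. G a (a + dm TYPE('b) + 2 * of_nat j) f) holomorphic_on UNIV"
    proof -
      have "(\<lambda>a. a + dm TYPE('b) + 2 * of_nat j) holomorphic_on UNIV" by (intro holomorphic_intros)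
      from hol2_slice[OF G_hol2[OF R f] open_UNIV holomorphic_on_ident this] show ?thesis by simp
    qed
    show "(\<lambda>a. rGamma ((a + dm TYPE('b) + 2 * of_nat j) / 2) * H0 a ?h) holomorphic_on UNIV"
      by (intro holomorphic_on_mult H0_holomorphic[OF R h])
        (auto intro!: holomorphic_intros holomorphic_on_compose_gen[OF _ holomorphic_rGamma, unfolded o_def])
    show "open {a. Re a > 0}" by (intro open_Collect_less continuous_intros)
    show "{a. Re a > 0} \<noteq> {}" by (auto intro!: exI[of _ 1])
    fix a :: complex assume a: "a \<in> {a. Re a > 0}"
    note eq = II_even_norm[OF f, of a j]
    show "G a (a + dm TYPE('b) + 2 * of_nat j) f = rGamma ((a + dm TYPE('b) + 2 * of_nat j) / 2) * H0 a ?h"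
    proof -
      have "H0 a ?h = rGamma ((a + 1) / 2) * II a (a + dm TYPE('b)) ?h" using a by (intro H0_G0[OF R h]) auto
      moreover have "G a (a + dm TYPE('b) + 2 * of_nat j) f = gf a (a + dm TYPE('b) + 2 * of_nat j) * II a (a + dm TYPE('b) + 2 * of_nat j) f"
        using a by (intro G_integral[OF R f]) auto
      ultimately show ?thesis unfolding eq gf_def by (simp only: mult_ac)
    qed
  qed auto
qed

text \<open>As for \<open>G_minus_one\<close>: shift to a = 1, read |x_n| as sgn(x_n) x_n, undo
  \<open>Qop\<close>, and integrate the normal derivative against the sign.\<close>

lemma H0_minus_one:
  fixes f :: "'b::euclidean_space \<times> real \<Rightarrow> complex"
  assumes R: "R > 0" and f: "f \<in> tf R"
  shows "H0 (-1) f = (\<integral>x'. f (x', 0) \<partial>lborel)"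
proof -
  note f' = tf_pderiv_dir[OF f en_Basis]
  have m[measurable]: "f \<in> borel_measurable borel" "pderiv_dir en f \<in> borel_measurable borel" by (rule tf_measurable[OF f] tf_measurable[OF f'])+
  have i: "integrable lborel (\<lambda>x. SP 0 (snd x) * pderiv_dir en f x)"
  proof (rule integrable_bounded_ball[where R=R and B="sem 0 (pderiv_dir en f)"])
    fix x
    have "\<bar>sgn (snd x)\<bar> * norm (pderiv_dir en f x) \<le> 1 * sem 0 (pderiv_dir en f)"
      using pderivs_le_sem[OF f', of "[]" 0 x] by (intro mult_mono) (auto simp: abs_sgn_eq)
    then show "norm (SP 0 (snd x) * pderiv_dir en f x) \<le> sem 0 (pderiv_dir en f)" by (simp add: SP_zero norm_mult)
  qed (use tf_zero[OF f'] in simp_all)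
  have "H0 (-1) f = (-1/2) * H0 1 (Pop f)" using H0_shift[OF R f, of "-1"] by simp
  also have "H0 1 (Pop f) = II 1 (1 + dm TYPE('b)) (Pop f)"
    by (subst H0_G0[OF R tf_Pop[OF R f]]) (auto simp: rGamma_inverse_Gamma)
  also have "\<dots> = (\<integral>x. SP 0 (snd x) * (of_real (snd x) * Qop (pderiv_dir en f) x) \<partial>lborel)"
    unfolding II_def
  proof (rule integral_cong_AE)
    have mQ[measurable]: "Pop f \<in> borel_measurable borel" "Qop (pderiv_dir en f) \<in> borel_measurable borel"
      by (rule tf_measurable[OF tf_Pop[OF R f]] tf_measurable[OF tf_Qop[OF R f']])+
    show "(\<lambda>x. Ker 1 (1 + dm TYPE('b)) x * Pop f x) \<in> borel_measurable lborel" by measurable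
    show "(\<lambda>x. SP 0 (snd x) * (of_real (snd x) * Qop (pderiv_dir en f) x)) \<in> borel_measurable lborel" by measurable
    show "AE x in lborel. Ker 1 (1 + dm TYPE('b)) x * Pop f x = SP 0 (snd x) * (of_real (snd x) * Qop (pderiv_dir en f) x)"
      using AE_snd_nonzero
    proof eventually_elim
      case (elim x)
      then have "x \<noteq> 0" by auto
      then show ?case using W_even[of x 0] of_real_mult_SP[of "snd x" 0] by (simp add: Ker_def Pop_def mult_ac flip: mult.assoc)
    qed
  qed
  also have "\<dots> = (\<integral>x. SP 0 (snd x) * pderiv_dir en f x \<partial>lborel)"
    by (rule odd_kernel_Qop[symmetric]) (use i tf_smooth[OF f'] in \<open>auto simp: sc_m1\<close>)
  also have "\<dots> = - 2 * (\<integral>x'. f (x', 0) \<partial>lborel)"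
    unfolding SP_zero
  proof (rule sgn_integral[where R=R])
    fix x' :: 'b and u :: real
    have "((\<lambda>t. f ((x', 0) + t *\<^sub>R en)) has_vector_derivative pderiv_dir en f ((x', 0) + u *\<^sub>R en)) (at u)"
      by (rule smooth_line_derivative[OF tf_smooth_on[OF f]]) auto
    then show "((\<lambda>u. f (x', u)) has_vector_derivative pderiv_dir en f (x', u)) (at u)" by simp
    have "continuous_on UNIV (\<lambda>u::real. (x', u))" by (intro continuous_on_Pair continuous_on_const continuous_on_id)
    then show "continuous_on UNIV (\<lambda>u. pderiv_dir en f (x', u))"
      by (rule continuous_on_compose2[OF tf_continuous[OF f', of UNIV]]) auto
  next
    show "(\<lambda>x'. f (x', 0)) \<in> borel_measurable borel" by (rule measurable_compose[OF measurable_emb m(1)])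
  qed (use i tf_zero[OF f] tf_zero[OF f'] in \<open>auto simp: SP_zero\<close>)
  finally show ?thesis by simp
qed

lemma fact_ratio: "(-1/2) * ((-1) ^ k * fact k / fact (2 * k)) / of_nat (2 * k + 1) = ((-1) ^ Suc k * fact (Suc k) / fact (2 * Suc k) :: complex)"
proof -
  define K where "K = (of_nat (Suc k) :: complex)"
  define M where "M = (of_nat (2 * k + 1) :: complex)"
  have nz: "K \<noteq> 0" "M \<noteq> 0" "(fact (2 * k) :: complex) \<noteq> 0"
    unfolding K_def M_def by (simp_all del: of_nat_Suc add: of_nat_eq_0_iff del: of_nat_add of_nat_mult)
  have f1: "fact (2 * Suc k) = 2 * K * M * (fact (2 * k) :: complex)" by (simp add: K_def M_def algebra_simps)
  have f2: "fact (Suc k) = K * (fact k :: complex)" by (simp add: K_def)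
  show ?thesis unfolding f1 f2 M_def[symmetric] using nz by (simp add: divide_simps)
qed

lemma H0_at_odd:
  fixes f :: "'b::euclidean_space \<times> real \<Rightarrow> complex"
  assumes R: "R > 0"
  shows "f \<in> tf R \<Longrightarrow> H0 (- 1 - 2 * of_nat k) f = (-1) ^ k * fact k / fact (2 * k) * (\<integral>x'. Dn (2 * k) f (x', 0) \<partial>lborel)"
proof (induction k arbitrary: f)
  case 0
  then show ?case using H0_minus_one[OF R] by simp
next
  case (Suc k)
  have e: "- 1 - 2 * of_nat (Suc k) + 2 = (- 1 - 2 * of_nat k :: complex)" by simp
  have "H0 (- 1 - 2 * of_nat (Suc k)) f = (-1/2) * H0 (- 1 - 2 * of_nat k) (Pop f)"
    using H0_shift[OF R Suc.prems, of "- 1 - 2 * of_nat (Suc k)"] unfolding e .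
  also have "\<dots> = (-1/2) * ((-1) ^ k * fact k / fact (2 * k) * (\<integral>x'. Dn (2 * k) (Pop f) (x', 0) \<partial>lborel))"
    by (subst Suc.IH[OF tf_Pop[OF R Suc.prems]]) simp
  also have "(\<integral>x'. Dn (2 * k) (Pop f) (x', 0) \<partial>lborel) = (\<integral>x'. Dn (2 * Suc k) f (x', 0) \<partial>lborel) / of_nat (2 * k + 1)"
    using lappn_Pop[OF tf_smooth[OF Suc.prems], of "(x', 0)" 0 k for x'] by (simp del: pderivs_Cons replicate.simps)
  also have "(-1/2) * ((-1) ^ k * fact k / fact (2 * k) * ((\<integral>x'. Dn (2 * Suc k) f (x', 0) \<partial>lborel) / of_nat (2 * k + 1)))
     = ((-1/2) * ((-1) ^ k * fact k / fact (2 * k)) / of_nat (2 * k + 1)) * (\<integral>x'. Dn (2 * Suc k) f (x', 0) \<partial>lborel)" by simp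
  finally show ?case unfolding fact_ratio .
qed

section \<open>Functions vanishing near the hyperplane\<close>

lemma powr_between: "0 < e \<Longrightarrow> e \<le> t \<Longrightarrow> t \<le> R \<Longrightarrow> t powr c \<le> e powr c + R powr (c::real)"
proof (cases "c \<ge> 0")
  case True
  assume "0 < e" "e \<le> t" "t \<le> R"
  then show ?thesis using powr_mono2[OF True, of t R] by (simp add: add_increasing)
next
  case False
  assume "0 < e" "e \<le> t" "t \<le> R"
  then show ?thesis using powr_mono2'[of c e t] False by (simp add: add_increasing2)
qed

lemma Ker_integrable_off:
  fixes f :: "'b::euclidean_space \<times> real \<Rightarrow> complex"
  assumes f: "f \<in> tf R" and e: "e > 0" and off: "\<And>x. \<bar>snd x\<bar> < e \<Longrightarrow> f x = 0"
  shows "integrable lborel (\<lambda>x. Ker a z x * f x)"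
proof -
  define c where "c = Re z - Re a - (real DIM('b) + 1)"
  have [measurable]: "f \<in> borel_measurable borel" by (rule tf_measurable[OF f])
  show ?thesis
  proof (rule integrable_bounded_ball[where R=R and B="((e powr Re a + R powr Re a) * (e powr c + R powr c)) * sem 0 f"])
    fix x :: "'b \<times> real"
    show "norm (Ker a z x * f x) \<le> ((e powr Re a + R powr Re a) * (e powr c + R powr c)) * sem 0 f"
    proof (cases "e \<le> \<bar>snd x\<bar> \<and> norm x \<le> R")
      case True
      then have u: "e \<le> \<bar>snd x\<bar>" "norm x \<le> R" by auto
      have n: "\<bar>snd x\<bar> \<le> norm x" using norm_snd_le[of "snd x" "fst x"] by simp
      have "norm (Ker a z x) \<le> (e powr Re a + R powr Re a) * (e powr c + R powr c)"
        unfolding norm_Ker c_def[symmetric] using u n e by (intro mult_mono powr_between) auto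
      then show ?thesis using pderivs_le_sem[OF f, of "[]" 0 x] unfolding norm_mult by (intro mult_mono) auto
    next
      case False
      then have "f x = 0" using off[of x] tf_zero[OF f, of x] by auto
      then show ?thesis using sem_nonneg[OF f, of 0] by simp
    qed
  qed (use tf_zero[OF f] in simp_all)
qed

text \<open>For such \<open>f\<close> the integral converges at all parameters and is entire in
  them, so the formula of \<open>G_integral\<close> continues.\<close>

lemma G_off:
  fixes f :: "'b::euclidean_space \<times> real \<Rightarrow> complex"
  assumes R: "R > 0" and f: "f \<in> tf R" and e: "e > 0" and off: "\<And>x. \<bar>snd x\<bar> < e \<Longrightarrow> f x = 0"
  shows "G a z f = gf a z * II a z f"
proof -
  have "G (fst (a, z)) (snd (a, z)) f = gf (fst (a, z)) (snd (a, z)) * II (fst (a, z)) (snd (a, z)) f"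
  proof (rule hol2_identity[OF open_UNIV convex_UNIV G_hol2[OF R f] _ open_dom[of 0] subset_UNIV])
    show "hol2 UNIV (\<lambda>p. gf (fst p) (snd p) * II (fst p) (snd p) f)"
      by (intro hol2_mult gf_hol2 II_hol2 open_UNIV tf_measurable[OF f] Ker_integrable_off[OF f e off])
    show "dom 0 \<noteq> {}" using dom_iff[of 1 1 0] by auto
    fix p assume "p \<in> dom 0"
    then show "G (fst p) (snd p) f = gf (fst p) (snd p) * II (fst p) (snd p) f"
      by (intro G_integral[OF R f]) (auto simp: dom_def)
  qed auto
  then show ?thesis by simp
qed

section \<open>Bump functions\<close>

text \<open>A family closed under differentiation up to linear combinations, see
  \<open>gk_derivative\<close>. All its members serve as generators when
  \<open>smooth_on_alg\<close> proves the bump smooth.\<close>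

definition gk :: "nat \<Rightarrow> real \<Rightarrow> real" where
  "gk k t = (if t > 0 then exp (- 1 / t) / t ^ k else 0)"

text \<open>Raise u <= exp u at u = 1/(tm) to the power m = k + 2: the exponential then beats t^(-k)
  by two powers of t. Quadratic decay makes the derivative at 0 vanish.\<close>

lemma gk_bound: "\<bar>gk k t\<bar> \<le> real (k + 2) ^ (k + 2) * t\<^sup>2"
proof (cases "t > 0")
  case True
  define m where "m = k + 2"
  have m: "real m > 0" by (simp add: m_def)
  have "1 / (t * m) \<le> exp (1 / (t * m))" using exp_ge_add_one_self[of "1 / (t * real m)"] by linarith
  then have "(1 / (t * m)) ^ m \<le> exp (1 / (t * m)) ^ m" using True m by (intro power_mono) auto
  also have "\<dots> = exp (1 / t)" using m by (simp add: exp_of_nat_mult[symmetric])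
  finally have "exp (- (1 / t)) \<le> (t * m) ^ m" using True m
    by (simp add: exp_minus power_divide field_simps)
  then have "exp (- 1 / t) / t ^ k \<le> (t * m) ^ m / t ^ k" using True by (intro divide_right_mono) auto
  also have "\<dots> = real m ^ m * t\<^sup>2" using True by (simp add: m_def power_mult_distrib power_add power2_eq_square)
  finally show ?thesis using True by (simp add: gk_def m_def)
qed (simp add: gk_def)

lemma gk_derivative: "(gk k has_real_derivative (gk (k + 2) t - of_nat k * gk (k + 1) t)) (at t)"
proof (cases t "0::real" rule: linorder_cases)
  case greater
  have "((\<lambda>t. exp (- 1 / t) / t ^ k) has_real_derivative (gk (k + 2) t - of_nat k * gk (k + 1) t)) (at t)"
  proof -
    have p: "((\<lambda>t. t ^ k) has_real_derivative (of_nat k * t ^ k / t)) (at t)"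
      using greater DERIV_pow[of k t] by (cases k) simp_all
    have e: "((\<lambda>t. exp (- 1 / t)) has_real_derivative (exp (- 1 / t) / t\<^sup>2)) (at t)"
      using greater by (auto intro!: derivative_eq_intros simp: power2_eq_square)
    have nz: "t ^ k \<noteq> 0" using greater by simp
    define E P where "E = exp (- 1 / t)" and "P = t ^ k"
    have "(E / t\<^sup>2 * P - E * (of_nat k * P / t)) / (P * P) = E / (P * t\<^sup>2) - of_nat k * (E / (P * t))"
      using nz greater by (simp add: P_def[symmetric] field_simps power2_eq_square)
    then show ?thesis
      using DERIV_divide[OF e p nz] greater
      by (simp add: gk_def E_def P_def power_add power2_eq_square mult_ac)
  qed
  then show ?thesis
    by (rule has_field_derivative_transform_within_open[OF _ open_greaterThan[of 0]]) (use greater in \<open>auto simp: gk_def\<close>)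
next
  case less
  have "((\<lambda>t. 0) has_real_derivative (gk (k + 2) t - of_nat k * gk (k + 1) t)) (at t)"
    using less by (simp add: gk_def)
  then show ?thesis
    by (rule has_field_derivative_transform_within_open[OF _ open_lessThan[of 0]]) (use less in \<open>auto simp: gk_def\<close>)
next
  case equal
  define C where "C = real (k + 2) ^ (k + 2)"
  have "((\<lambda>h. (gk k (0 + h) - gk k 0) / h) \<longlongrightarrow> 0) (at 0)"
  proof (rule Lim_null_comparison)
    show "\<forall>\<^sub>F h in at 0. norm ((gk k (0 + h) - gk k 0) / h) \<le> C * \<bar>h\<bar>"
      unfolding eventually_at
    proof (intro exI[of _ 1] conjI ballI impI)
      fix h :: real assume h: "h \<noteq> 0 \<and> dist h 0 < 1"
      show "norm ((gk k (0 + h) - gk k 0) / h) \<le> C * \<bar>h\<bar>"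
      proof -
        have "\<bar>gk k h\<bar> \<le> (C * \<bar>h\<bar>) * \<bar>h\<bar>" using gk_bound[of k h] unfolding C_def by (simp only: power2_eq_square mult.assoc abs_mult_self_eq)
        then show ?thesis using h by (simp add: gk_def[of k 0] pos_divide_le_eq)
      qed
    qed simp
    show "((\<lambda>h. C * \<bar>h\<bar>) \<longlongrightarrow> 0) (at 0)" by (auto intro!: tendsto_eq_intros)
  qed
  then show ?thesis using equal by (simp add: DERIV_def gk_def)
qed

definition bump :: "'a::euclidean_space \<Rightarrow> real \<Rightarrow> 'a \<Rightarrow> complex" where
  "bump c r x = of_real (gk 0 (r\<^sup>2 - (norm (x - c))\<^sup>2))"

lemma bump_zero: "0 < r \<Longrightarrow> r \<le> norm (x - c) \<Longrightarrow> bump c r x = 0"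
proof -
  assume "0 < r" "r \<le> norm (x - c)"
  then have "r\<^sup>2 \<le> (norm (x - c))\<^sup>2" by (intro power_mono) auto
  then show ?thesis by (simp add: bump_def gk_def)
qed

lemma smooth_bump: "smooth (bump c r :: 'a::euclidean_space \<Rightarrow> complex)"
  unfolding smooth_iff
proof -
  define q where "q = (\<lambda>x. r\<^sup>2 - (norm (x - c))\<^sup>2)"
  define B where "B = range (\<lambda>k x. complex_of_real (gk k (q x))) \<union> {f::'a \<Rightarrow> complex. smooth_on UNIV f}"
  have q: "(q has_derivative (\<lambda>v. - 2 * ((x - c) \<bullet> v))) (at x)" for x
    unfolding q_def power2_norm_eq_inner by (auto intro!: derivative_eq_intros simp: inner_commute)
  have d: "((\<lambda>x. complex_of_real (gk k (q x))) has_derivative (\<lambda>v. of_real ((gk (k + 2) (q x) - of_nat k * gk (k + 1) (q x)) * (- 2 * ((x - c) \<bullet> v))))) (at x)" for k x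
    using has_derivative_of_real[OF has_derivative_compose[OF q gk_derivative[unfolded has_field_derivative_def]]] .
  show "smooth_on UNIV (bump c r)"
  proof (rule smooth_on_alg[of UNIV _ B])
    show "bump c r \<in> alg B" by (rule alg.base) (auto simp: B_def bump_def[abs_def] q_def)
    fix g v assume "g \<in> B" "v \<in> (Basis :: 'a set)"
    then consider k where "g = (\<lambda>x. complex_of_real (gk k (q x)))" | "smooth_on UNIV g" by (auto simp: B_def)
    then show "\<exists>h\<in>alg B. \<forall>x\<in>UNIV. pderiv_dir v g x = h x"
    proof cases
      case 1
      have l: "(\<lambda>x. complex_of_real (x \<bullet> v)) \<in> alg B" by (rule alg.base) (simp add: B_def)
      have gb: "(\<lambda>x. complex_of_real (gk k (q x))) \<in> alg B" for k by (rule alg.base) (simp add: B_def)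
      have "(\<lambda>x. (complex_of_real (gk (k + 2) (q x)) + (- of_nat k) * complex_of_real (gk (k + 1) (q x))) * ((- 2) * (complex_of_real (x \<bullet> v) + (- of_real (c \<bullet> v))))) \<in> alg B"
        by (intro alg.mult alg.add alg.const l gb)
      then show ?thesis
        unfolding 1 using pderiv_dir_eq[OF d]
        by (intro bexI[of _ "\<lambda>x. (complex_of_real (gk (k + 2) (q x)) + (- of_nat k) * complex_of_real (gk (k + 1) (q x))) * ((- 2) * (complex_of_real (x \<bullet> v) + (- of_real (c \<bullet> v))))"])
          (auto simp: inner_diff_left)
    next
      case 2
      then show ?thesis using \<open>v \<in> Basis\<close> by (auto intro!: bexI[OF _ alg.base] smooth_on_pderiv_dir simp: B_def)
    qed
  next
    fix g x assume "g \<in> B"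
    then show "g differentiable (at x)" using smooth_on_differentiable[of UNIV g x] by (auto simp: B_def intro: differentiableI[OF d])
  qed auto
qed

lemma bump_tf:
  fixes c :: "'a::euclidean_space"
  shows "r > 0 \<Longrightarrow> bump c r \<in> tf (norm c + r)"
proof (rule tfI[OF smooth_bump])
  fix x :: 'a assume "r > 0" "norm c + r < norm x"
  then have "r \<le> norm (x - c)" using norm_triangle_ineq2[of x c] by linarith
  then show "bump c r x = 0" using \<open>r > 0\<close> by (rule bump_zero[rotated])
qed

text \<open>On a small ball F differs from F(c) by at most half of |F(c)|, so the integral differs
  from F(c) times the positive mass of the bump by at most half the modulus of that product.\<close>

lemma bump_integral_nonzero:
  fixes c :: "'a::euclidean_space" and F :: "'a \<Rightarrow> complex"
  assumes F: "continuous_on (ball c d) F" "F c \<noteq> 0" and d: "d > 0"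
  obtains r where "0 < r" "r < d" "(\<integral>x. F x * bump c r x \<partial>lborel) \<noteq> 0"
proof -
  have "isCont F c" using F(1) d by (simp add: continuous_on_eq_continuous_at)
  then obtain r0 where r0: "r0 > 0" "\<And>x. dist x c < r0 \<Longrightarrow> dist (F x) (F c) < norm (F c) / 2"
    using F(2) by (metis continuous_at_eps_delta half_gt_zero zero_less_norm_iff)
  define r where "r = min r0 d / 2"
  have r: "0 < r" "r < d" "r < r0" using r0 d by (auto simp: r_def)
  define g where "g = (\<lambda>x. gk 0 (r\<^sup>2 - (norm (x - c))\<^sup>2))"
  have g0: "g x \<ge> 0" for x by (simp add: g_def gk_def)
  have bg: "bump c r x = of_real (g x)" for x by (simp add: bump_def g_def)
  have ib: "integrable lborel (bump c r)" by (rule tf_integrable[OF bump_tf[OF r(1)]])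
  then have ig: "integrable lborel g" using integrable_Re[OF ib] by (simp add: bg)
  have cg: "continuous_on UNIV g"
    using continuous_on_Re[OF tf_continuous[OF bump_tf[OF r(1), of c], of UNIV]] by (simp add: bg)
  have pos: "(\<integral>x. g x \<partial>lborel) > 0"
  proof -
    have "(\<integral>x. g x \<partial>lborel) \<noteq> 0"
    proof
      assume "(\<integral>x. g x \<partial>lborel) = 0"
      then have "AE x in lborel. g x = 0" using integral_nonneg_eq_0_iff_AE[OF ig] g0 by simp
      moreover have "open {x. g x \<noteq> 0}" using cg by (intro open_Collect_neq continuous_on_const)
      moreover have "g c \<noteq> 0" using r by (simp add: g_def gk_def)
      ultimately show False
      proof -
        assume ae: "AE x in lborel. g x = 0" and o: "open {x. g x \<noteq> 0}" and "g c \<noteq> 0"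
        have "emeasure lborel {x. g x \<noteq> 0} = 0" 
          using ae o by (subst (asm) AE_iff_measurable[of "{x. g x \<noteq> 0}"]) auto
        then have "{x. g x \<noteq> 0} \<in> null_sets lborel" using o by auto
        then have "negligible {x. g x \<noteq> 0}" unfolding negligible_iff_null_sets by (rule null_sets_completionI)
        then show False using open_not_negligible[OF o] \<open>g c \<noteq> 0\<close> by blast
      qed
    qed
    moreover have "(\<integral>x. g x \<partial>lborel) \<ge> 0" by (intro Bochner_Integration.integral_nonneg g0)
    ultimately show ?thesis by linarith
  qed
  have [measurable]: "g \<in> borel_measurable borel" using cg by (rule borel_measurable_continuous_onI)
  have eqF: "F x * bump c r x = indicator (ball c r) x *\<^sub>R (F x * bump c r x)" for x
    using bump_zero[OF r(1), of x c] by (auto simp: indicator_def dist_norm norm_minus_commute)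
  have mF: "(\<lambda>x. F x * bump c r x) \<in> borel_measurable borel"
  proof -
    have "(\<lambda>x. indicator (ball c r) x *\<^sub>R (F x * bump c r x)) \<in> borel_measurable borel"
      by (rule borel_measurable_continuous_on_indicator)
        (use r in \<open>auto intro!: continuous_on_mult continuous_on_subset[OF F(1)] tf_continuous[OF bump_tf]\<close>)
    moreover have "(\<lambda>x. F x * bump c r x) = (\<lambda>x. indicator (ball c r) x *\<^sub>R (F x * bump c r x))"
      using eqF by (rule ext)
    ultimately show ?thesis by (simp only:)
  qed
  have le: "norm (F x * bump c r x - F c * of_real (g x)) \<le> norm (F c) / 2 * g x" for x
  proof (cases "norm (x - c) < r")
    case True
    then have d: "norm (F x - F c) \<le> norm (F c) / 2" using r0(2)[of x] r by (simp add: dist_norm)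
    have "norm (F x * bump c r x - F c * of_real (g x)) = norm (F x - F c) * g x"
      using g0[of x] by (simp add: bg left_diff_distrib[symmetric] norm_mult)
    then show ?thesis using mult_right_mono[OF d g0[of x]] by simp
  next
    case False
    then have "bump c r x = 0" using bump_zero[OF r(1), of x c] by linarith
    then show ?thesis using bg[of x] by simp
  qed
  have igc: "integrable lborel (\<lambda>x. F c * complex_of_real (g x))" using ig by (intro integrable_mult_right integrable_of_real)
  have idf: "integrable lborel (\<lambda>x. F x * bump c r x - F c * of_real (g x))"
  proof (rule Bochner_Integration.integrable_bound[of _ "\<lambda>x. norm (F c) / 2 * g x"])
    show "AE x in lborel. norm (F x * bump c r x - F c * of_real (g x)) \<le> norm (norm (F c) / 2 * g x)"
      unfolding real_norm_def by (rule AE_I2) (rule order_trans[OF le abs_ge_self])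
    show "(\<lambda>x. F x * bump c r x - F c * of_real (g x)) \<in> borel_measurable lborel" using mF by measurable
  qed (use ig in simp)
  have "norm (\<integral>x. F x * bump c r x - F c * of_real (g x) \<partial>lborel) \<le> (\<integral>x. norm (F c) / 2 * g x \<partial>lborel)"
    by (rule Bochner_Integration.integral_norm_bound_integral[OF idf _ le]) (use ig in simp)
  also have "\<dots> = norm (F c) / 2 * (\<integral>x. g x \<partial>lborel)" by simp
  also have "\<dots> < norm (F c) * (\<integral>x. g x \<partial>lborel)" using pos F(2) by simp
  finally have less: "norm (\<integral>x. F x * bump c r x - F c * of_real (g x) \<partial>lborel) < norm (F c) * (\<integral>x. g x \<partial>lborel)" .
  have "(\<integral>x. F x * bump c r x \<partial>lborel) \<noteq> 0"
  proof
    assume z: "(\<integral>x. F x * bump c r x \<partial>lborel) = 0"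
    have iF: "integrable lborel (\<lambda>x. F x * bump c r x)"
      using Bochner_Integration.integrable_add[OF idf igc] by simp
    have "(\<integral>x. F x * bump c r x - F c * of_real (g x) \<partial>lborel) = - (F c * of_real (\<integral>x. g x \<partial>lborel))"
      unfolding Bochner_Integration.integral_diff[OF iF igc] z by simp
    then show False using less pos by (simp add: norm_mult)
  qed
  with r that show ?thesis by blast
qed

section \<open>Matrix-valued families\<close>

definition xi :: "'m::finite \<Rightarrow> ('m pt \<Rightarrow> complex) \<Rightarrow> 'm pt \<Rightarrow> complex" where
  "xi i f x = of_real (fst x $ i) * f x"

lemma axis_Basis: "((axis i 1, 0) :: 'm::finite pt) \<in> Basis"
  by (auto simp: Basis_prod_def axis_in_Basis_iff)

lemma cop_xi: "cop (xi i :: ('m::finite pt \<Rightarrow> complex) \<Rightarrow> _)"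
  using cop_inner[OF axis_Basis[of i]]
  by (simp add: xi_def[abs_def] inner_prod_def inner_axis)

text \<open>The kernel \<open>sgn(x\<^sub>n) \<bar>x\<^sub>n\<bar>\<^sup>a\<^sup>-\<^sup>1 x\<^sub>i\<close> is odd in \<open>x\<^sub>n\<close>.  Pairing it with \<open>\<phi>\<close> therefore only sees the odd part of
  \<open>\<phi>\<close>, which is \<open>x\<^sub>n\<close> times \<open>Qop \<phi>\<close>, and the factor \<open>x\<^sub>n\<close> turns it into the even kernel.  So every
  spinor family of the theorem is obtained from an even scalar functional \<open>T\<close>.\<close>

definition MT ::
  "('m::finite option \<Rightarrow> complex^'s::finite^'s) \<Rightarrow> (('m pt \<Rightarrow> complex) \<Rightarrow> complex) \<Rightarrow> ('m pt, 's) mdist" where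
  "MT e T \<phi> = (\<chi> a b. (\<Sum>i\<in>UNIV. e (Some i) $ a $ b * T (Qop (xi i \<phi>))) + e None $ a $ b * T \<phi>)"

lemma MT_nth: "MT e T \<phi> $ a $ b = (\<Sum>i\<in>UNIV. e (Some i) $ a $ b * T (Qop (xi i \<phi>))) + e None $ a $ b * T \<phi>"
  by (simp add: MT_def)

lemma tf_Qop_xi: "R > 0 \<Longrightarrow> f \<in> tf R \<Longrightarrow> Qop (xi i f) \<in> tf R"
  by (intro cop_tf[OF cop_Qop] cop_tf[OF cop_xi])

lemma MT_cong:
  assumes "R > 0" "\<phi> \<in> tf R" "\<And>f. f \<in> tf R \<Longrightarrow> T f = S f"
  shows "MT e T \<phi> = MT e S \<phi>"
  by (simp only: MT_def assms(3)[OF assms(2)] assms(3)[OF tf_Qop_xi[OF assms(1,2)]])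

lemma MT_scale: "MT e (\<lambda>f. c * T f) \<phi> = csmult c (MT e T \<phi>)"
  by (simp add: MT_def csmult_def vec_eq_iff algebra_simps sum_distrib_left)

lemma cfn_MT:
  assumes T: "cfn T" shows "cfn (\<lambda>\<phi>. MT e T \<phi> $ a $ b)"
proof -
  have "cfn (\<lambda>\<phi>. e (Some i) $ a $ b * T (Qop (xi i \<phi>)))" for i
    by (rule cfn_scale[OF cfn_comp[OF T cop_comp[OF cop_Qop cop_xi]]])
  then show ?thesis unfolding MT_nth by (rule cfn_plus[OF cfn_sum_fun cfn_scale[OF T]])
qed

lemma hol2_MT:
  assumes "R > 0" "\<phi> \<in> tf R" "\<And>f. f \<in> tf R \<Longrightarrow> hol2 D (\<lambda>p. T p f)"
  shows "hol2 D (\<lambda>p. MT e (T p) \<phi> $ a $ b)"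
  unfolding MT_nth by (intro hol2_add hol2_sum hol2_cmult assms tf_Qop_xi)

lemma holomorphic_MT:
  assumes "R > 0" "\<phi> \<in> tf R" "\<And>f. f \<in> tf R \<Longrightarrow> (\<lambda>p. T p f) holomorphic_on D"
  shows "(\<lambda>p. MT e (T p) \<phi> $ a $ b) holomorphic_on D"
  unfolding MT_nth by (intro holomorphic_intros assms tf_Qop_xi)

lemma norm_matrix_le: "norm (A :: complex^'s::finite^'s) \<le> (\<Sum>a\<in>UNIV. \<Sum>b\<in>UNIV. cmod (A $ a $ b))"
proof -
  have 1: "norm x \<le> (\<Sum>i\<in>UNIV. norm (x $ i))" for x :: "'c::real_normed_vector^'s"
    unfolding norm_vec_def by (intro L2_set_le_sum) auto
  show ?thesis using order_trans[OF 1[of A] sum_mono[OF 1]] .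
qed

lemma test_functions_tf2:
  assumes "f \<in> test_functions" "g \<in> test_functions" obtains R where "R > 0" "f \<in> tf R" "g \<in> tf R"
proof -
  obtain R S where "R > 0" "f \<in> tf R" "S > 0" "g \<in> tf S" using assms by (meson test_functions_tf)
  then show ?thesis using that[of "max R S"] tf_mono[of f R "max R S"] tf_mono[of g S "max R S"] by simp
qed

text \<open>A compact set lies in some ball, where every entry has its own constant and order. There
  are finitely many entries: the constants are added, and the sum of the orders dominates each of
  them.\<close>

lemma distribution_entriesI:
  fixes T :: "('a::euclidean_space, 's::finite) mdist"
  assumes S: "\<And>a b. cfn (S a b)" and T: "\<And>\<phi> a b. \<phi> \<in> test_functions \<Longrightarrow> T \<phi> $ a $ b = S a b \<phi>"
  shows "distribution T"
  unfolding distribution_def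
proof (intro conjI ballI allI impI)
  fix \<phi> \<psi> :: "'a \<Rightarrow> complex" assume t: "\<phi> \<in> test_functions" "\<psi> \<in> test_functions"
  then obtain R where R: "R > 0" "\<phi> \<in> tf R" "\<psi> \<in> tf R" by (rule test_functions_tf2)
  show "T (\<lambda>x. \<phi> x + \<psi> x) = T \<phi> + T \<psi>"
    using T[OF t(1)] T[OF t(2)] T[OF tf_test(1)[OF tf_add[OF R(2,3)]]] cfn_add[OF S R]
    by (simp add: vec_eq_iff)
next
  fix c and \<phi> :: "'a \<Rightarrow> complex" assume t: "\<phi> \<in> test_functions"
  then obtain R where R: "R > 0" "\<phi> \<in> tf R" by (rule test_functions_tf)
  show "T (\<lambda>x. c * \<phi> x) = csmult c (T \<phi>)"
    using T[OF t(1)] T[OF tf_test(1)[OF tf_cmult[OF R(2)]]] cfn_cmult[OF S R]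
    by (simp add: vec_eq_iff csmult_def)
next
  fix K :: "'a set" assume "compact K"
  then obtain R where R: "R > 0" "K \<subseteq> cball 0 R" by (rule compact_subset_cball)
  obtain C M where C: "C a b \<ge> 0" "f \<in> tf R \<Longrightarrow> cmod (S a b f) \<le> C a b * sem (M a b) f" for a b f
    using cfn_bound[OF S R(1)] by metis
  define N where "N = (\<Sum>a\<in>UNIV. \<Sum>b\<in>UNIV. M a b)"
  have MN: "M a b \<le> N" for a b
  proof -
    have "M a b \<le> (\<Sum>b\<in>UNIV. M a b)" by (intro member_le_sum) auto
    also have "\<dots> \<le> N" unfolding N_def by (intro member_le_sum[of a UNIV "\<lambda>a. \<Sum>b\<in>UNIV. M a b"]) auto
    finally show ?thesis .
  qed
  show "\<exists>C N. \<forall>\<phi>\<in>test_functions. fsupp \<phi> \<subseteq> K \<longrightarrow>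
        norm (T \<phi>) \<le> C * (\<Sum>vs | set vs \<subseteq> Basis \<and> length vs \<le> N. SUP x. cmod (pderivs vs \<phi> x))"
  proof (intro exI ballI impI)
    fix \<phi> :: "'a \<Rightarrow> complex" assume t: "\<phi> \<in> test_functions" "fsupp \<phi> \<subseteq> K"
    then have f: "\<phi> \<in> tf R" using R(2) by (intro test_tf) auto
    have "norm (T \<phi>) \<le> (\<Sum>a\<in>UNIV. \<Sum>b\<in>UNIV. cmod (T \<phi> $ a $ b))" by (rule norm_matrix_le)
    also have "\<dots> \<le> (\<Sum>a\<in>UNIV. \<Sum>b\<in>UNIV. C a b * sem N \<phi>)"
      unfolding T[OF t(1)]
      by (intro sum_mono order_trans[OF C(2)[OF f]] mult_left_mono sem_mono[OF f] MN C(1))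
    also have "\<dots> = (\<Sum>a\<in>UNIV. \<Sum>b\<in>UNIV. C a b) * sem N \<phi>" by (simp add: sum_distrib_right)
    finally show "norm (T \<phi>) \<le> (\<Sum>a\<in>UNIV. \<Sum>b\<in>UNIV. C a b) *
      (\<Sum>vs | set vs \<subseteq> Basis \<and> length vs \<le> N. SUP x. cmod (pderivs vs \<phi> x))" unfolding sem_def .
  qed
qed

lemma distribution_MT:
  "cfn T \<Longrightarrow> (\<And>\<phi>. \<phi> \<in> test_functions \<Longrightarrow> D \<phi> = MT e T \<phi>) \<Longrightarrow> distribution D"
  by (rule distribution_entriesI[OF cfn_MT]) auto

text \<open>Two representations satisfy g h' = g' h on the open set, hence everywhere by the
  identity theorem; the quotient at \<open>p\<close> is therefore unique and the definite
  description denotes it.\<close>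

lemma mero_cont2_eq:
  assumes "open \<Omega>" "\<Omega> \<noteq> {}" and g: "hol2 UNIV g" and h: "hol2 UNIV h" "h p \<noteq> 0"
    and eq: "\<And>q. q \<in> \<Omega> \<Longrightarrow> g q = h q * f q"
  shows "mero_cont2 \<Omega> f p = g p / h p"
  unfolding mero_cont2_def
proof (rule the_equality)
  show "\<exists>ga ha. entire2 ga \<and> entire2 ha \<and> ha p \<noteq> 0 \<and> (\<forall>q\<in>\<Omega>. ga q = ha q * f q) \<and> g p / h p = ga p / ha p"
    using assms unfolding entire2_iff by blast
  fix v assume "\<exists>g h. entire2 g \<and> entire2 h \<and> h p \<noteq> 0 \<and> (\<forall>q\<in>\<Omega>. g q = h q * f q) \<and> v = g p / h p"
  then obtain g' h' where *: "hol2 UNIV g'" "hol2 UNIV h'" "h' p \<noteq> 0" "\<And>q. q \<in> \<Omega> \<Longrightarrow> g' q = h' q * f q" "v = g' p / h' p"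
    unfolding entire2_iff by blast
  have "g p * h' p = g' p * h p"
    by (rule hol2_identity[OF open_UNIV convex_UNIV hol2_mult[OF g *(2)] hol2_mult[OF *(1) h(1)] assms(1) subset_UNIV assms(2)])
      (simp_all add: eq *(4))
  then show "v = g p / h p" unfolding *(5) using h(2) *(3) by (simp add: frac_eq_eq)
qed

lemma holo_cont1_eq:
  assumes "open \<Omega>" "\<Omega> \<noteq> {}" and g: "g holomorphic_on UNIV" and eq: "\<And>w. w \<in> \<Omega> \<Longrightarrow> f w = g w"
  shows "holo_cont1 \<Omega> f z = g z"
  unfolding holo_cont1_def
proof (rule the_equality)
  show "\<exists>ga. ga holomorphic_on UNIV \<and> (\<forall>w\<in>\<Omega>. ga w = f w) \<and> g z = ga z" using g eq by metis
  fix v assume "\<exists>g. g holomorphic_on UNIV \<and> (\<forall>w\<in>\<Omega>. g w = f w) \<and> v = g z"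
  then obtain g' where *: "g' holomorphic_on UNIV" "\<And>w. w \<in> \<Omega> \<Longrightarrow> g' w = f w" "v = g' z" by blast
  have "g' z = g z"
    by (rule analytic_continuation_open[OF assms(1) open_UNIV assms(2) connected_UNIV subset_UNIV *(1) g]) (auto simp: *(2) eq)
  then show "v = g z" using *(3) by simp
qed

section \<open>The family A as a matrix family over the scalar kernel\<close>

lemma rsq_eq: "rsq x = (norm x)\<^sup>2"
  by (simp add: rsq_def norm_prod_def)

lemma W_rsq: "complex_of_real (rsq x) powr w = W (2 * w) x"
proof (cases "x = 0")
  case False
  then have "Ln (complex_of_real ((norm x)\<^sup>2)) = 2 * Ln (complex_of_real (norm x))"
    using ln_realpow[of "norm x" 2] Ln_of_real[of "norm x"] Ln_of_real[of "(norm x)\<^sup>2"] by (simp del: of_real_power)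
  then show ?thesis using False by (simp add: rsq_eq W_def powr_def mult_ac del: of_real_power)
qed (simp add: rsq_eq W_def)

lemma zeta_nth: "zeta e x $ a $ b = (\<Sum>i\<in>UNIV. of_real (fst x $ i) * e (Some i) $ a $ b) + of_real (snd x) * e None $ a $ b"
  by (simp add: zeta_def zeta'_def scaleR_conv_of_real[where 'a=complex])

text \<open>The odd scalar factor in front of zeta(x) in the kernel of the family A; multiplied by
  x_n it becomes \<open>Ker a z\<close>.\<close>

definition ksg :: "complex \<Rightarrow> complex \<Rightarrow> 'm::finite pt \<Rightarrow> complex" where
  "ksg a z x = SP (a - 1) (snd x) * W (z - a - dm TYPE(real^'m)) x"

lemma KA_plus_fun_nth:
  fixes x :: "'m::finite pt"
  shows "KA_plus_fun e lam nu x $ p $ q = ksg (lam + nu + 1/2) (lam - nu + 1/2) x * zeta e x $ p $ q"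
proof -
  have 1: "lam - 1/2 + (nu + 1/2) - 1/2 = lam + nu + 1/2 - 1" by simp
  have 2: "2 * (- (nu + 1/2) - (of_nat (CARD('m) + 1) - 1) / 2) = lam - nu + 1/2 - (lam + nu + 1/2) - dm TYPE(real^'m)"
    by (simp add: field_simps)
  show ?thesis unfolding KA_plus_fun_def KA_minus_def W_rsq ksg_def SP_def 1 2[symmetric] csmult_def by simp
qed

lemma ksg_reflect: "ksg a z (sc (-1) x) = - ksg a z x"
  by (simp add: ksg_def sc_m1 SP_minus)

lemma MT_II:
  fixes \<phi> :: "'m::finite pt \<Rightarrow> complex"
  assumes R: "R > 0" and f: "\<phi> \<in> tf R" and int: "\<And>i. integrable lborel (\<lambda>x. ksg a z x * xi i \<phi> x)"
    and int0: "integrable lborel (\<lambda>x. Ker a z x * \<phi> x)"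
  shows "MT e (II a z) \<phi> $ p $ q = (\<integral>x. ksg a z x * (zeta e x $ p $ q * \<phi> x) \<partial>lborel)"
proof -
  have K: "ksg a z x * of_real (snd x) = Ker a z x" for x :: "'m pt"
    using of_real_mult_SP[of "snd x" "a - 1"] by (simp add: ksg_def Ker_def mult_ac)
  have Q: "(\<integral>x. ksg a z x * xi i \<phi> x \<partial>lborel) = II a z (Qop (xi i \<phi>))" for i
    using odd_kernel_Qop[OF int[of i] ksg_reflect tf_smooth[OF cop_tf[OF cop_xi R f]]]
    by (simp add: II_def K flip: mult.assoc)
  have e: "ksg a z x * (zeta e x $ p $ q * \<phi> x) =
      (\<Sum>i\<in>UNIV. e (Some i) $ p $ q * (ksg a z x * xi i \<phi> x)) + e None $ p $ q * (Ker a z x * \<phi> x)" for x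
    unfolding zeta_nth K[symmetric] xi_def by (simp add: algebra_simps sum_distrib_left)
  have "(\<integral>x. ksg a z x * (zeta e x $ p $ q * \<phi> x) \<partial>lborel) =
      (\<Sum>i\<in>UNIV. e (Some i) $ p $ q * (\<integral>x. ksg a z x * xi i \<phi> x \<partial>lborel)) + e None $ p $ q * II a z \<phi>"
    unfolding e II_def
    by (subst Bochner_Integration.integral_add Bochner_Integration.integral_sum;
        (intro integrable_mult_right Bochner_Integration.integrable_sum int int0)?;
        subst Bochner_Integration.integral_sum; (intro integrable_mult_right int)?; simp)
  then show ?thesis unfolding Q MT_nth by simp
qed

lemma ksg_measurable [measurable]: "ksg a z \<in> borel_measurable (borel :: ('m::finite pt) measure)"
  unfolding ksg_def[abs_def] by measurable

text \<open>The odd kernel is homogeneous of degree z - 1 - n, one power of |x| short for small Re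
  z; the coordinate x_i supplies that power. The condition on \<open>a\<close> makes the exponent a
  - 1 of x_n exceed -1.\<close>

lemma ksg_integrable:
  fixes \<phi> :: "'m::finite pt \<Rightarrow> complex"
  assumes a: "Re a > 0" and z: "Re z > 0" and R: "R > 0" and f: "\<phi> \<in> tf R"
  shows "integrable lborel (\<lambda>x. ksg a z x * xi i \<phi> x)"
proof -
  have [measurable]: "(\<lambda>x::'m pt. fst x $ i) \<in> borel_measurable borel"
    by (intro borel_measurable_continuous_onI continuous_intros)
  have "integrable lborel (\<lambda>x. (ksg a z x * of_real (fst x $ i)) * \<phi> x)"
  proof (rule kernel_bounded_integrable(1)[of "Re a - 1" "Re z" R _ _ "sem 0 \<phi>"])
    fix x :: "'m pt"
    show "norm (ksg a z x * of_real (fst x $ i)) \<le>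
        \<bar>snd x\<bar> powr (Re a - 1) * norm x powr (Re z - (Re a - 1) - (real DIM(real^'m) + 1))"
    proof (cases "x = 0")
      case False
      have "\<bar>fst x $ i\<bar> \<le> norm x" using component_le_norm_cart[of "fst x" i] norm_fst_le[of "fst x" "snd x"] by simp
      then have "norm (ksg a z x * of_real (fst x $ i)) \<le>
          \<bar>snd x\<bar> powr (Re a - 1) * (norm x powr (Re z - Re a - (real DIM(real^'m) + 1)) * norm x)"
        by (simp add: ksg_def norm_mult norm_SP norm_W mult_left_mono mult.assoc add.commute[of 1])
      also have "norm x powr (Re z - Re a - (real DIM(real^'m) + 1)) * norm x = norm x powr (Re z - (Re a - 1) - (real DIM(real^'m) + 1))"
        using False powr_add[of "norm x" "Re z - Re a - (real DIM(real^'m) + 1)" 1] by (simp add: algebra_simps)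
      finally show ?thesis .
    qed (simp add: ksg_def)
  qed (use assms pderivs_le_sem[OF f, of "[]" 0] tf_zero[OF f] tf_measurable[OF f] in auto)
  then show ?thesis by (simp add: xi_def mult_ac)
qed

abbreviation aa :: "complex \<times> complex \<Rightarrow> complex" where "aa p \<equiv> fst p + snd p + 1/2"
abbreviation zz :: "complex \<times> complex \<Rightarrow> complex" where "zz p \<equiv> fst p - snd p + 1/2"

lemma gamma_factor_gf: "gamma_factor p = gf (aa p) (zz p)"
  by (cases p) (simp add: gamma_factor_def gf_def add_ac)

lemma KA_int_MT:
  fixes \<phi> :: "'m::finite pt \<Rightarrow> complex"
  assumes p: "p \<in> KA_domain" and R: "R > 0" and f: "\<phi> \<in> tf R"
  shows "KA_int e p \<phi> $ a $ b = MT e (II (aa p) (zz p)) \<phi> $ a $ b"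
proof -
  have d: "Re (aa p) > 0" "Re (zz p) > 0" using p by (auto simp: KA_domain_def)
  have "KA_int e p \<phi> $ a $ b = (\<integral>x. ksg (aa p) (zz p) x * (zeta e x $ a $ b * \<phi> x) \<partial>lborel)"
    by (cases p) (simp add: KA_int_def mat_times_dist_def KA_plus_fun_nth mult.assoc)
  also have "\<dots> = MT e (II (aa p) (zz p)) \<phi> $ a $ b"
    using d by (intro MT_II[symmetric, OF R f] ksg_integrable[OF d R f] Ker_integrable[OF _ d(2) R f]) simp
  finally show ?thesis .
qed

lemma hol2_aa: "hol2 D (\<lambda>p. aa p)" and hol2_zz: "hol2 D (\<lambda>p. zz p)"
  by (intro hol2_add hol2_diff hol2_fst hol2_snd hol2_const)+

lemma hol2_GMT:
  assumes "R > 0" "\<phi> \<in> tf R" shows "hol2 UNIV (\<lambda>p. MT e (G (aa p) (zz p)) \<phi> $ a $ b)"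
  by (rule hol2_MT[OF assms]) (intro G_compose_hol2[OF assms(1)] hol2_aa hol2_zz)

lemma rGamma_half_zero: "rGamma ((w::complex) / 2) = 0 \<longleftrightarrow> (\<exists>k::nat. w = - 2 * of_nat k)"
proof -
  have "w / 2 = - of_nat k \<longleftrightarrow> w = - 2 * of_nat k" for k :: nat by (simp add: field_simps)
  then show ?thesis unfolding rGamma_eq_zero_iff by (auto elim!: nonpos_Ints_cases')
qed

lemma gamma_factor_zero: "gamma_factor p = 0 \<longleftrightarrow> p \<in> Xplus \<union> Yplus"
proof (cases p)
  case (Pair lam nu)
  have "(lam + nu + 3/2 = - 2 * of_nat k) = (lam + nu = - 3/2 - 2 * of_nat k)"
    "(lam - nu + 1/2 = - 2 * of_nat k) = (lam - nu = - 1/2 - 2 * of_nat k)" for k :: nat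
    unfolding eq_iff_diff_eq_0[of "lam + nu + 3/2"] eq_iff_diff_eq_0[of "lam - nu + 1/2"]
      eq_iff_diff_eq_0[of "lam + nu"] eq_iff_diff_eq_0[of "lam - nu"] by (simp_all add: algebra_simps)
  then show ?thesis unfolding Pair gamma_factor_def Xplus_def Yplus_def
    by (simp only: prod.case mult_eq_0_iff rGamma_half_zero mem_Collect_eq Un_iff)
qed

lemma hol2_gamma_factor: "hol2 D gamma_factor"
  unfolding gamma_factor_gf[abs_def] gf_def
  by (intro hol2_mult hol2_rGamma hol2_divide_const hol2_add hol2_const hol2_aa hol2_zz hol2_fst hol2_snd hol2_diff)

lemma off_poles: "open (- (Xplus \<union> Yplus))" "- (Xplus \<union> Yplus) \<noteq> {}"
proof -
  have "- (Xplus \<union> Yplus) = gamma_factor -` (- {0})" using gamma_factor_zero by auto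
  then show "open (- (Xplus \<union> Yplus))"
    using continuous_open_vimage[of "- {0}" gamma_factor] hol2_continuous[OF hol2_gamma_factor[of UNIV]]
    by (simp add: continuous_on_eq_continuous_at open_vimage)
  have "(0, 0) \<notin> Xplus \<union> Yplus" by (auto simp: Xplus_def Yplus_def complex_eq_iff)
  then show "- (Xplus \<union> Yplus) \<noteq> {}" by blast
qed

text \<open>On the domain of integrability the matrix family of \<open>G\<close> is
  \<open>gamma_factor\<close> times the integral, so off the poles \<open>KA_plus\<close> is their
  quotient. Multiplying by \<open>gamma_factor\<close> leaves the denominator 1, and the second
  continuation is defined at every point.\<close>

lemma KAt_tf:
  fixes \<phi> :: "'m::finite pt \<Rightarrow> complex"
  assumes R: "R > 0" and f: "\<phi> \<in> tf R"
  shows "KAt e p \<phi> = MT e (G (aa p) (zz p)) \<phi>"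
proof -
  have dom: "open KA_domain" "KA_domain \<noteq> {}"
  proof -
    have "KA_domain = {p. Re (fst p + snd p) > - 1/2} \<inter> {p. Re (fst p - snd p) > - 1/2}"
      by (auto simp: KA_domain_def)
    moreover have "open ({p::complex \<times> complex. Re (fst p + snd p) > - 1/2} \<inter> {p. Re (fst p - snd p) > - 1/2})"
      by (intro open_Int open_Collect_less continuous_intros)
    ultimately show "open KA_domain" by (simp only:)
    show "KA_domain \<noteq> {}" by (auto simp: KA_domain_def intro!: exI[of _ "0::complex"])
  qed
  have *: "KA_plus e q \<phi> $ a $ b = MT e (G (aa q) (zz q)) \<phi> $ a $ b / gamma_factor q"
    if "q \<in> - (Xplus \<union> Yplus)" for q a b
  proof -
    have "MT e (G (aa r) (zz r)) \<phi> $ a $ b = gamma_factor r * KA_int e r \<phi> $ a $ b" if r: "r \<in> KA_domain" for r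
    proof -
      have "Re (aa r) > -1" "Re (zz r) > 0" using r by (auto simp: KA_domain_def)
      then have "MT e (G (aa r) (zz r)) \<phi> = MT e (\<lambda>f. gamma_factor r * II (aa r) (zz r) f) \<phi>"
        unfolding gamma_factor_gf by (intro MT_cong[OF R f] G_integral[OF R])
      then show ?thesis unfolding KA_int_MT[OF r R f] by (simp add: MT_scale csmult_def)
    qed
    then show ?thesis using mero_cont2_eq[OF dom hol2_GMT[OF R f] hol2_gamma_factor, of q e a b] gamma_factor_zero[of q] that
      by (simp add: KA_plus_def)
  qed
  have "KAt e p \<phi> $ a $ b = MT e (G (aa p) (zz p)) \<phi> $ a $ b" for a b
  proof -
    have "mero_cont2 (- (Xplus \<union> Yplus)) (\<lambda>q. gamma_factor q * KA_plus e q \<phi> $ a $ b) p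
        = MT e (G (aa p) (zz p)) \<phi> $ a $ b / 1"
    proof (rule mero_cont2_eq[OF off_poles hol2_GMT[OF R f] hol2_const])
      fix q assume q: "q \<in> - (Xplus \<union> Yplus)"
      then show "MT e (G (aa q) (zz q)) \<phi> $ a $ b = 1 * (gamma_factor q * KA_plus e q \<phi> $ a $ b)"
        using gamma_factor_zero[of q] by (simp add: *[OF q])
    qed simp
    then show ?thesis by (simp add: KAt_def)
  qed
  then show ?thesis by (simp add: vec_eq_iff)
qed

lemma KAt_eq: "\<phi> \<in> test_functions \<Longrightarrow> KAt e p \<phi> = MT e (G (aa p) (zz p)) \<phi>"
  by (metis test_functions_tf KAt_tf)

lemma holomorphic_family2_KAt: "holomorphic_family2 (KAt (e :: 'm::finite option \<Rightarrow> complex^'s::finite^'s))"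
  unfolding holomorphic_family2_def entire2_iff
proof (intro conjI allI ballI)
  show "distribution (KAt e p)" for p by (rule distribution_MT[OF cfn_G KAt_eq])
  fix \<phi> :: "'m pt \<Rightarrow> complex" and a b assume "\<phi> \<in> test_functions"
  then obtain R where R: "R > 0" "\<phi> \<in> tf R" by (rule test_functions_tf)
  show "hol2 UNIV (\<lambda>p. KAt e p \<phi> $ a $ b)" unfolding KAt_tf[OF R] by (rule hol2_GMT[OF R])
qed

section \<open>Supports\<close>

definition off :: "real \<Rightarrow> ('b::euclidean_space \<times> real \<Rightarrow> complex) \<Rightarrow> bool" where
  "off \<epsilon> f \<longleftrightarrow> \<epsilon> > 0 \<and> (\<forall>x. \<bar>snd x\<bar> < \<epsilon> \<longrightarrow> f x = 0)"

text \<open>Common interface of \<open>G\<close> and the second renormalization: away from the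
  hyperplane the functional is \<open>C\<close> times the kernel, and \<open>C = 0\<close> is the
  case of support on the hyperplane.\<close>

definition off_kernel :: "((('b::euclidean_space \<times> real \<Rightarrow> complex)) \<Rightarrow> complex) \<Rightarrow> complex \<Rightarrow> complex \<Rightarrow> complex \<Rightarrow> bool" where
  "off_kernel T C a z \<longleftrightarrow> (\<forall>R f \<epsilon>. R > 0 \<longrightarrow> f \<in> tf R \<longrightarrow> off \<epsilon> f \<longrightarrow> T f = C * II a z f)"

lemma off_kernel_G: "off_kernel (G a z) (gf a z) a z"
  unfolding off_kernel_def off_def using G_off by blast

lemma off_xi: "off \<epsilon> f \<Longrightarrow> off \<epsilon> (xi i f)"
  by (simp add: off_def xi_def)

text \<open>Along with x, the open slab |x_n| < \<epsilon> contains all \<open>sc t x\<close> with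
  |t| <= 1, so the average only meets points near which \<open>f\<close> vanishes.\<close>

lemma off_Qop:
  fixes f :: "'b::euclidean_space \<times> real \<Rightarrow> complex"
  assumes "off \<epsilon> f" shows "off \<epsilon> (Qop f)"
  unfolding off_def
proof (intro conjI allI impI)
  fix x :: "'b \<times> real" assume x: "\<bar>snd x\<bar> < \<epsilon>"
  have "pderiv_dir en f (sc t x) = 0" if "t \<in> {-1..1}" for t
  proof -
    have "\<bar>t\<bar> * \<bar>snd x\<bar> \<le> 1 * \<bar>snd x\<bar>" using that by (intro mult_right_mono) auto
    then have s: "sc t x \<in> {y. \<bar>snd y\<bar> < \<epsilon>}" using x by (simp add: sc_def abs_mult)
    have o: "open {y::'b \<times> real. \<bar>snd y\<bar> < \<epsilon>}" by (intro open_Collect_less continuous_intros)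
    have "pderivs [en] f (sc t x) = pderivs [en] (\<lambda>x. 0) (sc t x)"
      by (rule pderivs_cong[OF o _ s]) (use assms in \<open>auto simp: off_def\<close>)
    then show ?thesis unfolding pderivs_const by simp
  qed
  then have "avg 0 (pderiv_dir en f) x = integral {-1..1} (\<lambda>t::real. 0)"
    unfolding avg_def by (intro Henstock_Kurzweil_Integration.integral_cong) auto
  then show "Qop f x = 0" by (simp add: Qop_def)
qed (use assms in \<open>simp add: off_def\<close>)

text \<open>Off the hyperplane by dividing by x_n, on it by continuity.\<close>

lemma Qop_even:
  fixes f :: "'b::euclidean_space \<times> real \<Rightarrow> complex"
  assumes f: "R > 0" "f \<in> tf R" and even: "\<And>x. f (sc (-1) x) = f x" shows "Qop f = (\<lambda>x. 0)"
proof
  fix x :: "'b \<times> real"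
  have z: "Qop f y = 0" if "snd y \<noteq> 0" for y
    using Qop_mult[OF tf_smooth[OF f(2)], of y] that by (simp add: even)
  show "Qop f x = 0"
  proof (cases "snd x = 0")
    case True
    define s where "s = (\<lambda>n::nat. (fst x, inverse (real (Suc n))))"
    have "s \<longlonglongrightarrow> (fst x, 0)"
      unfolding s_def by (intro tendsto_Pair tendsto_const LIMSEQ_inverse_real_of_nat)
    then have "s \<longlonglongrightarrow> x" using True by (metis prod.collapse)
    moreover have "isCont (Qop f) x"
      using tf_continuous[OF tf_Qop[OF f], of UNIV] by (metis UNIV_I continuous_on_eq_continuous_at open_UNIV)
    ultimately have "(\<lambda>n. Qop f (s n)) \<longlonglongrightarrow> Qop f x" by (rule isCont_tendsto_compose[rotated])
    moreover have "(\<lambda>n. Qop f (s n)) = (\<lambda>n. 0)" by (rule ext, rule z) (simp add: s_def)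
    ultimately show ?thesis by (simp add: LIMSEQ_const_iff)
  qed (rule z)
qed

lemma ksg_integrable_off:
  fixes \<phi> :: "'m::finite pt \<Rightarrow> complex"
  assumes R: "R > 0" and f: "\<phi> \<in> tf R" and o: "off \<epsilon> \<phi>"
  shows "integrable lborel (\<lambda>x. ksg a z x * xi i \<phi> x)"
proof -
  note t = cop_tf[OF cop_xi R f, of i]
  have [measurable]: "xi i \<phi> \<in> borel_measurable borel" by (rule tf_measurable[OF t])
  show ?thesis
  proof (rule Bochner_Integration.integrable_bound)
    \<comment> \<open>In absolute value \<open>ksg a z\<close> equals
      \<open>Ker (a - 1) (z - 1)\<close>: the exponents coincide, and the two differ only by the
      sign of x_n.\<close>
    show "integrable lborel (\<lambda>x. Ker (a - 1) (z - 1) x * xi i \<phi> x)"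
      using off_xi[OF o, of i] by (intro Ker_integrable_off[OF t, of \<epsilon>]) (auto simp: off_def)
    show "AE x in lborel. norm (ksg a z x * xi i \<phi> x) \<le> norm (Ker (a - 1) (z - 1) x * xi i \<phi> x)"
      by (rule AE_I2) (simp add: ksg_def Ker_def norm_mult norm_AP norm_SP)
  qed measurable
qed

lemma MT_off:
  fixes \<phi> :: "'m::finite pt \<Rightarrow> complex"
  assumes T: "off_kernel T C a z" and R: "R > 0" and f: "\<phi> \<in> tf R" and o: "off \<epsilon> \<phi>"
  shows "MT e T \<phi> $ p $ q = C * (\<integral>x. ksg a z x * (zeta e x $ p $ q * \<phi> x) \<partial>lborel)"
proof -
  have 1: "T \<phi> = C * II a z \<phi>" using T R f o unfolding off_kernel_def by blast
  have 2: "T (Qop (xi i \<phi>)) = C * II a z (Qop (xi i \<phi>))" for i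
    using T R tf_Qop_xi[OF R f] off_Qop[OF off_xi[OF o]] unfolding off_kernel_def by blast
  have "MT e T \<phi> $ p $ q = C * MT e (II a z) \<phi> $ p $ q"
    unfolding MT_nth 1 2 by (simp add: distrib_left sum_distrib_left mult.left_commute)
  also have "MT e (II a z) \<phi> $ p $ q = (\<integral>x. ksg a z x * (zeta e x $ p $ q * \<phi> x) \<partial>lborel)"
    using o by (intro MT_II[OF R f ksg_integrable_off[OF R f o]] Ker_integrable_off[OF f, of \<epsilon>]) (auto simp: off_def)
  finally show ?thesis .
qed

definition coord :: "'m::finite pt \<Rightarrow> 'm option \<Rightarrow> complex" where
  "coord x j = (case j of None \<Rightarrow> of_real (snd x) | Some i \<Rightarrow> of_real (fst x $ i))"

lemma zeta_coord: "zeta e x $ a $ b = (\<Sum>j\<in>UNIV. coord x j * e j $ a $ b)"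
  by (simp add: zeta_nth coord_def UNIV_option_conv sum.reindex add.commute)

text \<open>The anticommutator of zeta(x) with a generator e_j is -2 x_j, so zeta(x) = 0 forces
  every coordinate to vanish. One diagonal entry suffices to read this off.\<close>

lemma zeta_nonzero:
  fixes e :: "'m::finite option \<Rightarrow> complex^'s::finite^'s"
  assumes e: "clifford_rep e" and x: "x \<noteq> 0" shows "\<exists>a b. zeta e x $ a $ b \<noteq> 0"
proof (rule ccontr)
  assume "\<not> ?thesis"
  then have z: "(\<Sum>j\<in>UNIV. coord x j * e j $ a $ b) = 0" for a b by (simp add: zeta_coord)
  have "coord x j = 0" for j
  proof -
    fix p :: 's
    have 1: "(\<Sum>u\<in>UNIV. coord x u * (e u ** e j) $ p $ p) = 0"
    proof -
      have "(\<Sum>u\<in>UNIV. coord x u * (e u ** e j) $ p $ p) = (\<Sum>k\<in>UNIV. (\<Sum>u\<in>UNIV. coord x u * e u $ p $ k) * e j $ k $ p)"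
        by (simp add: matrix_matrix_mult_def sum_distrib_left sum_distrib_right mult.assoc) (rule sum.swap)
      then show ?thesis by (simp add: z)
    qed
    have 2: "(\<Sum>u\<in>UNIV. coord x u * (e j ** e u) $ p $ p) = 0"
    proof -
      have "(\<Sum>u\<in>UNIV. coord x u * (e j ** e u) $ p $ p) = (\<Sum>k\<in>UNIV. e j $ p $ k * (\<Sum>u\<in>UNIV. coord x u * e u $ k $ p))"
        by (simp add: matrix_matrix_mult_def sum_distrib_left mult.left_commute) (rule sum.swap)
      then show ?thesis by (simp add: z)
    qed
    have "(e u ** e j) $ p $ p + (e j ** e u) $ p $ p = (if u = j then - 2 else 0)" for u
    proof (cases "u = j")
      case True
      have "e j ** e j = - mat 1" using e by (simp add: clifford_rep_def)
      then show ?thesis using True by (simp add: mat_def)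
    next
      case False
      then have "e u ** e j = - (e j ** e u)" using e unfolding clifford_rep_def by blast
      then have "(e u ** e j) $ p $ p = - ((e j ** e u) $ p $ p)" by simp
      then show ?thesis using False by simp
    qed
    then have "(\<Sum>u\<in>UNIV. coord x u * (if u = j then - 2 else 0)) = (\<Sum>u\<in>UNIV. coord x u * ((e u ** e j) $ p $ p + (e j ** e u) $ p $ p))"
      by (simp only:)
    also have "\<dots> = 0" unfolding distrib_left sum.distrib 1 2 by simp
    finally show "coord x j = 0" by (simp add: if_distrib cong: if_cong)
  qed
  from this[of None] this[of "Some i" for i] have "x = 0"
    by (simp add: coord_def prod_eq_iff vec_eq_iff)
  with x show False by simp
qed

lemma eNone_nonzero:
  fixes e :: "'m::finite option \<Rightarrow> complex^'s::finite^'s"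
  assumes e: "clifford_rep e" shows "\<exists>a b. e None $ a $ b \<noteq> 0"
  using zeta_nonzero[OF e, of "(0, 1)"] by (simp add: zeta_nth zero_prod_def)

lemma dist_supp_subset:
  assumes "open \<Omega>" "\<And>\<phi>. \<phi> \<in> test_functions \<Longrightarrow> fsupp \<phi> \<subseteq> \<Omega> \<Longrightarrow> D \<phi> = 0"
  shows "dist_supp D \<subseteq> - \<Omega>"
  unfolding dist_supp_def using assms by blast

lemma dist_supp_supset:
  assumes "\<And>\<Omega> x. open \<Omega> \<Longrightarrow> x \<in> \<Omega> \<Longrightarrow> x \<in> S \<Longrightarrow> \<exists>\<phi>\<in>test_functions. fsupp \<phi> \<subseteq> \<Omega> \<and> D \<phi> \<noteq> 0"
  shows "S \<subseteq> dist_supp D"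
  unfolding dist_supp_def using assms by blast

lemma bump_fsupp: "0 < r \<Longrightarrow> r < d \<Longrightarrow> ball c d \<subseteq> \<Omega> \<Longrightarrow> (\<And>x. bump c r x = 0 \<Longrightarrow> f x = 0) \<Longrightarrow> fsupp f \<subseteq> \<Omega>"
proof -
  assume *: "0 < r" "r < d" "ball c d \<subseteq> \<Omega>" and f: "\<And>x. bump c r x = 0 \<Longrightarrow> f x = 0"
  have "fsupp f \<subseteq> cball c r"
  proof (rule fsupp_subset_closed)
    fix x assume "x \<notin> cball c r"
    then have "r \<le> norm (x - c)" by (simp add: dist_norm norm_minus_commute)
    then show "f x = 0" by (rule f[OF bump_zero[OF *(1)]])
  qed simp
  also have "\<dots> \<subseteq> ball c d" using *(2) by auto
  finally show ?thesis using *(3) by blast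
qed

text \<open>Every nonempty open set contains a point \<open>c\<close> off the hyperplane. Near it
  the functional is integration against the scalar kernel times zeta(x), and a small bump detects a
  nonzero entry of zeta(c).\<close>

lemma dist_supp_MT_UNIV:
  fixes D :: "('m::finite pt, 's::finite) mdist"
  assumes e: "clifford_rep e" and D: "\<And>\<phi>. \<phi> \<in> test_functions \<Longrightarrow> D \<phi> = MT e T \<phi>"
    and T: "off_kernel T C a z" and C: "C \<noteq> 0"
  shows "dist_supp D = UNIV"
proof -
  have "UNIV \<subseteq> dist_supp D"
  proof (rule dist_supp_supset)
    fix \<Omega> :: "'m pt set" and y assume o: "open \<Omega>" "y \<in> \<Omega>"
    obtain d where d: "d > 0" "ball y d \<subseteq> \<Omega>" using o by (rule openE)
    obtain c where c: "c \<in> \<Omega>" "snd c \<noteq> 0"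
    proof (cases "snd y = 0")
      case True
      have "dist y (y + (0, d/2)) < d" using d(1) by (simp add: dist_norm norm_prod_def)
      then show ?thesis using that[of "y + (0, d/2)"] d True by auto
    qed (use that o in blast)
    obtain d' where d': "d' > 0" "ball c d' \<subseteq> \<Omega>" using o(1) c(1) by (rule openE)
    have "c \<noteq> 0" using c(2) by auto
    then obtain p q where pq: "zeta e c $ p $ q \<noteq> 0" using zeta_nonzero[OF e] by blast
    \<comment> \<open>Half the height of \<open>c\<close>: a ball of radius at most \<epsilon>
      around \<open>c\<close> misses the slab |x_n| < \<epsilon>.\<close>
    define \<epsilon> where "\<epsilon> = \<bar>snd c\<bar> / 2"
    define d2 where "d2 = min d' \<epsilon>"
    have pos: "\<epsilon> > 0" "d2 > 0" using c d' by (auto simp: \<epsilon>_def d2_def)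
    have far: "d2 \<le> norm (x - c)" if "\<bar>snd x\<bar> < \<epsilon>" for x
    proof -
      have "\<bar>snd x - snd c\<bar> \<le> norm (x - c)"
        using norm_snd_le[of "snd x - snd c" "fst x - fst c"] by (simp add: minus_prod_def)
      then show ?thesis using that unfolding \<epsilon>_def d2_def by linarith
    qed
    have snz: "snd x \<noteq> 0" if "x \<in> ball c d2" for x
      using far[of x] that pos by (auto simp: dist_norm norm_minus_commute)
    define F where "F = (\<lambda>x. ksg a z x * zeta e x $ p $ q)"
    have cF: "continuous_on (ball c d2) F"
    proof -
      have 1: "continuous_on (ball c d2) (\<lambda>x::'m pt. of_real (sgn (snd x)) :: complex)"
        using snz by (intro continuous_intros) auto
      have 2: "continuous_on (ball c d2) (\<lambda>x::'m pt. complex_of_real \<bar>snd x\<bar> powr w)" for w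
        using snz by (intro continuous_on_powr_complex continuous_intros) (auto simp: complex_nonpos_Reals_iff)
      have 3: "continuous_on (ball c d2) (W w :: 'm pt \<Rightarrow> complex)" for w
        by (rule continuous_on_subset[OF smooth_on_continuous[OF smooth_on_W]]) (use snz in fastforce)
      have 4: "continuous_on (ball c d2) (\<lambda>x. zeta e x $ p $ q)"
        unfolding zeta_nth by (intro continuous_intros)
      show ?thesis unfolding F_def ksg_def SP_def by (intro continuous_on_mult 1 2 3 4)
    qed
    have "F c \<noteq> 0" using pq c \<open>c \<noteq> 0\<close> by (simp add: F_def ksg_def SP_def W_def sgn_zero_iff)
    from bump_integral_nonzero[OF cF this pos(2)] obtain r
      where r: "0 < r" "r < d2" "(\<integral>x. F x * bump c r x \<partial>lborel) \<noteq> 0" .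
    have t: "bump c r \<in> tf (norm c + r)" by (rule bump_tf[OF r(1)])
    have o': "off \<epsilon> (bump c r)"
      unfolding off_def using pos(1) far r(1,2) by (auto intro!: bump_zero intro: order_trans[OF less_imp_le])
    have R: "norm c + r > 0" using r(1) by (simp add: add_nonneg_pos)
    have "MT e T (bump c r) $ p $ q = C * (\<integral>x. F x * bump c r x \<partial>lborel)"
      unfolding MT_off[OF T R t o'] F_def by (simp add: mult.assoc)
    then have "MT e T (bump c r) $ p $ q \<noteq> 0" using r(3) C by simp
    then have "D (bump c r) \<noteq> 0" unfolding D[OF tf_test(1)[OF t]] by auto
    moreover have "fsupp (bump c r) \<subseteq> \<Omega>"
      by (rule bump_fsupp[of r d' c]) (use r d' in \<open>auto simp: d2_def\<close>)
    ultimately show "\<exists>\<phi>\<in>test_functions. fsupp \<phi> \<subseteq> \<Omega> \<and> D \<phi> \<noteq> 0" using tf_test(1)[OF t] by blast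
  qed
  then show ?thesis by blast
qed

lemma test_off:
  fixes \<phi> :: "'b::euclidean_space \<times> real \<Rightarrow> complex"
  assumes "\<phi> \<in> test_functions" "fsupp \<phi> \<subseteq> {x. snd x \<noteq> 0}" obtains \<epsilon> where "off \<epsilon> \<phi>"
proof (cases "fsupp \<phi> = {}")
  case True
  then have "off 1 \<phi>" using fsupp_zero[of _ \<phi>] by (simp add: off_def)
  then show ?thesis by (rule that)
next
  case False
  have "compact (fsupp \<phi>)" using assms(1) by (simp add: test_functions_def)
  moreover have "continuous_on (fsupp \<phi>) (\<lambda>x. \<bar>snd x\<bar>)" by (intro continuous_intros)
  ultimately obtain y where y: "y \<in> fsupp \<phi>" "\<And>x. x \<in> fsupp \<phi> \<Longrightarrow> \<bar>snd y\<bar> \<le> \<bar>snd x\<bar>"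
    using continuous_attains_inf[of "fsupp \<phi>" "\<lambda>x. \<bar>snd x\<bar>"] False by blast
  then have "off \<bar>snd y\<bar> \<phi>" unfolding off_def using assms(2) y(2) by (force intro: fsupp_zero)
  then show ?thesis by (rule that)
qed

text \<open>The function is even in x_n, so that the tangential entries of \<open>MT\<close> vanish
  on it, and the power of x_n absorbs 2k normal derivatives, leaving an ordinary bump on the
  hyperplane.\<close>

definition hbump :: "nat \<Rightarrow> 'b::euclidean_space \<Rightarrow> real \<Rightarrow> 'b \<times> real \<Rightarrow> complex" where
  "hbump k c r x = of_real (snd x) ^ (2 * k) * bump (c, 0) r x"

lemma hbump_tf: "r > 0 \<Longrightarrow> hbump k c r \<in> tf (norm c + r)"
  unfolding hbump_def[abs_def] using bump_tf[of r "(c, 0)"]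
  by (intro tf_mult) (auto simp: smooth_iff[symmetric] norm_prod_def intro: smooth_on_power[OF open_UNIV, folded smooth_iff] smooth_snd)

text \<open>The constant 0 in \<open>off_kernel\<close> bounds the support from above. For the
  converse, \<open>hbump\<close> is tested near nonzero points of the hyperplane, where the density
  \<open>F\<close> is continuous and nonzero. The origin is reached through nearby multiples of a
  tangential basis vector.\<close>

lemma dist_supp_MT_hyperplane:
  fixes D :: "('m::finite pt, 's::finite) mdist"
  assumes e: "clifford_rep e" and T: "cfn T" and D: "\<And>\<phi>. \<phi> \<in> test_functions \<Longrightarrow> D \<phi> = MT e T \<phi>"
    and off: "off_kernel T 0 a z"
    and F: "\<And>c. c \<noteq> 0 \<Longrightarrow> continuous_on (- {0}) F \<and> F c \<noteq> 0"
    and h: "\<And>c r. 0 < r \<Longrightarrow> r < norm c \<Longrightarrow> T (hbump k c r) = (\<integral>x. F x * bump c r x \<partial>lborel)"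
  shows "dist_supp D = hyperplane"
proof
  have "dist_supp D \<subseteq> - {x. snd x \<noteq> 0}"
  proof (rule dist_supp_subset)
    show "open {x::'m pt. snd x \<noteq> 0}" by (intro open_Collect_neq continuous_intros)
    fix \<phi> :: "'m pt \<Rightarrow> complex" assume t: "\<phi> \<in> test_functions" and s: "fsupp \<phi> \<subseteq> {x. snd x \<noteq> 0}"
    obtain \<epsilon> where o: "off \<epsilon> \<phi>" by (rule test_off[OF t s])
    obtain R where R: "R > 0" "\<phi> \<in> tf R" by (rule test_functions_tf[OF t])
    show "D \<phi> = 0" unfolding D[OF t] by (simp add: vec_eq_iff MT_off[OF off R o])
  qed
  then show "dist_supp D \<subseteq> hyperplane" by (auto simp: hyperplane_def)
  show "hyperplane \<subseteq> dist_supp D"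
  proof (rule dist_supp_supset)
    fix \<Omega> :: "'m pt set" and y assume o: "open \<Omega>" "y \<in> \<Omega>" "y \<in> hyperplane"
    obtain c where c: "(c, 0) \<in> \<Omega>" "c \<noteq> 0"
    proof (cases "fst y = 0")
      case True
      then have y: "y = 0" using o(3) by (simp add: hyperplane_def prod_eq_iff)
      obtain d where d: "d > 0" "ball y d \<subseteq> \<Omega>" using o(1,2) by (rule openE)
      obtain b :: "real^'m" where b: "b \<in> Basis" using nonempty_Basis by blast
      have "dist y ((d/2) *\<^sub>R b, 0::real) < d" using d(1) b by (simp add: y dist_norm norm_prod_def)
      then have "((d/2) *\<^sub>R b, 0) \<in> \<Omega>" using d(2) by auto
      moreover have "(d/2) *\<^sub>R b \<noteq> 0" using d(1) nonzero_Basis[OF b] by simp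
      ultimately show ?thesis by (rule that)
    next
      case False
      then show ?thesis using that[of "fst y"] o(2,3) by (simp add: hyperplane_def) (metis prod.collapse)
    qed
    obtain d where d: "d > 0" "ball (c, 0) d \<subseteq> \<Omega>" using o(1) c(1) by (rule openE)
    define d2 where "d2 = min d (norm c)"
    have d2: "d2 > 0" using d c by (simp add: d2_def)
    have "continuous_on (ball c d2) F"
      by (rule continuous_on_subset[OF conjunct1[OF F[OF c(2)]]]) (auto simp: d2_def dist_norm)
    from bump_integral_nonzero[OF this conjunct2[OF F[OF c(2)]] d2] obtain r
      where r: "0 < r" "r < d2" "(\<integral>x. F x * bump c r x \<partial>lborel) \<noteq> 0" .
    have t: "hbump k c r \<in> tf (norm c + r)" by (rule hbump_tf[OF r(1)])
    have R: "norm c + r > 0" using r(1) by (simp add: add_nonneg_pos)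
    have "Qop (xi i (hbump k c r)) = (\<lambda>x. 0)" for i
    proof (rule Qop_even[OF R cop_tf[OF cop_xi R t]])
      fix x :: "'m pt"
      have "norm (sc (-1) x - (c, 0)) = norm (x - (c, 0))" by (simp add: sc_def norm_prod_def)
      then show "xi i (hbump k c r) (sc (-1) x) = xi i (hbump k c r) x"
        by (simp add: xi_def hbump_def bump_def sc_m1)
    qed
    then have M: "MT e T (hbump k c r) $ p $ q = e None $ p $ q * T (hbump k c r)" for p q
      by (simp add: MT_nth cfn_zero[OF T])
    obtain p q where "e None $ p $ q \<noteq> 0" using eNone_nonzero[OF e] by blast
    then have "MT e T (hbump k c r) $ p $ q \<noteq> 0" unfolding M using h[of r c] r by (simp add: d2_def)
    then have "D (hbump k c r) \<noteq> 0" unfolding D[OF tf_test(1)[OF t]] by auto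
    moreover have "fsupp (hbump k c r) \<subseteq> \<Omega>"
      by (rule bump_fsupp[of r d "(c, 0)"]) (use r d in \<open>auto simp: d2_def hbump_def\<close>)
    ultimately show "\<exists>\<phi>\<in>test_functions. fsupp \<phi> \<subseteq> \<Omega> \<and> D \<phi> \<noteq> 0" using tf_test(1)[OF t] by blast
  qed
qed

lemma Dn_snd_power:
  fixes g :: "'b::euclidean_space \<times> real \<Rightarrow> complex"
  assumes T: "open T" and g: "smooth_on T g" and x: "x \<in> T" "snd x = 0"
  shows "Dn m (\<lambda>x. of_real (snd x) ^ m * g x) x = fact m * g x"
proof (induction m)
  case (Suc m)
  have s: "smooth_on T (\<lambda>x. of_real (snd x) ^ m * g x)"
    by (intro smooth_on_mult smooth_on_power T g smooth_on_UNIV_D[OF smooth_snd])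
  show ?case
    using Dn_snd_mult[OF T s x(1), of m] Suc.IH x(2) by (simp add: mult.assoc del: pderivs_Cons replicate.simps)
qed simp

section \<open>The families B and C\<close>

lemma hbump_slice:
  fixes w :: "'b::euclidean_space \<times> real \<Rightarrow> complex"
  assumes T: "open T" and w: "smooth_on T w" and x: "(x', 0) \<in> T"
  shows "Dn (2 * k) (\<lambda>x. w x * hbump k c r x) (x', 0) = fact (2 * k) * (w (x', 0) * bump c r x')"
proof -
  have "(\<lambda>x. w x * hbump k c r x) = (\<lambda>x. of_real (snd x) ^ (2 * k) * (w x * bump (c, 0) r x))"
    by (simp add: hbump_def mult_ac)
  moreover have "smooth_on T (\<lambda>x. w x * bump (c, 0) r x)"
    by (intro smooth_on_mult T w smooth_on_UNIV_D[OF smooth_bump])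
  ultimately show ?thesis
    using Dn_snd_power[OF T, of "\<lambda>x. w x * bump (c, 0) r x" "(x', 0)" "2 * k"] x
    by (simp add: bump_def norm_prod_def del: pderivs_Cons replicate.simps)
qed

lemma W_bump_integrable:
  fixes c :: "'b::euclidean_space"
  assumes r: "0 < r" "r < norm c"
  shows "integrable lborel (\<lambda>x. W s x * bump c r x)"
proof -
  note t = bump_tf[OF r(1), of c]
  have [measurable]: "bump c r \<in> borel_measurable borel" by (rule tf_measurable[OF t])
  define B where "B = (norm c - r) powr Re s + (norm c + r) powr Re s"
  show ?thesis
  proof (rule integrable_bounded_ball[where R="norm c + r" and B="B * sem 0 (bump c r)"])
    fix x
    show "norm (W s x * bump c r x) \<le> B * sem 0 (bump c r)"
    proof (cases "norm (x - c) < r")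
      case True
      have "norm c - r \<le> norm x" "norm x \<le> norm c + r"
        using True norm_triangle_ineq2[of c x] norm_triangle_ineq2[of x c] by (auto simp: norm_minus_commute)
      then show ?thesis using r pderivs_le_sem[OF t, of "[]" 0 x] powr_between[of "norm c - r" "norm x" "norm c + r" "Re s"]
        unfolding norm_mult norm_W B_def by (intro mult_mono) auto
    next
      case False
      then have "bump c r x = 0" by (intro bump_zero[OF r(1)]) simp
      moreover have "0 \<le> B * sem 0 (bump c r)" unfolding B_def by (intro mult_nonneg_nonneg sem_nonneg[OF t]) simp
      ultimately show ?thesis by simp
    qed
  qed (use tf_zero[OF t] in simp_all)
qed

lemma W_bump_holomorphic:
  fixes c :: "'b::euclidean_space"
  assumes r: "0 < r" "r < norm c"
  shows "(\<lambda>s. \<integral>x. W s x * bump c r x \<partial>lborel) holomorphic_on UNIV"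
proof -
  have [measurable]: "bump c r \<in> borel_measurable borel" by (rule tf_measurable[OF bump_tf[OF r(1)]])
  have e: "exp (s * of_real (ln (norm x)) + t * of_real 0) * bump c r x = W s x * bump c r x" for s t x
  proof (cases "x = 0")
    case True
    then have "bump c r x = 0" using r by (intro bump_zero) auto
    then show ?thesis by simp
  next
    case False
    then show ?thesis by (simp add: W_def powr_def Ln_of_real)
  qed
  have "hol2 UNIV (\<lambda>p. \<integral>x. exp (fst p * of_real (ln (norm x)) + snd p * of_real 0) * bump c r x \<partial>lborel)"
    by (rule exp_integral_hol2) (auto simp only: e intro!: W_bump_integrable r, measurable)
  from hol2_slice[OF this open_UNIV holomorphic_on_ident holomorphic_on_const[of 0]] show ?thesis
    unfolding fst_conv snd_conv e by simp
qed

text \<open>\<open>G_at_odd\<close> requires Re z to be large because of the singularity at the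
  origin. Here the bump stays away from the origin, its weighted integral is entire in z, and the
  formula continues to all z.\<close>

lemma G_hbump:
  fixes c :: "'b::euclidean_space"
  assumes r: "0 < r" "r < norm c"
  shows "G (- 1 - 2 * of_nat k) z (hbump k c r) =
    (\<integral>x. ((-1) ^ k * fact k * rGamma (z / 2) * W (z + 1 + 2 * of_nat k - dm TYPE('b)) x) * bump c r x \<partial>lborel)"
proof -
  have R: "norm c + r > 0" using r by (simp add: add_nonneg_pos)
  note t = hbump_tf[OF r(1), of k c]
  have "G (- 1 - 2 * of_nat k) z (hbump k c r) =
    (-1) ^ k * fact k * rGamma (z / 2) * (\<integral>x. W (z + 1 + 2 * of_nat k - dm TYPE('b)) x * bump c r x \<partial>lborel)"
  proof (rule analytic_continuation_open[of "{z. Re z > real DIM('b) + 1}" UNIV "\<lambda>z. G (- 1 - 2 * of_nat k) z (hbump k c r)"])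
    show "open {z. Re z > real DIM('b) + 1}" by (intro open_Collect_less continuous_intros)
    show "{z. Re z > real DIM('b) + 1} \<noteq> {}" by (auto intro!: exI[of _ "of_nat (DIM('b) + 2)"])
    show "(\<lambda>z. G (- 1 - 2 * of_nat k) z (hbump k c r)) holomorphic_on UNIV"
      using hol2_slice[OF G_hol2[OF R t] open_UNIV holomorphic_on_const holomorphic_on_ident] by simp
    have "(\<lambda>z. z + 1 + 2 * of_nat k - dm TYPE('b)) holomorphic_on UNIV" by (intro holomorphic_intros)
    from holomorphic_on_compose_gen[OF this W_bump_holomorphic[OF r], unfolded o_def]
    show "(\<lambda>z. (-1) ^ k * fact k * rGamma (z / 2) * (\<integral>x. W (z + 1 + 2 * of_nat k - dm TYPE('b)) x * bump c r x \<partial>lborel)) holomorphic_on UNIV"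
      by (intro holomorphic_on_mult) (auto intro!: holomorphic_intros holomorphic_on_compose_gen[OF _ holomorphic_rGamma, unfolded o_def])
    fix z assume z: "z \<in> {z. Re z > real DIM('b) + 1}"
    have "(if x' = 0 then 0 else Dn (2 * k) (\<lambda>x. W s x * hbump k c r x) (x', 0)) = fact (2 * k) * (W s x' * bump c r x')" for s and x' :: 'b
      using hbump_slice[OF open_U0 smooth_on_W, of x' k s c r] by (auto simp: W_def norm_prod_def simp del: pderivs_Cons replicate.simps)
    then have "BB k s (hbump k c r) = fact (2 * k) * (\<integral>x. W s x * bump c r x \<partial>lborel)" for s
      unfolding BB_def by simp
    then show "G (- 1 - 2 * of_nat k) z (hbump k c r) =
       (-1) ^ k * fact k * rGamma (z / 2) * (\<integral>x. W (z + 1 + 2 * of_nat k - dm TYPE('b)) x * bump c r x \<partial>lborel)"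
      using z by (subst G_at_odd[OF R t]) simp_all
  qed auto
  then show ?thesis by (simp add: mult.assoc)
qed

text \<open>The second renormalization in scalar form: the continuation in a of |x_n|^a |x|^(2j) /
  Gamma((a+1)/2).\<close>

definition HJ :: "nat \<Rightarrow> complex \<Rightarrow> ('b::euclidean_space \<times> real \<Rightarrow> complex) \<Rightarrow> complex" where
  "HJ j a f = H0 a (\<lambda>x. of_real ((norm x)\<^sup>2) ^ j * f x)"

lemma cfn_HJ: "cfn (HJ j a)"
  unfolding HJ_def[abs_def] by (rule cfn_comp[OF cfn_H0 cop_norm_sq_power])

lemma smooth_norm_sq_power: "smooth (\<lambda>x::'a::euclidean_space. complex_of_real ((norm x)\<^sup>2) ^ j)"
  unfolding smooth_iff by (intro smooth_on_power open_UNIV smooth_on_norm_sq)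

lemma HJ_at_odd:
  fixes f :: "'b::euclidean_space \<times> real \<Rightarrow> complex"
  assumes "R > 0" "f \<in> tf R"
  shows "HJ j (- 1 - 2 * of_nat k) f = (-1) ^ k * fact k / fact (2 * k) * (\<integral>x'. Dn (2 * k) (\<lambda>x. of_real ((norm x)\<^sup>2) ^ j * f x) (x', 0) \<partial>lborel)"
  unfolding HJ_def by (rule H0_at_odd[OF assms(1) tf_norm_sq_power[OF assms]])

lemma HJ_hbump:
  fixes c :: "'b::euclidean_space"
  assumes r: "0 < r"
  shows "HJ j (- 1 - 2 * of_nat k) (hbump k c r) = (\<integral>x. ((-1) ^ k * fact k * of_real ((norm x)\<^sup>2) ^ j) * bump c r x \<partial>lborel)"
proof -
  have R: "norm c + r > 0" using r by (simp add: add_nonneg_pos)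
  have "Dn (2 * k) (\<lambda>x. of_real ((norm x)\<^sup>2) ^ j * hbump k c r x) (x', 0) = fact (2 * k) * (of_real ((norm x')\<^sup>2) ^ j * bump c r x')" for x' :: 'b
    using hbump_slice[OF open_UNIV smooth_norm_sq_power[unfolded smooth_iff], of x' k j c r]
    by (simp add: norm_prod_def del: pderivs_Cons replicate.simps)
  then show ?thesis unfolding HJ_at_odd[OF R hbump_tf[OF r]] by (simp add: mult.assoc del: of_real_power)
qed

text \<open>The derivatives in the family B are not controlled at x' = 0; changing a measurable
  function at one point affects neither measurability nor the integral.\<close>

lemma integral_punctured:
  fixes f g :: "'b::euclidean_space \<Rightarrow> complex"
  assumes [measurable]: "g \<in> borel_measurable borel" and eq: "\<And>x. x \<noteq> 0 \<Longrightarrow> f x = g x"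
  shows "(\<integral>x. f x \<partial>lborel) = (\<integral>x. g x \<partial>lborel)"
proof (rule integral_cong_AE)
  have "f = (\<lambda>x. if x = 0 then f 0 else g x)" using eq by auto
  moreover have "(\<lambda>x. if x = 0 then f 0 else g x) \<in> borel_measurable borel" by measurable
  ultimately show "f \<in> borel_measurable lborel" by simp
  show "AE x in lborel. f x = g x" using AE_nonzero by eventually_elim (rule eq)
qed simp

definition slice :: "nat \<Rightarrow> ('b::euclidean_space \<times> real \<Rightarrow> complex) \<Rightarrow> ('b \<times> real \<Rightarrow> complex) \<Rightarrow> 'b \<Rightarrow> complex" where
  "slice k w f x' = (if x' = 0 then 0 else Dn (2 * k) (\<lambda>x. w x * f x) (x', 0))"

text \<open>By \<open>Dn_odd_weight\<close> the odd normal derivative of w x_i \<phi> is 2k + 1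
  times an even one of w \<open>Qop (xi i \<phi>)\<close>. Both summands of the delta combination
  then carry the factor -(2k+1); in the first the sign is (-1)^(2k+1).\<close>

lemma delta_comb_MT:
  fixes \<phi> w :: "'m::finite pt \<Rightarrow> complex"
  assumes w: "smooth_on U0 w" "\<And>x. w (sc (-1) x) = w x" and R: "R > 0" and f: "\<phi> \<in> tf R"
    and int: "\<And>f. f \<in> tf R \<Longrightarrow> integrable lborel (slice k w f)"
  shows "delta_comb (e :: 'm option \<Rightarrow> complex^'s::finite^'s) k w \<phi> = MT e (\<lambda>f. - of_nat (2 * k + 1) * (\<integral>x. slice k w f x \<partial>lborel)) \<phi>"
proof -
  have sw: "smooth_on U0 (\<lambda>x. w x * f x)" if "f \<in> tf R" for f :: "'m pt \<Rightarrow> complex"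
    by (intro smooth_on_mult open_U0 w smooth_on_UNIV_D[OF tf_smooth[OF that]])
  note tx = cop_tf[OF cop_xi R f] and tQ = tf_Qop_xi[OF R f]
  have 1: "(\<integral>x'. Dn (2 * k + 1) (\<lambda>x. csmult (w x) (zeta' e x) $ p $ q * \<phi> x) (x', 0) \<partial>lborel)
      = (\<Sum>i\<in>UNIV. of_nat (2 * k + 1) * (e (Some i) $ p $ q * (\<integral>x. slice k w (Qop (xi i \<phi>)) x \<partial>lborel)))" for p q
  proof -
    have "(\<integral>x'. Dn (2 * k + 1) (\<lambda>x. csmult (w x) (zeta' e x) $ p $ q * \<phi> x) (x', 0) \<partial>lborel)
      = (\<integral>x'. (\<Sum>i\<in>UNIV. of_nat (2 * k + 1) * (e (Some i) $ p $ q * slice k w (Qop (xi i \<phi>)) x')) \<partial>lborel)"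
    proof (rule integral_punctured)
      show "(\<lambda>x'. \<Sum>i\<in>UNIV. of_nat (2 * k + 1) * (e (Some i) $ p $ q * slice k w (Qop (xi i \<phi>)) x')) \<in> borel_measurable borel"
        using borel_measurable_integrable[OF int[OF tQ]] by (intro borel_measurable_sum borel_measurable_times) simp_all
      fix x' :: "real^'m" assume x: "x' \<noteq> 0"
      then have x0: "(x', 0::real) \<in> U0" by simp
      have e: "(\<lambda>x. csmult (w x) (zeta' e x) $ p $ q * \<phi> x) = (\<lambda>x. \<Sum>i\<in>UNIV. e (Some i) $ p $ q * (w x * xi i \<phi> x))"
        by (simp add: fun_eq_iff csmult_def zeta'_def xi_def sum_distrib_left sum_distrib_right mult_ac scaleR_conv_of_real[where 'a=complex])
      have c: "smooth_on U0 (\<lambda>x. e (Some i) $ p $ q * (w x * xi i \<phi> x))" for i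
        by (intro smooth_on_mult[OF open_U0 smooth_on_const[OF open_U0]] sw tx)
      have "Dn (2 * k + 1) (\<lambda>x. csmult (w x) (zeta' e x) $ p $ q * \<phi> x) (x', 0)
         = (\<Sum>i\<in>UNIV. e (Some i) $ p $ q * Dn (2 * k + 1) (\<lambda>x. w x * xi i \<phi> x) (x', 0))"
        unfolding e pderivs_sum[OF open_U0 finite c set_Dn x0] pderivs_cmult[OF open_U0 sw[OF tx] set_Dn x0] ..
      then show "Dn (2 * k + 1) (\<lambda>x. csmult (w x) (zeta' e x) $ p $ q * \<phi> x) (x', 0)
         = (\<Sum>i\<in>UNIV. of_nat (2 * k + 1) * (e (Some i) $ p $ q * slice k w (Qop (xi i \<phi>)) x'))"
        unfolding Dn_odd_weight[OF w R tx x] slice_def using x by (simp add: mult_ac del: pderivs_Cons replicate.simps)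
    qed
    also have "\<dots> = (\<Sum>i\<in>UNIV. of_nat (2 * k + 1) * (e (Some i) $ p $ q * (\<integral>x. slice k w (Qop (xi i \<phi>)) x \<partial>lborel)))"
      by (subst Bochner_Integration.integral_sum) (auto intro!: integrable_mult_right int tQ)
    finally show ?thesis .
  qed
  have 2: "(\<integral>x'. Dn (2 * k) (\<lambda>x. csmult (w x) (e None) $ p $ q * \<phi> x) (x', 0) \<partial>lborel) = e None $ p $ q * (\<integral>x. slice k w \<phi> x \<partial>lborel)" for p q
  proof -
    have e: "(\<lambda>x. csmult (w x) (e None) $ p $ q * \<phi> x) = (\<lambda>x. e None $ p $ q * (w x * \<phi> x))"
      by (simp add: fun_eq_iff csmult_def mult_ac)
    have "(\<integral>x'. Dn (2 * k) (\<lambda>x. csmult (w x) (e None) $ p $ q * \<phi> x) (x', 0) \<partial>lborel) = (\<integral>x. e None $ p $ q * slice k w \<phi> x \<partial>lborel)"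
    proof (rule integral_punctured)
      show "(\<lambda>x. e None $ p $ q * slice k w \<phi> x) \<in> borel_measurable borel"
        using borel_measurable_integrable[OF int[OF f]] by simp
      fix x' :: "real^'m" assume x: "x' \<noteq> 0"
      then have x0: "(x', 0::real) \<in> U0" by simp
      show "Dn (2 * k) (\<lambda>x. csmult (w x) (e None) $ p $ q * \<phi> x) (x', 0) = e None $ p $ q * slice k w \<phi> x'"
        unfolding e pderivs_cmult[OF open_U0 sw[OF f] set_Dn x0] slice_def using x by (simp del: pderivs_Cons replicate.simps)
    qed
    then show ?thesis by simp
  qed
  have nth: "csmult c A $ p $ q = c * A $ p $ q" for c p q and A :: "complex^'s^'s" by (simp add: csmult_def)
  define N where "N = (of_nat (2 * k + 1) :: complex)"
  show ?thesis
    unfolding vec_eq_iff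
  proof (intro allI)
    fix p q
    have "delta_comb e k w \<phi> $ p $ q =
      (-1) ^ (2 * k + 1) * (\<Sum>i\<in>UNIV. N * (e (Some i) $ p $ q * (\<integral>x. slice k w (Qop (xi i \<phi>)) x \<partial>lborel)))
      - N * ((-1) ^ (2 * k) * (e None $ p $ q * (\<integral>x. slice k w \<phi> x \<partial>lborel)))"
      unfolding N_def
      by (simp only: delta_comb_def mat_times_dist_def delta_n_def vector_minus_component vec_lambda_beta nth 1[unfolded nth] 2[unfolded nth])
    also have "\<dots> = MT e (\<lambda>f. - of_nat (2 * k + 1) * (\<integral>x. slice k w f x \<partial>lborel)) \<phi> $ p $ q"
      unfolding MT_nth N_def[symmetric] by (simp add: sum_negf mult_ac)
    finally show "delta_comb e k w \<phi> $ p $ q = MT e (\<lambda>f. - of_nat (2 * k + 1) * (\<integral>x. slice k w f x \<partial>lborel)) \<phi> $ p $ q" .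
  qed
qed

definition cB :: "nat \<Rightarrow> complex" where
  "cB k = (-1) ^ (k + 1) * fact k / fact (2 * k + 1)"

lemma cB_nonzero: "cB k \<noteq> 0"
  unfolding cB_def divide_eq_0_iff mult_eq_0_iff power_eq_0_iff by (simp only: fact_nonzero) simp

text \<open>Reconciles the constant (-1)^k k! / (2k)! of the scalar functionals with the one in the
  theorem; their quotient is the factor -(2k+1) of \<open>delta_comb_MT\<close>.\<close>

lemma cB_mult: "cB k * (- of_nat (2 * k + 1) * I) = (-1) ^ k * fact k / fact (2 * k) * I"
proof -
  have "fact (2 * k + 1) = of_nat (2 * k + 1) * (fact (2 * k) :: complex)" by simp
  moreover have "(of_nat (2 * k + 1) :: complex) \<noteq> 0" by (simp only: of_nat_eq_0_iff)
  moreover have "(-1) ^ (k + 1) * F / (M * D) * (- M * I) = (-1) ^ k * F / D * I" if "M \<noteq> 0" for F M D :: complex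
    using that by simp
  ultimately show ?thesis unfolding cB_def by (simp only: not_False_eq_True)
qed

text \<open>On the half-plane of the definition the delta combination is an integral over the
  hyperplane, which \<open>G_at_odd\<close> identifies with \<open>G\<close> at a = -1 - 2k. As
  \<open>G\<close> is entire in nu, it is the continuation.\<close>

lemma KBt_MT:
  fixes \<phi> :: "'m::finite pt \<Rightarrow> complex"
  assumes R: "R > 0" and f: "\<phi> \<in> tf R"
  shows "csmult (cB k) (KBt e k nu \<phi>) = MT e (G (- 1 - 2 * of_nat k) (- 1 - 2 * of_nat k - 2 * nu)) \<phi>"
proof -
  define g where "g = (\<lambda>v p q. MT e (\<lambda>f. 1 / cB k * G (- 1 - 2 * of_nat k) (- 1 - 2 * of_nat k - 2 * v) f) \<phi> $ p $ q)"
  have "KBt e k nu \<phi> $ p $ q = g nu p q" for p q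
  proof -
    have "holo_cont1 {v. Re (- 2 * v - of_nat (CARD('m) + 1)) > real (2*k+1)}
       (\<lambda>v. let lam = - 3/2 - 2 * of_nat k - v in
          rGamma ((lam - v + 1/2) / 2) *
          delta_comb e k (\<lambda>x. of_real (rsq x) powr (- v - of_nat (CARD('m) + 1) / 2)) \<phi> $ p $ q)
       nu = g nu p q"
    proof (rule holo_cont1_eq[where g="\<lambda>v. g v p q"])
      show "open {v. Re (- 2 * v - of_nat (CARD('m) + 1)) > real (2*k+1)}" by (intro open_Collect_less continuous_intros)
      show "{v. Re (- 2 * v - of_nat (CARD('m) + 1)) > real (2*k+1)} \<noteq> {}"
        by (auto intro!: exI[of _ "- of_nat (CARD('m) + 2 * k + 3)"])
      have h: "(\<lambda>v. - 1 - 2 * of_nat k - 2 * v) holomorphic_on UNIV" by (intro holomorphic_intros)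
      have "(\<lambda>v. G (- 1 - 2 * of_nat k) (- 1 - 2 * of_nat k - 2 * v) f) holomorphic_on UNIV"
        if "f \<in> tf R" for f :: "'m pt \<Rightarrow> complex"
        using hol2_slice[OF G_hol2[OF R that] open_UNIV holomorphic_on_const h] by simp
      then show "(\<lambda>v. g v p q) holomorphic_on UNIV" unfolding g_def
        by (intro holomorphic_MT[OF R f] holomorphic_on_mult holomorphic_on_const)
      fix v assume v: "v \<in> {v. Re (- 2 * v - of_nat (CARD('m) + 1)) > real (2*k+1)}"
      \<comment> \<open>\<open>s\<close> is the exponent of |x| in the weight and \<open>z\<close>,
        defined next, the second scalar parameter. The half-plane yields both Re s > 2k and Re z >
        n.\<close>
      define s where "s = - 2 * v - of_nat (CARD('m) + 1)"
      define z where "z = - 1 - 2 * of_nat k - 2 * v"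
      have s: "s = z + 1 + 2 * of_nat k - dm TYPE(real^'m)" by (simp add: s_def z_def)
      have Rs: "Re s > 2 * real k" using v by (simp add: s_def)
      have Rz: "Re z > real DIM(real^'m) + 1" using v by (simp add: z_def)
      have w: "(\<lambda>x::'m pt. of_real (rsq x) powr (- v - of_nat (CARD('m) + 1) / 2)) = W s"
      proof -
        have "2 * (- v - c / 2) = - 2 * v - c" for c :: complex by (simp add: field_simps)
        then have "2 * (- v - of_nat (CARD('m) + 1) / 2) = s" unfolding s_def by blast
        then show ?thesis unfolding W_rsq by simp
      qed
      have sl: "slice k (W s) f = (\<lambda>x'. if x' = 0 then 0 else Dn (2 * k) (\<lambda>x. W s x * f x) (x', 0))" for f :: "'m pt \<Rightarrow> complex"
        by (simp add: slice_def fun_eq_iff del: pderivs_Cons replicate.simps)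
      have "delta_comb e k (W s) \<phi> = MT e (\<lambda>f. - of_nat (2 * k + 1) * BB k s f) \<phi>"
        unfolding BB_def sl[symmetric]
        by (rule delta_comb_MT[OF smooth_on_W W_reflect R f]) (auto simp only: sl intro!: Dn_W_integrable[OF R _ Rs])
      then have "rGamma (z / 2) * delta_comb e k (W s) \<phi> $ p $ q = MT e (\<lambda>f. rGamma (z / 2) * (- of_nat (2 * k + 1) * BB k s f)) \<phi> $ p $ q"
        by (simp only: MT_scale csmult_def vec_lambda_beta)
      also have "\<dots> = g v p q"
        unfolding g_def z_def[symmetric]
      proof (rule arg_cong[where f="\<lambda>M. M $ p $ q"], rule MT_cong[OF R f])
        fix f :: "'m pt \<Rightarrow> complex" assume f: "f \<in> tf R"
        have "G (- 1 - 2 * of_nat k) z f = cB k * (- of_nat (2 * k + 1) * (rGamma (z / 2) * BB k s f))"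
          unfolding cB_mult using G_at_odd[OF R f Rz, of k] by (simp add: s)
        then show "rGamma (z / 2) * (- of_nat (2 * k + 1) * BB k s f) = 1 / cB k * G (- 1 - 2 * of_nat k) z f"
          using cB_nonzero[of k] by (simp add: mult_ac)
      qed
      finally have "rGamma (z / 2) * delta_comb e k (W s) \<phi> $ p $ q = g v p q" .
      moreover have "(- 3/2 - 2 * of_nat k - v) - v + 1/2 = z" by (simp add: z_def)
      ultimately show "(let lam = - 3/2 - 2 * of_nat k - v in
          rGamma ((lam - v + 1/2) / 2) *
          delta_comb e k (\<lambda>x. of_real (rsq x) powr (- v - of_nat (CARD('m) + 1) / 2)) \<phi> $ p $ q) = g v p q"
        unfolding Let_def w by (simp only:)
    qed
    then show ?thesis by (simp add: KBt_def)
  qed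
  then show ?thesis unfolding g_def MT_scale using cB_nonzero[of k] by (simp add: vec_eq_iff csmult_def)
qed

lemma delta_comb_HJ:
  fixes \<phi> :: "'m::finite pt \<Rightarrow> complex"
  assumes R: "R > 0" and f: "\<phi> \<in> tf R"
  shows "csmult (cB k) (delta_comb e k (\<lambda>x. of_real (rsq x ^ j)) \<phi>) = MT e (HJ j (- 1 - 2 * of_nat k)) \<phi>"
proof -
  let ?w = "\<lambda>x::'m pt. complex_of_real ((norm x)\<^sup>2) ^ j"
  have w: "(\<lambda>x::'m pt. complex_of_real (rsq x ^ j)) = ?w" by (simp add: rsq_eq)
  have c: "(\<lambda>x'. Dn (2 * k) (\<lambda>x. ?w x * f x) (x', 0)) \<in> borel_measurable borel"
    "integrable lborel (\<lambda>x'. Dn (2 * k) (\<lambda>x. ?w x * f x) (x', 0))" if f: "f \<in> tf R" for f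
  proof -
    have t: "Dn (2 * k) (\<lambda>x. ?w x * f x) \<in> tf R" by (rule tf_pderivs[OF tf_norm_sq_power[OF R f] set_Dn])
    have "continuous_on UNIV (\<lambda>x'::real^'m. (x', 0::real))" by (intro continuous_intros)
    then have *: "continuous_on UNIV (\<lambda>x'. Dn (2 * k) (\<lambda>x. ?w x * f x) (x', 0))"
      by (rule continuous_on_compose2[OF tf_continuous[OF t, of UNIV]]) auto
    then show "(\<lambda>x'. Dn (2 * k) (\<lambda>x. ?w x * f x) (x', 0)) \<in> borel_measurable borel"
      by (rule borel_measurable_continuous_onI)
    show "integrable lborel (\<lambda>x'. Dn (2 * k) (\<lambda>x. ?w x * f x) (x', 0))"
      by (rule integrable_continuous_compact_support[OF *, of R]) (rule tf_zero[OF t], simp add: norm_prod_def)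
  qed
  have sl: "slice k ?w f = (\<lambda>x'. if x' = 0 then 0 else Dn (2 * k) (\<lambda>x. ?w x * f x) (x', 0))" for f
    by (simp add: slice_def fun_eq_iff del: pderivs_Cons replicate.simps)
  have I: "(\<integral>x. slice k ?w f x \<partial>lborel) = (\<integral>x'. Dn (2 * k) (\<lambda>x. ?w x * f x) (x', 0) \<partial>lborel)" if "f \<in> tf R" for f
    by (rule integral_punctured[OF c(1)[OF that]]) (simp add: slice_def del: pderivs_Cons replicate.simps)
  have int: "integrable lborel (slice k ?w f)" if f: "f \<in> tf R" for f
  proof (rule Bochner_Integration.integrable_bound[OF c(2)[OF f]])
    show "slice k ?w f \<in> borel_measurable lborel"
      unfolding sl using c(1)[OF f] by (intro measurable_If) simp_all
  qed (rule AE_I2, simp add: slice_def del: pderivs_Cons replicate.simps)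
  have "delta_comb e k ?w \<phi> = MT e (\<lambda>f. - of_nat (2 * k + 1) * (\<integral>x. slice k ?w f x \<partial>lborel)) \<phi>"
    by (rule delta_comb_MT[OF smooth_on_UNIV_D[OF smooth_norm_sq_power] _ R f int]) (simp add: norm_sc_minus1)
  then have "csmult (cB k) (delta_comb e k ?w \<phi>) = MT e (\<lambda>f. cB k * (- of_nat (2 * k + 1) * (\<integral>x. slice k ?w f x \<partial>lborel))) \<phi>"
    by (simp only: MT_scale)
  also have "\<dots> = MT e (HJ j (- 1 - 2 * of_nat k)) \<phi>"
    by (rule MT_cong[OF R f]) (simp only: cB_mult I HJ_at_odd[OF R])
  finally show ?thesis unfolding w .
qed

section \<open>The family C and the support at the origin\<close>

lemma pderiv_dir_coord:
  assumes f: "smooth f"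
  shows "pderiv_dir v (\<lambda>x. complex_of_real (x \<bullet> c) * f x) = (\<lambda>x. complex_of_real (x \<bullet> c) * pderiv_dir v f x + of_real (v \<bullet> c) * f x)"
proof
  fix x
  show "pderiv_dir v (\<lambda>x. complex_of_real (x \<bullet> c) * f x) x = complex_of_real (x \<bullet> c) * pderiv_dir v f x + of_real (v \<bullet> c) * f x"
    using pderiv_dir_mult[OF differentiableI[OF has_derivative_inner_complex] smooth_on_differentiable[of UNIV f x], of v c] f
    by (simp add: smooth_iff pderiv_dir_inner)
qed

lemma smooth_coord: "smooth f \<Longrightarrow> smooth (\<lambda>x. complex_of_real (x \<bullet> c) * f x)"
  by (simp add: smooth_iff smooth_on_mult)

lemma lapp_coord:
  fixes f :: "'b::euclidean_space \<times> real \<Rightarrow> complex"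
  assumes f: "smooth f" and b: "b \<in> Basis"
  shows "lapp (\<lambda>x. complex_of_real (x \<bullet> (b, 0)) * f x) = (\<lambda>x. complex_of_real (x \<bullet> (b, 0)) * lapp f x + 2 * pderiv_dir (b, 0) f x)"
proof
  fix x :: "'b \<times> real"
  let ?d = "\<lambda>i. pderiv_dir (i::'b, 0::real)"
  have "?d i (?d i (\<lambda>x. complex_of_real (x \<bullet> (b, 0)) * f x)) x =
      complex_of_real (x \<bullet> (b, 0)) * ?d i (?d i f) x + (if i = b then 2 * ?d b f x else 0)" if i: "i \<in> Basis" for i
  proof -
    have ib: "(i, 0::real) \<bullet> (b, 0) = (if i = b then 1 else 0)" using i b by (simp add: inner_Basis)
    have c: "smooth (\<lambda>x. complex_of_real (x \<bullet> (b, 0)) * ?d i f x)" "smooth (\<lambda>x. (if i = b then 1 else 0) * f x)"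
      by (rule smooth_coord[OF smooth_pderiv[OF f pair_Basis[OF i]]], rule smooth_cmult[OF f])
    have "?d i (\<lambda>x. complex_of_real (x \<bullet> (b, 0)) * f x) = (\<lambda>x. complex_of_real (x \<bullet> (b, 0)) * ?d i f x + (if i = b then 1 else 0) * f x)"
      unfolding pderiv_dir_coord[OF f] ib by simp
    then have "?d i (?d i (\<lambda>x. complex_of_real (x \<bullet> (b, 0)) * f x)) x = ?d i (\<lambda>x. complex_of_real (x \<bullet> (b, 0)) * ?d i f x) x + ?d i (\<lambda>x. (if i = b then 1 else 0) * f x) x"
      using c by (simp only:) (intro pderiv_dir_add smooth_on_differentiable[of UNIV], auto simp: smooth_iff)
    also have "\<dots> = complex_of_real (x \<bullet> (b, 0)) * ?d i (?d i f) x + (if i = b then 2 * ?d b f x else 0)"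
      unfolding pderiv_dir_coord[OF smooth_pderiv[OF f pair_Basis[OF i]]] pderiv_dir_cmult[OF f] ib by auto
    finally show ?thesis .
  qed
  then show "lapp (\<lambda>x. complex_of_real (x \<bullet> (b, 0)) * f x) x = complex_of_real (x \<bullet> (b, 0)) * lapp f x + 2 * ?d b f x"
    using b by (simp add: lapp_def sum.distrib sum_distrib_left)
qed

text \<open>The commutator of x_b with the r-th power of the tangential Laplacian, by induction on
  r. For r = 0 the factor 2r removes the term with the truncated exponent r - 1.\<close>

lemma lappn_coord:
  fixes f :: "'b::euclidean_space \<times> real \<Rightarrow> complex"
  assumes b: "b \<in> Basis"
  shows "smooth f \<Longrightarrow> (lapp ^^ r) (\<lambda>x. complex_of_real (x \<bullet> (b, 0)) * f x) =
    (\<lambda>x. complex_of_real (x \<bullet> (b, 0)) * (lapp ^^ r) f x + of_nat (2 * r) * pderiv_dir (b, 0) ((lapp ^^ (r - 1)) f) x)"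
proof (induction r arbitrary: f)
  case (Suc r)
  note f = Suc.prems
  note fb = smooth_pderiv[OF f pair_Basis[OF b]]
  have *: "(lapp ^^ Suc r) g = (lapp ^^ r) (lapp g)" for g :: "'b \<times> real \<Rightarrow> complex"
    by (simp only: funpow_Suc_right o_apply)
  have "(lapp ^^ Suc r) (\<lambda>x. complex_of_real (x \<bullet> (b, 0)) * f x) =
     (\<lambda>x. (complex_of_real (x \<bullet> (b, 0)) * (lapp ^^ r) (lapp f) x + of_nat (2 * r) * pderiv_dir (b, 0) ((lapp ^^ (r - 1)) (lapp f)) x)
        + 2 * (lapp ^^ r) (pderiv_dir (b, 0) f) x)"
    unfolding * lapp_coord[OF f b] lappn_add[OF smooth_coord[OF smooth_lapp[OF f]] smooth_cmult[OF fb]]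
      Suc.IH[OF smooth_lapp[OF f]] lappn_cmult[OF fb] ..
  also have "\<dots> = (\<lambda>x. complex_of_real (x \<bullet> (b, 0)) * (lapp ^^ Suc r) f x + of_nat (2 * Suc r) * pderiv_dir (b, 0) ((lapp ^^ (Suc r - 1)) f) x)"
    unfolding lappn_pderiv[OF f pair_Basis[OF b]]
  proof (cases r)
    case (Suc k)
    have "(lapp ^^ (r - 1)) (lapp f) = (lapp ^^ r) f" unfolding Suc by (simp only: funpow_Suc_right o_apply diff_Suc_1)
    then show "(\<lambda>x. (complex_of_real (x \<bullet> (b, 0)) * (lapp ^^ r) (lapp f) x + of_nat (2 * r) * pderiv_dir (b, 0) ((lapp ^^ (r - 1)) (lapp f)) x)
        + 2 * pderiv_dir (b, 0) ((lapp ^^ r) f) x) = (\<lambda>x. complex_of_real (x \<bullet> (b, 0)) * (lapp ^^ Suc r) f x + of_nat (2 * Suc r) * pderiv_dir (b, 0) ((lapp ^^ (Suc r - 1)) f) x)"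
      unfolding *[symmetric] by (simp add: algebra_simps)
  qed (simp add: fun_eq_iff)
  finally show ?case .
qed simp

lemma Dn_coord:
  fixes f :: "'b::euclidean_space \<times> real \<Rightarrow> complex"
  assumes f: "smooth f"
  shows "Dn m (\<lambda>x. complex_of_real (x \<bullet> (b, 0)) * f x) = (\<lambda>x. complex_of_real (x \<bullet> (b, 0)) * Dn m f x)"
proof (induction m)
  case (Suc m)
  have "smooth (Dn m f)" by (rule smooth_pderivs[OF f set_Dn])
  then show ?case using pderiv_dir_coord[of "Dn m f" en "(b, 0)"] Suc.IH by simp
qed simp

lemma Dn_coord_power:
  fixes f :: "'b::euclidean_space \<times> real \<Rightarrow> complex"
  assumes f: "smooth f"
  shows "Dn m (\<lambda>x. complex_of_real (x \<bullet> (b, 0)) ^ k * f x) = (\<lambda>x. complex_of_real (x \<bullet> (b, 0)) ^ k * Dn m f x)"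
proof (induction k)
  case (Suc k)
  have "smooth (\<lambda>x. complex_of_real (x \<bullet> (b, 0)) ^ k * f x)"
    using f unfolding smooth_iff by (intro smooth_on_mult smooth_on_power smooth_on_inner open_UNIV)
  from Dn_coord[OF this, of m b] Suc.IH show ?case by (simp add: mult.assoc del: pderivs_Cons replicate.simps)
qed simp

lemma pderiv_coord_power:
  fixes f :: "'b::euclidean_space \<times> real \<Rightarrow> complex"
  assumes f: "smooth f" and b: "b \<in> Basis"
  shows "pderiv_dir (b, 0) (\<lambda>x. complex_of_real (x \<bullet> (b, 0)) ^ k * f x) =
    (\<lambda>x. of_nat k * (complex_of_real (x \<bullet> (b, 0)) ^ (k - 1) * f x) + complex_of_real (x \<bullet> (b, 0)) ^ k * pderiv_dir (b, 0) f x)"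
proof (induction k)
  case (Suc k)
  have s: "smooth (\<lambda>x. complex_of_real (x \<bullet> (b, 0)) ^ k * f x)"
    using f unfolding smooth_iff by (intro smooth_on_mult smooth_on_power smooth_on_inner open_UNIV)
  have bb: "(b, 0::real) \<bullet> (b, 0) = 1" using b by simp
  have "pderiv_dir (b, 0) (\<lambda>x. complex_of_real (x \<bullet> (b, 0)) ^ Suc k * f x) =
     (\<lambda>x. complex_of_real (x \<bullet> (b, 0)) * pderiv_dir (b, 0) (\<lambda>x. complex_of_real (x \<bullet> (b, 0)) ^ k * f x) x + complex_of_real (x \<bullet> (b, 0)) ^ k * f x)"
    using pderiv_dir_coord[OF s, of "(b, 0)" "(b, 0)"] unfolding bb by (simp add: mult.assoc)
  also have "\<dots> = (\<lambda>x. of_nat (Suc k) * (complex_of_real (x \<bullet> (b, 0)) ^ (Suc k - 1) * f x) + complex_of_real (x \<bullet> (b, 0)) ^ Suc k * pderiv_dir (b, 0) f x)"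
    unfolding Suc.IH by (cases k) (simp_all add: fun_eq_iff algebra_simps)
  finally show ?case .
qed simp

text \<open>By the commutator rule each tangential Laplacian consumes two powers of x_b; surplus
  powers leave a zero at the origin.\<close>

lemma lappn_coord_power:
  fixes f :: "'b::euclidean_space \<times> real \<Rightarrow> complex"
  assumes b: "b \<in> Basis"
  shows "smooth f \<Longrightarrow> k \<ge> 2 * r \<Longrightarrow> (lapp ^^ r) (\<lambda>x. complex_of_real (x \<bullet> (b, 0)) ^ k * f x) 0 = (if k = 2 * r then fact k * f 0 else 0)"
proof (induction r arbitrary: f k)
  case 0
  then show ?case by (simp add: zero_power)
next
  case (Suc r)
  define m where "m = k - 2"
  have k: "k = Suc (Suc m)" using Suc.prems(2) by (simp add: m_def)
  have s: "smooth (\<lambda>x. complex_of_real (x \<bullet> (b, 0)) ^ j * g x)" if "smooth g" for j and g :: "'b \<times> real \<Rightarrow> complex"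
    using that unfolding smooth_iff by (intro smooth_on_mult smooth_on_power smooth_on_inner open_UNIV)
  note fb = smooth_pderiv[OF Suc.prems(1) pair_Basis[OF b]]
  have "(lapp ^^ Suc r) (\<lambda>x. complex_of_real (x \<bullet> (b, 0)) ^ k * f x) 0 =
    (lapp ^^ Suc r) (\<lambda>x. complex_of_real (x \<bullet> (b, 0)) * (complex_of_real (x \<bullet> (b, 0)) ^ Suc m * f x)) 0"
    by (simp add: k mult.assoc)
  also have "\<dots> = of_nat (2 * Suc r) * (lapp ^^ r) (pderiv_dir (b, 0) (\<lambda>x. complex_of_real (x \<bullet> (b, 0)) ^ Suc m * f x)) 0"
    unfolding lappn_coord[OF b s[OF Suc.prems(1)]] lappn_pderiv[OF s[OF Suc.prems(1)] pair_Basis[OF b]] by simp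
  also have "(lapp ^^ r) (pderiv_dir (b, 0) (\<lambda>x. complex_of_real (x \<bullet> (b, 0)) ^ Suc m * f x)) 0 =
     of_nat (Suc m) * (lapp ^^ r) (\<lambda>x. complex_of_real (x \<bullet> (b, 0)) ^ m * f x) 0
      + (lapp ^^ r) (\<lambda>x. complex_of_real (x \<bullet> (b, 0)) ^ Suc m * pderiv_dir (b, 0) f x) 0"
    unfolding pderiv_coord_power[OF Suc.prems(1) b] diff_Suc_1
      lappn_add[OF smooth_cmult[OF s[OF Suc.prems(1)]] s[OF fb]] lappn_cmult[OF s[OF Suc.prems(1)]] ..
  also have "\<dots> = of_nat (Suc m) * (if m = 2 * r then fact m * f 0 else 0)"
    using Suc.IH[OF Suc.prems(1), of m] Suc.IH[OF fb, of "Suc m"] Suc.prems(2) by (simp add: k)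
  finally show ?case unfolding k by auto
qed

lemma lapp_local: "open T \<Longrightarrow> (\<And>x. x \<in> T \<Longrightarrow> f x = 0) \<Longrightarrow> x \<in> T \<Longrightarrow> lapp f x = 0"
  using pderivs_cong[of T f "\<lambda>x. 0" x "[(i, 0), (i, 0)]" for i] pderivs_const[of "[(i, 0), (i, 0)]" for i]
  unfolding lapp_def by (intro sum.neutral ballI) simp

lemma lappn_Dn_local: "open T \<Longrightarrow> (\<And>x. x \<in> T \<Longrightarrow> f x = 0) \<Longrightarrow> x \<in> T \<Longrightarrow> (lapp ^^ j) (Dn m f) x = 0"
proof (induction j arbitrary: x)
  case 0
  then show ?case using pderivs_cong[of T f "\<lambda>x. 0" x "replicate m en"] by (simp add: pderivs_const)
next
  case (Suc j)
  then show ?case using lapp_local[of T "(lapp ^^ j) (Dn m f)" x] by simp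
qed

lemma Tl_local:
  fixes f :: "'b::euclidean_space \<times> real \<Rightarrow> complex"
  assumes "open T" "\<And>x. x \<in> T \<Longrightarrow> f x = 0" "0 \<in> T"
  shows "Tl l y f = 0" and "smooth f \<Longrightarrow> Tl l y (Qop f) = 0"
  using lappn_Dn_local[OF assms] lappn_Qop[of f "0 :: 'b \<times> real"]
  by (simp_all add: Tl_def del: pderivs_Cons replicate.simps)

text \<open>Only the term m = 0, with l tangential Laplacians, survives. Its coefficient 1 / l! is
  independent of y, so the value is nonzero even where the Pochhammer factors of the other terms
  vanish.\<close>

lemma Tl_coord_power:
  fixes f :: "'b::euclidean_space \<times> real \<Rightarrow> complex"
  assumes b: "b \<in> Basis" and f: "smooth f"
  shows "Tl l y (\<lambda>x. complex_of_real (x \<bullet> (b, 0)) ^ (2 * l) * f x) = fact (2 * l) / fact l * f 0"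
proof -
  have "Tl l y (\<lambda>x. complex_of_real (x \<bullet> (b, 0)) ^ (2 * l) * f x) = (\<Sum>m\<le>l. if m = 0 then fact (2 * l) / fact l * f 0 else 0)"
    unfolding Tl_def Dn_coord_power[OF f]
    by (intro sum.cong refl, subst lappn_coord_power[OF b smooth_pderivs[OF f set_Dn]]) (auto simp: bco_def)
  then show ?thesis by simp
qed

text \<open>\<open>Tl\<close> is a combination of derivatives at 0 and hence local. For the origin
  itself the test function is x_b^(2l) times a bump, with b tangential; it is even in x_n, so only
  the e_n entry of \<open>MT\<close> is left.\<close>

lemma dist_supp_Tl:
  fixes D :: "('m::finite pt, 's::finite) mdist"
  assumes e: "clifford_rep e" and C: "C \<noteq> 0" and D: "\<And>\<phi>. \<phi> \<in> test_functions \<Longrightarrow> D \<phi> = MT e (\<lambda>f. C * Tl l y f) \<phi>"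
  shows "dist_supp D = {0}"
proof
  have "dist_supp D \<subseteq> - (- {0})"
  proof (rule dist_supp_subset)
    fix \<phi> :: "'m pt \<Rightarrow> complex" assume t: "\<phi> \<in> test_functions" "fsupp \<phi> \<subseteq> - {0}"
    obtain R where R: "R > 0" "\<phi> \<in> tf R" by (rule test_functions_tf[OF t(1)])
    have T: "open (- fsupp \<phi>)" "0 \<in> - fsupp \<phi>" "\<And>x. x \<in> - fsupp \<phi> \<Longrightarrow> \<phi> x = 0"
      using t(2) by (auto simp: fsupp_def intro: fsupp_zero[unfolded fsupp_def])
    have x: "\<And>x. x \<in> - fsupp \<phi> \<Longrightarrow> xi i \<phi> x = 0" for i using T(3) by (simp add: xi_def)
    have "Tl l y (Qop (xi i \<phi>)) = 0" for i
      by (rule Tl_local(2)[OF T(1) x T(2) tf_smooth[OF cop_tf[OF cop_xi R]]])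
    moreover have "Tl l y \<phi> = 0" by (rule Tl_local(1)[OF T(1) T(3) T(2)])
    ultimately show "D \<phi> = 0" unfolding D[OF t(1)] by (simp add: MT_def vec_eq_iff)
  qed simp
  then show "dist_supp D \<subseteq> {0}" by simp
  show "{0} \<subseteq> dist_supp D"
  proof (rule dist_supp_supset)
    fix \<Omega> :: "'m pt set" and x assume o: "open \<Omega>" "x \<in> \<Omega>" "x \<in> {0}"
    then obtain d where d: "d > 0" "ball 0 d \<subseteq> \<Omega>" by (auto elim!: openE)
    obtain b :: "real^'m" where b: "b \<in> Basis" using nonempty_Basis by blast
    define r where "r = d / 2"
    have r: "r > 0" "r < d" using d by (auto simp: r_def)
    define \<phi> where "\<phi> = (\<lambda>x::'m pt. complex_of_real (x \<bullet> (b, 0)) ^ (2 * l) * bump 0 r x)"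
    have t: "\<phi> \<in> tf r" unfolding \<phi>_def using bump_tf[OF r(1), of "0 :: 'm pt"]
      by (intro tf_mult) (auto simp: smooth_iff intro!: smooth_on_power)
    have "Qop (xi i \<phi>) = (\<lambda>x. 0)" for i
    proof (rule Qop_even[OF r(1) cop_tf[OF cop_xi r(1) t]])
      fix x :: "'m pt"
      show "xi i \<phi> (sc (-1) x) = xi i \<phi> x"
        by (simp add: xi_def \<phi>_def bump_def sc_m1 inner_prod_def norm_sc_minus1)
    qed
    moreover have "Tl l y \<phi> \<noteq> 0" unfolding \<phi>_def Tl_coord_power[OF b smooth_bump] using r by (simp add: bump_def gk_def)
    moreover obtain p q where "e None $ p $ q \<noteq> 0" using eNone_nonzero[OF e] by blast
    ultimately have "MT e (\<lambda>f. C * Tl l y f) \<phi> $ p $ q \<noteq> 0"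
      using C by (simp add: MT_nth cfn_zero[OF cfn_Tl])
    then have "D \<phi> \<noteq> 0" unfolding D[OF tf_test(1)[OF t]] by auto
    moreover have "fsupp \<phi> \<subseteq> \<Omega>"
      by (rule bump_fsupp[of r d 0]) (use r d in \<open>auto simp: \<phi>_def\<close>)
    ultimately show "\<exists>\<phi>\<in>test_functions. fsupp \<phi> \<subseteq> \<Omega> \<and> D \<phi> \<noteq> 0" using tf_test(1)[OF t] by blast
  qed
qed

lemma d_n_power: "(d_n ^^ m) T \<phi> = (-1) ^ m *\<^sub>R T (Dn m \<phi>)"
proof (induction m arbitrary: \<phi>)
  case (Suc m)
  have "(d_n ^^ Suc m) T \<phi> = - ((d_n ^^ m) T (pderiv_dir en \<phi>))" by (simp add: d_n_def dist_deriv_def)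
  then show ?case unfolding Suc.IH Dn_Suc by simp
qed simp

lemma lapp_axis: "lapp f x = (\<Sum>i\<in>UNIV. pderiv_dir (axis i 1, 0) (pderiv_dir (axis i 1, 0) f) x)"
  for f :: "'m::finite pt \<Rightarrow> complex"
proof -
  have B: "(Basis :: (real^'m) set) = range (\<lambda>i. axis i 1)" by (auto simp: Basis_vec_def)
  have inj: "inj (\<lambda>i::'m. axis i (1::real))" by (auto simp: inj_def axis_eq_axis)
  show ?thesis unfolding lapp_def B sum.reindex[OF inj] o_def ..
qed

lemma laplace'_pderiv: "laplace' T \<phi> = (\<Sum>i\<in>UNIV. T (pderiv_dir (axis i 1, 0) (pderiv_dir (axis i 1, 0) \<phi>)))"
  by (simp add: laplace'_def d_i_def dist_deriv_def)

text \<open>Each application moves one tangential Laplacian to the test function; linearity of the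
  entries of \<open>T\<close> collects the sum over the directions.\<close>

lemma laplace'_power:
  fixes T :: "('m::finite pt, 's::finite) mdist"
  assumes R: "R > 0" and f: "\<phi> \<in> tf R"
  shows "(\<And>a b. cfn (\<lambda>\<phi>. T \<phi> $ a $ b)) \<Longrightarrow> (laplace' ^^ j) T \<phi> = T ((lapp ^^ j) \<phi>)"
proof (induction j arbitrary: T)
  case (Suc j)
  let ?d = "\<lambda>i::'m. pderiv_dir (axis i 1, 0::real)"
  have c: "cfn (\<lambda>\<phi>. laplace' T \<phi> $ a $ b)" for a b
  proof -
    have "cfn (\<lambda>\<phi>. T (?d i (?d i \<phi>)) $ a $ b)" for i
      by (rule cfn_comp[OF Suc.prems cop_comp[OF cop_pderiv[OF axis_Basis] cop_pderiv[OF axis_Basis]]])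
    then show ?thesis unfolding laplace'_pderiv sum_component by (rule cfn_sum_fun)
  qed
  define \<psi> where "\<psi> = (lapp ^^ j) \<phi>"
  have t: "?d i (?d i \<psi>) \<in> tf R" for i
    unfolding \<psi>_def by (intro tf_pderiv_dir axis_Basis cop_tf[OF cop_lappn R f])
  have "lapp \<psi> = (\<lambda>x. \<Sum>i\<in>UNIV. ?d i (?d i \<psi>) x)" by (rule ext) (rule lapp_axis)
  then have "T (lapp \<psi>) $ a $ b = (\<Sum>i\<in>UNIV. T (?d i (?d i \<psi>)) $ a $ b)" for a b
    using cfn_sum[OF Suc.prems[of a b] R finite t] by simp
  then have "laplace' T \<psi> = T (lapp \<psi>)" by (simp add: vec_eq_iff laplace'_pderiv)
  moreover have "(laplace' ^^ Suc j) T \<phi> = laplace' T \<psi>"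
    unfolding funpow_Suc_right o_apply Suc.IH[OF c] \<psi>_def ..
  ultimately show ?case by (simp add: \<psi>_def)
qed simp

lemma cfn_d_n_power:
  fixes T :: "('m::finite pt, 's::finite) mdist"
  assumes "\<And>a b. cfn (\<lambda>\<phi>. T \<phi> $ a $ b)" shows "cfn (\<lambda>\<phi>. (d_n ^^ m) T \<phi> $ a $ b)"
proof -
  have "cfn (\<lambda>\<phi>. of_real ((-1) ^ m) * T (Dn m \<phi>) $ a $ b)"
    by (rule cfn_scale[OF cfn_comp[OF assms cop_pderivs[OF set_Dn]]])
  then show ?thesis by (simp add: d_n_power scaleR_conv_of_real[where 'a=complex] del: pderivs_Cons replicate.simps)
qed

lemma delta0_nth: "delta0 \<phi> $ a $ b = (if a = b then \<phi> 0 else 0)"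
  by (simp add: delta0_def mat_def)

lemma cfn_delta0: "cfn (\<lambda>\<phi>. delta0 \<phi> $ a $ b)"
  by (cases "a = b") (simp_all add: delta0_nth cfn_eval cfn_0)

lemma mult_mat_nth: "((A :: complex^'s::finite^'t::finite) ** mat c) $ a $ b = A $ a $ b * c"
proof -
  have "((A ** mat c) $ a $ b) = (\<Sum>k\<in>UNIV. if k = b then A $ a $ k * c else 0)"
    unfolding matrix_matrix_mult_def by (simp add: mat_def if_distrib cong: if_cong)
  then show ?thesis by simp
qed

lemma mult_uminus_mat_nth: "((A :: complex^'s::finite^'t::finite) ** - mat c) $ a $ b = - (A $ a $ b * c)"
proof -
  have "- mat c = (mat (- c) :: complex^'s^'s)" by (simp add: vec_eq_iff mat_def)
  then show ?thesis by (simp only: mult_mat_nth) simp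
qed

lemma dirac'_delta0_nth:
  fixes e :: "'m::finite option \<Rightarrow> complex^'s::finite^'s"
  shows "dirac' e delta0 \<phi> $ a $ b = - (\<Sum>i\<in>UNIV. e (Some i) $ a $ b * pderiv_dir (axis i 1, 0) \<phi> 0)"
proof -
  have "dirac' e delta0 \<phi> $ a $ b = (\<Sum>i\<in>UNIV. (e (Some i) ** - mat (pderiv_dir (axis i 1, 0) \<phi> 0)) $ a $ b)"
    by (simp add: dirac'_def d_i_def dist_deriv_def delta0_def)
  then show ?thesis unfolding mult_uminus_mat_nth sum_negf .
qed

lemma cfn_dirac'_delta0:
  fixes e :: "'m::finite option \<Rightarrow> complex^'s::finite^'s"
  shows "cfn (\<lambda>\<phi>. dirac' e delta0 \<phi> $ a $ b)"
proof -
  have 1: "cfn (\<lambda>\<phi> :: 'm pt \<Rightarrow> complex. pderiv_dir (axis i 1, 0) \<phi> 0)" for i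
    by (rule cfn_comp[OF cfn_eval cop_pderiv[OF axis_Basis]])
  have "cfn (\<lambda>\<phi> :: 'm pt \<Rightarrow> complex. (-1) * (\<Sum>i\<in>UNIV. e (Some i) $ a $ b * pderiv_dir (axis i 1, 0) \<phi> 0))"
    by (intro cfn_scale cfn_sum_fun 1)
  then show ?thesis by (simp add: dirac'_delta0_nth)
qed

text \<open>These are the coefficients of the Dirac sum in the family C: 2 (l - m) arises from
  commuting x_i with the tangential Laplacians, 1 / (2m+1) from dividing by x_n.\<close>

lemma bco_odd:
  assumes m: "m < l"
  shows "bco l m y * of_nat (2 * (l - m)) / of_nat (2 * m + 1) =
    2 ^ (2 * m + 1) * pochhammer y m / (fact (l - Suc m) * fact (2 * m + 1))"
proof -
  have 1: "fact (l - m) = of_nat (l - m) * (fact (l - Suc m) :: complex)"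
    using m by (metis Suc_diff_Suc fact_Suc)
  have 2: "fact (2 * m + 1) = of_nat (2 * m + 1) * (fact (2 * m) :: complex)" by simp
  have 3: "of_nat (2 * (l - m)) = 2 * (of_nat (l - m) :: complex)" by simp
  have 4: "(2 :: complex) ^ (2 * m + 1) = 2 * 4 ^ m" by (simp add: power_mult)
  have nz: "(of_nat (l - m) :: complex) \<noteq> 0" using m by (simp only: of_nat_eq_0_iff)
  have "P * Q / (L * F * D) * (2 * L) / M = 2 * P * Q / (F * (M * D))" if "L \<noteq> 0" for P Q L F D M :: complex
    using that by (simp add: mult_ac)
  then show ?thesis unfolding bco_def 1 2 3 4 using nz by blast
qed

text \<open>All derivatives are transposed to \<phi> and the sums reversed, with m = l - j in the
  e_n-sum and m = l - 1 - j in the Dirac sum. The former is then \<open>Tl\<close> of \<phi>, the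
  latter is built from \<open>Tl\<close> of the functions \<open>Qop (xi i \<phi>)\<close>.\<close>

lemma KCt_MT:
  fixes e :: "'m::finite option \<Rightarrow> complex^'s::finite^'s" and \<phi> :: "'m::finite pt \<Rightarrow> complex"
  assumes R: "R > 0" and f: "\<phi> \<in> tf R"
  shows "KCt e l nu \<phi> = MT e (Tl l (nu + 1/2 - of_nat l)) \<phi>"
proof -
  define y where "y = nu + 1/2 - of_nat l"
  note sm = tf_smooth[OF f]
  have nth: "csmult c A $ p $ q = c * A $ p $ q" for c p q and A :: "complex^'s::finite^'s" by (simp add: csmult_def)
  let ?L = "\<lambda>i m. pderiv_dir (axis i 1, 0) ((lapp ^^ (l - Suc m)) (Dn (2 * m + 1) \<phi>)) 0"
  have A: "(laplace' ^^ j) ((d_n ^^ (2*l - 2*j - 1)) (dirac' e delta0)) \<phi> $ p $ q =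
     (\<Sum>i\<in>UNIV. e (Some i) $ p $ q * ?L i (l - Suc j))" if j: "j < l" for j p q
  proof -
    have 1: "2*l - 2*j - 1 = 2 * (l - Suc j) + 1" "l - Suc (l - Suc j) = j" using j by auto
    have "(laplace' ^^ j) ((d_n ^^ (2*l - 2*j - 1)) (dirac' e delta0)) \<phi> = (d_n ^^ (2*l - 2*j - 1)) (dirac' e delta0) ((lapp ^^ j) \<phi>)"
      by (rule laplace'_power[OF R f cfn_d_n_power[OF cfn_dirac'_delta0]])
    \<comment> \<open>The odd number of normal derivatives gives one sign and the derivative inside
      the Dirac operator another; they cancel.\<close>
    also have "\<dots> = - dirac' e delta0 (Dn (2 * (l - Suc j) + 1) ((lapp ^^ j) \<phi>))"
      unfolding d_n_power 1 by (simp del: pderivs_Cons replicate.simps)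
    finally show ?thesis
      unfolding 1 vector_uminus_component by (simp add: dirac'_delta0_nth pderivs_lappn[OF sm set_Dn] del: pderivs_Cons replicate.simps)
  qed
  have B: "(e None ** (laplace' ^^ j) ((d_n ^^ (2*l - 2*j)) delta0) \<phi>) $ p $ q =
     e None $ p $ q * (lapp ^^ j) (Dn (2 * (l - j)) \<phi>) 0" if j: "j \<le> l" for j p q
  proof -
    have 1: "2*l - 2*j = 2 * (l - j)" by auto
    have "(laplace' ^^ j) ((d_n ^^ (2*l - 2*j)) (delta0 :: ('m pt, 's) mdist)) \<phi> = (d_n ^^ (2*l - 2*j)) delta0 ((lapp ^^ j) \<phi>)"
      by (rule laplace'_power[OF R f cfn_d_n_power[OF cfn_delta0]])
    also have "\<dots> = mat ((lapp ^^ j) (Dn (2 * (l - j)) \<phi>) 0)"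
      unfolding d_n_power 1 by (simp add: delta0_def pderivs_lappn[OF sm set_Dn] del: pderivs_Cons replicate.simps)
    finally show ?thesis by (simp only: mult_mat_nth)
  qed
  have Q: "Tl l y (Qop (xi i \<phi>)) = (\<Sum>m<l. 2 ^ (2 * m + 1) * pochhammer y m / (fact (l - Suc m) * fact (2 * m + 1)) * ?L i m)" for i
  proof -
    have x: "xi i g = (\<lambda>x. complex_of_real (x \<bullet> (axis i 1, 0)) * g x)" for g
      by (simp add: xi_def fun_eq_iff inner_prod_def inner_axis)
    have ax: "axis i (1::real) \<in> Basis" by (simp add: axis_in_Basis_iff)
    have z: "(lapp ^^ (l - m)) (Dn (2 * m) (Qop (xi i \<phi>))) 0 = of_nat (2 * (l - m)) * ?L i m / of_nat (2 * m + 1)" for m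
    proof -
      have "(lapp ^^ (l - m)) (Dn (2 * m) (Qop (xi i \<phi>))) 0 = (lapp ^^ (l - m)) (Dn (2 * m + 1) (xi i \<phi>)) 0 / of_nat (2 * m + 1)"
        by (rule lappn_Qop[OF tf_smooth[OF cop_tf[OF cop_xi R f]]]) simp
      also have "(lapp ^^ (l - m)) (Dn (2 * m + 1) (xi i \<phi>)) 0 = of_nat (2 * (l - m)) * ?L i m"
        unfolding x Dn_coord[OF sm] lappn_coord[OF ax smooth_pderivs[OF sm set_Dn]] by (simp del: pderivs_Cons replicate.simps)
      finally show ?thesis .
    qed
    have "Tl l y (Qop (xi i \<phi>)) = (\<Sum>m<Suc l. bco l m y * (of_nat (2 * (l - m)) * ?L i m / of_nat (2 * m + 1)))"
      unfolding Tl_def z lessThan_Suc_atMost ..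
    also have "\<dots> = (\<Sum>m<l. bco l m y * (of_nat (2 * (l - m)) * ?L i m / of_nat (2 * m + 1)))" by simp
    also have "\<dots> = (\<Sum>m<l. 2 ^ (2 * m + 1) * pochhammer y m / (fact (l - Suc m) * fact (2 * m + 1)) * ?L i m)"
      by (intro sum.cong refl) (simp only: bco_odd[symmetric] lessThan_iff, simp)
    finally show ?thesis .
  qed
  show ?thesis
    unfolding vec_eq_iff
  proof (intro allI)
    fix p q
    let ?c = "\<lambda>m. 2 ^ (2 * m + 1) * pochhammer y m / (fact (l - Suc m) * fact (2 * m + 1))"
    have "(\<Sum>j<l. 2 ^ (2*l - 2*j - 1) * pochhammer y (l - j - 1) / (fact j * fact (2*l - 2*j - 1)) *
        (laplace' ^^ j) ((d_n ^^ (2*l - 2*j - 1)) (dirac' e delta0)) \<phi> $ p $ q)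
       = (\<Sum>j<l. ?c (l - Suc j) * (\<Sum>i\<in>UNIV. e (Some i) $ p $ q * ?L i (l - Suc j)))"
    proof (intro sum.cong refl)
      fix j assume "j \<in> {..<l}"
      then have j: "j < l" by simp
      then have 1: "2*l - 2*j - 1 = 2 * (l - Suc j) + 1" "l - Suc (l - Suc j) = j" "l - j - 1 = l - Suc j" by auto
      show "2 ^ (2*l - 2*j - 1) * pochhammer y (l - j - 1) / (fact j * fact (2*l - 2*j - 1)) *
        (laplace' ^^ j) ((d_n ^^ (2*l - 2*j - 1)) (dirac' e delta0)) \<phi> $ p $ q = ?c (l - Suc j) * (\<Sum>i\<in>UNIV. e (Some i) $ p $ q * ?L i (l - Suc j))"
        unfolding A[OF j] unfolding 1 ..
    qed
    also have "\<dots> = (\<Sum>m<l. ?c m * (\<Sum>i\<in>UNIV. e (Some i) $ p $ q * ?L i m))"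
      by (rule sum.nat_diff_reindex)
    also have "\<dots> = (\<Sum>i\<in>UNIV. e (Some i) $ p $ q * Tl l y (Qop (xi i \<phi>)))"
      unfolding Q sum_distrib_left by (subst sum.swap) (simp add: mult_ac del: pderivs_Cons replicate.simps)
    finally have 1: "(\<Sum>j<l. 2 ^ (2*l - 2*j - 1) * pochhammer y (l - j - 1) / (fact j * fact (2*l - 2*j - 1)) *
        (laplace' ^^ j) ((d_n ^^ (2*l - 2*j - 1)) (dirac' e delta0)) \<phi> $ p $ q) = (\<Sum>i\<in>UNIV. e (Some i) $ p $ q * Tl l y (Qop (xi i \<phi>)))" .
    let ?h = "\<lambda>m. bco l m y * (e None $ p $ q * (lapp ^^ (l - m)) (Dn (2 * m) \<phi>) 0)"
    have "(\<Sum>j\<le>l. 2 ^ (2*l - 2*j) * pochhammer y (l - j) / (fact j * fact (2*l - 2*j)) *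
        (e None ** (laplace' ^^ j) ((d_n ^^ (2*l - 2*j)) delta0) \<phi>) $ p $ q) = (\<Sum>j<Suc l. ?h (Suc l - Suc j))"
      unfolding lessThan_Suc_atMost
    proof (intro sum.cong refl)
      fix j assume "j \<in> {..l}"
      then have j: "j \<le> l" by simp
      then have 1: "2*l - 2*j = 2 * (l - j)" "l - (l - j) = j" by auto
      show "2 ^ (2*l - 2*j) * pochhammer y (l - j) / (fact j * fact (2*l - 2*j)) *
        (e None ** (laplace' ^^ j) ((d_n ^^ (2*l - 2*j)) delta0) \<phi>) $ p $ q = ?h (Suc l - Suc j)"
        unfolding B[OF j] unfolding 1 bco_def diff_Suc_Suc by (simp add: power_mult del: pderivs_Cons replicate.simps)
    qed
    also have "\<dots> = (\<Sum>j<Suc l. ?h j)" by (rule sum.nat_diff_reindex)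
    also have "\<dots> = e None $ p $ q * Tl l y \<phi>"
      unfolding Tl_def sum_distrib_left lessThan_Suc_atMost by (simp add: mult_ac del: pderivs_Cons replicate.simps)
    finally show "KCt e l nu \<phi> $ p $ q = MT e (Tl l (nu + 1/2 - of_nat l)) \<phi> $ p $ q"
      unfolding KCt_def y_def[symmetric] MT_nth vector_add_component sum_component nth 1 by (simp only:)
  qed
qed

section \<open>The second renormalization\<close>

lemma H0_off:
  fixes f :: "'b::euclidean_space \<times> real \<Rightarrow> complex"
  assumes R: "R > 0" and f: "f \<in> tf R" and o: "off \<epsilon> f"
  shows "H0 a f = rGamma ((a + 1) / 2) * II a (a + dm TYPE('b)) f"
proof (rule analytic_continuation_open[of "{a. Re a > -1}" UNIV "\<lambda>a. H0 a f"])
  show "(\<lambda>a. H0 a f) holomorphic_on UNIV" by (rule H0_holomorphic[OF R f])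
  have "hol2 UNIV (\<lambda>p. II (fst p) (snd p) f)"
    using o by (intro II_hol2 open_UNIV tf_measurable[OF f] Ker_integrable_off[OF f, of \<epsilon>]) (auto simp: off_def)
  moreover have "(\<lambda>a. a + dm TYPE('b)) holomorphic_on UNIV" by (intro holomorphic_intros)
  ultimately have "(\<lambda>a. II (fst (a, a + dm TYPE('b))) (snd (a, a + dm TYPE('b))) f) holomorphic_on UNIV"
    by (intro hol2_slice[OF _ open_UNIV holomorphic_on_ident]) auto
  moreover have "(\<lambda>a::complex. (a + 1) / 2) holomorphic_on UNIV" by (intro holomorphic_intros) auto
  ultimately show "(\<lambda>a. rGamma ((a + 1) / 2) * II a (a + dm TYPE('b)) f) holomorphic_on UNIV"
    using holomorphic_on_compose_gen[OF _ holomorphic_rGamma, of "\<lambda>a. (a + 1) / 2" UNIV UNIV]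
    by (intro holomorphic_on_mult) (simp_all add: o_def)
  show "open {a. Re a > -1}" by (intro open_Collect_less continuous_intros)
  show "{a. Re a > -1} \<noteq> {}" by (auto intro!: exI[of _ "0::complex"])
  show "\<And>a. a \<in> {a. Re a > -1} \<Longrightarrow> H0 a f = rGamma ((a + 1) / 2) * II a (a + dm TYPE('b)) f"
    by (rule H0_G0[OF R f]) simp
qed auto

lemma off_kernel_HJ:
  "off_kernel (HJ j a :: ('b::euclidean_space \<times> real \<Rightarrow> complex) \<Rightarrow> complex) (rGamma ((a + 1) / 2)) a (a + dm TYPE('b) + 2 * of_nat j)"
  unfolding off_kernel_def
proof (intro allI impI)
  fix R :: real and f :: "'b \<times> real \<Rightarrow> complex" and \<epsilon> assume R: "R > 0" and f: "f \<in> tf R" and o: "off \<epsilon> f"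
  have "off \<epsilon> (\<lambda>x. complex_of_real ((norm x)\<^sup>2) ^ j * f x)" using o by (simp add: off_def)
  then show "HJ j a f = rGamma ((a + 1) / 2) * II a (a + dm TYPE('b) + 2 * of_nat j) f"
    unfolding HJ_def II_even_norm[OF f] by (rule H0_off[OF R tf_norm_sq_power[OF R f]])
qed

lemma HJ_holomorphic:
  fixes f :: "'b::euclidean_space \<times> real \<Rightarrow> complex"
  shows "R > 0 \<Longrightarrow> f \<in> tf R \<Longrightarrow> (\<lambda>a. HJ j a f) holomorphic_on UNIV"
  unfolding HJ_def by (rule H0_holomorphic[OF _ tf_norm_sq_power])

lemma G_HJ:
  fixes f :: "'b::euclidean_space \<times> real \<Rightarrow> complex"
  shows "R > 0 \<Longrightarrow> f \<in> tf R \<Longrightarrow> z = a + dm TYPE('b) + 2 * of_nat j \<Longrightarrow> G a z f = rGamma (z / 2) * HJ j a f"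
  unfolding HJ_def by (simp only: G_even_norm)

definition nuj :: "nat \<Rightarrow> nat \<Rightarrow> complex" where
  "nuj n j = - rhoH n - 1/2 - of_nat j"

text \<open>In the scalar parameters the condition nu = -rhoH - 1/2 - j is z = a + n + 2j, the line
  of \<open>G_even_norm\<close>.\<close>

lemma nuj_zz: "lam - nuj n j + 1/2 = (lam + nuj n j + 1/2) + of_nat n + 2 * of_nat j"
  by (simp add: nuj_def rhoH_def field_simps)

lemma Gamma_poles: "open {l. (l - c + 1/2) / 2 \<notin> (\<int>\<^sub>\<le>\<^sub>0 :: complex set)}" "{l. (l - c + 1/2) / 2 \<notin> (\<int>\<^sub>\<le>\<^sub>0 :: complex set)} \<noteq> {}"
proof -
  have "{l. (l - c + 1/2) / 2 \<notin> (\<int>\<^sub>\<le>\<^sub>0 :: complex set)} = (\<lambda>l. (l - c + 1/2) / 2) -` (- \<int>\<^sub>\<le>\<^sub>0)" by auto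
  moreover have "open ((\<lambda>l::complex. (l - c + 1/2) / 2) -` (- \<int>\<^sub>\<le>\<^sub>0))"
    by (intro open_vimage continuous_intros) (auto simp: open_Compl)
  ultimately show "open {l. (l - c + 1/2) / 2 \<notin> (\<int>\<^sub>\<le>\<^sub>0 :: complex set)}" by simp
  have "(c + 3/2 - c + 1/2) / 2 = (1 :: complex)" by simp
  then have "c + 3/2 \<in> {l. (l - c + 1/2) / 2 \<notin> (\<int>\<^sub>\<le>\<^sub>0 :: complex set)}" by (simp add: one_notin_nonpos_Ints)
  then show "{l. (l - c + 1/2) / 2 \<notin> (\<int>\<^sub>\<le>\<^sub>0 :: complex set)} \<noteq> {}" by blast
qed

lemma KAt_nuj:
  fixes \<phi> :: "'m::finite pt \<Rightarrow> complex"
  assumes R: "R > 0" and f: "\<phi> \<in> tf R" and nu: "nu = nuj (CARD('m) + 1) j" and l: "(l - nu + 1/2) / 2 \<notin> \<int>\<^sub>\<le>\<^sub>0"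
  shows "csmult (Gamma ((l - nu + 1/2) / 2)) (KAt e (l, nu) \<phi>) = MT e (HJ j (l + nu + 1/2)) \<phi>"
proof -
  have z: "l - nu + 1/2 = (l + nu + 1/2) + dm TYPE(real^'m) + 2 * of_nat j" unfolding nu nuj_zz by simp
  have "MT e (G (l + nu + 1/2) (l - nu + 1/2)) \<phi> = MT e (\<lambda>f. rGamma ((l - nu + 1/2) / 2) * HJ j (l + nu + 1/2) f) \<phi>"
    by (rule MT_cong[OF R f G_HJ[OF R _ z]])
  moreover have "Gamma ((l - nu + 1/2) / 2) * rGamma ((l - nu + 1/2) / 2) = 1"
    using l by (simp add: rGamma_inverse_Gamma Gamma_eq_zero_iff)
  ultimately show ?thesis unfolding KAt_tf[OF R f] MT_scale by (simp add: csmult_def mult.assoc[symmetric])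
qed

text \<open>Off the Gamma poles, Gamma(z/2) cancels the factor 1 / Gamma(z/2) in
  \<open>G_HJ\<close>. What remains is entire in lambda and therefore is the continuation.\<close>

lemma KAtt_tf:
  fixes \<phi> :: "'m::finite pt \<Rightarrow> complex"
  assumes R: "R > 0" and f: "\<phi> \<in> tf R"
  shows "KAtt e j lam \<phi> = MT e (HJ j (lam + nuj (CARD('m) + 1) j + 1/2)) \<phi>"
proof -
  define nu where "nu = nuj (CARD('m) + 1) j"
  have "holo_cont1 {l. (l - nu + 1/2) / 2 \<notin> \<int>\<^sub>\<le>\<^sub>0}
        (\<lambda>l. Gamma ((l - nu + 1/2) / 2) * KAt e (l, nu) \<phi> $ a $ b) lam = MT e (HJ j (lam + nu + 1/2)) \<phi> $ a $ b" for a b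
  proof (rule holo_cont1_eq[OF Gamma_poles, where g="\<lambda>l. MT e (HJ j (l + nu + 1/2)) \<phi> $ a $ b"])
    have "(\<lambda>l. l + nu + 1/2) holomorphic_on UNIV" by (intro holomorphic_intros)
    then have "(\<lambda>l. HJ j (l + nu + 1/2) f) holomorphic_on UNIV" if "f \<in> tf R" for f :: "'m pt \<Rightarrow> complex"
      using holomorphic_on_compose_gen[OF _ HJ_holomorphic[OF R that], of "\<lambda>l. l + nu + 1/2" UNIV j] by (simp add: o_def)
    then show "(\<lambda>l. MT e (HJ j (l + nu + 1/2)) \<phi> $ a $ b) holomorphic_on UNIV" by (rule holomorphic_MT[OF R f])
    fix l assume "l \<in> {l. (l - nu + 1/2) / 2 \<notin> \<int>\<^sub>\<le>\<^sub>0}"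
    then show "Gamma ((l - nu + 1/2) / 2) * KAt e (l, nu) \<phi> $ a $ b = MT e (HJ j (l + nu + 1/2)) \<phi> $ a $ b"
      using KAt_nuj[OF R f nu_def, of l e] by (simp add: csmult_def vec_eq_iff)
  qed
  then show ?thesis by (simp add: vec_eq_iff KAtt_def Let_def nu_def nuj_def)
qed

lemma KAtt_eq:
  "\<phi> \<in> test_functions \<Longrightarrow> KAtt (e :: 'm::finite option \<Rightarrow> complex^'s::finite^'s) j lam \<phi> = MT e (HJ j (lam + nuj (CARD('m) + 1) j + 1/2)) \<phi>"
  by (metis test_functions_tf KAtt_tf)

lemma KCt_eq: "\<phi> \<in> test_functions \<Longrightarrow> KCt e l nu \<phi> = MT e (Tl l (nu + 1/2 - of_nat l)) \<phi>"
  by (metis test_functions_tf KCt_MT)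

lemma holomorphic_family1_KAtt:
  "holomorphic_family1 (KAtt (e :: 'm::finite option \<Rightarrow> complex^'s::finite^'s) j)"
  unfolding holomorphic_family1_def
proof (intro conjI allI ballI)
  show "distribution (KAtt e j z)" for z by (rule distribution_MT[OF cfn_HJ KAtt_eq])
  fix \<phi> :: "'m pt \<Rightarrow> complex" and a b assume "\<phi> \<in> test_functions"
  then obtain R where R: "R > 0" "\<phi> \<in> tf R" by (rule test_functions_tf)
  have "(\<lambda>l. l + nuj (CARD('m) + 1) j + 1/2) holomorphic_on UNIV" by (intro holomorphic_intros)
  then have "(\<lambda>l. HJ j (l + nuj (CARD('m) + 1) j + 1/2) f) holomorphic_on UNIV" if "f \<in> tf R" for f :: "'m pt \<Rightarrow> complex"
    using holomorphic_on_compose_gen[OF _ HJ_holomorphic[OF R(1) that], of "\<lambda>l. l + nuj (CARD('m) + 1) j + 1/2" UNIV j] by (simp add: o_def)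
  then show "(\<lambda>z. KAtt e j z \<phi> $ a $ b) holomorphic_on UNIV"
    unfolding KAtt_tf[OF R] by (rule holomorphic_MT[OF R])
qed

lemma holomorphic_family1_KCt:
  "holomorphic_family1 (KCt (e :: 'm::finite option \<Rightarrow> complex^'s::finite^'s) l)"
  unfolding holomorphic_family1_def
proof (intro conjI allI ballI)
  show "distribution (KCt e l z)" for z by (rule distribution_MT[OF cfn_Tl KCt_eq])
  fix \<phi> :: "'m pt \<Rightarrow> complex" and a b assume "\<phi> \<in> test_functions"
  then obtain R where R: "R > 0" "\<phi> \<in> tf R" by (rule test_functions_tf)
  have "(\<lambda>z. Tl l (z + 1/2 - of_nat l) f) holomorphic_on UNIV" for f :: "'m pt \<Rightarrow> complex"
    unfolding Tl_def bco_def by (intro holomorphic_intros) auto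
  then show "(\<lambda>z. KCt e l z \<phi> $ a $ b) holomorphic_on UNIV"
    unfolding KCt_MT[OF R] by (rule holomorphic_MT[OF R])
qed

section \<open>Zeros, special values and supports of the renormalized family A\<close>

lemma dist_eqI_tf: "(\<And>R \<phi>. R > 0 \<Longrightarrow> \<phi> \<in> tf R \<Longrightarrow> T \<phi> = S \<phi>) \<Longrightarrow> dist_eq T S"
  unfolding dist_eq_def by (metis test_functions_tf)

lemma supp_KAt_regular:
  assumes "clifford_rep e" "p \<notin> Xplus \<union> Yplus" shows "dist_supp (KAt e p) = UNIV"
  by (rule dist_supp_MT_UNIV[OF assms(1) KAt_eq off_kernel_G]) (use assms(2) gamma_factor_zero[of p] gamma_factor_gf[of p] in simp_all)

lemma KAt_X:
  assumes "lam + nu = - 3/2 - 2 * of_nat k"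
  shows "aa (lam, nu) = - 1 - 2 * of_nat k" "zz (lam, nu) = - 1 - 2 * of_nat k - 2 * nu"
proof -
  have l: "lam = - 3/2 - 2 * of_nat k - nu" using assms by (simp add: algebra_simps)
  show "aa (lam, nu) = - 1 - 2 * of_nat k" "zz (lam, nu) = - 1 - 2 * of_nat k - 2 * nu" by (simp_all add: l)
qed

lemma KAt_KBt:
  assumes "lam + nu = - 3/2 - 2 * of_nat k"
  shows "dist_eq (KAt e (lam, nu)) (dist_scale ((-1) ^ (k+1) * fact k / fact (2*k+1)) (KBt e k nu))"
  by (rule dist_eqI_tf) (simp only: KAt_tf KAt_X[OF assms] dist_scale_def cB_def[symmetric] KBt_MT)

lemma W_nonzero: "x \<noteq> 0 \<Longrightarrow> W s x \<noteq> 0"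
  by (simp add: W_def)

text \<open>On \<open>Xplus\<close> the factor 1 / Gamma((a+1)/2) vanishes, so nothing is left off
  the hyperplane; outside \<open>Yplus\<close> the factor 1 / Gamma(z/2) in the density
  \<open>F\<close> is nonzero.\<close>

lemma supp_KAt_X:
  fixes e :: "'m::finite option \<Rightarrow> complex^'s::finite^'s"
  assumes e: "clifford_rep e" and x: "lam + nu = - 3/2 - 2 * of_nat k" and y: "(lam, nu) \<notin> Yplus"
  shows "dist_supp (KAt e (lam, nu)) = hyperplane"
proof -
  define z where "z = zz (lam, nu)"
  define F :: "real^'m \<Rightarrow> complex" where "F = (\<lambda>x. (-1) ^ k * fact k * rGamma (z / 2) * W (z + 1 + 2 * of_nat k - dm TYPE(real^'m)) x)"
  have "rGamma (z / 2) \<noteq> 0"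
  proof
    assume "rGamma (z / 2) = 0"
    then obtain l :: nat where l: "z = - 2 * of_nat l" unfolding rGamma_half_zero by blast
    have "lam - nu = z - 1/2" by (simp add: z_def)
    then have "lam - nu = - 1/2 - 2 * of_nat l" unfolding l by simp
    then show False using y by (auto simp: Yplus_def)
  qed
  then have F: "continuous_on (- {0}) F \<and> F c \<noteq> 0" if "c \<noteq> 0" for c
    unfolding F_def using W_nonzero[OF that]
    by (auto intro!: continuous_on_mult continuous_on_const smooth_on_continuous[OF smooth_on_W])
  have "rGamma ((- 1 - 2 * of_nat k + 1) / 2 :: complex) = 0"
    using rGamma_half_zero[of "- 1 - 2 * of_nat k + 1"] by auto
  then have C: "gf (- 1 - 2 * of_nat k) z = 0" by (simp add: gf_def)
  show ?thesis
  proof (rule dist_supp_MT_hyperplane[OF e cfn_G, where F=F and k=k])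
    show "KAt e (lam, nu) \<phi> = MT e (G (- 1 - 2 * of_nat k) z) \<phi>" if "\<phi> \<in> test_functions" for \<phi>
      using KAt_eq[OF that, of e "(lam, nu)"] unfolding KAt_X(1)[OF x] z_def .
    show "off_kernel (G (- 1 - 2 * of_nat k) z :: ('m pt \<Rightarrow> complex) \<Rightarrow> complex) 0 (- 1 - 2 * of_nat k) z"
      using off_kernel_G[of "- 1 - 2 * of_nat k" z] unfolding C .
    show "G (- 1 - 2 * of_nat k) z (hbump k c r) = (\<integral>x. F x * bump c r x \<partial>lborel)" if "0 < r" "r < norm c" for c r
      unfolding F_def by (rule G_hbump[OF that])
  qed (rule F)
qed

text \<open>Along lambda - nu = -1/2 - 2l one has z = -2l, and the data of
  \<open>G_at_minus_even\<close> become nu + n/2 in the Gamma function and y = nu + 1/2 - l in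
  \<open>Tl\<close>.\<close>

lemma KAt_Y:
  fixes \<phi> :: "'m::finite pt \<Rightarrow> complex"
  assumes y: "lam - nu = - 1/2 - 2 * of_nat l" and R: "R > 0" and f: "\<phi> \<in> tf R"
  shows "KAt e (lam, nu) \<phi> = MT e (\<lambda>f. (gam CARD('m) l * rGamma (nu + of_nat (CARD('m) + 1) / 2)) * Tl l (nu + 1/2 - of_nat l) f) \<phi>"
proof -
  have lam: "lam = nu - 1/2 - 2 * of_nat l" using y by (simp add: algebra_simps)
  have z: "zz (lam, nu) = - 2 * of_nat l" by (simp add: lam)
  have 1: "(aa (lam, nu) + 2 * of_nat l + dm TYPE(real^'m)) / 2 = nu + of_nat (CARD('m) + 1) / 2"
    and 2: "(aa (lam, nu) + 1) / 2 = nu + 1/2 - of_nat l" by (simp_all add: lam field_simps)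
  have d: "DIM(real^'m) = CARD('m)" by simp
  show ?thesis unfolding KAt_tf[OF R f] z
  proof (rule MT_cong[OF R f])
    fix f :: "'m pt \<Rightarrow> complex" assume f: "f \<in> tf R"
    show "G (aa (lam, nu)) (- 2 * of_nat l) f =
        gam CARD('m) l * rGamma (nu + of_nat (CARD('m) + 1) / 2) * Tl l (nu + 1/2 - of_nat l) f"
      using G_at_minus_even[OF R f, of "aa (lam, nu)" l] unfolding 1 2 unfolding d .
  qed
qed

lemma gam_eq: "gam CARD('m::finite) l = (-1) ^ l * fact l * of_real (pi powr ((real (CARD('m) + 1) - 1) / 2)) / 2 ^ (2 * l)"
  by (simp add: gam_def power_mult)

lemma gam_nonzero: "gam d l \<noteq> 0"
  by (simp add: gam_def)

lemma KAt_KCt: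
  fixes e :: "'m::finite option \<Rightarrow> complex^'s::finite^'s"
  assumes "lam - nu = - 1/2 - 2 * of_nat l"
  shows "dist_eq (KAt e (lam, nu)) (dist_scale (gam CARD('m) l * rGamma (nu + of_nat (CARD('m) + 1) / 2)) (KCt e l nu))"
  by (rule dist_eqI_tf) (simp only: KAt_Y[OF assms] dist_scale_def MT_scale KCt_MT)

text \<open>With i = j + 2l the two conditions separate: l labels the line in \<open>Yplus\<close>
  and j the pole of Gamma(nu + n/2). So \<open>Leven\<close> is where the constant relating the
  families A and C vanishes.\<close>

lemma Leven_iff:
  "(lam, nu) \<in> Leven n \<longleftrightarrow> (\<exists>l::nat. lam - nu = - 1/2 - 2 * of_nat l) \<and> nu + of_nat n / 2 \<in> \<int>\<^sub>\<le>\<^sub>0"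
proof
  assume "(lam, nu) \<in> Leven n"
  then obtain i j l :: nat where *: "lam = - rho n - 1/2 - of_nat i" "nu = - rhoH n - 1/2 - of_nat j" "int i - int j = 2 * int l"
    unfolding Leven_def by auto
  have i: "i = j + 2 * l" using *(3) by linarith
  have "lam - nu = - 1/2 - 2 * of_nat l" unfolding *(1,2) i by (simp add: rho_def rhoH_def field_simps)
  moreover have "nu + of_nat n / 2 = - of_nat j" unfolding *(2) by (simp add: rhoH_def field_simps)
  ultimately show "(\<exists>l::nat. lam - nu = - 1/2 - 2 * of_nat l) \<and> nu + of_nat n / 2 \<in> \<int>\<^sub>\<le>\<^sub>0" by auto
next
  assume "(\<exists>l::nat. lam - nu = - 1/2 - 2 * of_nat l) \<and> nu + of_nat n / 2 \<in> \<int>\<^sub>\<le>\<^sub>0"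
  then obtain l j :: nat where *: "lam - nu = - 1/2 - 2 * of_nat l" "nu + of_nat n / 2 = - of_nat j"
    by (auto elim!: nonpos_Ints_cases')
  have h: "nu = - of_nat j - of_nat n / 2" using *(2) unfolding eq_diff_eq .
  have nu: "nu = - rhoH n - 1/2 - of_nat j" unfolding h by (simp add: rhoH_def field_simps)
  have hl: "lam = nu - 1/2 - 2 * of_nat l" using *(1) by (simp add: algebra_simps)
  have "lam = - rho n - 1/2 - of_nat (j + 2 * l)" unfolding hl nu by (simp add: rho_def rhoH_def field_simps)
  moreover have "int (j + 2 * l) - int j = 2 * int l" by simp
  ultimately show "(lam, nu) \<in> Leven n" unfolding Leven_def using nu by blast
qed

lemma supp_KAt_Y:
  fixes e :: "'m::finite option \<Rightarrow> complex^'s::finite^'s"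
  assumes e: "clifford_rep e" and y: "lam - nu = - 1/2 - 2 * of_nat l" and L: "(lam, nu) \<notin> Leven (CARD('m) + 1)"
  shows "dist_supp (KAt e (lam, nu)) = {0}"
proof -
  have "rGamma (nu + of_nat (CARD('m) + 1) / 2) \<noteq> 0"
    using L y unfolding Leven_iff rGamma_eq_zero_iff by blast
  then have "gam CARD('m) l * rGamma (nu + of_nat (CARD('m) + 1) / 2) \<noteq> 0" using gam_nonzero by simp
  then show ?thesis
  proof (rule dist_supp_Tl[OF e])
    fix \<phi> :: "'m pt \<Rightarrow> complex" assume "\<phi> \<in> test_functions"
    then obtain R where R: "R > 0" "\<phi> \<in> tf R" by (rule test_functions_tf)
    show "KAt e (lam, nu) \<phi> = MT e (\<lambda>f. (gam CARD('m) l * rGamma (nu + of_nat (CARD('m) + 1) / 2)) * Tl l (nu + 1/2 - of_nat l) f) \<phi>"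
      by (rule KAt_Y[OF y R])
  qed
qed

text \<open>Outside \<open>Leven\<close> all the supports found are nonempty, so the distribution is
  nonzero there; on \<open>Leven\<close> the constant in \<open>KAt_KCt\<close> is 0.\<close>

lemma KAt_zero_iff:
  fixes e :: "'m::finite option \<Rightarrow> complex^'s::finite^'s"
  assumes e: "clifford_rep e"
  shows "dist_eq (KAt e p) (\<lambda>\<phi>. 0) \<longleftrightarrow> p \<in> Leven (CARD('m) + 1)"
proof
  obtain lam nu where p: "p = (lam, nu)" by (cases p)
  assume "dist_eq (KAt e p) (\<lambda>\<phi>. 0)"
  then have "dist_supp (KAt e p) \<subseteq> - UNIV" by (intro dist_supp_subset) (auto simp: dist_eq_def)
  then have s: "dist_supp (KAt e (lam, nu)) = {}" by (simp add: p)
  have y: "(lam, nu) \<in> Yplus"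
  proof (rule ccontr)
    assume y: "(lam, nu) \<notin> Yplus"
    have "(0, 0) \<in> (hyperplane :: 'm pt set)" by (simp add: hyperplane_def)
    then show False
      using s y supp_KAt_regular[OF e, of "(lam, nu)"] supp_KAt_X[OF e _ y] by (auto simp: Xplus_def)
  qed
  show "p \<in> Leven (CARD('m) + 1)"
    using y s supp_KAt_Y[OF e, of lam nu] unfolding p by (auto simp: Yplus_def)
next
  assume "p \<in> Leven (CARD('m) + 1)"
  then obtain lam nu and l :: nat where p: "p = (lam, nu)" "lam - nu = - 1/2 - 2 * of_nat l" "nu + of_nat (CARD('m) + 1) / 2 \<in> \<int>\<^sub>\<le>\<^sub>0"
    by (cases p) (auto simp only: Leven_iff)
  show "dist_eq (KAt e p) (\<lambda>\<phi>. 0)"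
    using KAt_KCt[OF p(2), of e] p(3) unfolding p(1) dist_eq_def dist_scale_def rGamma_eq_zero_iff[symmetric]
    by (simp add: csmult_def vec_eq_iff)
qed

text \<open>At the special point the exponent of |x_n| is -(n + i + j). When i - j is even its
  parity is that of n, which decides between the two supports.\<close>

lemma KAtt_param: "- rho n - 1/2 - of_nat i + nuj n j + 1/2 = - of_nat (n + i + j)"
  by (simp add: nuj_def rho_def rhoH_def field_simps)

text \<open>At an even integer a, Gamma((a+1)/2) has no pole, so the kernel persists off the
  hyperplane with a nonzero constant.\<close>

lemma supp_KAtt_even:
  fixes e :: "'m::finite option \<Rightarrow> complex^'s::finite^'s"
  assumes e: "clifford_rep e" and n: "even (CARD('m) + 1 + i + j)"
  shows "dist_supp (KAtt e j (- rho (CARD('m) + 1) - 1/2 - of_nat i)) = UNIV"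
proof (rule dist_supp_MT_UNIV[OF e _ off_kernel_HJ])
  show "KAtt e j (- rho (CARD('m) + 1) - 1/2 - of_nat i) \<phi> = MT e (HJ j (- of_nat (CARD('m) + 1 + i + j))) \<phi>"
    if "\<phi> \<in> test_functions" for \<phi>
    using KAtt_eq[OF that, of e j "- rho (CARD('m) + 1) - 1/2 - of_nat i"] unfolding KAtt_param .
  show "rGamma ((- of_nat (CARD('m) + 1 + i + j) + 1) / 2 :: complex) \<noteq> 0"
    unfolding rGamma_half_zero
  proof
    assume "\<exists>k::nat. - of_nat (CARD('m) + 1 + i + j) + 1 = (- 2 * of_nat k :: complex)"
    then obtain k :: nat where "- of_nat (CARD('m) + 1 + i + j) + 1 = (- 2 * of_nat k :: complex)" ..
    then have "of_nat (CARD('m) + 1 + i + j) = (of_nat (2 * k + 1) :: complex)"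
      by (simp add: algebra_simps)
    then have "CARD('m) + 1 + i + j = 2 * k + 1" by (simp only: of_nat_eq_iff)
    then show False using n by presburger
  qed
qed

lemma supp_KAtt_odd:
  fixes e :: "'m::finite option \<Rightarrow> complex^'s::finite^'s"
  assumes e: "clifford_rep e" and k: "CARD('m) + 1 + i + j = 2 * k + 1"
  shows "dist_supp (KAtt e j (- rho (CARD('m) + 1) - 1/2 - of_nat i)) = hyperplane"
proof -
  have a: "- of_nat (CARD('m) + 1 + i + j) = (- 1 - 2 * of_nat k :: complex)" unfolding k by simp
  define F :: "real^'m \<Rightarrow> complex" where "F = (\<lambda>x. (-1) ^ k * fact k * of_real ((norm x)\<^sup>2) ^ j)"
  have F: "continuous_on (- {0}) F \<and> F c \<noteq> 0" if "c \<noteq> 0" for c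
    unfolding F_def using that by (auto intro!: continuous_intros)
  have C: "rGamma ((- 1 - 2 * of_nat k + 1) / 2 :: complex) = 0"
    using rGamma_half_zero[of "- 1 - 2 * of_nat k + 1"] by auto
  show ?thesis
  proof (rule dist_supp_MT_hyperplane[OF e cfn_HJ, where F=F and k=k])
    show "KAtt e j (- rho (CARD('m) + 1) - 1/2 - of_nat i) \<phi> = MT e (HJ j (- 1 - 2 * of_nat k)) \<phi>" if "\<phi> \<in> test_functions" for \<phi>
      using KAtt_eq[OF that, of e j "- rho (CARD('m) + 1) - 1/2 - of_nat i"] unfolding KAtt_param a .
    show "off_kernel (HJ j (- 1 - 2 * of_nat k) :: ('m pt \<Rightarrow> complex) \<Rightarrow> complex) 0 (- 1 - 2 * of_nat k)
        (- 1 - 2 * of_nat k + dm TYPE(real^'m) + 2 * of_nat j)"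
      using off_kernel_HJ[of j "- 1 - 2 * of_nat k"] unfolding C .
    show "HJ j (- 1 - 2 * of_nat k) (hbump k c r) = (\<integral>x. F x * bump c r x \<partial>lborel)" if "0 < r" for c r
      unfolding F_def by (rule HJ_hbump[OF that])
  qed (rule F)
qed

lemma KAtt_delta_comb:
  fixes e :: "'m::finite option \<Rightarrow> complex^'s::finite^'s"
  assumes k: "CARD('m) + 1 + i + j = 2 * k + 1"
  shows "dist_eq (KAtt e j (- rho (CARD('m) + 1) - 1/2 - of_nat i))
     (dist_scale ((-1) ^ (k+1) * fact k / fact (2*k+1)) (delta_comb e k (\<lambda>x. of_real (rsq x ^ j))))"
proof -
  have a: "- of_nat (CARD('m) + 1 + i + j) = (- 1 - 2 * of_nat k :: complex)" unfolding k by simp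
  show ?thesis
    by (rule dist_eqI_tf) (simp only: KAtt_tf KAtt_param a dist_scale_def cB_def[symmetric] delta_comb_HJ)
qed

theorem theorem5p3:
  fixes n :: nat and e :: "'m::finite option \<Rightarrow> complex^'s::finite^'s"
  assumes "n \<ge> 2" and "CARD('m) = n - 1"
    and "irreducible_clifford_rep e"
  shows
    "holomorphic_family2 (KAt e) \<and>
     (\<forall>p. dist_eq (KAt e p) (\<lambda>\<phi>. 0) \<longleftrightarrow> p \<in> Leven n) \<and>
     (\<forall>p. p \<notin> Xplus \<union> Yplus \<longrightarrow> dist_supp (KAt e p) = UNIV) \<and>
     (\<forall>lam nu. \<forall>k::nat. (lam, nu) \<in> Xplus - Yplus \<and> lam + nu = - 3/2 - 2 * of_nat k \<longrightarrow>
        dist_eq (KAt e (lam, nu))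
          (dist_scale ((-1) ^ (k+1) * fact k / fact (2*k+1)) (KBt e k nu)) \<and>
        dist_supp (KAt e (lam, nu)) = hyperplane) \<and>
     (\<forall>lam nu. \<forall>l::nat. (lam, nu) \<in> Yplus - Leven n \<and> lam - nu = - 1/2 - 2 * of_nat l \<longrightarrow>
        dist_eq (KAt e (lam, nu))
          (dist_scale ((-1) ^ l * fact l * of_real (pi powr ((real n - 1) / 2))
                         / (2 ^ (2*l) * Gamma (nu + of_nat n / 2)))
             (KCt e l nu)) \<and>
        dist_supp (KAt e (lam, nu)) = {0}) \<and>
     (\<forall>i j l :: nat. int i - int j = 2 * int l \<longrightarrow>
       (let lam0 = - rho n - 1/2 - of_nat i; nu0 = - rhoH n - 1/2 - of_nat j in
        holomorphic_family1 (KCt e l) \<and>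
        (\<forall>lam nu. lam - nu = - 1/2 - (of_nat i - of_nat j) \<and> nu + rhoH n + 1/2 \<notin> \<int>\<^sub>\<le>\<^sub>0 \<longrightarrow>
           dist_eq (KCt e l nu)
             (dist_scale ((-1) ^ l * 2 ^ (2*l) / (fact l * of_real (pi powr ((real n - 1) / 2)))
                            * Gamma (nu + rhoH n + 1/2))
                (KAt e (lam, nu)))) \<and>
        holomorphic_family1 (KAtt e j) \<and>
        (\<forall>lam. (lam - nu0 + 1/2) / 2 \<notin> \<int>\<^sub>\<le>\<^sub>0 \<longrightarrow>
           dist_eq (KAtt e j lam)
             (dist_scale (Gamma ((lam - nu0 + 1/2) / 2)) (KAt e (lam, nu0)))) \<and>
        dist_supp (KCt e l nu0) = {0} \<and>
        (even n \<longrightarrow> dist_supp (KAtt e j lam0) = UNIV) \<and>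
        (odd n \<longrightarrow> dist_supp (KAtt e j lam0) = hyperplane \<and>
           (\<forall>k::nat. 2 * k = n + i + j - 1 \<longrightarrow>
              dist_eq (KAtt e j lam0)
                (dist_scale ((-1) ^ (k+1) * fact k / fact (2*k+1))
                   (delta_comb e k (\<lambda>x. of_real (rsq x ^ j))))))))"
proof -
  have n: "n = CARD('m) + 1" using assms(1,2) by simp
  have e: "clifford_rep e" using assms(3) by (simp add: irreducible_clifford_rep_def)
  define P where "P = complex_of_real (pi powr ((real n - 1) / 2))"
  have P: "P \<noteq> 0" "gam CARD('m) l = (-1) ^ l * fact l * P / 2 ^ (2 * l)" for l
    unfolding P_def n gam_eq by simp_all
  \<comment> \<open>Division by Gamma agrees with multiplication by \<open>rGamma\<close> at every
    point: at a pole Gamma is 0 by convention, and so is the quotient.\<close>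
  have C: "(-1) ^ l * fact l * P / (2 ^ (2*l) * Gamma (nu + of_nat n / 2)) = gam CARD('m) l * rGamma (nu + of_nat n / 2)" for l nu
    unfolding P(2) rGamma_inverse_Gamma by (simp only: divide_inverse inverse_mult_distrib mult.assoc)
  have rH: "nu + rhoH n + 1/2 = nu + of_nat n / 2" for nu by (simp add: rhoH_def field_simps)
  have Y: "dist_eq (KCt e l nu)
      (dist_scale ((-1) ^ l * 2 ^ (2*l) / (fact l * P) * Gamma (nu + rhoH n + 1/2)) (KAt e (lam, nu)))"
    if y: "lam - nu = - 1/2 - 2 * of_nat l" and g: "nu + rhoH n + 1/2 \<notin> \<int>\<^sub>\<le>\<^sub>0" for l lam nu
  proof -
    \<comment> \<open>The constants of the two directions are inverse to each other up to the square
      of the sign \<open>S\<close>.\<close>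
    have "S * B / (F * P) * H * (S * F * P / B * inverse H) = S * S" if "B \<noteq> 0" "F \<noteq> 0" "H \<noteq> 0" for S B F H
      using that P(1) by simp
    moreover have "Gamma (nu + of_nat n / 2) \<noteq> 0" using g unfolding rH Gamma_eq_zero_iff .
    moreover have "(-1) ^ l * (-1) ^ l = (1 :: complex)" by (simp flip: power_mult_distrib)
    ultimately have "(-1) ^ l * 2 ^ (2*l) / (fact l * P) * Gamma (nu + of_nat n / 2) * (gam CARD('m) l * rGamma (nu + of_nat n / 2)) = 1"
      unfolding P(2) rGamma_inverse_Gamma by simp
    then show ?thesis
      using KAt_KCt[OF y, of e, folded n] unfolding dist_eq_def dist_scale_def rH
      by (simp add: csmult_def vec_eq_iff mult.assoc[symmetric])
  qed
  have nu0: "- rhoH n - 1/2 - of_nat j = nuj n j" for j by (simp add: nuj_def)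
  have A: "dist_eq (KAtt e j lam) (dist_scale (Gamma ((lam - nuj n j + 1/2) / 2)) (KAt e (lam, nuj n j)))"
    if "(lam - nuj n j + 1/2) / 2 \<notin> \<int>\<^sub>\<le>\<^sub>0" for j lam
    by (rule dist_eqI_tf) (simp only: dist_scale_def KAt_nuj[OF _ _ arg_cong[OF n, of "\<lambda>n. nuj n j"] that] KAtt_tf n[symmetric])
  have K0: "dist_supp (KCt e l nu) = {0}" for l nu
    by (rule dist_supp_Tl[OF e, of 1]) (simp_all add: KCt_eq)
  have last: "let lam0 = - rho n - 1/2 - of_nat i; nu0 = - rhoH n - 1/2 - of_nat j in
        holomorphic_family1 (KCt e l) \<and>
        (\<forall>lam nu. lam - nu = - 1/2 - (of_nat i - of_nat j) \<and> nu + rhoH n + 1/2 \<notin> \<int>\<^sub>\<le>\<^sub>0 \<longrightarrow>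
           dist_eq (KCt e l nu)
             (dist_scale ((-1) ^ l * 2 ^ (2*l) / (fact l * P) * Gamma (nu + rhoH n + 1/2))
                (KAt e (lam, nu)))) \<and>
        holomorphic_family1 (KAtt e j) \<and>
        (\<forall>lam. (lam - nu0 + 1/2) / 2 \<notin> \<int>\<^sub>\<le>\<^sub>0 \<longrightarrow>
           dist_eq (KAtt e j lam)
             (dist_scale (Gamma ((lam - nu0 + 1/2) / 2)) (KAt e (lam, nu0)))) \<and>
        dist_supp (KCt e l nu0) = {0} \<and>
        (even n \<longrightarrow> dist_supp (KAtt e j lam0) = UNIV) \<and>
        (odd n \<longrightarrow> dist_supp (KAtt e j lam0) = hyperplane \<and>
           (\<forall>k::nat. 2 * k = n + i + j - 1 \<longrightarrow>
              dist_eq (KAtt e j lam0)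
                (dist_scale ((-1) ^ (k+1) * fact k / fact (2*k+1))
                   (delta_comb e k (\<lambda>x. of_real (rsq x ^ j))))))"
    if l: "int i - int j = 2 * int l" for i j l :: nat
    unfolding Let_def nu0
  proof (intro conjI allI impI holomorphic_family1_KCt holomorphic_family1_KAtt A K0; (elim conjE)?)
    fix lam nu
    have i: "i = j + 2 * l" using l by linarith
    assume "lam - nu = - 1/2 - (of_nat i - of_nat j)" "nu + rhoH n + 1/2 \<notin> \<int>\<^sub>\<le>\<^sub>0"
    then show "dist_eq (KCt e l nu) (dist_scale ((-1) ^ l * 2 ^ (2*l) / (fact l * P) * Gamma (nu + rhoH n + 1/2)) (KAt e (lam, nu)))"
      by (intro Y) (simp_all add: i)
  next
    assume "even n"
    then have "even (CARD('m) + 1 + i + j)" using l unfolding n by presburger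
    from supp_KAtt_even[OF e this] show "dist_supp (KAtt e j (- rho n - 1/2 - of_nat i)) = UNIV" unfolding n .
  next
    assume "odd n"
    \<comment> \<open>As i and j have the same parity, n + i + j is odd together with n.\<close>
    then obtain k where "CARD('m) + 1 + i + j = 2 * k + 1" using l unfolding n by (metis add.assoc even_add even_diff oddE even_of_nat dvd_triv_left of_nat_eq_iff)
    from supp_KAtt_odd[OF e this] show "dist_supp (KAtt e j (- rho n - 1/2 - of_nat i)) = hyperplane" unfolding n .
  next
    fix k :: nat assume "odd n" "2 * k = n + i + j - 1"
    \<comment> \<open>The truncated subtraction is harmless because n is positive.\<close>
    then have "CARD('m) + 1 + i + j = 2 * k + 1" unfolding n by linarith
    from KAtt_delta_comb[OF this, of e] show "dist_eq (KAtt e j (- rho n - 1/2 - of_nat i))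
       (dist_scale ((-1) ^ (k+1) * fact k / fact (2*k+1)) (delta_comb e k (\<lambda>x. of_real (rsq x ^ j))))" unfolding n .
  qed
  show ?thesis
    unfolding P_def[symmetric] C
    using holomorphic_family2_KAt[of e] KAt_zero_iff[OF e, folded n] supp_KAt_regular[OF e] KAt_KBt[of _ _ _ e]
      supp_KAt_X[OF e] KAt_KCt[of _ _ _ e, folded n] supp_KAt_Y[OF e, folded n] last by blast
qed

end
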